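(* Let $N\ge3$ be an integer and let $\frac{2}{N-2}<\alpha<\alpha_0$. Let $U$ be a radially symmetric, stationary solution of $\partial_tu=\Delta u+|u|^\alpha u$ that is singular at $x=0$. Given $\delta>0$ and $u_0\in L^1_{\mathrm{loc}}(\mathbb{R}^N)\cap L^\infty(\{|x|>\delta\})$ such that $u_0(x)=U(x)$ for a.e. $x$ with $|x|<\delta$, there exist $T>0$ and a solution $u\in L^{\alpha+1}_{\mathrm{loc}}((0,T)\times\mathbb{R}^N)\cap C((0,T)\times(\mathbb{R}^N\setminus\{0\}))$ of $$\partial_tu=\Delta u+|u|^\alpha u$$ in the sense of distributions $\mathcal{D}'((0,T)\times\mathbb{R}^N)$, such that, for some constant $C$, $$|u(t,x)-U(x)|\le C(1+|x|^{-\eta}),\qquad 0<t<T,\ x\ne0,$$ and $u(t)\to u_0$ in $L^1_{\mathrm{loc}}(\mathbb{R}^N)$ as $t\to0$. Moreover, $u(t)$ is singular at $x=0$ for all $0<t<T$ and satisfies $|x|^{\frac2\alpha}u(t,x)\to\beta^{\frac1\alpha}$ as $x\to0$.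
   Context: All functions are real-valued. Constants: $$\alpha_0=\frac{4}{N-4+2\sqrt{N-1}}\in\Bigl(\frac2{N-2},\frac4{N-2}\Bigr),\quad \beta=\frac2\alpha\Bigl(N-2-\frac2\alpha\Bigr)>0,\quad \eta=\frac{N-2}{2}-\sqrt{\frac{(N-2)^2}{4}-\beta(\alpha+1)}>0$$ (the quantity under the square root is positive when $\frac2{N-2}<\alpha<\alpha_0$). A radially symmetric stationary solution that is singular at $x=0$ is a function $U(x)=v(|x|)$, $x\neq0$, where $v\in C^2(0,\infty)$ solves $v''+\frac{N-1}{r}v'+|v|^\alpha v=0$ on $(0,\infty)$ and $v(r)$ does not have a finite limit as $r\to0$.
   Formalization: The printed limit β^{1/α} fails when U is negative near 0 (e.g. U = −β^{1/α}|x|^{-2/α}); it is proved instead that U has a constant sign σ = ±1 near 0 and |x|^{2/α}u(t,x) → σβ^{1/α}, which is the printed limit when U > 0 near 0. *)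

theory Defs
  imports "HOL-Analysis.Analysis"
begin

text \<open>
  The space \<open>\<real>\<^sup>N\<close> is a type \<open>'a::euclidean_space\<close> with \<open>DIM('a) = N\<close>; space-time is the
  Euclidean space \<open>real \<times> 'a\<close>, whose Lebesgue measure is the product one.
\<close>

definition alpha0 :: "nat \<Rightarrow> real" where
  "alpha0 N = 4 / (real N - 4 + 2 * sqrt (real N - 1))"

definition beta :: "nat \<Rightarrow> real \<Rightarrow> real" where
  "beta N \<alpha> = 2 / \<alpha> * (real N - 2 - 2 / \<alpha>)"

definition eta :: "nat \<Rightarrow> real \<Rightarrow> real" where
  "eta N \<alpha> = (real N - 2) / 2 - sqrt ((real N - 2)\<^sup>2 / 4 - beta N \<alpha> * (\<alpha> + 1))"

text \<open>The function \<open>U\<close> lives on \<open>x \<noteq> 0\<close>; its value at the origin is irrelevant.\<close>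

definition singular_radial_stationary :: "real \<Rightarrow> ('a::euclidean_space \<Rightarrow> real) \<Rightarrow> bool" where
  "singular_radial_stationary \<alpha> U \<longleftrightarrow>
     (\<exists>v v' v''.
        (\<forall>r>0. (v has_real_derivative v' r) (at r)) \<and>
        (\<forall>r>0. (v' has_real_derivative v'' r) (at r)) \<and>
        continuous_on {0<..} v'' \<and>
        (\<forall>r>0. v'' r + (real DIM('a) - 1) / r * v' r + \<bar>v r\<bar> powr \<alpha> * v r = 0) \<and>
        \<not> (\<exists>l::real. (v \<longlongrightarrow> l) (at_right 0)) \<and>
        (\<forall>x. x \<noteq> 0 \<longrightarrow> U x = v (norm x)))"

definition singular_at_origin :: "('a::euclidean_space \<Rightarrow> real) \<Rightarrow> bool" where
  "singular_at_origin f \<longleftrightarrow> \<not> (\<exists>l::real. (f \<longlongrightarrow> l) (at 0))"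

definition L_loc :: "real \<Rightarrow> 'a::euclidean_space set \<Rightarrow> ('a \<Rightarrow> real) \<Rightarrow> bool" where
  "L_loc p \<Omega> f \<longleftrightarrow>
     f \<in> borel_measurable (lebesgue_on \<Omega>) \<and>
     (\<forall>K. compact K \<and> K \<subseteq> \<Omega> \<longrightarrow> set_integrable lebesgue K (\<lambda>x. \<bar>f x\<bar> powr p))"

definition tendsto_L1_loc ::
    "('b \<Rightarrow> 'a::euclidean_space \<Rightarrow> real) \<Rightarrow> ('a \<Rightarrow> real) \<Rightarrow> 'b filter \<Rightarrow> bool" where
  "tendsto_L1_loc f g F \<longleftrightarrow>
     (\<forall>\<^sub>F t in F. L_loc 1 UNIV (f t)) \<and> L_loc 1 UNIV g \<and>
     (\<forall>K. compact K \<longrightarrow> ((\<lambda>t. LINT x:K|lebesgue. \<bar>f t x - g x\<bar>) \<longlongrightarrow> 0) F)"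

definition dir_deriv :: "'a::euclidean_space \<Rightarrow> ('a \<Rightarrow> real) \<Rightarrow> 'a \<Rightarrow> real" where
  "dir_deriv v f = (\<lambda>x. frechet_derivative f (at x) v)"

primrec C_k :: "nat \<Rightarrow> ('a::euclidean_space \<Rightarrow> real) \<Rightarrow> bool" where
  "C_k 0 f \<longleftrightarrow> continuous_on UNIV f"
| "C_k (Suc k) f \<longleftrightarrow> f differentiable_on UNIV \<and> (\<forall>v. C_k k (dir_deriv v f))"

definition test_function :: "'a::euclidean_space set \<Rightarrow> ('a \<Rightarrow> real) \<Rightarrow> bool" where
  "test_function \<Omega> \<phi> \<longleftrightarrow>
     (\<forall>k. C_k k \<phi>) \<and> compact (closure {x. \<phi> x \<noteq> 0}) \<and> closure {x. \<phi> x \<noteq> 0} \<subseteq> \<Omega>"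

definition time_deriv :: "(real \<times> 'a::euclidean_space \<Rightarrow> real) \<Rightarrow> real \<times> 'a \<Rightarrow> real" where
  "time_deriv \<phi> = dir_deriv (1, 0) \<phi>"

definition space_laplacian :: "(real \<times> 'a::euclidean_space \<Rightarrow> real) \<Rightarrow> real \<times> 'a \<Rightarrow> real" where
  "space_laplacian \<phi> = (\<lambda>z. \<Sum>b\<in>Basis. dir_deriv (0, b) (dir_deriv (0, b) \<phi>) z)"

text \<open>
  The equation \<open>\<partial>\<^sub>t u = \<Delta> u + \<bar>u\<bar>\<^sup>\<alpha> u\<close> in \<open>\<D>'((0,T) \<times> \<real>\<^sup>N)\<close>. Local integrability of \<open>u\<close> and of
  the nonlinear term makes both of them distributions (and both integrals below meaningful).
\<close>

definition heat_solution_distr ::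
    "real \<Rightarrow> real \<Rightarrow> (real \<times> 'a::euclidean_space \<Rightarrow> real) \<Rightarrow> bool" where
  "heat_solution_distr \<alpha> T u \<longleftrightarrow>
     (let \<Omega> = {0<..<T} \<times> (UNIV :: 'a set) in
        L_loc 1 \<Omega> u \<and> L_loc 1 \<Omega> (\<lambda>z. \<bar>u z\<bar> powr \<alpha> * u z) \<and>
        (\<forall>\<phi>. test_function \<Omega> \<phi> \<longrightarrow>
           (LINT z:\<Omega>|lebesgue. u z * (- time_deriv \<phi> z)) =
           (LINT z:\<Omega>|lebesgue. u z * space_laplacian \<phi> z)
             + (LINT z:\<Omega>|lebesgue. \<bar>u z\<bar> powr \<alpha> * u z * \<phi> z)))"

end

theory Submission
  imports Defs "HOL-Probability.Distributions" "HOL-Real_Asymp.Real_Asymp"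
begin

text \<open>
  The solution is sought as \<open>u = U + w\<close>, where \<open>w\<close> starts from the bounded function \<open>u\<^sub>0 - U\<close> and solves
  \<open>\<partial>\<^sub>t w = \<Delta>w + f(U + w) - f(U)\<close> with \<open>f(s) = \<bar>s\<bar>\<^sup>\<alpha> s\<close>. Write \<open>l = 2/\<alpha>\<close>.

  \<^emph>\<open>The singularity of \<open>U\<close>.\<close> In the variable \<open>t = - ln r\<close> the function \<open>y = r\<^sup>l v(r)\<close> moves in a double-well
  potential with positive friction (\<open>damped_oscillator\<close>), so it converges to \<open>0\<close> or to \<open>\<plusminus>\<beta> powr (1/\<alpha>)\<close>.
  Convergence to \<open>0\<close> would make \<open>v\<close> converge at the origin, against singularity. At the other equilibria the
  linearisation has two real negative exponents because \<open>\<alpha> < \<alpha>\<^sub>0\<close>, so the convergence is exponential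
  in \<open>t\<close>, that is, with a power rate in \<open>r\<close> (\<open>singular_profile\<close>).

  \<^emph>\<open>Barriers.\<close> Hence \<open>f'(U) = (\<alpha> + 1) \<bar>U\<bar>\<^sup>\<alpha>\<close> is an inverse-square potential
  \<open>\<beta> (\<alpha> + 1) r powr (-2)\<close> up to an error \<open>O(r powr (d - 2))\<close> with \<open>d > 0\<close>. Since
  \<open>- \<Delta> (r powr (-k)) = k (N - 2 - k) r powr (- k - 2)\<close>, and \<open>\<eta>\<close> is the smaller root of
  \<open>k (N - 2 - k) = \<beta> (\<alpha> + 1)\<close>, the power \<open>r powr (-\<eta>)\<close> balances the potential exactly. Subtracting a multiple of
  \<open>r powr (- (\<eta> - d))\<close>, for which the Laplacian is strictly weaker than the potential, leaves room for the error
  and for the nonlinearity: \<open>\<Phi> = K + r powr (-\<eta>) - c r powr (- (\<eta> - d))\<close> satisfies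
  \<open>f'(\<bar>U\<bar> + \<Phi>) \<Phi> \<le> - \<Delta>\<Phi> + D\<close> (\<open>supersolution_profile\<close>).

  \<^emph>\<open>Existence.\<close> Near the origin, where the potential is critical, the iteration gains no small factor. But
  \<open>f(U + a) - f(U)\<close> is increasing in \<open>a\<close>: the Duhamel iteration started at \<open>- \<Phi>\<close> increases, and it stays below
  \<open>\<Phi>\<close> on a short time interval because the Duhamel integral of a power \<open>r powr (- k - 2)\<close> is known exactly
  (\<open>duhamel_power\<close>). Its limit is a mild solution \<open>w\<close> with \<open>\<bar>w\<bar> \<le> \<Phi>\<close>
  (\<open>duhamel_fixed_point\<close>, \<open>mild_solution_near_stationary\<close>). As \<open>\<eta> < l\<close>, this bound shows that \<open>w\<close> does not
  disturb the leading singular term of \<open>U\<close>.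

  \<^emph>\<open>The equation and the data.\<close> All potentials involved are locally integrable, as \<open>l + 2 < N\<close>. Testing the
  representation by the heat kernel against \<open>\<partial>\<^sub>t \<phi> + \<Delta>\<phi>\<close> turns the mild equation into the distributional one
  (\<open>duhamel_distribution\<close>, \<open>heat_flow_distribution\<close>), and a cutoff near the origin shows that the singularity
  of \<open>U\<close> carries no mass (\<open>stationary_distribution\<close>). Continuity of translations in \<open>L\<^sup>1\<close> gives the initial trace.
\<close>

section \<open>The Gaussian and the heat kernel\<close>

lemma lborel_affine_real_valued:
  fixes f :: "'a::euclidean_space \<Rightarrow> real" and c :: real
  assumes c: "c \<noteq> 0" and [measurable]: "f \<in> borel_measurable borel"
  shows lborel_integrable_affine_iff: "integrable lborel (\<lambda>x. f (t + c *\<^sub>R x)) \<longleftrightarrow> integrable lborel f"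
    and lborel_integral_affine: "(\<integral>x. f x \<partial>lborel) = \<bar>c\<bar> ^ DIM('a) * (\<integral>x. f (t + c *\<^sub>R x) \<partial>lborel)"
proof -
  show "integrable lborel (\<lambda>x. f (t + c *\<^sub>R x)) \<longleftrightarrow> integrable lborel f"
  proof -
    have "integrable lborel f \<longleftrightarrow> integrable (density (distr lborel borel (\<lambda>x. t + c *\<^sub>R x)) (\<lambda>_. \<bar>c\<bar>^DIM('a))) f"
      by (rule arg_cong[OF lborel_affine[OF c, of t], of "\<lambda>M. integrable M f"])
    also have "\<dots> \<longleftrightarrow> integrable (distr lborel borel (\<lambda>x. t + c *\<^sub>R x)) (\<lambda>x. \<bar>c\<bar>^DIM('a) *\<^sub>R f x)"
      by (rule integrable_density) auto
    also have "\<dots> \<longleftrightarrow> integrable (distr lborel borel (\<lambda>x. t + c *\<^sub>R x)) f"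
      using c by simp
    also have "\<dots> \<longleftrightarrow> integrable lborel (\<lambda>x. f (t + c *\<^sub>R x))"
      by (rule integrable_distr_eq) auto
    finally show ?thesis by simp
  qed
  show "(\<integral>x. f x \<partial>lborel) = \<bar>c\<bar> ^ DIM('a) * (\<integral>x. f (t + c *\<^sub>R x) \<partial>lborel)"
    using c by (subst lborel_affine[OF c, of t]) (simp add: integral_density integral_distr)
qed

text \<open>The mass of \<open>F\<close> is invariant under translation by \<open>v\<close>, and \<open>F (x + v) - F x\<close> is the average of
  \<open>F'\<close> over the segment from \<open>x\<close> to \<open>x + v\<close>; so no decay of \<open>F\<close> at infinity has to be discussed when
  integrating by parts.\<close>
lemma integral_directional_derivative_zero:
  fixes F F' :: "'e::euclidean_space \<Rightarrow> real"
  assumes deriv: "\<And>x. ((\<lambda>h. F (x + h *\<^sub>R v)) has_real_derivative F' x) (at 0)"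
    and cont: "continuous_on UNIV F'" and int: "integrable lborel F" and int': "integrable lborel F'"
  shows "(\<integral>x. F' x \<partial>lborel) = 0"
proof -
  have [measurable]: "F' \<in> borel_measurable borel" "F \<in> borel_measurable borel"
    using int int' by auto
  have d: "((\<lambda>s. F (x + s *\<^sub>R v)) has_real_derivative F' (x + s *\<^sub>R v)) (at s)" for x s
    using deriv[of "x + s *\<^sub>R v"] DERIV_shift[of "\<lambda>h. F (x + h *\<^sub>R v)" "F' (x + s *\<^sub>R v)" 0 s]
    by (simp add: scaleR_add_left add.commute add.left_commute add.assoc)
  have c: "isCont (\<lambda>s. F' (x + s *\<^sub>R v)) s" for x s
  proof -
    have "continuous_on UNIV (\<lambda>s. F' (x + s *\<^sub>R v))"
      by (intro continuous_on_compose2[OF cont] continuous_intros) auto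
    then show ?thesis by (simp add: continuous_on_eq_continuous_at)
  qed
  have FTC: "(\<integral>s. F' (x + s *\<^sub>R v) * indicator {0..1} s \<partial>lborel) = F (x + v) - F x" for x
    using integral_FTC_Icc_real[of 0 1 "\<lambda>s. F (x + s *\<^sub>R v)" "\<lambda>s. F' (x + s *\<^sub>R v)"] d c by simp
  have tr: "integrable lborel (\<lambda>x. f (x + a)) \<and> (\<integral>x. f (x + a) \<partial>lborel) = (\<integral>x. f x \<partial>lborel)"
    if "integrable lborel f" for f :: "'e \<Rightarrow> real" and a
    using that lborel_integrable_affine_iff[of 1 f a] lborel_integral_affine[of 1 f a]
    by (simp add: add.commute)
  have nF': "integrable lborel (\<lambda>x. \<bar>F' x\<bar>)" using int' by simp
  have I: "integrable (lborel \<Otimes>\<^sub>M lborel) (\<lambda>(s::real, x). F' (x + s *\<^sub>R v) * indicator {0..1} s)"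
  proof (rule lborel_pair.Fubini_integrable)
    have "(\<lambda>s. \<integral>y. norm (case (s::real, y) of (s, x) \<Rightarrow> F' (x + s *\<^sub>R v) * indicator {0..1} s) \<partial>lborel)
       = (\<lambda>s. (\<integral>y. \<bar>F' y\<bar> \<partial>lborel) * indicator {0..1} s)"
      using tr[OF nF'] by (auto simp: abs_mult split: split_indicator)
    then show "integrable lborel (\<lambda>s. \<integral>y. norm (case (s::real, y) of (s, x) \<Rightarrow> F' (x + s *\<^sub>R v) * indicator {0..1} s) \<partial>lborel)"
      by (simp add: emeasure_lborel_Icc)
    show "AE s in lborel. integrable lborel (\<lambda>y. case (s::real, y) of (s, x) \<Rightarrow> F' (x + s *\<^sub>R v) * indicator {0..1} s)"
      using tr[OF int'] by auto
  qed measurable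
  have "0 = (\<integral>x. F (x + v) - F x \<partial>lborel)"
    using tr[OF int, of v] int by simp
  also have "\<dots> = (\<integral>x. (\<integral>s. F' (x + s *\<^sub>R v) * indicator {0..1} s \<partial>lborel) \<partial>lborel)"
    by (simp add: FTC)
  also have "\<dots> = (\<integral>s. (\<integral>x. F' (x + s *\<^sub>R v) * indicator {0..1} s \<partial>lborel) \<partial>lborel)"
    using lborel_pair.Fubini_integral[of "\<lambda>s x. F' (x + s *\<^sub>R v) * indicator {0..1} s"] I by simp
  also have "\<dots> = (\<integral>s. (\<integral>x. F' x \<partial>lborel) * indicator {0..1} (s::real) \<partial>lborel)"
    using tr[OF int'] by simp
  also have "\<dots> = (\<integral>x. F' x \<partial>lborel)" by (simp add: measure_def)
  finally show ?thesis by simp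
qed

lemma integrable_exp_neg_norm_sq:
  assumes "c > 0"
  shows "integrable lborel (\<lambda>z::'a::euclidean_space. exp (- c * (norm z)\<^sup>2))"
proof -
  define \<sigma> where "\<sigma> = 1 / sqrt (2 * c)"
  have sp: "\<sigma> > 0" using assms by (simp add: \<sigma>_def)
  have s2: "2 * \<sigma>\<^sup>2 = 1 / c" using assms by (simp add: \<sigma>_def power_divide)
  have e: "exp (- c * x\<^sup>2) = sqrt (2 * pi * \<sigma>\<^sup>2) * normal_density 0 \<sigma> x" for x
    using assms s2 sp by (simp add: normal_density_def s2 divide_simps)
  have i1: "integrable lborel (\<lambda>x::real. exp (- c * x\<^sup>2))"
    unfolding e using sp by simp
  have "(\<integral>\<^sup>+z. ennreal (exp (- c * (norm (z::'a))\<^sup>2)) \<partial>lborel) = (\<integral>\<^sup>+z. (\<Prod>b\<in>Basis. ennreal (exp (- c * (z \<bullet> b)\<^sup>2))) \<partial>(lborel :: 'a measure))"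
  proof (intro nn_integral_cong)
    fix z :: 'a
    have "(norm z)\<^sup>2 = (\<Sum>b\<in>Basis. (z \<bullet> b)\<^sup>2)"
      unfolding power2_norm_eq_inner by (subst euclidean_inner) (simp add: power2_eq_square)
    then show "ennreal (exp (- c * (norm z)\<^sup>2)) = (\<Prod>b\<in>Basis. ennreal (exp (- c * (z \<bullet> b)\<^sup>2)))"
      by (simp add: prod_ennreal exp_sum[symmetric] sum_distrib_left sum_negf)
  qed
  also have "\<dots> = (\<Prod>b\<in>(Basis::'a set). \<integral>\<^sup>+x. ennreal (exp (- c * x\<^sup>2)) \<partial>lborel)"
    by (rule nn_integral_lborel_prod) auto
  also have "\<dots> < \<infinity>"
    using i1 by (simp add: integrable_iff_bounded power_less_top_ennreal)
  finally show ?thesis by (intro integrableI_bounded) auto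
qed

text \<open>The heat kernel at time one. Dividing by the mass instead of writing out \<open>(4 \<pi>) powr (N/2)\<close> makes
  the total mass one by construction.\<close>
definition gauss :: "'a::euclidean_space \<Rightarrow> real" where
  "gauss z = exp (- ((norm z)\<^sup>2 / 4)) / (\<integral>x. exp (- ((norm (x::'a))\<^sup>2 / 4)) \<partial>lborel)"

lemma gauss_mass_pos: "(\<integral>x. exp (- ((norm (x::'a::euclidean_space))\<^sup>2 / 4)) \<partial>lborel) > 0"
proof -
  have i: "integrable lborel (\<lambda>x::'a. exp (- ((norm x)\<^sup>2 / 4)))"
    using integrable_exp_neg_norm_sq[of "1/4"] by simp
  have "(\<integral>x. exp (- ((norm (x::'a))\<^sup>2 / 4)) \<partial>lborel) \<noteq> 0"
  proof
    assume "(\<integral>x. exp (- ((norm (x::'a))\<^sup>2 / 4)) \<partial>lborel) = 0"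
    then have "AE x::'a in lborel. False"
      using integral_nonneg_eq_0_iff_AE[OF i] by simp
    then have "emeasure lborel (UNIV :: 'a set) = 0"
      unfolding eventually_False Measure_Space.ae_filter_eq_bot_iff by simp
    then show False by (simp add: emeasure_lborel_UNIV)
  qed
  then show ?thesis by (simp add: order.not_eq_order_implies_strict[OF not_sym])
qed

lemma gauss_pos: "gauss z > 0"
  using gauss_mass_pos[where 'a='a] by (simp add: gauss_def)

lemma gauss_nonneg [simp]: "gauss z \<ge> 0" using gauss_pos[of z] by simp

lemma continuous_on_gauss: "continuous_on UNIV (gauss :: 'a::euclidean_space \<Rightarrow> real)"
  unfolding gauss_def[abs_def] using gauss_mass_pos[where 'a='a] by (intro continuous_intros) auto

lemma gauss_borel [measurable]: "(gauss :: 'a::euclidean_space \<Rightarrow> real) \<in> borel_measurable borel"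
  by (intro borel_measurable_continuous_onI continuous_on_gauss)

lemma gauss_integrable: "integrable lborel (gauss :: 'a::euclidean_space \<Rightarrow> real)"
  unfolding gauss_def[abs_def] using integrable_exp_neg_norm_sq[of "1/4", where 'a='a] by simp

lemma gauss_integral: "(\<integral>z. gauss (z::'a::euclidean_space) \<partial>lborel) = 1"
  unfolding gauss_def using gauss_mass_pos[where 'a='a] by simp

lemma gauss_moment_integrable: "integrable lborel (\<lambda>z::'a::euclidean_space. norm z * gauss z)"
proof -
  define Z where "Z = (\<integral>x. exp (- ((norm (x::'a))\<^sup>2 / 4)) \<partial>lborel)"
  have Z: "Z > 0" unfolding Z_def by (rule gauss_mass_pos)
  have bd: "norm z * gauss z \<le> 8 / Z * exp (- (1/8) * (norm z)\<^sup>2)" for z :: 'a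
  proof -
    have "norm z \<le> 8 * (1 + (norm z)\<^sup>2/8)"
    proof -
      have "2 * norm z \<le> (norm z)\<^sup>2 + 1"
        using zero_le_power2[of "norm z - 1"] by (simp add: power2_diff)
      moreover have "n \<le> 8 * (1 + s / 8)" if "2 * n \<le> s + 1" "0 \<le> n" for n s :: real
        using that by (simp add: field_simps)
      ultimately show ?thesis using norm_ge_zero[of z] by blast
    qed
    also have "\<dots> \<le> 8 * exp ((norm z)\<^sup>2/8)" by (intro mult_left_mono exp_ge_add_one_self) auto
    finally have "norm z * exp (- ((norm z)\<^sup>2/4)) \<le> 8 * exp ((norm z)\<^sup>2/8) * exp (- ((norm z)\<^sup>2/4))"
      by (intro mult_right_mono) auto
    also have "\<dots> = 8 * exp (- (1/8) * (norm z)\<^sup>2)" by (simp add: exp_add[symmetric] mult.assoc)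
    finally show ?thesis
      using Z divide_right_mono[of "norm z * exp (- ((norm z)\<^sup>2/4))" _ Z] by (simp add: gauss_def Z_def[symmetric])
  qed
  show ?thesis
  proof (rule Bochner_Integration.integrable_bound)
    show "integrable lborel (\<lambda>z::'a. 8 / Z * exp (- (1/8) * (norm z)\<^sup>2))"
      using integrable_exp_neg_norm_sq[of "1/8", where 'a='a] by simp
    show "AE z::'a in lborel. norm (norm z * gauss z) \<le> norm (8 / Z * exp (- (1/8) * (norm z)\<^sup>2))"
      by (intro AE_I2) (use bd Z in \<open>auto simp: abs_mult abs_of_pos\<close>)
  qed measurable
qed

lemma gauss_has_derivative:
  "((\<lambda>h. gauss (x + h *\<^sub>R v)) has_real_derivative - (x \<bullet> v) / 2 * gauss x) (at 0)"
  unfolding gauss_def power2_norm_eq_inner using gauss_mass_pos[where 'a='a]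
  by (auto intro!: derivative_eq_intros simp: inner_add_left inner_add_right inner_commute power2_norm_eq_inner field_simps)

lemma gauss_mult_bounded_integrable:
  fixes F :: "'a::euclidean_space \<Rightarrow> real"
  assumes [measurable]: "F \<in> borel_measurable borel" and bdd: "\<And>x. \<bar>F x\<bar> \<le> B"
  shows "integrable lborel (\<lambda>x. gauss x * F x)"
proof (rule Bochner_Integration.integrable_bound[where f="\<lambda>x. B * gauss x"])
  have "0 \<le> B" using bdd[of 0] by linarith
  then have "gauss x * \<bar>F x\<bar> \<le> B * gauss x" for x
    using mult_left_mono[OF bdd[of x] gauss_nonneg[of x]] by (simp only: mult.commute)
  with \<open>0 \<le> B\<close> show "AE x in lborel. norm (gauss x * F x) \<le> norm (B * gauss x)"
    by (simp add: abs_mult)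
qed (use gauss_integrable in auto)

text \<open>As \<open>gauss\<close> has gradient \<open>- x gauss(x) / 2\<close>, this is the vanishing of the integral of the derivative
  of \<open>gauss * F\<close>. It trades the drift that comes from the scaling \<open>x = sqrt t z\<close> for a second derivative.\<close>
lemma gauss_integration_by_parts:
  fixes F F' :: "'a::euclidean_space \<Rightarrow> real"
  assumes deriv: "\<And>x. ((\<lambda>h. F (x + h *\<^sub>R v)) has_real_derivative F' x) (at 0)"
    and cont: "continuous_on UNIV F" "continuous_on UNIV F'"
    and bdd: "\<And>x. \<bar>F x\<bar> \<le> B" "\<And>x. \<bar>F' x\<bar> \<le> B"
  shows "(\<integral>x. gauss x * (x \<bullet> v) / 2 * F x \<partial>lborel) = (\<integral>x. gauss x * F' x \<partial>lborel)"
    and "integrable lborel (\<lambda>x. gauss x * (x \<bullet> v) / 2 * F x)" "integrable lborel (\<lambda>x. gauss x * F' x)"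
proof -
  have [measurable]: "F \<in> borel_measurable borel" "F' \<in> borel_measurable borel"
    using cont by (auto intro: borel_measurable_continuous_onI)
  have B: "0 \<le> B" using bdd(1)[of 0] by linarith
  have i0: "integrable lborel (\<lambda>x. gauss x * F x)"
    by (rule gauss_mult_bounded_integrable[OF _ bdd(1)]) auto
  show i1: "integrable lborel (\<lambda>x. gauss x * F' x)"
    by (rule gauss_mult_bounded_integrable[OF _ bdd(2)]) auto
  show i2: "integrable lborel (\<lambda>x. gauss x * (x \<bullet> v) / 2 * F x)"
  proof (rule Bochner_Integration.integrable_bound[where f="\<lambda>x. norm v * B * (norm x * gauss x)"])
    show "AE x in lborel. norm (gauss x * (x \<bullet> v) / 2 * F x) \<le> norm (norm v * B * (norm x * gauss x))"
    proof (intro AE_I2)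
      fix x :: 'a
      have "\<bar>x \<bullet> v\<bar> * \<bar>F x\<bar> \<le> (norm x * norm v) * B"
        using Cauchy_Schwarz_ineq2[of x v] bdd by (intro mult_mono) auto
      then have "gauss x * (\<bar>x \<bullet> v\<bar> * \<bar>F x\<bar>) \<le> gauss x * ((norm x * norm v) * B)"
        by (intro mult_left_mono) auto
      moreover have "0 \<le> gauss x * (\<bar>x \<bullet> v\<bar> * \<bar>F x\<bar>)" by simp
      ultimately have "gauss x * (\<bar>x \<bullet> v\<bar> * \<bar>F x\<bar>) / 2 \<le> gauss x * ((norm x * norm v) * B)" by linarith
      then show "norm (gauss x * (x \<bullet> v) / 2 * F x) \<le> norm (norm v * B * (norm x * gauss x))"
        using B by (simp add: abs_mult algebra_simps)
    qed
  qed (use gauss_moment_integrable in auto)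
  have "(\<integral>x. gauss x * F' x - gauss x * (x \<bullet> v) / 2 * F x \<partial>lborel) = 0"
  proof (rule integral_directional_derivative_zero[where F="\<lambda>x. gauss x * F x" and v=v])
    show "((\<lambda>h. gauss (x + h *\<^sub>R v) * F (x + h *\<^sub>R v)) has_real_derivative
        gauss x * F' x - gauss x * (x \<bullet> v) / 2 * F x) (at 0)" for x
      using DERIV_mult[OF gauss_has_derivative[of x v] deriv[of x]] by (simp add: algebra_simps)
    show "continuous_on UNIV (\<lambda>x. gauss x * F' x - gauss x * (x \<bullet> v) / 2 * F x)"
      by (intro continuous_intros continuous_on_gauss cont) auto
  qed (use i0 i1 i2 in auto)
  then show "(\<integral>x. gauss x * (x \<bullet> v) / 2 * F x \<partial>lborel) = (\<integral>x. gauss x * F' x \<partial>lborel)"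
    using i1 i2 by simp
qed

lemma fst_borel_measurable [measurable]:
  "(fst :: 'a::euclidean_space \<times> 'b::euclidean_space \<Rightarrow> 'a) \<in> borel_measurable borel"
  by (intro borel_measurable_continuous_onI continuous_intros)

lemma snd_borel_measurable [measurable]:
  "(snd :: 'a::euclidean_space \<times> 'b::euclidean_space \<Rightarrow> 'b) \<in> borel_measurable borel"
  by (intro borel_measurable_continuous_onI continuous_intros)

text \<open>Vanishing for \<open>t \<le> 0\<close> makes the convolution in space-time see the past only.\<close>
definition heat_kernel :: "real \<times> 'a::euclidean_space \<Rightarrow> real" where
  "heat_kernel p = (if fst p > 0 then gauss (snd p /\<^sub>R sqrt (fst p)) / sqrt (fst p) ^ DIM('a) else 0)"

lemma heat_kernel_nonneg [simp]: "heat_kernel p \<ge> 0"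
  by (simp add: heat_kernel_def)

lemma heat_kernel_borel [measurable]: "(heat_kernel :: real \<times> 'a::euclidean_space \<Rightarrow> real) \<in> borel_measurable borel"
  unfolding heat_kernel_def[abs_def] by measurable

lemma heat_kernel_rescale:
  "t > 0 \<Longrightarrow> sqrt t ^ DIM('a) * heat_kernel (t, sqrt t *\<^sub>R (z::'a::euclidean_space)) = gauss z"
  by (simp add: heat_kernel_def)

lemma integral_heat_kernel:
  fixes f :: "'a::euclidean_space \<Rightarrow> real"
  assumes t: "t > 0" and [measurable]: "f \<in> borel_measurable borel"
  shows heat_kernel_integral_rescale: "(\<integral>x. heat_kernel (t, x) * f x \<partial>lborel) = (\<integral>z. gauss z * f (sqrt t *\<^sub>R z) \<partial>lborel)"
    and heat_kernel_integrable_rescale: "integrable lborel (\<lambda>x. heat_kernel (t, x) * f x) \<longleftrightarrow> integrable lborel (\<lambda>z. gauss z * f (sqrt t *\<^sub>R z))"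
proof -
  have c: "sqrt t \<noteq> 0" and c': "\<bar>sqrt t\<bar> = sqrt t" using t by auto
  have e: "gauss z * f (sqrt t *\<^sub>R z) = sqrt t ^ DIM('a) * (heat_kernel (t, sqrt t *\<^sub>R z) * f (sqrt t *\<^sub>R z))" for z
    by (simp add: heat_kernel_rescale[OF t, symmetric])
  have m: "(\<lambda>x. heat_kernel (t, x) * f x) \<in> borel_measurable borel" by measurable
  show "(\<integral>x. heat_kernel (t, x) * f x \<partial>lborel) = (\<integral>z. gauss z * f (sqrt t *\<^sub>R z) \<partial>lborel)"
    unfolding e using lborel_integral_affine[OF c m, of 0] by (simp add: c')
  show "integrable lborel (\<lambda>x. heat_kernel (t, x) * f x) \<longleftrightarrow> integrable lborel (\<lambda>z. gauss z * f (sqrt t *\<^sub>R z))"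
    unfolding e using lborel_integrable_affine_iff[OF c m, of 0] t by simp
qed

lemma heat_kernel_integral_one:
  assumes "t > 0"
  shows "(\<integral>x. heat_kernel (t, x :: 'a::euclidean_space) \<partial>lborel) = 1" "integrable lborel (\<lambda>x::'a. heat_kernel (t, x))"
  using heat_kernel_integral_rescale[OF assms, of "\<lambda>_::'a. 1"] heat_kernel_integrable_rescale[OF assms, of "\<lambda>_::'a. 1"]
    gauss_integral[where 'a='a] gauss_integrable[where 'a='a] by auto

lemma integrable_lborel_product:
  fixes f :: "'a::euclidean_space \<Rightarrow> real" and g :: "'b::euclidean_space \<Rightarrow> real"
  assumes f: "integrable lborel f" and g: "integrable lborel g"
  shows "integrable (lborel \<Otimes>\<^sub>M lborel) (\<lambda>p. f (fst p) * g (snd p))"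
proof (rule lborel_pair.Fubini_integrable)
  have [measurable]: "f \<in> borel_measurable borel" "g \<in> borel_measurable borel" using f g by auto
  show "(\<lambda>p. f (fst p) * g (snd p)) \<in> borel_measurable (lborel \<Otimes>\<^sub>M lborel)" by measurable
qed (use f g in \<open>auto simp: abs_mult\<close>)

lemma set_integrable_inverse_sqrt:
  assumes "T > 0"
  shows "integrable lborel (\<lambda>\<tau>. indicator {0<..<T} \<tau> * (1 / sqrt \<tau>))"
proof -
  have "set_integrable lborel (einterval 0 (ereal T)) (\<lambda>\<tau>. 1 / sqrt \<tau>)"
  proof (rule interval_integral_FTC_nonneg(1)[where F="\<lambda>\<tau>. 2 * sqrt \<tau>" and A=0 and B="2 * sqrt T"])
    show "DERIV (\<lambda>\<tau>. 2 * sqrt \<tau>) x :> 1 / sqrt x" if "0 < ereal x" for x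
      using that by (auto intro!: derivative_eq_intros simp: field_simps)
    show "isCont (\<lambda>\<tau>. 1 / sqrt \<tau>) x" if "0 < ereal x" for x
      using that by (intro continuous_intros) auto
    have "((\<lambda>\<tau>. 2 * sqrt \<tau>) \<longlongrightarrow> 2 * sqrt 0) (at_right 0)" by (intro tendsto_intros)
    then show "(((\<lambda>\<tau>. 2 * sqrt \<tau>) \<circ> real_of_ereal) \<longlongrightarrow> 0) (at_right 0)"
      unfolding zero_ereal_def by (subst ereal_tendsto_simps1) simp
    have "((\<lambda>\<tau>. 2 * sqrt \<tau>) \<longlongrightarrow> 2 * sqrt T) (at_left T)" by (intro tendsto_intros)
    then show "(((\<lambda>\<tau>. 2 * sqrt \<tau>) \<circ> real_of_ereal) \<longlongrightarrow> 2 * sqrt T) (at_left (ereal T))"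
      by (subst ereal_tendsto_simps1)
  qed (use assms in auto)
  then show ?thesis
    unfolding zero_ereal_def einterval_eq set_integrable_def by simp
qed

text \<open>Along the parabola \<open>\<tau> \<mapsto> (\<tau>, sqrt \<tau> x)\<close> the fundamental theorem of calculus expresses
  \<open>\<phi> (T, sqrt T x) - \<phi> (0, 0)\<close> by the first derivatives of \<open>\<phi>\<close>. Averaging over \<open>x\<close> with Gaussian weight and
  integrating by parts turns the drift term into the Laplacian. No derivative of the heat kernel itself is
  taken, and its singularity at the origin is replaced by the integrable factor \<open>1 / sqrt \<tau>\<close>.\<close>
lemma heat_kernel_ito:
  fixes \<phi> \<phi>t :: "real \<times> 'a::euclidean_space \<Rightarrow> real" and \<phi>x \<phi>xx :: "'a \<Rightarrow> real \<times> 'a \<Rightarrow> real"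
  assumes T: "T > 0"
    and D: "\<And>z. (\<phi> has_derivative (\<lambda>v. \<phi>t z * fst v + (\<Sum>b\<in>Basis. \<phi>x b z * (snd v \<bullet> b)))) (at z)"
    and D2: "\<And>b z. b \<in> Basis \<Longrightarrow> ((\<lambda>h. \<phi>x b (z + h *\<^sub>R (0, b))) has_real_derivative \<phi>xx b z) (at 0)"
    and cont: "continuous_on UNIV \<phi>t" "\<And>b. b \<in> Basis \<Longrightarrow> continuous_on UNIV (\<phi>x b)"
      "\<And>b. b \<in> Basis \<Longrightarrow> continuous_on UNIV (\<phi>xx b)"
    and bdd: "\<And>z. \<bar>\<phi> z\<bar> \<le> B" "\<And>z. \<bar>\<phi>t z\<bar> \<le> B" "\<And>b z. b \<in> Basis \<Longrightarrow> \<bar>\<phi>x b z\<bar> \<le> B"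
      "\<And>b z. b \<in> Basis \<Longrightarrow> \<bar>\<phi>xx b z\<bar> \<le> B"
  defines "L \<equiv> \<lambda>z. \<phi>t z + (\<Sum>b\<in>Basis. \<phi>xx b z)"
  shows "integrable lborel (\<lambda>p. indicator ({0<..<T} \<times> UNIV) p * (heat_kernel p * L p))" (is ?int)
    and "(\<integral>p. indicator ({0<..<T} \<times> UNIV) p * (heat_kernel p * L p) \<partial>lborel)
       = (\<integral>x. heat_kernel (T, x) * \<phi> (T, x) \<partial>lborel) - \<phi> (0, 0)" (is ?eq)
proof -
  have B: "B \<ge> 0" using bdd(1)[of 0] by linarith
  have c\<phi>: "continuous_on UNIV \<phi>"
    using D by (auto simp: continuous_on_eq_continuous_at intro: has_derivative_continuous)
  have m[measurable]: "\<phi> \<in> borel_measurable borel" "\<phi>t \<in> borel_measurable borel"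
    "\<And>b. b \<in> Basis \<Longrightarrow> \<phi>x b \<in> borel_measurable borel" "\<And>b. b \<in> Basis \<Longrightarrow> \<phi>xx b \<in> borel_measurable borel"
    using cont c\<phi> by (auto intro: borel_measurable_continuous_onI)
  have [measurable]: "L \<in> borel_measurable borel" unfolding L_def by measurable
  define K where "K = B + DIM('a) * B"
  have LK: "\<bar>L z\<bar> \<le> K" for z
  proof -
    have "\<bar>\<Sum>b\<in>Basis. \<phi>xx b z\<bar> \<le> (\<Sum>b\<in>(Basis::'a set). B)"
      by (rule order_trans[OF sum_abs]) (intro sum_mono bdd)
    then show ?thesis using bdd(2)[of z] by (simp add: L_def K_def)
  qed
  \<comment> \<open>the derivative of \<open>\<phi>\<close> along the parabola\<close>
  define g where "g = (\<lambda>\<tau> x. \<phi>t (\<tau>, sqrt \<tau> *\<^sub>R x) + (\<Sum>b\<in>Basis. \<phi>x b (\<tau>, sqrt \<tau> *\<^sub>R x) * (x \<bullet> b)) / (2 * sqrt \<tau>))"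
  have g_m[measurable]: "(\<lambda>p. g (fst p) (snd p)) \<in> borel_measurable borel"
    unfolding g_def by measurable
  have g_m2[measurable]: "(\<lambda>x. g \<tau> x) \<in> borel_measurable borel" "(\<lambda>\<tau>. g \<tau> x) \<in> borel_measurable borel" for \<tau> x
    unfolding g_def by measurable
  have g_bd: "\<bar>g \<tau> x\<bar> \<le> B + DIM('a) * B * norm x * (1 / sqrt \<tau>)" if "\<tau> > 0" for \<tau> x
  proof -
    have "\<bar>\<Sum>b\<in>Basis. \<phi>x b (\<tau>, sqrt \<tau> *\<^sub>R x) * (x \<bullet> b)\<bar> \<le> (\<Sum>b\<in>(Basis::'a set). B * norm x)"
      by (rule order_trans[OF sum_abs], intro sum_mono)
         (use B bdd(3) Basis_le_norm in \<open>auto simp: abs_mult intro!: mult_mono\<close>)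
    then have "\<bar>\<Sum>b\<in>Basis. \<phi>x b (\<tau>, sqrt \<tau> *\<^sub>R x) * (x \<bullet> b)\<bar> / (2 * sqrt \<tau>) \<le> DIM('a) * (B * norm x) / (2 * sqrt \<tau>)"
      using that by (intro divide_right_mono) auto
    also have "\<dots> \<le> DIM('a) * B * norm x * (1 / sqrt \<tau>)"
      using that B by (simp add: field_simps)
    finally have "\<bar>(\<Sum>b\<in>Basis. \<phi>x b (\<tau>, sqrt \<tau> *\<^sub>R x) * (x \<bullet> b)) / (2 * sqrt \<tau>)\<bar> \<le> DIM('a) * B * norm x * (1 / sqrt \<tau>)"
      using that by (simp add: abs_divide)
    then show ?thesis using bdd(2)[of "(\<tau>, sqrt \<tau> *\<^sub>R x)"] unfolding g_def by linarith
  qed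
  have g_int: "integrable lborel (\<lambda>\<tau>. indicator {0<..<T} \<tau> * g \<tau> x)" for x
  proof (rule Bochner_Integration.integrable_bound)
    show "integrable lborel (\<lambda>\<tau>. B * indicator {0<..<T} \<tau> + DIM('a) * B * norm x * (indicator {0<..<T} \<tau> * (1 / sqrt \<tau>)))"
      using set_integrable_inverse_sqrt[OF T] T by (intro Bochner_Integration.integrable_add integrable_mult_right) auto
    show "AE \<tau> in lborel. norm (indicator {0<..<T} \<tau> * g \<tau> x) \<le> norm (B * indicator {0<..<T} \<tau> + DIM('a) * B * norm x * (indicator {0<..<T} \<tau> * (1 / sqrt \<tau>)))"
      using g_bd[of _ x] B by (auto intro!: AE_I2 order_trans[OF _ abs_ge_self] split: split_indicator)
  qed measurable
  have FTC: "(\<integral>\<tau>. indicator {0<..<T} \<tau> * g \<tau> x \<partial>lborel) = \<phi> (T, sqrt T *\<^sub>R x) - \<phi> (0, 0)" for x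
  proof -
    have cs: "continuous_on UNIV (\<lambda>\<tau>. \<phi> (\<tau>, sqrt \<tau> *\<^sub>R x))"
      by (intro continuous_on_compose2[OF c\<phi>] continuous_intros) auto
    then have lim: "((\<lambda>\<tau>. \<phi> (\<tau>, sqrt \<tau> *\<^sub>R x)) \<longlongrightarrow> \<phi> (s, sqrt s *\<^sub>R x)) (at s within A)" for s A
      by (meson UNIV_I continuous_on_def continuous_on_subset subset_UNIV tendsto_within_subset)
    have "(LBINT \<tau>=0..ereal T. g \<tau> x) = \<phi> (T, sqrt T *\<^sub>R x) - \<phi> (0, 0)"
    proof (rule interval_integral_FTC_integrable[where F="\<lambda>\<tau>. \<phi> (\<tau>, sqrt \<tau> *\<^sub>R x)"])
      fix \<tau> :: real assume "0 < ereal \<tau>"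
      then have \<tau>: "\<tau> > 0" by simp
      have d1: "((\<lambda>\<tau>. (\<tau>, sqrt \<tau> *\<^sub>R x)) has_derivative (\<lambda>h. (h, (h * (inverse (sqrt \<tau>) / 2)) *\<^sub>R x))) (at \<tau>)"
      proof -
        have "(sqrt has_derivative (\<lambda>h. h * (inverse (sqrt \<tau>) / 2))) (at \<tau>)"
          using DERIV_real_sqrt[OF \<tau>] unfolding has_field_derivative_def
          by (rule has_derivative_eq_rhs) (simp add: fun_eq_iff)
        then show ?thesis
          by (intro has_derivative_Pair has_derivative_ident has_derivative_scaleR_left)
      qed
      have "((\<lambda>\<tau>. \<phi> (\<tau>, sqrt \<tau> *\<^sub>R x)) has_derivative (\<lambda>h. \<phi>t (\<tau>, sqrt \<tau> *\<^sub>R x) * h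
           + (\<Sum>b\<in>Basis. \<phi>x b (\<tau>, sqrt \<tau> *\<^sub>R x) * (((h * (inverse (sqrt \<tau>) / 2)) *\<^sub>R x) \<bullet> b)))) (at \<tau>)"
        using has_derivative_compose[OF d1 D] by simp
      also have "(\<lambda>h. \<phi>t (\<tau>, sqrt \<tau> *\<^sub>R x) * h
           + (\<Sum>b\<in>Basis. \<phi>x b (\<tau>, sqrt \<tau> *\<^sub>R x) * (((h * (inverse (sqrt \<tau>) / 2)) *\<^sub>R x) \<bullet> b))) = (\<lambda>h. h *\<^sub>R g \<tau> x)"
      proof
        fix h
        have "(\<Sum>b\<in>Basis. \<phi>x b (\<tau>, sqrt \<tau> *\<^sub>R x) * (((h * (inverse (sqrt \<tau>) / 2)) *\<^sub>R x) \<bullet> b))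
           = (h * (inverse (sqrt \<tau>) / 2)) * (\<Sum>b\<in>Basis. \<phi>x b (\<tau>, sqrt \<tau> *\<^sub>R x) * (x \<bullet> b))"
          unfolding sum_distrib_left by (intro sum.cong refl) simp
        then show "\<phi>t (\<tau>, sqrt \<tau> *\<^sub>R x) * h
           + (\<Sum>b\<in>Basis. \<phi>x b (\<tau>, sqrt \<tau> *\<^sub>R x) * (((h * (inverse (sqrt \<tau>) / 2)) *\<^sub>R x) \<bullet> b)) = h *\<^sub>R g \<tau> x"
          by (simp only: g_def real_scaleR_def distrib_left) (simp add: field_simps)
      qed
      finally show "((\<lambda>\<tau>. \<phi> (\<tau>, sqrt \<tau> *\<^sub>R x)) has_vector_derivative g \<tau> x) (at \<tau>)"
        by (simp add: has_vector_derivative_def)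
      have "continuous_on {0<..} (\<lambda>\<tau>. g \<tau> x)" unfolding g_def
        by (intro continuous_intros continuous_on_compose2[OF cont(1)] continuous_on_compose2[OF cont(2)]) auto
      then show "isCont (\<lambda>\<tau>. g \<tau> x) \<tau>"
        using \<tau> by (simp add: continuous_on_eq_continuous_at)
    next
      show "set_integrable lborel (einterval 0 (ereal T)) (\<lambda>\<tau>. g \<tau> x)"
        unfolding zero_ereal_def einterval_eq set_integrable_def using g_int[of x] by simp
      show "(((\<lambda>\<tau>. \<phi> (\<tau>, sqrt \<tau> *\<^sub>R x)) \<circ> real_of_ereal) \<longlongrightarrow> \<phi> (0, 0)) (at_right 0)"
        unfolding zero_ereal_def using lim[of 0] by (subst ereal_tendsto_simps1) simp
      show "(((\<lambda>\<tau>. \<phi> (\<tau>, sqrt \<tau> *\<^sub>R x)) \<circ> real_of_ereal) \<longlongrightarrow> \<phi> (T, sqrt T *\<^sub>R x)) (at_left (ereal T))"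
        using lim[of T] by (subst ereal_tendsto_simps1) simp
    qed (use T in auto)
    then show ?thesis using T
      by (simp add: interval_lebesgue_integral_def zero_ereal_def einterval_eq set_lebesgue_integral_def)
  qed
  have I: "integrable (lborel \<Otimes>\<^sub>M lborel) (\<lambda>(\<tau>, x). indicator {0<..<T} \<tau> * (gauss x * g \<tau> x))"
  proof (rule Bochner_Integration.integrable_bound)
    show "integrable (lborel \<Otimes>\<^sub>M lborel) (\<lambda>p::real\<times>'a. (B * indicator {0<..<T} (fst p)) * gauss (snd p)
        + (DIM('a) * B * (indicator {0<..<T} (fst p) * (1 / sqrt (fst p)))) * (norm (snd p) * gauss (snd p)))"
      using set_integrable_inverse_sqrt[OF T] T gauss_integrable gauss_moment_integrable
      by (intro Bochner_Integration.integrable_add integrable_lborel_product integrable_mult_right) auto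
    show "(\<lambda>(\<tau>, x). indicator {0<..<T} \<tau> * (gauss x * g \<tau> x)) \<in> borel_measurable (lborel \<Otimes>\<^sub>M lborel)"
      unfolding split_beta' lborel_prod by measurable
    show "AE p in lborel \<Otimes>\<^sub>M lborel. norm (case p of (\<tau>, x) \<Rightarrow> indicator {0<..<T} \<tau> * (gauss x * g \<tau> x))
       \<le> norm ((B * indicator {0<..<T} (fst p)) * gauss (snd p)
        + (DIM('a) * B * (indicator {0<..<T} (fst p) * (1 / sqrt (fst p)))) * (norm (snd p) * gauss (snd p)))"
    proof (intro AE_I2)
      fix p :: "real \<times> 'a"
      show "norm (case p of (\<tau>, x) \<Rightarrow> indicator {0<..<T} \<tau> * (gauss x * g \<tau> x))
       \<le> norm ((B * indicator {0<..<T} (fst p)) * gauss (snd p)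
        + (DIM('a) * B * (indicator {0<..<T} (fst p) * (1 / sqrt (fst p)))) * (norm (snd p) * gauss (snd p)))"
      proof (cases "fst p \<in> {0<..<T}")
        case True
        then have "gauss (snd p) * \<bar>g (fst p) (snd p)\<bar> \<le> gauss (snd p) * (B + DIM('a) * B * norm (snd p) * (1 / sqrt (fst p)))"
          using g_bd by (intro mult_left_mono) auto
        also have "\<dots> \<le> \<bar>\<dots>\<bar>" by (rule abs_ge_self)
        finally show ?thesis using True
          by (auto simp: split_beta' abs_mult algebra_simps)
      qed (auto simp: split_beta')
    qed
  qed
  \<comment> \<open>the Gaussian average of the drift is the average of the Laplacian\<close>
  have key: "(\<integral>x. gauss x * g \<tau> x \<partial>lborel) = (\<integral>x. heat_kernel (\<tau>, x) * L (\<tau>, x) \<partial>lborel)" if \<tau>: "\<tau> > 0" for \<tau>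
  proof -
    let ?e = "\<lambda>x::'a. (\<tau>, sqrt \<tau> *\<^sub>R x)"
    have ibp: "(\<integral>x. gauss x * (x \<bullet> b) / 2 * \<phi>x b (?e x) \<partial>lborel) = (\<integral>x. gauss x * (sqrt \<tau> * \<phi>xx b (?e x)) \<partial>lborel)"
      "integrable lborel (\<lambda>x. gauss x * (x \<bullet> b) / 2 * \<phi>x b (?e x))"
      "integrable lborel (\<lambda>x. gauss x * (sqrt \<tau> * \<phi>xx b (?e x)))" if b: "b \<in> Basis" for b
    proof -
      have 1: "((\<lambda>h. \<phi>x b (?e (x + h *\<^sub>R b))) has_real_derivative sqrt \<tau> * \<phi>xx b (?e x)) (at 0)" for x
      proof -
        have "((\<lambda>h. \<phi>x b (?e x + (sqrt \<tau> * h) *\<^sub>R (0, b))) has_real_derivative \<phi>xx b (?e x) * sqrt \<tau>) (at 0)"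
          by (rule DERIV_chain2[where f="\<lambda>h. \<phi>x b (?e x + h *\<^sub>R (0, b))" and g="\<lambda>h. sqrt \<tau> * h"])
             (use D2[OF b, of "?e x"] in \<open>auto intro!: derivative_eq_intros\<close>)
        then show ?thesis by (simp add: algebra_simps)
      qed
      have 2: "continuous_on UNIV (\<lambda>x. \<phi>x b (?e x))" "continuous_on UNIV (\<lambda>x. sqrt \<tau> * \<phi>xx b (?e x))"
        using b by (intro continuous_intros continuous_on_compose2[OF cont(2)] continuous_on_compose2[OF cont(3)]; auto)+
      have 3: "\<bar>\<phi>x b (?e x)\<bar> \<le> (1 + sqrt \<tau>) * B" "\<bar>sqrt \<tau> * \<phi>xx b (?e x)\<bar> \<le> (1 + sqrt \<tau>) * B" for x
      proof -
        have "1 * \<bar>\<phi>x b (?e x)\<bar> \<le> (1 + sqrt \<tau>) * B" using bdd(3)[OF b] B \<tau> by (intro mult_mono) auto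
        then show "\<bar>\<phi>x b (?e x)\<bar> \<le> (1 + sqrt \<tau>) * B" by simp
        show "\<bar>sqrt \<tau> * \<phi>xx b (?e x)\<bar> \<le> (1 + sqrt \<tau>) * B"
          unfolding abs_mult using bdd(4)[OF b] B \<tau> by (intro mult_mono) auto
      qed
      show "(\<integral>x. gauss x * (x \<bullet> b) / 2 * \<phi>x b (?e x) \<partial>lborel) = (\<integral>x. gauss x * (sqrt \<tau> * \<phi>xx b (?e x)) \<partial>lborel)"
        by (rule gauss_integration_by_parts(1)[OF 1 2 3])
      show "integrable lborel (\<lambda>x. gauss x * (x \<bullet> b) / 2 * \<phi>x b (?e x))"
        by (rule gauss_integration_by_parts(2)[OF 1 2 3])
      show "integrable lborel (\<lambda>x. gauss x * (sqrt \<tau> * \<phi>xx b (?e x)))"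
        by (rule gauss_integration_by_parts(3)[OF 1 2 3])
    qed
    have i0: "integrable lborel (\<lambda>x. gauss x * \<phi>t (?e x))"
      by (rule gauss_mult_bounded_integrable[OF _ bdd(2)]) measurable
    have s: "1 / sqrt \<tau> * (gauss x * (sqrt \<tau> * a)) = gauss x * a" for x :: 'a and a using \<tau> by simp
    have ixx: "integrable lborel (\<lambda>x. gauss x * \<phi>xx b (?e x))" if "b \<in> Basis" for b
      using integrable_mult_right[OF ibp(3)[OF that], of "1 / sqrt \<tau>"] unfolding s by simp
    have "(\<integral>x. gauss x * g \<tau> x \<partial>lborel) = (\<integral>x. gauss x * \<phi>t (?e x) + (\<Sum>b\<in>Basis. 1 / sqrt \<tau> * (gauss x * (x \<bullet> b) / 2 * \<phi>x b (?e x))) \<partial>lborel)"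
      by (intro Bochner_Integration.integral_cong) (auto simp: g_def algebra_simps sum_distrib_left sum_divide_distrib)
    also have "\<dots> = (\<integral>x. gauss x * \<phi>t (?e x) \<partial>lborel) + (\<Sum>b\<in>Basis. 1 / sqrt \<tau> * (\<integral>x. gauss x * (x \<bullet> b) / 2 * \<phi>x b (?e x) \<partial>lborel))"
      using ibp(2) i0 by (subst Bochner_Integration.integral_add) (auto simp del: times_divide_eq_left times_divide_eq_right)
    also have "\<dots> = (\<integral>x. gauss x * \<phi>t (?e x) \<partial>lborel) + (\<Sum>b\<in>Basis. (\<integral>x. 1 / sqrt \<tau> * (gauss x * (sqrt \<tau> * \<phi>xx b (?e x))) \<partial>lborel))"
      by (intro arg_cong2[where f="(+)"] refl sum.cong) (simp only: ibp(1) integral_mult_right_zero)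
    also have "\<dots> = (\<integral>x. gauss x * \<phi>t (?e x) \<partial>lborel) + (\<Sum>b\<in>Basis. (\<integral>x. gauss x * \<phi>xx b (?e x) \<partial>lborel))"
      unfolding s ..
    also have "\<dots> = (\<integral>x. gauss x * L (?e x) \<partial>lborel)"
      using i0 ixx by (simp add: L_def distrib_left sum_distrib_left)
    also have "\<dots> = (\<integral>x. heat_kernel (\<tau>, x) * L (\<tau>, x) \<partial>lborel)"
      by (rule heat_kernel_integral_rescale[OF \<tau>, symmetric]) measurable
    finally show ?thesis .
  qed
  have hkL: "integrable lborel (\<lambda>x. heat_kernel (\<tau>, x) * \<bar>L (\<tau>, x)\<bar>)" 
    "(\<integral>x. heat_kernel (\<tau>, x) * \<bar>L (\<tau>, x)\<bar> \<partial>lborel) \<le> K" if \<tau>: "\<tau> > 0" for \<tau>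
  proof -
    have 1: "heat_kernel (\<tau>, x) * \<bar>L (\<tau>, x)\<bar> \<le> K * heat_kernel (\<tau>, x)" for x
      using mult_left_mono[OF LK heat_kernel_nonneg, of "(\<tau>, x)" "(\<tau>, x)"] by (simp only: mult.commute)
    show 2: "integrable lborel (\<lambda>x. heat_kernel (\<tau>, x) * \<bar>L (\<tau>, x)\<bar>)"
      by (rule Bochner_Integration.integrable_bound[where f="\<lambda>x::'a. K * heat_kernel (\<tau>, x)"])
         (use heat_kernel_integral_one(2)[OF \<tau>] 1 in \<open>auto intro: order_trans[OF _ abs_ge_self]\<close>)
    have "(\<integral>x. heat_kernel (\<tau>, x) * \<bar>L (\<tau>, x)\<bar> \<partial>lborel) \<le> (\<integral>x. K * heat_kernel (\<tau>, x::'a) \<partial>lborel)"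
      using heat_kernel_integral_one(2)[OF \<tau>] by (intro Bochner_Integration.integral_mono[OF 2 _ 1]) auto
    then show "(\<integral>x. heat_kernel (\<tau>, x) * \<bar>L (\<tau>, x)\<bar> \<partial>lborel) \<le> K"
      using heat_kernel_integral_one(1)[OF \<tau>, where 'a='a] by simp
  qed
  have J: "integrable (lborel \<Otimes>\<^sub>M lborel) (\<lambda>p. indicator ({0<..<T} \<times> UNIV) p * (heat_kernel p * L p))"
  proof (rule lborel_pair.Fubini_integrable)
    show "integrable lborel (\<lambda>\<tau>. \<integral>y. norm (indicator ({0<..<T} \<times> UNIV) (\<tau>, y) * (heat_kernel (\<tau>, y) * L (\<tau>, y))) \<partial>lborel)"
    proof (rule Bochner_Integration.integrable_bound[where f="\<lambda>\<tau>. K * indicator {0<..<T} \<tau>"])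
      show "AE \<tau> in lborel. norm (\<integral>y. norm (indicator ({0<..<T} \<times> UNIV) (\<tau>, y) * (heat_kernel (\<tau>, y) * L (\<tau>, y))) \<partial>lborel) \<le> norm (K * indicator {0<..<T} \<tau>)"
        using hkL(2) by (intro AE_I2) (auto simp: indicator_def abs_mult intro: order_trans[OF _ abs_ge_self])
      show "(\<lambda>\<tau>. \<integral>y. norm (indicator ({0<..<T} \<times> UNIV) (\<tau>, y) * (heat_kernel (\<tau>, y) * L (\<tau>, y))) \<partial>lborel) \<in> borel_measurable lborel"
        unfolding measurable_lborel2 indicator_times by measurable
    qed (use T in auto)
    show "AE \<tau> in lborel. integrable lborel (\<lambda>y. indicator ({0<..<T} \<times> UNIV) (\<tau>, y) * (heat_kernel (\<tau>, y) * L (\<tau>, y)))"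
    proof (intro AE_I2)
      fix \<tau> show "integrable lborel (\<lambda>y. indicator ({0<..<T} \<times> UNIV) (\<tau>, y) * (heat_kernel (\<tau>, y) * L (\<tau>, y)))"
        using integrable_norm_cancel[of lborel "\<lambda>y. heat_kernel (\<tau>, y) * L (\<tau>, y)"] hkL(1)[of \<tau>]
        by (cases "\<tau> \<in> {0<..<T}") (auto simp: abs_mult)
    qed
    show "(\<lambda>p. indicator ({0<..<T} \<times> UNIV) p * (heat_kernel p * L p)) \<in> borel_measurable (lborel \<Otimes>\<^sub>M lborel)"
      unfolding lborel_prod indicator_times by measurable
  qed
  then show ?int by (simp add: lborel_prod)
  have "(\<integral>p. indicator ({0<..<T} \<times> UNIV) p * (heat_kernel p * L p) \<partial>lborel)
     = (\<integral>\<tau>. (\<integral>x. indicator ({0<..<T} \<times> UNIV) (\<tau>, x) * (heat_kernel (\<tau>, x) * L (\<tau>, x)) \<partial>lborel) \<partial>lborel)"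
    using lborel_pair.integral_fst'[OF J] by (simp add: lborel_prod)
  also have "\<dots> = (\<integral>\<tau>. (\<integral>x. indicator {0<..<T} \<tau> * (gauss x * g \<tau> x) \<partial>lborel) \<partial>lborel)"
  proof (rule Bochner_Integration.integral_cong[OF refl])
    fix \<tau> :: real
    show "(\<integral>x. indicator ({0<..<T} \<times> UNIV) (\<tau>, x) * (heat_kernel (\<tau>, x) * L (\<tau>, x)) \<partial>lborel)
        = (\<integral>x. indicator {0<..<T} \<tau> * (gauss x * g \<tau> x) \<partial>lborel)"
      using key[of \<tau>] by (cases "\<tau> \<in> {0<..<T}") auto
  qed
  also have "\<dots> = (\<integral>x. (\<integral>\<tau>. indicator {0<..<T} \<tau> * (gauss x * g \<tau> x) \<partial>lborel) \<partial>lborel)"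
    using lborel_pair.Fubini_integral[OF I] by simp
  also have "\<dots> = (\<integral>x. gauss x * (\<phi> (T, sqrt T *\<^sub>R x) - \<phi> (0, 0)) \<partial>lborel)"
    unfolding FTC[symmetric] by (simp add: mult.left_commute)
  also have "\<dots> = (\<integral>x. gauss x * \<phi> (T, sqrt T *\<^sub>R x) \<partial>lborel) - \<phi> (0, 0)"
  proof -
    have "integrable lborel (\<lambda>x. gauss x * \<phi> (T, sqrt T *\<^sub>R x))"
      by (rule gauss_mult_bounded_integrable[OF _ bdd(1)]) measurable
    then show ?thesis
      using gauss_integrable[where 'a='a] gauss_integral[where 'a='a] by (simp add: right_diff_distrib)
  qed
  also have "(\<integral>x. gauss x * \<phi> (T, sqrt T *\<^sub>R x) \<partial>lborel) = (\<integral>x. heat_kernel (T, x) * \<phi> (T, x) \<partial>lborel)"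
    by (rule heat_kernel_integral_rescale[OF T, symmetric]) measurable
  finally show ?eq .
qed

section \<open>Heat flow and Duhamel potentials of powers of the norm\<close>

definition heat_flow :: "('a::euclidean_space \<Rightarrow> real) \<Rightarrow> real \<times> 'a \<Rightarrow> real" where
  "heat_flow f z = (\<integral>y. heat_kernel (fst z, snd z - y) * f y \<partial>lborel)"

definition duhamel :: "(real \<times> 'a::euclidean_space \<Rightarrow> real) \<Rightarrow> real \<times> 'a \<Rightarrow> real" where
  "duhamel h z = (\<integral>p. indicator ({0<..} \<times> UNIV) p * (heat_kernel (z - p) * h p) \<partial>lborel)"

text \<open>The constant in \<open>- \<Delta> (norm x powr (- k)) = hardy N k * norm x powr (- k - 2)\<close>; its largest value
  over \<open>k\<close> is the constant of Hardy's inequality.\<close>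
definition hardy :: "nat \<Rightarrow> real \<Rightarrow> real" where
  "hardy N k = k * (real N - 2 - k)"

lemma lborel_reflect:
  fixes f :: "'a::euclidean_space \<Rightarrow> real"
  assumes [measurable]: "f \<in> borel_measurable borel"
  shows lborel_integrable_reflect_iff: "integrable lborel (\<lambda>x. f (c - x)) \<longleftrightarrow> integrable lborel f"
    and lborel_integral_reflect: "(\<integral>x. f (c - x) \<partial>lborel) = (\<integral>x. f x \<partial>lborel)"
  using lborel_integrable_affine_iff[of "-1" f c] lborel_integral_affine[of "-1" f c] by auto

lemma AE_snd_neq:
  fixes x :: "'a::euclidean_space"
  shows "AE p in (lborel :: (real \<times> 'a) measure). snd p \<noteq> x"
proof -
  have "AE p in (lborel :: real measure) \<Otimes>\<^sub>M (lborel :: 'a measure). snd p \<noteq> x"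
  proof (rule lborel_pair.AE_pair_measure)
    show "AE t in (lborel :: real measure). AE y in (lborel :: 'a measure). snd (t, y) \<noteq> x"
      using AE_lborel_singleton[of x] by simp
    show "{p \<in> space ((lborel :: real measure) \<Otimes>\<^sub>M (lborel :: 'a measure)). snd p \<noteq> x} \<in> sets (lborel \<Otimes>\<^sub>M lborel)"
      unfolding lborel_prod by simp
  qed
  then show ?thesis unfolding lborel_prod .
qed

lemma heat_kernel_spacetime_integrable:
  fixes t :: real
  assumes "t > 0"
  shows "integrable lborel (\<lambda>p::real \<times> 'a::euclidean_space. indicator ({0<..<t} \<times> UNIV) p * heat_kernel p)"
    and "(\<integral>p. indicator ({0<..<t} \<times> UNIV) p * heat_kernel (p::real \<times> 'a) \<partial>lborel) = t"
proof -
  have eq: "(\<integral>y. indicator ({0<..<t} \<times> UNIV) (s, y) * heat_kernel (s, y::'a) \<partial>lborel) = indicator {0<..<t} s" for s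
    using heat_kernel_integral_one(1)[of s, where 'a='a] by (auto simp: indicator_times split: split_indicator)
  have 1: "integrable (lborel \<Otimes>\<^sub>M lborel) (\<lambda>p::real \<times> 'a. indicator ({0<..<t} \<times> UNIV) p * heat_kernel p)"
  proof (rule lborel_pair.Fubini_integrable)
    show "integrable lborel (\<lambda>s. \<integral>y. norm (indicator ({0<..<t} \<times> UNIV) (s, y) * heat_kernel (s, y::'a)) \<partial>lborel)"
      using assms by (simp add: eq abs_mult)
    show "AE s in lborel. integrable lborel (\<lambda>y. indicator ({0<..<t} \<times> UNIV) (s, y) * heat_kernel (s, y::'a))"
      using heat_kernel_integral_one(2)[where 'a='a] by (auto simp: indicator_times split: split_indicator)
    show "(\<lambda>p::real\<times>'a. indicator ({0<..<t} \<times> UNIV) p * heat_kernel p) \<in> borel_measurable (lborel \<Otimes>\<^sub>M lborel)"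
      unfolding lborel_prod indicator_times by measurable
  qed
  then show "integrable lborel (\<lambda>p::real \<times> 'a. indicator ({0<..<t} \<times> UNIV) p * heat_kernel p)"
    by (simp add: lborel_prod)
  show "(\<integral>p. indicator ({0<..<t} \<times> UNIV) p * heat_kernel (p::real \<times> 'a) \<partial>lborel) = t"
    using lborel_pair.integral_fst'[OF 1] assms by (simp add: lborel_prod eq)
qed

text \<open>A smooth bounded approximation of \<open>norm w powr (- k)\<close> from below.\<close>
definition reg_power :: "real \<Rightarrow> real \<Rightarrow> 'a::euclidean_space \<Rightarrow> real" where
  "reg_power \<epsilon> k w = ((norm w)\<^sup>2 + \<epsilon>) powr (- k / 2)"

text \<open>Minus the Laplacian of \<open>reg_power \<epsilon> k\<close>; it is nonnegative for \<open>0 < k < N - 2\<close>.\<close>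
definition reg_power_source :: "real \<Rightarrow> real \<Rightarrow> 'a::euclidean_space \<Rightarrow> real" where
  "reg_power_source \<epsilon> k w = k * ((real DIM('a) - 2 - k) * (norm w)\<^sup>2 + real DIM('a) * \<epsilon>) * ((norm w)\<^sup>2 + \<epsilon>) powr (- k / 2 - 2)"

text \<open>The time-independent function \<open>reg_power \<epsilon> k\<close>, reflected about \<open>x\<close>, is inserted into
  \<open>heat_kernel_ito\<close>; all its derivatives are bounded thanks to \<open>\<epsilon> > 0\<close>.\<close>
lemma reg_power_ito:
  fixes x :: "'a::euclidean_space"
  assumes \<epsilon>: "\<epsilon> > 0" and k: "k > 0" and t: "t > 0"
  shows "integrable lborel (\<lambda>p. indicator ({0<..<t} \<times> UNIV) p * (heat_kernel p * reg_power_source \<epsilon> k (x - snd p)))"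
    and "(\<integral>p. indicator ({0<..<t} \<times> UNIV) p * (heat_kernel p * reg_power_source \<epsilon> k (x - snd p)) \<partial>lborel)
       = reg_power \<epsilon> k x - (\<integral>y. heat_kernel (t, y) * reg_power \<epsilon> k (x - y) \<partial>lborel)"
proof -
  define q where "q = (\<lambda>z::real \<times> 'a. (norm (x - snd z))\<^sup>2 + \<epsilon>)"
  define \<phi>x where "\<phi>x = (\<lambda>b (z::real\<times>'a). k * ((x - snd z) \<bullet> b) * q z powr (- k / 2 - 1))"
  define \<phi>xx where "\<phi>xx = (\<lambda>b (z::real\<times>'a). - k * q z powr (- k / 2 - 1) + k * (k + 2) * ((x - snd z) \<bullet> b)\<^sup>2 * q z powr (- k / 2 - 2))"
  have q: "q z \<ge> \<epsilon>" "q z > 0" for z using \<epsilon> by (auto simp: q_def intro: add_nonneg_pos)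
  have dq: "(q has_derivative (\<lambda>v. - 2 * ((x - snd z) \<bullet> snd v))) (at z)" for z
    unfolding q_def power2_norm_eq_inner
    by (auto intro!: derivative_eq_intros simp: inner_commute algebra_simps)
  have dpow: "((\<lambda>z. q z powr a) has_derivative (\<lambda>v. a * q z powr (a - 1) * (- 2 * ((x - snd z) \<bullet> snd v)))) (at z)" for z a
    using has_derivative_compose[OF dq has_field_derivative_imp_has_derivative[OF has_real_derivative_powr[OF q(2), of a]], of z] by simp
  have D: "((\<lambda>z. reg_power \<epsilon> k (x - snd z)) has_derivative (\<lambda>v. (\<lambda>_. 0) z * fst v + (\<Sum>b\<in>Basis. \<phi>x b z * (snd v \<bullet> b)))) (at z)" for z
  proof -
    have "(\<lambda>v. - k / 2 * q z powr (- k / 2 - 1) * (- 2 * ((x - snd z) \<bullet> snd v))) = (\<lambda>v. 0 * fst v + (\<Sum>b\<in>Basis. \<phi>x b z * (snd v \<bullet> b)))"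
    proof
      fix v :: "real \<times> 'a"
      have "(\<Sum>b\<in>Basis. \<phi>x b z * (snd v \<bullet> b)) = k * q z powr (- k / 2 - 1) * (\<Sum>b\<in>Basis. ((x - snd z) \<bullet> b) * (snd v \<bullet> b))"
        by (simp add: \<phi>x_def sum_distrib_left mult_ac)
      also have "(\<Sum>b\<in>Basis. ((x - snd z) \<bullet> b) * (snd v \<bullet> b)) = (x - snd z) \<bullet> snd v"
        by (rule euclidean_inner[symmetric])
      finally show "- k / 2 * q z powr (- k / 2 - 1) * (- 2 * ((x - snd z) \<bullet> snd v)) = 0 * fst v + (\<Sum>b\<in>Basis. \<phi>x b z * (snd v \<bullet> b))"
        by simp
    qed
    then show ?thesis using dpow[where a="- k / 2", of z] by (simp add: reg_power_def q_def)
  qed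
  have D2: "((\<lambda>h. \<phi>x b (z + h *\<^sub>R (0, b))) has_real_derivative \<phi>xx b z) (at 0)" if b: "b \<in> Basis" for b z
  proof -
    have nb: "b \<bullet> b = 1" using b by (simp add: inner_Basis)
    have 0: "q (z + h *\<^sub>R (0, b)) > 0" for h by (rule q)
    have dq1: "((\<lambda>h. q (z + h *\<^sub>R (0, b))) has_real_derivative - 2 * ((x - snd z) \<bullet> b)) (at 0)"
      unfolding q_def power2_norm_eq_inner
      by (auto intro!: derivative_eq_intros simp: inner_commute algebra_simps)
    have dl: "((\<lambda>h. k * ((x - snd (z + h *\<^sub>R (0, b))) \<bullet> b)) has_real_derivative - k) (at 0)"
      by (auto intro!: derivative_eq_intros simp: nb inner_diff_left inner_add_left)
    have q0: "q (z + 0 *\<^sub>R (0, b)) = q z" by (simp add: zero_prod_def[symmetric])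
    have dp: "((\<lambda>h. q (z + h *\<^sub>R (0, b)) powr (- k / 2 - 1)) has_real_derivative (- k / 2 - 1) * q z powr (- k / 2 - 1 - 1) * (- 2 * ((x - snd z) \<bullet> b))) (at 0)"
      using DERIV_chain2[OF has_real_derivative_powr[OF 0[of 0]] dq1, of "- k / 2 - 1"] by (simp add: zero_prod_def[symmetric])
    have e: "- k / 2 - 1 - 1 = - k / 2 - 2" by simp
    have alg: "- k * X + (- k / 2 - 1) * Y * (- 2 * A) * (k * A) = - k * X + k * (k + 2) * A\<^sup>2 * Y" for A X Y :: real
      by (simp add: field_simps power2_eq_square)
    show ?thesis unfolding \<phi>x_def
      by (rule DERIV_cong[OF DERIV_mult[OF dl dp]])
         (simp only: \<phi>xx_def e scaleR_zero_left add_0_right alg)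
  qed
  have cq: "continuous_on UNIV q" unfolding q_def by (intro continuous_intros)
  have cpow: "continuous_on UNIV (\<lambda>z. q z powr a)" for a
    using q(2) by (intro continuous_intros cq) (auto simp: less_imp_neq[symmetric])
  have ipow: "q z powr (- a) \<le> \<epsilon> powr (- a)" if "a \<ge> 0" for a z
    using \<epsilon> q(1)[of z] that by (intro powr_mono2') auto
  have nb: "\<bar>(x - snd z) \<bullet> b\<bar>\<^sup>2 \<le> q z" if "b \<in> Basis" for b z
  proof -
    have "\<bar>(x - snd z) \<bullet> b\<bar>\<^sup>2 \<le> (norm (x - snd z))\<^sup>2" by (intro power_mono Basis_le_norm that) auto
    then show ?thesis using \<epsilon> by (simp add: q_def)
  qed
  have nb1: "\<bar>(x - snd z) \<bullet> b\<bar> \<le> q z powr (1/2)" if "b \<in> Basis" for b z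
    using nb[OF that] q(2)[of z] real_le_rsqrt by (simp add: powr_half_sqrt)
  define B where "B = \<epsilon> powr (- k / 2) + k * \<epsilon> powr (- (k / 2 + 1 / 2)) + (k + k * (k + 2)) * \<epsilon> powr (- (k / 2 + 1))"
  have p: "0 \<le> \<epsilon> powr (- k / 2)" "0 \<le> k * \<epsilon> powr (- (k / 2 + 1 / 2))" "0 \<le> (k + k * (k + 2)) * \<epsilon> powr (- (k / 2 + 1))"
    using k by auto
  have b0: "\<bar>reg_power \<epsilon> k (x - snd z)\<bar> \<le> B" for z :: "real \<times> 'a"
  proof -
    have "\<bar>reg_power \<epsilon> k (x - snd z)\<bar> \<le> \<epsilon> powr (- k / 2)"
      using ipow[of "k/2" z] k by (simp add: reg_power_def q_def)
    then show ?thesis using p unfolding B_def by linarith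
  qed
  have b1: "\<bar>\<phi>x b z\<bar> \<le> B" if b: "b \<in> Basis" for b z
  proof -
    have "\<bar>\<phi>x b z\<bar> = k * (\<bar>(x - snd z) \<bullet> b\<bar> * q z powr (- k / 2 - 1))"
      using k by (simp add: \<phi>x_def abs_mult)
    also have "\<dots> \<le> k * (q z powr (1/2) * q z powr (- k / 2 - 1))"
      using k nb1[OF b, of z] by (intro mult_left_mono mult_right_mono) auto
    also have "q z powr (1/2) * q z powr (- k / 2 - 1) = q z powr (- (k / 2 + 1/2))"
      by (simp add: powr_add[symmetric] algebra_simps)
    also have "k * \<dots> \<le> k * \<epsilon> powr (- (k / 2 + 1/2))"
      using k by (intro mult_left_mono ipow) auto
    finally show ?thesis using p unfolding B_def by linarith
  qed
  have b2: "\<bar>\<phi>xx b z\<bar> \<le> B" if b: "b \<in> Basis" for b z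
  proof -
    have "\<bar>\<phi>xx b z\<bar> \<le> k * q z powr (- k / 2 - 1) + k * (k + 2) * ((\<bar>(x - snd z) \<bullet> b\<bar>)\<^sup>2 * q z powr (- k / 2 - 2))"
      unfolding \<phi>xx_def using k by (intro order_trans[OF abs_triangle_ineq]) (simp add: abs_mult)
    also have "\<dots> \<le> k * q z powr (- k / 2 - 1) + k * (k + 2) * (q z powr 1 * q z powr (- k / 2 - 2))"
      using k nb[OF b, of z] q(2)[of z] by (intro add_left_mono mult_left_mono mult_right_mono) auto
    also have "q z powr 1 * q z powr (- k / 2 - 2) = q z powr (- k / 2 - 1)"
      unfolding powr_add[symmetric] by (rule arg_cong[where f="\<lambda>a. _ powr a"]) simp
    also have "k * q z powr (- k / 2 - 1) + k * (k + 2) * q z powr (- k / 2 - 1) = (k + k * (k + 2)) * q z powr (- (k / 2 + 1))"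
      by (simp add: distrib_right)
    also have "\<dots> \<le> (k + k * (k + 2)) * \<epsilon> powr (- (k / 2 + 1))"
      using k by (intro mult_left_mono ipow) auto
    finally show ?thesis using p unfolding B_def by linarith
  qed
  have L: "0 + (\<Sum>b\<in>Basis. \<phi>xx b z) = - reg_power_source \<epsilon> k (x - snd z)" for z
  proof -
    define Y where "Y = q z powr (- k / 2 - 2)"
    have X: "q z powr (- k / 2 - 1) = q z * Y"
      unfolding Y_def powr_mult_base[OF less_imp_le[OF q(2)]] by (rule arg_cong[where f="\<lambda>a. _ powr a"]) simp
    have "norm (x - snd z) * norm (x - snd z) = (\<Sum>b\<in>Basis. ((x - snd z) \<bullet> b)\<^sup>2)"
      using euclidean_inner[of "x - snd z" "x - snd z"] by (simp only: power2_eq_square power2_norm_eq_inner[symmetric])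
    then have n: "(norm (x - snd z))\<^sup>2 = (\<Sum>b\<in>Basis. ((x - snd z) \<bullet> b)\<^sup>2)" by (simp only: power2_eq_square)
    have "\<phi>xx b z = - k * (q z * Y) + (k * (k + 2) * Y) * ((x - snd z) \<bullet> b)\<^sup>2" for b
      unfolding \<phi>xx_def X Y_def[symmetric] by simp
    then have "(\<Sum>b\<in>Basis. \<phi>xx b z) = (\<Sum>b\<in>(Basis::'a set). - k * (q z * Y)) + (k * (k + 2) * Y) * (norm (x - snd z))\<^sup>2"
      unfolding n by (simp only: sum.distrib sum_distrib_left)
    also have "(\<Sum>b\<in>(Basis::'a set). - k * (q z * Y)) = real DIM('a) * (- k * (q z * Y))"
      by (simp only: sum_constant)
    finally have sum: "(\<Sum>b\<in>Basis. \<phi>xx b z) = real DIM('a) * (- k * (q z * Y)) + (k * (k + 2) * Y) * (norm (x - snd z))\<^sup>2" .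
    have "reg_power_source \<epsilon> k (x - snd z) = k * ((real DIM('a) - 2 - k) * (norm (x - snd z))\<^sup>2 + real DIM('a) * \<epsilon>) * Y"
      by (simp only: reg_power_source_def Y_def q_def)
    moreover have "q z = (norm (x - snd z))\<^sup>2 + \<epsilon>" by (simp add: q_def)
    ultimately show ?thesis
      unfolding sum by (simp only:) (simp add: algebra_simps)
  qed
  have B0: "0 \<le> B" using p unfolding B_def by linarith
  note ito = heat_kernel_ito[OF t D D2 continuous_on_const _ _ b0 _ b1 b2]
  have c1: "continuous_on UNIV (\<phi>x b)" "continuous_on UNIV (\<phi>xx b)" for b
    unfolding \<phi>x_def \<phi>xx_def by (intro continuous_on_mult continuous_on_add continuous_on_const continuous_on_power continuous_on_inner continuous_on_diff continuous_on_snd continuous_on_id cpow)+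
  have "integrable lborel (\<lambda>p. indicator ({0<..<t} \<times> UNIV) p * (heat_kernel p * (0 + (\<Sum>b\<in>Basis. \<phi>xx b p))))"
    by (rule ito(1)) (use c1 B0 in auto)
  then show "integrable lborel (\<lambda>p. indicator ({0<..<t} \<times> UNIV) p * (heat_kernel p * reg_power_source \<epsilon> k (x - snd p)))"
    unfolding L by simp
  have "(\<integral>p. indicator ({0<..<t} \<times> UNIV) p * (heat_kernel p * (0 + (\<Sum>b\<in>Basis. \<phi>xx b p))) \<partial>lborel)
       = (\<integral>y. heat_kernel (t, y) * reg_power \<epsilon> k (x - snd (t, y)) \<partial>lborel) - reg_power \<epsilon> k (x - snd (0::real, 0::'a))"
    by (rule ito(2)) (use c1 B0 in auto)
  then show "(\<integral>p. indicator ({0<..<t} \<times> UNIV) p * (heat_kernel p * reg_power_source \<epsilon> k (x - snd p)) \<partial>lborel)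
       = reg_power \<epsilon> k x - (\<integral>y. heat_kernel (t, y) * reg_power \<epsilon> k (x - y) \<partial>lborel)"
    unfolding L by simp
qed

text \<open>Fatou's lemma as a criterion of integrability: a uniform bound on the integrals of nonnegative
  functions passes to the pointwise limit.\<close>
lemma integrable_Fatou:
  fixes f :: "nat \<Rightarrow> 'b \<Rightarrow> real"
  assumes int: "\<And>n. integrable M (f n)" and nonneg: "\<And>n x. 0 \<le> f n x"
    and bd: "\<And>n. (\<integral>x. f n x \<partial>M) \<le> C"
    and lim: "AE x in M. (\<lambda>n. f n x) \<longlonglongrightarrow> u x" and [measurable]: "u \<in> borel_measurable M"
  shows "integrable M u"
proof (rule integrableI_bounded)
  have [measurable]: "f n \<in> borel_measurable M" for n using int by auto
  have "(\<integral>\<^sup>+x. ennreal (norm (u x)) \<partial>M) = (\<integral>\<^sup>+x. liminf (\<lambda>n. ennreal (f n x)) \<partial>M)"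
  proof (rule nn_integral_cong_AE)
    show "AE x in M. ennreal (norm (u x)) = liminf (\<lambda>n. ennreal (f n x))"
      using lim
    proof eventually_elim
      case (elim x)
      have "0 \<le> u x" by (rule LIMSEQ_le_const[OF elim]) (use nonneg in auto)
      moreover have "(\<lambda>n. ennreal (f n x)) \<longlonglongrightarrow> ennreal (u x)" by (intro tendsto_ennrealI elim)
      ultimately show ?case by (simp add: lim_imp_Liminf)
    qed
  qed
  also have "\<dots> \<le> liminf (\<lambda>n. \<integral>\<^sup>+x. ennreal (f n x) \<partial>M)"
    by (rule nn_integral_liminf) auto
  also have "\<dots> \<le> liminf (\<lambda>n::nat. ennreal C)"
    by (intro Liminf_mono always_eventually allI)
       (use nonneg bd in \<open>auto simp: nn_integral_eq_integral[OF int] intro: ennreal_leI\<close>)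
  also have "\<dots> = ennreal C" by (simp add: Liminf_const)
  finally have "(\<integral>\<^sup>+x. ennreal (norm (u x)) \<partial>M) \<le> ennreal C" .
  then show "(\<integral>\<^sup>+x. ennreal (norm (u x)) \<partial>M) < \<infinity>"
    by (rule le_less_trans) simp
qed measurable

lemma norm_sq_powr: "((norm w)\<^sup>2) powr a = norm w powr (2 * a)"
  by (cases "w = 0") (auto simp: powr_powr powr_numeral[symmetric] simp del: powr_numeral)

lemma reg_power_nonneg [simp]: "0 \<le> reg_power \<epsilon> k w" by (simp add: reg_power_def)

lemma reg_power_le:
  assumes "w \<noteq> 0" "\<epsilon> > 0" "k > 0"
  shows "reg_power \<epsilon> k w \<le> norm w powr (- k)"
  using assms powr_mono2'[of "- k / 2" "(norm w)\<^sup>2" "(norm w)\<^sup>2 + \<epsilon>"] norm_sq_powr[of w "- k / 2"]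
  by (simp add: reg_power_def)

lemma reg_power_bounded:
  assumes "\<epsilon> > 0" "k > 0"
  shows "\<bar>reg_power \<epsilon> k w\<bar> \<le> \<epsilon> powr (- k / 2)"
  using assms powr_mono2'[of "- k / 2" \<epsilon> "(norm w)\<^sup>2 + \<epsilon>"] by (simp add: reg_power_def)

lemma reg_power_tendsto:
  assumes "w \<noteq> 0" and "e \<longlonglongrightarrow> 0"
  shows "(\<lambda>n. reg_power (e n) k w) \<longlonglongrightarrow> norm w powr (- k)"
proof -
  have "(\<lambda>n. ((norm w)\<^sup>2 + e n) powr (- k / 2)) \<longlonglongrightarrow> ((norm w)\<^sup>2 + 0) powr (- k / 2)"
    by (intro tendsto_intros assms) (use assms in auto)
  then show ?thesis by (simp add: reg_power_def norm_sq_powr)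
qed

lemma reg_power_source_nonneg:
  fixes w :: "'a::euclidean_space"
  assumes "0 < k" "k < real DIM('a) - 2" "\<epsilon> > 0"
  shows "0 \<le> reg_power_source \<epsilon> k w"
  using assms by (simp add: reg_power_source_def)

lemma reg_power_source_tendsto:
  fixes w :: "'a::euclidean_space"
  assumes w: "w \<noteq> 0" and e: "e \<longlonglongrightarrow> 0"
  shows "(\<lambda>n. reg_power_source (e n) k w) \<longlonglongrightarrow> hardy DIM('a) k * norm w powr (- k - 2)"
proof -
  have "(\<lambda>n. reg_power_source (e n) k w) \<longlonglongrightarrow>
     k * ((real DIM('a) - 2 - k) * (norm w)\<^sup>2 + real DIM('a) * 0) * ((norm w)\<^sup>2 + 0) powr (- k / 2 - 2)"
    unfolding reg_power_source_def by (intro tendsto_intros e) (use w in auto)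
  also have "((norm w)\<^sup>2 + 0) powr (- k / 2 - 2) = norm w powr (- k - 4)"
    by (simp add: norm_sq_powr algebra_simps)
  also have "k * ((real DIM('a) - 2 - k) * (norm w)\<^sup>2 + real DIM('a) * 0) * norm w powr (- k - 4)
     = hardy DIM('a) k * (norm w powr 2 * norm w powr (- k - 4))"
    using w by (simp add: hardy_def algebra_simps)
  also have "norm w powr 2 * norm w powr (- k - 4) = norm w powr (- k - 2)"
    unfolding powr_add[symmetric] by (rule arg_cong[where f="\<lambda>a. _ powr a"]) simp
  finally show ?thesis .
qed

lemma reg_power_source_le:
  fixes w :: "'a::euclidean_space"
  assumes k: "0 < k" "k < real DIM('a) - 2" and e: "\<epsilon> > 0" and w: "w \<noteq> 0"
  shows "reg_power_source \<epsilon> k w \<le> k * real DIM('a) * norm w powr (- k - 2)"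
proof -
  let ?q = "(norm w)\<^sup>2 + \<epsilon>"
  have q: "?q > 0" using e by (auto intro: add_nonneg_pos)
  have "reg_power_source \<epsilon> k w \<le> k * (real DIM('a) * ?q) * ?q powr (- k / 2 - 2)"
    unfolding reg_power_source_def using k
    by (intro mult_right_mono mult_left_mono) (auto simp: algebra_simps intro: add_nonneg_nonneg)
  also have "\<dots> = k * real DIM('a) * (?q * ?q powr (- k / 2 - 2))" by simp
  also have "?q * ?q powr (- k / 2 - 2) = ?q powr (- (k / 2 + 1))"
    using powr_mult_base[of ?q "- k / 2 - 2"] q by (simp add: algebra_simps)
  also have "\<dots> \<le> ((norm w)\<^sup>2) powr (- (k / 2 + 1))"
    using w e k by (intro powr_mono2') auto
  also have "\<dots> = norm w powr (- k - 2)"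
    unfolding norm_sq_powr by (rule arg_cong[where f="\<lambda>a. _ powr a"]) simp
  finally show ?thesis using k by (simp add: mult_left_mono)
qed

lemma reg_power_borel [measurable]: "(reg_power \<epsilon> k :: 'a::euclidean_space \<Rightarrow> real) \<in> borel_measurable borel"
  "(reg_power_source \<epsilon> k :: 'a::euclidean_space \<Rightarrow> real) \<in> borel_measurable borel"
  unfolding reg_power_def[abs_def] reg_power_source_def[abs_def] by measurable

lemma heat_kernel_mult_bounded_integrable:
  fixes F :: "'a::euclidean_space \<Rightarrow> real"
  assumes t: "t > 0" and [measurable]: "F \<in> borel_measurable borel" and bdd: "\<And>x. \<bar>F x\<bar> \<le> B"
  shows "integrable lborel (\<lambda>x. heat_kernel (t, x) * F x)"
  unfolding heat_kernel_integrable_rescale[OF t assms(2)]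
  by (rule gauss_mult_bounded_integrable[OF _ bdd]) measurable

text \<open>The limit \<open>\<epsilon> \<rightarrow> 0\<close> in \<open>reg_power_ito\<close>. The two integrals in it are nonnegative with sum \<open>reg_power \<epsilon> k x\<close>,
  hence at most \<open>norm x powr (- k)\<close>; Fatou's lemma makes the limits integrable, and they dominate the approximations.\<close>
lemma power_potential:
  fixes x :: "'a::euclidean_space"
  assumes x: "x \<noteq> 0" and k: "0 < k" "k < real DIM('a) - 2" and t: "t > 0"
  shows "integrable lborel (\<lambda>y. heat_kernel (t, y) * norm (x - y) powr (- k))" (is ?i1)
    and "integrable lborel (\<lambda>p. indicator ({0<..<t} \<times> UNIV) p * (heat_kernel p * norm (x - snd p) powr (- k - 2)))" (is ?i2)
    and "hardy DIM('a) k * (\<integral>p. indicator ({0<..<t} \<times> UNIV) p * (heat_kernel p * norm (x - snd p) powr (- k - 2)) \<partial>lborel)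
       = norm x powr (- k) - (\<integral>y. heat_kernel (t, y) * norm (x - y) powr (- k) \<partial>lborel)" (is ?eq)
proof -
  define e where "e = (\<lambda>n. inverse (real (Suc n)))"
  have e: "e n > 0" "e \<longlonglongrightarrow> 0" for n
    unfolding e_def using LIMSEQ_inverse_real_of_nat by auto
  have P: "hardy DIM('a) k > 0" using k by (simp add: hardy_def)
  note ito = reg_power_ito[OF e(1) k(1) t, of _ x]
  let ?f = "\<lambda>n y. heat_kernel (t, y) * reg_power (e n) k (x - y)"
  let ?g = "\<lambda>n p. indicator ({0<..<t} \<times> UNIV) p * (heat_kernel p * reg_power_source (e n) k (x - snd p))"
  have fi: "integrable lborel (?f n)" for n
    by (rule heat_kernel_mult_bounded_integrable[OF t _ reg_power_bounded[OF e(1) k(1)]]) measurable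
  have g0: "0 \<le> ?g n p" for n p
    using reg_power_source_nonneg[OF k e(1)] by simp
  have f0: "0 \<le> ?f n y" for n y by simp
  have "0 \<le> (\<integral>p. ?g n p \<partial>lborel)" "0 \<le> (\<integral>y. ?f n y \<partial>lborel)" for n
    using g0 f0 by (auto intro!: Bochner_Integration.integral_nonneg)
  note nn = this
  have If: "(\<integral>y. ?f n y \<partial>lborel) \<le> norm x powr (- k)" for n
    using nn(1)[of n] ito(2)[of n] reg_power_le[OF x e(1)[of n] k(1)] by linarith
  have Ig: "(\<integral>p. ?g n p \<partial>lborel) \<le> norm x powr (- k)" for n
    using nn(2)[of n] ito(2)[of n] reg_power_le[OF x e(1)[of n] k(1)] by linarith
  have AEy: "AE y in lborel. x - y \<noteq> 0" using AE_lborel_singleton[of x] by eventually_elim auto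
  have AEp: "AE p in (lborel :: (real \<times> 'a) measure). x - snd p \<noteq> 0" using AE_snd_neq[of x] by eventually_elim auto
  have flim: "AE y in lborel. (\<lambda>n. ?f n y) \<longlonglongrightarrow> heat_kernel (t, y) * norm (x - y) powr (- k)"
    using AEy by eventually_elim (intro tendsto_intros reg_power_tendsto e)
  have glim: "AE p in lborel. (\<lambda>n. ?g n p) \<longlonglongrightarrow> indicator ({0<..<t} \<times> UNIV) p * (heat_kernel p * (hardy DIM('a) k * norm (x - snd p) powr (- k - 2)))"
    using AEp by eventually_elim (intro tendsto_intros reg_power_source_tendsto e)
  show i1: ?i1
    by (rule integrable_Fatou[OF fi f0 If flim]) measurable
  have "integrable lborel (\<lambda>p. indicator ({0<..<t} \<times> UNIV) p * (heat_kernel p * (hardy DIM('a) k * norm (x - snd p) powr (- k - 2))))"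
    by (rule integrable_Fatou[OF ito(1) g0 Ig glim]) (unfold indicator_times, measurable)
  then have "integrable lborel (\<lambda>p. hardy DIM('a) k * (indicator ({0<..<t} \<times> UNIV) p * (heat_kernel p * norm (x - snd p) powr (- k - 2))))"
    by (simp add: mult_ac)
  then show i2: ?i2
    using P by simp
  have "(\<lambda>n. \<integral>y. ?f n y \<partial>lborel) \<longlonglongrightarrow> (\<integral>y. heat_kernel (t, y) * norm (x - y) powr (- k) \<partial>lborel)"
  proof (rule integral_dominated_convergence[OF _ _ i1 flim])
    show "AE y in lborel. norm (?f n y) \<le> heat_kernel (t, y) * norm (x - y) powr (- k)" for n
      using AEy by eventually_elim (auto simp: abs_mult intro!: mult_left_mono reg_power_le e k)
  qed measurable
  moreover have "(\<lambda>n. \<integral>p. ?g n p \<partial>lborel) \<longlonglongrightarrow> (\<integral>p. indicator ({0<..<t} \<times> UNIV) p * (heat_kernel p * (hardy DIM('a) k * norm (x - snd p) powr (- k - 2))) \<partial>lborel)"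
  proof (rule integral_dominated_convergence[OF _ _ _ glim])
    show "integrable lborel (\<lambda>p. k * real DIM('a) * (indicator ({0<..<t} \<times> UNIV) p * (heat_kernel p * norm (x - snd p) powr (- k - 2))))"
      using i2 by simp
    show "AE p in lborel. norm (?g n p) \<le> k * real DIM('a) * (indicator ({0<..<t} \<times> UNIV) p * (heat_kernel p * norm (x - snd p) powr (- k - 2)))" for n
      using AEp
    proof eventually_elim
      case (elim p)
      have "heat_kernel p * reg_power_source (e n) k (x - snd p) \<le> heat_kernel p * (k * real DIM('a) * norm (x - snd p) powr (- k - 2))"
        by (intro mult_left_mono reg_power_source_le k e elim) auto
      then show ?case using g0[of p n] by (auto simp: mult_ac split: split_indicator)
    qed
  qed (unfold indicator_times, measurable)
  then have "(\<lambda>n. \<integral>p. ?g n p \<partial>lborel) \<longlonglongrightarrow> hardy DIM('a) k * (\<integral>p. (indicator ({0<..<t} \<times> UNIV) p * (heat_kernel p * (norm (x - snd p) powr (- k - 2)))) \<partial>lborel)"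
    by (simp add: mult.left_commute[of _ "hardy DIM('a) k"])
  moreover have "(\<lambda>n. reg_power (e n) k x - (\<integral>y. ?f n y \<partial>lborel)) \<longlonglongrightarrow> norm x powr (- k) - (\<integral>y. heat_kernel (t, y) * norm (x - y) powr (- k) \<partial>lborel)"
    by (intro tendsto_diff reg_power_tendsto x e calculation)
  ultimately show ?eq
    unfolding ito(2) using LIMSEQ_unique by blast
qed

lemma heat_flow_power_integrable:
  fixes x :: "'a::euclidean_space"
  assumes "x \<noteq> 0" "0 < k" "k < real DIM('a) - 2" "t > 0"
  shows "integrable lborel (\<lambda>y. heat_kernel (t, x - y) * norm y powr (- k))"
  using lborel_integrable_reflect_iff[of "\<lambda>y. heat_kernel (t, y) * norm (x - y) powr (- k)" x] power_potential(1)[OF assms]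
  by simp

lemma duhamel_kernel_reflect:
  "indicator ({0<..} \<times> UNIV) p * (heat_kernel ((t, x) - p) * c) =
   (indicator ({0<..<t} \<times> UNIV) ((t, x) - p) * (heat_kernel ((t, x) - p) * c) :: real)"
  by (cases p) (auto simp: heat_kernel_def indicator_def)

text \<open>The stationary solution \<open>norm x powr (- k)\<close> of the heat equation with source
  \<open>hardy N k * norm x powr (- k - 2)\<close>, written in mild form. It replaces the maximum principle in the barrier
  argument.\<close>
lemma duhamel_power:
  fixes x :: "'a::euclidean_space"
  assumes "x \<noteq> 0" "0 < k" "k < real DIM('a) - 2" "t > 0"
  shows "integrable lborel (\<lambda>p. indicator ({0<..} \<times> UNIV) p * (heat_kernel ((t, x) - p) * norm (snd p) powr (- k - 2)))"
    and "hardy DIM('a) k * duhamel (\<lambda>p. norm (snd p) powr (- k - 2)) (t, x)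
       = norm x powr (- k) - heat_flow (\<lambda>y. norm y powr (- k)) (t, x)"
proof -
  let ?f = "\<lambda>p. indicator ({0<..<t} \<times> UNIV) p * (heat_kernel p * norm (x - snd p) powr (- k - 2)) :: real"
  have [measurable]: "?f \<in> borel_measurable borel" unfolding indicator_times by measurable
  have eq: "indicator ({0<..} \<times> UNIV) p * (heat_kernel ((t, x) - p) * norm (snd p) powr (- k - 2)) = ?f ((t, x) - p)" for p
    unfolding duhamel_kernel_reflect by simp
  show "integrable lborel (\<lambda>p. indicator ({0<..} \<times> UNIV) p * (heat_kernel ((t, x) - p) * norm (snd p) powr (- k - 2)))"
    unfolding eq using lborel_integrable_reflect_iff[of ?f "(t, x)"] power_potential(2)[OF assms] by simp
  have "duhamel (\<lambda>p. norm (snd p) powr (- k - 2)) (t, x) = (\<integral>p. ?f p \<partial>lborel)"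
    unfolding duhamel_def eq by (rule lborel_integral_reflect) measurable
  moreover have "heat_flow (\<lambda>y. norm y powr (- k)) (t, x) = (\<integral>y. heat_kernel (t, y) * norm (x - y) powr (- k) \<partial>lborel)"
    using lborel_integral_reflect[of "\<lambda>y. heat_kernel (t, y) * norm (x - y) powr (- k)" x] by (simp add: heat_flow_def)
  ultimately show "hardy DIM('a) k * duhamel (\<lambda>p. norm (snd p) powr (- k - 2)) (t, x)
       = norm x powr (- k) - heat_flow (\<lambda>y. norm y powr (- k)) (t, x)"
    using power_potential(3)[OF assms] by simp
qed

lemma duhamel_const:
  fixes x :: "'a::euclidean_space"
  assumes "t > 0"
  shows "integrable lborel (\<lambda>p. indicator ({0<..} \<times> UNIV) p * (heat_kernel ((t, x) - p) * c))"
    and "duhamel (\<lambda>p. c) (t, x) = c * t"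
proof -
  let ?f = "\<lambda>p::real \<times> 'a. indicator ({0<..<t} \<times> UNIV) p * (heat_kernel p * c) :: real"
  have [measurable]: "?f \<in> borel_measurable borel" unfolding indicator_times by measurable
  have f: "?f = (\<lambda>p. c * (indicator ({0<..<t} \<times> UNIV) p * heat_kernel p))" by (simp add: fun_eq_iff)
  show "integrable lborel (\<lambda>p. indicator ({0<..} \<times> UNIV) p * (heat_kernel ((t, x) - p) * c))"
    unfolding duhamel_kernel_reflect using lborel_integrable_reflect_iff[of ?f "(t, x)"] 
      heat_kernel_spacetime_integrable(1)[OF assms, where 'a='a] by (simp add: f)
  have "duhamel (\<lambda>p. c) (t, x) = (\<integral>p. ?f p \<partial>lborel)"
    unfolding duhamel_def duhamel_kernel_reflect by (rule lborel_integral_reflect) measurable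
  then show "duhamel (\<lambda>p. c) (t, x) = c * t"
    using heat_kernel_spacetime_integrable(2)[OF assms, where 'a='a] by (simp add: f)
qed

section \<open>Continuity and monotone iteration of Duhamel integrals\<close>

lemma heat_kernel_eq:
  "t > 0 \<Longrightarrow> heat_kernel (t, z::'a::euclidean_space) =
     exp (- ((norm z)\<^sup>2 / (4 * t))) / (sqrt t ^ DIM('a) * (\<integral>x. exp (- ((norm (x::'a))\<^sup>2 / 4)) \<partial>lborel))"
  by (simp add: heat_kernel_def gauss_def power_divide field_simps)

lemma heat_kernel_isCont:
  fixes p :: "real \<times> 'a::euclidean_space"
  assumes "fst p \<noteq> 0"
  shows "isCont heat_kernel p"
proof -
  have 1: "continuous_on ({0<..} \<times> UNIV) (\<lambda>p::real\<times>'a. gauss (snd p /\<^sub>R sqrt (fst p)) / sqrt (fst p) ^ DIM('a))"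
    by (intro continuous_intros continuous_on_compose2[OF continuous_on_gauss]) auto
  have 2: "continuous_on ({0<..} \<times> UNIV) (heat_kernel :: real \<times> 'a \<Rightarrow> real)"
    by (rule continuous_on_eq[OF 1]) (auto simp: heat_kernel_def)
  have 3: "continuous_on ({..<0} \<times> UNIV) (heat_kernel :: real \<times> 'a \<Rightarrow> real)"
    by (rule continuous_on_eq[OF continuous_on_const[of _ 0]]) (auto simp: heat_kernel_def)
  have o: "open ({0<..} \<times> (UNIV::'a set) :: (real \<times> 'a) set)" "open ({..<0} \<times> (UNIV::'a set) :: (real \<times> 'a) set)"
    by (auto intro: open_Times)
  show ?thesis
  proof (cases "fst p > 0")
    case True
    then have "p \<in> {0<..} \<times> UNIV" by (simp add: mem_Times_iff)
    then show ?thesis using 2 continuous_on_eq_continuous_at[OF o(1)] by blast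
  next
    case False
    then have "fst p < 0" using assms by simp
    then have "p \<in> {..<0} \<times> UNIV" by (simp add: mem_Times_iff)
    then show ?thesis using 3 continuous_on_eq_continuous_at[OF o(2)] by blast
  qed
qed

text \<open>A heat kernel at a nearby point is bounded by a multiple of one at a later time, since the Gaussian at
  time \<open>4 t0\<close> is wide enough to absorb the shift. This is the majorant for continuity in \<open>(t, x)\<close>.\<close>
lemma heat_kernel_dominated:
  fixes x x0 :: "'a::euclidean_space"
  assumes t0: "t0 > 0"
  shows "\<exists>C\<ge>0. \<forall>t x y. t0 / 2 \<le> t \<longrightarrow> t \<le> 2 * t0 \<longrightarrow> norm (x - x0) \<le> 1 \<longrightarrow>
     heat_kernel (t, x - y) \<le> C * heat_kernel (4 * t0, x0 - y)"
proof -
  define Z where "Z = (\<integral>x. exp (- ((norm (x::'a))\<^sup>2 / 4)) \<partial>lborel)"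
  have Z: "Z > 0" unfolding Z_def by (rule gauss_mass_pos)
  define C where "C = exp (1 / (8 * t0)) * (sqrt (4 * t0) ^ DIM('a) / sqrt (t0 / 2) ^ DIM('a))"
  have C: "C \<ge> 0" using t0 by (simp add: C_def)
  have "heat_kernel (t, x - y) \<le> C * heat_kernel (4 * t0, x0 - y)"
    if t: "t0 / 2 \<le> t" "t \<le> 2 * t0" and x: "norm (x - x0) \<le> 1" for t and x y :: 'a
  proof -
    have tp: "t > 0" using t t0 by simp
    have "norm (x0 - y) \<le> norm (x - x0) + norm (x - y)"
      using norm_triangle_ineq[of "x0 - x" "x - y"] by (simp add: norm_minus_commute)
    then have "(norm (x0 - y))\<^sup>2 \<le> (norm (x - x0) + norm (x - y))\<^sup>2" by (intro power_mono) auto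
    also have "\<dots> \<le> 2 * (norm (x - x0))\<^sup>2 + 2 * (norm (x - y))\<^sup>2"
      using zero_le_power2[of "norm (x - x0) - norm (x - y)"] by (simp add: power2_sum power2_diff)
    also have "(norm (x - x0))\<^sup>2 \<le> 1" using x by (simp add: power_le_one)
    finally have "(norm (x0 - y))\<^sup>2 - 2 \<le> 2 * (norm (x - y))\<^sup>2" by simp
    then have "((norm (x0 - y))\<^sup>2 - 2) / (16 * t0) \<le> (2 * (norm (x - y))\<^sup>2) / (16 * t0)"
      using t0 by (intro divide_right_mono) auto
    also have "\<dots> = (norm (x - y))\<^sup>2 / (8 * t0)" by simp
    also have "\<dots> \<le> (norm (x - y))\<^sup>2 / (4 * t)" using t tp by (intro divide_left_mono) auto
    finally have "- ((norm (x - y))\<^sup>2 / (4 * t)) \<le> 1 / (8 * t0) + - ((norm (x0 - y))\<^sup>2 / (4 * (4 * t0)))"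
      using t0 by (simp add: diff_divide_distrib)
    then have "exp (- ((norm (x - y))\<^sup>2 / (4 * t))) \<le> exp (1 / (8 * t0)) * exp (- ((norm (x0 - y))\<^sup>2 / (4 * (4 * t0))))"
      unfolding mult_exp_exp by (simp only: exp_le_cancel_iff)
    then have "heat_kernel (t, x - y) \<le> (exp (1 / (8 * t0)) * exp (- ((norm (x0 - y))\<^sup>2 / (4 * (4 * t0))))) / (sqrt (t0 / 2) ^ DIM('a) * Z)"
      unfolding heat_kernel_eq[OF tp] Z_def[symmetric] using t t0 Z
      by (intro frac_le mult_right_mono power_mono mult_pos_pos) auto
    also have "\<dots> = C * heat_kernel (4 * t0, x0 - y)"
      unfolding heat_kernel_eq[OF mult_pos_pos[OF zero_less_numeral t0]] Z_def[symmetric] C_def using t0 Z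
      by (simp add: field_simps)
    finally show ?thesis .
  qed
  then show ?thesis using C by blast
qed

lemma heat_flow_continuous:
  fixes f :: "'a::euclidean_space \<Rightarrow> real"
  assumes [measurable]: "f \<in> borel_measurable borel"
    and int: "\<And>t x. t > 0 \<Longrightarrow> x \<in> X \<Longrightarrow> integrable lborel (\<lambda>y. heat_kernel (t, x - y) * f y)"
  shows "continuous_on ({0<..} \<times> X) (heat_flow f)"
  unfolding continuous_on_sequentially
proof (intro ballI allI impI, elim conjE)
  fix s and a :: "real \<times> 'a" assume a: "a \<in> {0<..} \<times> X" and s: "\<forall>n. s n \<in> {0<..} \<times> X" and lim: "s \<longlonglongrightarrow> a"
  define t0 where "t0 = fst a"
  have t0: "t0 > 0" using a by (auto simp: t0_def)
  obtain C where C: "C \<ge> 0" "\<And>t x y. t0 / 2 \<le> t \<Longrightarrow> t \<le> 2 * t0 \<Longrightarrow> norm (x - snd a) \<le> 1 \<Longrightarrow>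
     heat_kernel (t, x - y) \<le> C * heat_kernel (4 * t0, snd a - y)"
    using heat_kernel_dominated[OF t0, of "snd a"] by blast
  have l1: "(\<lambda>n. fst (s n)) \<longlonglongrightarrow> t0" "(\<lambda>n. snd (s n)) \<longlonglongrightarrow> snd a"
    unfolding t0_def by (intro tendsto_intros lim)+
  have "\<forall>\<^sub>F n in sequentially. t0 / 2 < fst (s n) \<and> fst (s n) < 2 * t0 \<and> dist (snd (s n)) (snd a) < 1"
    using t0 by (intro eventually_conj order_tendstoD[OF l1(1)] tendstoD[OF l1(2)]) auto
  then obtain n0 where n0: "\<And>n. n \<ge> n0 \<Longrightarrow> t0 / 2 < fst (s n) \<and> fst (s n) < 2 * t0 \<and> dist (snd (s n)) (snd a) < 1"
    by (auto simp: eventually_sequentially)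
  have "(\<lambda>n. \<integral>y. heat_kernel (fst (s (n + n0)), snd (s (n + n0)) - y) * f y \<partial>lborel) \<longlonglongrightarrow> (\<integral>y. heat_kernel (fst a, snd a - y) * f y \<partial>lborel)"
  proof (rule integral_dominated_convergence[where w="\<lambda>y. C * \<bar>heat_kernel (4 * t0, snd a - y) * f y\<bar>"])
    show "integrable lborel (\<lambda>y. C * \<bar>heat_kernel (4 * t0, snd a - y) * f y\<bar>)"
      using int[of "4 * t0" "snd a"] t0 a by (auto intro!: integrable_mult_right integrable_abs)
    show "AE y in lborel. (\<lambda>n. heat_kernel (fst (s (n + n0)), snd (s (n + n0)) - y) * f y) \<longlonglongrightarrow> heat_kernel (fst a, snd a - y) * f y"
    proof (intro AE_I2 tendsto_mult tendsto_const)
      fix y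
      have "(\<lambda>n. (fst (s (n + n0)), snd (s (n + n0)) - y)) \<longlonglongrightarrow> (fst a, snd a - y)"
        using LIMSEQ_ignore_initial_segment[OF lim, of n0] by (intro tendsto_intros)
      then show "(\<lambda>n. heat_kernel (fst (s (n + n0)), snd (s (n + n0)) - y)) \<longlonglongrightarrow> heat_kernel (fst a, snd a - y)"
        using t0 by (intro isCont_tendsto_compose[OF heat_kernel_isCont]) (auto simp: t0_def)
    qed
    show "AE y in lborel. norm (heat_kernel (fst (s (n + n0)), snd (s (n + n0)) - y) * f y) \<le> C * \<bar>heat_kernel (4 * t0, snd a - y) * f y\<bar>" for n
    proof (intro AE_I2)
      fix y
      have "heat_kernel (fst (s (n + n0)), snd (s (n + n0)) - y) \<le> C * heat_kernel (4 * t0, snd a - y)"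
        using n0[of "n + n0"] by (intro C) (auto simp: dist_norm)
      then have "heat_kernel (fst (s (n + n0)), snd (s (n + n0)) - y) * \<bar>f y\<bar> \<le> (C * heat_kernel (4 * t0, snd a - y)) * \<bar>f y\<bar>"
        by (intro mult_right_mono) auto
      then show "norm (heat_kernel (fst (s (n + n0)), snd (s (n + n0)) - y) * f y) \<le> C * \<bar>heat_kernel (4 * t0, snd a - y) * f y\<bar>"
        by (simp add: abs_mult mult.assoc)
    qed
  qed measurable
  then show "(heat_flow f \<circ> s) \<longlonglongrightarrow> heat_flow f a"
    unfolding heat_flow_def o_def by (rule LIMSEQ_offset)
qed

lemma AE_fst_neq:
  fixes t :: real
  shows "AE p in (lborel :: (real \<times> 'a::euclidean_space) measure). fst p \<noteq> t"
proof -
  have "AE p in (lborel :: real measure) \<Otimes>\<^sub>M (lborel :: 'a measure). fst p \<noteq> t"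
  proof (rule lborel_pair.AE_pair_measure)
    show "AE s in (lborel :: real measure). AE y in (lborel :: 'a measure). fst (s, y) \<noteq> t"
      using AE_lborel_singleton[of t] by eventually_elim simp
    show "{p \<in> space ((lborel :: real measure) \<Otimes>\<^sub>M (lborel :: 'a measure)). fst p \<noteq> t} \<in> sets (lborel \<Otimes>\<^sub>M lborel)"
      unfolding lborel_prod by simp
  qed
  then show ?thesis unfolding lborel_prod .
qed

abbreviation duhamel_integrand :: "(real \<times> 'a::euclidean_space \<Rightarrow> real) \<Rightarrow> real \<times> 'a \<Rightarrow> real \<times> 'a \<Rightarrow> real" where
  "duhamel_integrand h z p \<equiv> indicator ({0<..} \<times> UNIV) p * (heat_kernel (z - p) * h p)"

lemma duhamel_integrand_borel [measurable]:
  "h \<in> borel_measurable borel \<Longrightarrow> duhamel_integrand h z \<in> borel_measurable borel"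
  unfolding indicator_times by measurable

lemma duhamel_integrand_joint_borel [measurable (raw)]:
  fixes h :: "real \<times> 'a::euclidean_space \<Rightarrow> real"
  assumes [measurable]: "h \<in> borel_measurable borel"
  shows "(\<lambda>(z, p). duhamel_integrand h z p) \<in> borel_measurable (borel \<Otimes>\<^sub>M lborel)"
  unfolding indicator_times by measurable

lemma duhamel_borel:
  fixes h :: "real \<times> 'a::euclidean_space \<Rightarrow> real"
  assumes h: "h \<in> borel_measurable borel"
  shows "duhamel h \<in> borel_measurable borel"
  unfolding duhamel_def[abs_def]
  by (rule lborel.borel_measurable_lebesgue_integral) (rule duhamel_integrand_joint_borel[OF h])

lemma duhamel_dominated:
  fixes h H :: "real \<times> 'a::euclidean_space \<Rightarrow> real"
  assumes [measurable]: "h \<in> borel_measurable borel" and bd: "\<And>p. \<bar>h p\<bar> \<le> H p"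
    and int: "integrable lborel (duhamel_integrand H z)"
  shows "integrable lborel (duhamel_integrand h z)" and "\<bar>duhamel h z\<bar> \<le> duhamel H z"
proof -
  have le: "\<bar>duhamel_integrand h z p\<bar> \<le> duhamel_integrand H z p" for p
    unfolding abs_mult using bd[of p] by (auto simp: split: split_indicator intro!: mult_left_mono)
  show 1: "integrable lborel (duhamel_integrand h z)"
    by (rule Bochner_Integration.integrable_bound[OF int])
       (use le in \<open>auto intro!: AE_I2 order_trans[OF _ abs_ge_self]\<close>)
  show "\<bar>duhamel h z\<bar> \<le> duhamel H z"
    unfolding duhamel_def
    by (rule order_trans[OF integral_abs_bound Bochner_Integration.integral_mono]) (use 1 int le in auto)
qed

lemma duhamel_mono:
  fixes h H :: "real \<times> 'a::euclidean_space \<Rightarrow> real"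
  assumes "integrable lborel (duhamel_integrand h z)" "integrable lborel (duhamel_integrand H z)"
    and "\<And>p. h p \<le> H p"
  shows "duhamel h z \<le> duhamel H z"
  unfolding duhamel_def
  by (rule Bochner_Integration.integral_mono) (use assms in \<open>auto split: split_indicator intro!: mult_left_mono\<close>)

text \<open>Scheffe's lemma: the kernels \<open>duhamel_integrand H z\<close> converge almost everywhere and their masses
  converge by assumption, hence they converge in \<open>L\<^sup>1\<close>. The increments of \<open>duhamel_integrand h\<close> are bounded by those
  of \<open>duhamel_integrand H\<close>. In this way continuity is only ever computed for explicit majorants.\<close>
lemma duhamel_continuous:
  fixes h H :: "real \<times> 'a::euclidean_space \<Rightarrow> real"
  assumes [measurable]: "h \<in> borel_measurable borel" "H \<in> borel_measurable borel"
    and bd: "\<And>p. \<bar>h p\<bar> \<le> H p"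
    and int: "\<And>z. z \<in> S \<Longrightarrow> integrable lborel (duhamel_integrand H z)"
    and cont: "continuous_on S (duhamel H)"
  shows "continuous_on S (duhamel h)"
  unfolding continuous_on_sequentially
proof (intro ballI allI impI, elim conjE)
  fix s a assume a: "a \<in> S" and s: "\<forall>n. s n \<in> S" and lim: "s \<longlonglongrightarrow> a"
  have H0: "0 \<le> H p" for p using bd[of p] by linarith
  have "(\<lambda>n. duhamel H (s n)) \<longlonglongrightarrow> duhamel H a"
    using cont a s lim unfolding continuous_on_sequentially o_def by blast
  then have limH: "(\<lambda>n. ennreal (duhamel H (s n))) \<longlonglongrightarrow> ennreal (duhamel H a)" by (rule tendsto_ennrealI)
  have nn: "(\<integral>\<^sup>+p. ennreal (norm (duhamel_integrand H z p)) \<partial>lborel) = ennreal (duhamel H z)" if "z \<in> S" for z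
    unfolding duhamel_def using int[OF that] H0
    by (subst nn_integral_eq_integral[symmetric]) (auto simp: abs_mult)
  have conv: "(\<lambda>n. \<integral>\<^sup>+p. ennreal (norm (duhamel_integrand H (s n) p - duhamel_integrand H a p)) \<partial>lborel) \<longlonglongrightarrow> 0"
  proof (rule Scheffe_lemma1)
    show "integrable lborel (duhamel_integrand H (s n))" for n using int s by auto
    show "integrable lborel (duhamel_integrand H a)" using int a by auto
    show "AE p in lborel. (\<lambda>n. duhamel_integrand H (s n) p) \<longlonglongrightarrow> duhamel_integrand H a p"
      using AE_fst_neq[of "fst a"]
    proof eventually_elim
      case (elim p)
      have "(\<lambda>n. s n - p) \<longlonglongrightarrow> a - p" by (intro tendsto_intros lim)
      then have "(\<lambda>n. heat_kernel (s n - p)) \<longlonglongrightarrow> heat_kernel (a - p)"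
        using elim by (intro isCont_tendsto_compose[OF heat_kernel_isCont]) auto
      then show ?case by (intro tendsto_intros)
    qed
    have "limsup (\<lambda>n. ennreal (duhamel H (s n))) = ennreal (duhamel H a)"
      by (rule lim_imp_Limsup[OF _ limH]) simp
    then show "limsup (\<lambda>n. \<integral>\<^sup>+p. ennreal (norm (duhamel_integrand H (s n) p)) \<partial>lborel) \<le> (\<integral>\<^sup>+p. ennreal (norm (duhamel_integrand H a p)) \<partial>lborel)"
      using nn a s by auto
  qed
  have "(\<lambda>n. ennreal \<bar>duhamel h (s n) - duhamel h a\<bar>) \<longlonglongrightarrow> 0"
  proof (rule tendsto_sandwich[OF _ _ tendsto_const conv])
    show "\<forall>\<^sub>F n in sequentially. ennreal \<bar>duhamel h (s n) - duhamel h a\<bar> \<le> (\<integral>\<^sup>+p. ennreal (norm (duhamel_integrand H (s n) p - duhamel_integrand H a p)) \<partial>lborel)"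
    proof (intro always_eventually allI)
      fix n
      have i: "integrable lborel (duhamel_integrand h (s n))" "integrable lborel (duhamel_integrand h a)"
        using duhamel_dominated(1)[OF assms(1) bd int] s a by auto
      have "\<bar>duhamel h (s n) - duhamel h a\<bar> = \<bar>\<integral>p. duhamel_integrand h (s n) p - duhamel_integrand h a p \<partial>lborel\<bar>"
        unfolding duhamel_def using i by simp
      then have "ennreal \<bar>duhamel h (s n) - duhamel h a\<bar> \<le> (\<integral>\<^sup>+p. ennreal (norm (duhamel_integrand h (s n) p - duhamel_integrand h a p)) \<partial>lborel)"
        using integral_norm_bound_ennreal[of lborel "\<lambda>p. duhamel_integrand h (s n) p - duhamel_integrand h a p"] i by auto
      also have "\<dots> \<le> (\<integral>\<^sup>+p. ennreal (norm (duhamel_integrand H (s n) p - duhamel_integrand H a p)) \<partial>lborel)"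
      proof (intro nn_integral_mono ennreal_leI)
        fix p
        have e: "duhamel_integrand f (s n) p - duhamel_integrand f a p = indicator ({0<..} \<times> UNIV) p * ((heat_kernel (s n - p) - heat_kernel (a - p)) * f p)" for f
          by (simp add: algebra_simps)
        show "norm (duhamel_integrand h (s n) p - duhamel_integrand h a p) \<le> norm (duhamel_integrand H (s n) p - duhamel_integrand H a p)"
          unfolding e norm_mult using bd[of p] H0[of p] by (intro mult_left_mono) auto
      qed
      finally show "ennreal \<bar>duhamel h (s n) - duhamel h a\<bar> \<le> (\<integral>\<^sup>+p. ennreal (norm (duhamel_integrand H (s n) p - duhamel_integrand H a p)) \<partial>lborel)" .
    qed
  qed auto
  then have "(\<lambda>n. \<bar>duhamel h (s n) - duhamel h a\<bar>) \<longlonglongrightarrow> 0"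
    using tendsto_ennreal_iff[of "\<lambda>n. \<bar>duhamel h (s n) - duhamel h a\<bar>" sequentially 0] by (simp add: ennreal_0)
  then have "(\<lambda>n. duhamel h (s n) - duhamel h a) \<longlonglongrightarrow> 0" by (rule tendsto_rabs_zero_cancel)
  then show "(duhamel h \<circ> s) \<longlonglongrightarrow> duhamel h a"
    unfolding o_def by (rule LIM_zero_cancel)
qed

text \<open>The class of bounds for source terms: a time-independent power singularity at \<open>x = 0\<close> plus a
  constant, whose Duhamel integral is explicit.\<close>
definition power_majorant :: "real \<Rightarrow> real \<Rightarrow> real \<Rightarrow> real \<times> 'a::euclidean_space \<Rightarrow> real" where
  "power_majorant A k B p = A * norm (snd p) powr (- k - 2) + B"

lemma power_majorant_borel [measurable]: "power_majorant A k B \<in> borel_measurable borel"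
  unfolding power_majorant_def[abs_def] by measurable

lemma duhamel_power_majorant:
  fixes z :: "real \<times> 'a::euclidean_space"
  assumes z: "fst z > 0" "snd z \<noteq> 0" and k: "0 < k" "k < real DIM('a) - 2"
  shows "integrable lborel (duhamel_integrand (power_majorant A k B) z)"
    and "duhamel (power_majorant A k B) z = A / hardy DIM('a) k * (norm (snd z) powr (- k) - heat_flow (\<lambda>y. norm y powr (- k)) z) + B * fst z"
proof -
  obtain t x where [simp]: "z = (t, x)" by (cases z)
  have t: "t > 0" and x: "x \<noteq> 0" using z by auto
  have e: "duhamel_integrand (power_majorant A k B) z = (\<lambda>p. A * duhamel_integrand (\<lambda>p. norm (snd p) powr (- k - 2)) (t, x) p + duhamel_integrand (\<lambda>p. B) (t, x) p)"
    by (auto simp: power_majorant_def algebra_simps)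
  have P: "hardy DIM('a) k > 0" using k by (simp add: hardy_def)
  note i = duhamel_power(1)[OF x k t] duhamel_const(1)[OF t, of x B]
  show "integrable lborel (duhamel_integrand (power_majorant A k B) z)"
    unfolding e using i by (intro Bochner_Integration.integrable_add integrable_mult_right)
  have "duhamel (power_majorant A k B) z = A * duhamel (\<lambda>p. norm (snd p) powr (- k - 2)) (t, x) + duhamel (\<lambda>p. B) (t, x)"
    unfolding duhamel_def e using i by (subst Bochner_Integration.integral_add) (auto simp del: mult.left_commute)
  also have "duhamel (\<lambda>p. norm (snd p) powr (- k - 2)) (t, x) = (norm x powr (- k) - heat_flow (\<lambda>y. norm y powr (- k)) (t, x)) / hardy DIM('a) k"
    using duhamel_power(2)[OF x k t] P by (simp add: field_simps)
  finally show "duhamel (power_majorant A k B) z = A / hardy DIM('a) k * (norm (snd z) powr (- k) - heat_flow (\<lambda>y. norm y powr (- k)) z) + B * fst z"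
    using duhamel_const(2)[OF t, of B x] by simp
qed

lemma heat_flow_power_continuous:
  assumes k: "0 < k" "k < real DIM('a) - 2"
  shows "continuous_on ({0<..} \<times> - {0}) (heat_flow (\<lambda>y::'a::euclidean_space. norm y powr (- k)))"
  by (rule heat_flow_continuous) (use heat_flow_power_integrable k in auto)

lemma duhamel_power_majorant_continuous:
  assumes k: "0 < k" "k < real DIM('a) - 2"
  shows "continuous_on ({0<..} \<times> - {0}) (duhamel (power_majorant A k B :: real \<times> 'a::euclidean_space \<Rightarrow> real))"
proof -
  have "continuous_on ({0<..} \<times> - {0}) (\<lambda>z::real\<times>'a. A / hardy DIM('a) k * (norm (snd z) powr (- k) - heat_flow (\<lambda>y. norm y powr (- k)) z) + B * fst z)"
    by (intro continuous_intros heat_flow_power_continuous k) auto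
  then show ?thesis
    by (rule continuous_on_eq) (rule duhamel_power_majorant(2)[OF _ _ k, symmetric], auto)
qed

lemma duhamel_power_majorant_tendsto_0:
  fixes x :: "'a::euclidean_space"
  assumes k: "0 < k" "k < real DIM('a) - 2" and x: "x \<noteq> 0"
    and s: "\<And>n. 0 < s n" "\<And>n. s n < 1" "s \<longlonglongrightarrow> 0"
  shows "(\<lambda>n. duhamel (power_majorant A k B) (s n, x)) \<longlonglongrightarrow> 0"
proof -
  let ?f = "\<lambda>t p. indicator ({0<..<t} \<times> UNIV) p * (heat_kernel p * norm (x - snd p) powr (- k - 2)) :: real"
  have P: "hardy DIM('a) k > 0" using k by (simp add: hardy_def)
  have eq: "duhamel (power_majorant A k B) (t, x) = A * (\<integral>p. ?f t p \<partial>lborel) + B * t" if t: "t > 0" for t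
  proof -
    have "heat_flow (\<lambda>y. norm y powr (- k)) (t, x) = (\<integral>y. heat_kernel (t, y) * norm (x - y) powr (- k) \<partial>lborel)"
      using lborel_integral_reflect[of "\<lambda>y. heat_kernel (t, y) * norm (x - y) powr (- k)" x] by (simp add: heat_flow_def)
    then have "norm x powr (- k) - heat_flow (\<lambda>y. norm y powr (- k)) (t, x) = hardy DIM('a) k * (\<integral>p. ?f t p \<partial>lborel)"
      using power_potential(3)[OF x k t] by simp
    then show ?thesis
      using duhamel_power_majorant(2)[of "(t, x)" k A B] t x k P by simp
  qed
  have "(\<lambda>n. \<integral>p. ?f (s n) p \<partial>lborel) \<longlonglongrightarrow> (\<integral>p. 0 \<partial>(lborel :: (real \<times> 'a) measure))"
  proof (rule integral_dominated_convergence[where w="?f 1"])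
    show "integrable lborel (?f 1)" by (rule power_potential(2)[OF x k]) simp
    show "AE p in lborel. (\<lambda>n. ?f (s n) p) \<longlonglongrightarrow> 0"
    proof (intro AE_I2)
      fix p :: "real \<times> 'a"
      have "\<forall>\<^sub>F n in sequentially. ?f (s n) p = 0"
      proof (cases "fst p > 0")
        case True
        have "\<forall>\<^sub>F n in sequentially. s n < fst p" using order_tendstoD(2)[OF s(3) True] .
        then show ?thesis by eventually_elim (auto simp: indicator_def)
      next
        case False
        then have "?f (s n) p = 0" for n by (cases p) auto
        then show ?thesis by simp
      qed
      then show "(\<lambda>n. ?f (s n) p) \<longlonglongrightarrow> 0" by (rule tendsto_eventually)
    qed
    show "AE p in lborel. norm (?f (s n) p) \<le> ?f 1 p" for n
      using s(2)[of n] by (intro AE_I2) (auto simp: indicator_def)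
  qed (unfold indicator_times, measurable)
  then have "(\<lambda>n. \<integral>p. ?f (s n) p \<partial>lborel) \<longlonglongrightarrow> 0" by simp
  then have "(\<lambda>n. A * (\<integral>p. ?f (s n) p \<partial>lborel) + B * s n) \<longlonglongrightarrow> A * 0 + B * 0"
    by (intro tendsto_intros s(3))
  then show ?thesis by (simp add: eq s(1))
qed

text \<open>Monotone iteration. The assumption \<open>inv\<close> says that the solution operator maps functions between
  \<open>- \<Phi>\<close> and \<open>\<Phi>\<close> to such functions. Started at \<open>- \<Phi>\<close>, the iterates increase because \<open>g\<close> is monotone, so they
  converge pointwise, and \<open>H\<close> dominates the source terms in the passage to the limit. Neither a Lipschitz
  constant nor smallness is required, which matters as \<open>g\<close> may have a critical singularity in \<open>y\<close>.\<close>
lemma duhamel_fixed_point: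
  fixes g :: "'a::euclidean_space \<Rightarrow> real \<Rightarrow> real" and \<Phi> H :: "'a \<Rightarrow> real" and F :: "real \<times> 'a \<Rightarrow> real" and T :: real
  defines "Q \<equiv> {p. 0 < fst p \<and> fst p < T \<and> snd p \<noteq> 0}"
  assumes meas [measurable]: "(\<lambda>p. g (fst p) (snd p)) \<in> borel_measurable borel"
      "\<Phi> \<in> borel_measurable borel" "H \<in> borel_measurable borel" "F \<in> borel_measurable borel"
    and mono: "\<And>y a b. a \<le> b \<Longrightarrow> g y a \<le> g y b"
    and cont: "\<And>y. continuous_on UNIV (g y)"
    and bound: "\<And>y a. y \<noteq> 0 \<Longrightarrow> \<bar>a\<bar> \<le> \<Phi> y \<Longrightarrow> \<bar>g y a\<bar> \<le> H y"
    and H0: "\<And>y. 0 \<le> H y" and \<Phi>0: "\<And>y. y \<noteq> 0 \<Longrightarrow> 0 \<le> \<Phi> y"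
    and int: "\<And>p. p \<in> Q \<Longrightarrow> integrable lborel (duhamel_integrand (\<lambda>q. H (snd q)) p)"
    and inv: "\<And>p. p \<in> Q \<Longrightarrow> \<bar>F p\<bar> + duhamel (\<lambda>q. H (snd q)) p \<le> \<Phi> (snd p)"
  shows "\<exists>w \<in> borel_measurable borel. (\<forall>p\<in>Q. \<bar>w p\<bar> \<le> \<Phi> (snd p) \<and>
     w p = F p + duhamel (\<lambda>q. if q \<in> Q then g (snd q) (w q) else 0) p)"
proof -
  have Qm[measurable]: "Measurable.pred borel (\<lambda>p. p \<in> Q)" unfolding Q_def by simp
  define src where "src = (\<lambda>(w::real\<times>'a\<Rightarrow>real) q. if q \<in> Q then g (snd q) (w q) else 0)"
  define S where "S = (\<lambda>w p. if p \<in> Q then F p + duhamel (src w) p else 0)"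
  define W where "W = rec_nat (\<lambda>p. if p \<in> Q then - \<Phi> (snd p) else 0) (\<lambda>_. S)"
  have W0: "W 0 = (\<lambda>p. if p \<in> Q then - \<Phi> (snd p) else 0)" and WS: "W (Suc n) = S (W n)" for n
    by (auto simp: W_def)
  have src_m: "src w \<in> borel_measurable borel" if [measurable]: "w \<in> borel_measurable borel" for w
  proof -
    have "(\<lambda>q. (snd q, w q)) \<in> borel_measurable borel" by (intro borel_measurable_Pair) measurable
    from measurable_compose[OF this meas(1)] have [measurable]: "(\<lambda>q. g (snd q) (w q)) \<in> borel_measurable borel" by simp
    show ?thesis unfolding src_def by measurable
  qed
  have S_m: "S w \<in> borel_measurable borel" if w: "w \<in> borel_measurable borel" for w
  proof -
    have [measurable]: "duhamel (src w) \<in> borel_measurable borel" by (rule duhamel_borel[OF src_m[OF w]])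
    show ?thesis unfolding S_def by measurable
  qed
  have W_m: "W n \<in> borel_measurable borel" for n
    by (induction n) (auto simp: W0 WS intro!: S_m)
  have src_bd: "\<bar>src w q\<bar> \<le> H (snd q)" if "\<forall>p\<in>Q. \<bar>w p\<bar> \<le> \<Phi> (snd p)" for w q
  proof (cases "q \<in> Q")
    case True
    have "\<bar>w q\<bar> \<le> \<Phi> (snd q)" using that True by blast
    moreover have "snd q \<noteq> 0" using True by (simp add: Q_def)
    ultimately show ?thesis using bound True by (simp add: src_def)
  qed (simp add: src_def H0)
  have src_int: "integrable lborel (duhamel_integrand (src w) p)" "\<bar>duhamel (src w) p\<bar> \<le> duhamel (\<lambda>q. H (snd q)) p"
    if "p \<in> Q" "w \<in> borel_measurable borel" "\<forall>p\<in>Q. \<bar>w p\<bar> \<le> \<Phi> (snd p)" for w p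
    using duhamel_dominated[OF src_m[OF that(2)] src_bd[OF that(3)] int[OF that(1)]] by auto
  have S_bd: "\<bar>S w p\<bar> \<le> \<Phi> (snd p)" if "p \<in> Q" "w \<in> borel_measurable borel" "\<forall>p\<in>Q. \<bar>w p\<bar> \<le> \<Phi> (snd p)" for w p
    using src_int(2)[OF that] inv[OF that(1)] that(1) by (simp add: S_def)
  have W_bd: "\<forall>p\<in>Q. \<bar>W n p\<bar> \<le> \<Phi> (snd p)" for n
    by (induction n) (use \<Phi>0 S_bd W_m in \<open>auto simp: W0 WS Q_def\<close>)
  have W_mono: "W n p \<le> W (Suc n) p" if "p \<in> Q" for n p
    using that
  proof (induction n arbitrary: p)
    case 0
    then show ?case using W_bd[of 1] by (auto simp: W0 abs_le_iff)
  next
    case (Suc n)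
    have "duhamel (src (W n)) p \<le> duhamel (src (W (Suc n))) p"
      using Suc.prems W_m W_bd Suc.IH
      by (intro duhamel_mono src_int) (auto simp: src_def intro!: mono)
    then show ?case using Suc.prems by (simp only: WS[of n] WS[of "Suc n"] S_def if_True) 
  qed
  define w where "w = (\<lambda>p. lim (\<lambda>n. W n p))"
  have w_m: "w \<in> borel_measurable borel"
    unfolding w_def by (rule borel_measurable_lim_metric) (rule W_m)
  have conv: "(\<lambda>n. W n p) \<longlonglongrightarrow> w p" if p: "p \<in> Q" for p
  proof -
    have "incseq (\<lambda>n. W n p)" using W_mono[OF p] by (intro incseq_SucI)
    moreover have "W n p \<le> \<Phi> (snd p)" for n using W_bd p by (auto simp: abs_le_iff)
    ultimately obtain L where "(\<lambda>n. W n p) \<longlonglongrightarrow> L" using incseq_convergent by metis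
    then show ?thesis unfolding w_def using limI by blast
  qed
  have w_bd: "\<forall>p\<in>Q. \<bar>w p\<bar> \<le> \<Phi> (snd p)"
  proof
    fix p assume p: "p \<in> Q"
    show "\<bar>w p\<bar> \<le> \<Phi> (snd p)"
      by (rule LIMSEQ_le_const2[OF tendsto_rabs[OF conv[OF p]]]) (use W_bd p in auto)
  qed
  have "w p = F p + duhamel (src w) p" if p: "p \<in> Q" for p
  proof -
    have "(\<lambda>n. duhamel (src (W n)) p) \<longlonglongrightarrow> duhamel (src w) p"
      unfolding duhamel_def
    proof (rule integral_dominated_convergence[where w="duhamel_integrand (\<lambda>q. H (snd q)) p"])
      show "integrable lborel (duhamel_integrand (\<lambda>q. H (snd q)) p)" by (rule int[OF p])
      show "AE q in lborel. (\<lambda>n. duhamel_integrand (src (W n)) p q) \<longlonglongrightarrow> duhamel_integrand (src w) p q"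
      proof (intro AE_I2 tendsto_mult tendsto_const)
        fix q
        have "isCont (g (snd q)) (w q)" using cont by (auto simp: continuous_on_eq_continuous_at)
        then show "(\<lambda>n. src (W n) q) \<longlonglongrightarrow> src w q"
          using conv[of q] by (cases "q \<in> Q") (auto simp: src_def intro: isCont_tendsto_compose)
      qed
      show "AE q in lborel. norm (duhamel_integrand (src (W n)) p q) \<le> duhamel_integrand (\<lambda>q. H (snd q)) p q" for n
        unfolding norm_mult using src_bd[OF W_bd] by (auto intro!: AE_I2 mult_left_mono split: split_indicator)
      have [measurable]: "src (W n) \<in> borel_measurable borel" "src w \<in> borel_measurable borel" for n
        using src_m W_m w_m by auto
      show "duhamel_integrand (src w) p \<in> borel_measurable lborel" "duhamel_integrand (src (W n)) p \<in> borel_measurable lborel" for n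
        using duhamel_integrand_borel[of "src w" p] duhamel_integrand_borel[of "src (W n)" p] by auto
    qed
    then have "(\<lambda>n. F p + duhamel (src (W n)) p) \<longlonglongrightarrow> F p + duhamel (src w) p" by (intro tendsto_intros)
    moreover have "(\<lambda>n. F p + duhamel (src (W n)) p) = (\<lambda>n. W (Suc n) p)"
      using p by (simp add: WS S_def)
    moreover have "(\<lambda>n. W (Suc n) p) \<longlonglongrightarrow> w p" using conv[OF p] by (rule LIMSEQ_Suc)
    ultimately show ?thesis using LIMSEQ_unique by metis
  qed
  then show ?thesis using w_m w_bd by (intro bexI[of _ w]) (auto simp: src_def)
qed

section \<open>Mild solutions as distributional solutions\<close>

lemma dir_deriv_zero_outside:
  assumes K: "closed K" "\<And>z. z \<notin> K \<Longrightarrow> f z = 0" and z: "z \<notin> K"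
  shows "dir_deriv v f z = 0"
proof -
  have "(f has_derivative (\<lambda>_. 0)) (at z)"
    by (rule has_derivative_transform_within_open[of "\<lambda>_. 0" _ z UNIV "- K"]) (use K z in auto)
  then have "(\<lambda>_. 0) = frechet_derivative f (at z)" by (rule frechet_derivative_at)
  then show ?thesis unfolding dir_deriv_def by metis
qed

lemma bounded_of_compact_support:
  fixes f :: "'a::euclidean_space \<Rightarrow> real"
  assumes "continuous_on UNIV f" "compact K" "\<And>z. z \<notin> K \<Longrightarrow> f z = 0"
  shows "\<exists>B\<ge>0. \<forall>z. \<bar>f z\<bar> \<le> B"
proof -
  have "bounded (f ` K)"
    using assms by (intro compact_imp_bounded compact_continuous_image) (auto intro: continuous_on_subset)
  then obtain B where B: "\<And>z. z \<in> K \<Longrightarrow> \<bar>f z\<bar> \<le> B" by (auto simp: bounded_iff)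
  then have "\<bar>f z\<bar> \<le> max B 0" for z using assms(3) by (cases "z \<in> K") (auto simp: le_max_iff_disj)
  then show ?thesis by (intro exI[of _ "max B 0"]) auto
qed

text \<open>The derivatives of a test function in the form in which \<open>heat_kernel_ito\<close> needs them, with one compact
  set outside of which all of them vanish.\<close>
lemma test_function_calculus:
  fixes \<phi> :: "real \<times> 'a::euclidean_space \<Rightarrow> real"
  assumes \<phi>: "test_function \<Omega> \<phi>"
  defines "\<phi>x \<equiv> \<lambda>b. dir_deriv (0, b) \<phi>"
  defines "\<phi>xx \<equiv> \<lambda>b. dir_deriv (0, b) (dir_deriv (0, b) \<phi>)"
  shows "\<And>z. (\<phi> has_derivative (\<lambda>v. time_deriv \<phi> z * fst v + (\<Sum>b\<in>Basis. \<phi>x b z * (snd v \<bullet> b)))) (at z)"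
    and "\<And>b z. ((\<lambda>h. \<phi>x b (z + h *\<^sub>R (0, b))) has_real_derivative \<phi>xx b z) (at 0)"
    and "continuous_on UNIV \<phi>" "continuous_on UNIV (time_deriv \<phi>)" "\<And>b. continuous_on UNIV (\<phi>x b)" "\<And>b. continuous_on UNIV (\<phi>xx b)"
    and "\<exists>K. compact K \<and> K \<subseteq> \<Omega> \<and> (\<forall>z. z \<notin> K \<longrightarrow> \<phi> z = 0 \<and> time_deriv \<phi> z = 0 \<and> (\<forall>b. \<phi>x b z = 0 \<and> \<phi>xx b z = 0))"
proof -
  have ck: "C_k k \<phi>" for k using \<phi> by (simp add: test_function_def)
  have "\<phi> differentiable_on UNIV" using ck[of "Suc 0"] by simp
  then have d1: "\<phi> differentiable (at z)" for z
    unfolding differentiable_on_def by blast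
  have "dir_deriv v \<phi> differentiable_on UNIV" for v using ck[of "Suc (Suc 0)"] unfolding C_k.simps by blast
  then have d2: "dir_deriv v \<phi> differentiable (at z)" for v z
    unfolding differentiable_on_def by blast
  have c0: "continuous_on UNIV (dir_deriv v \<phi>)" for v using ck[of "Suc 0"] unfolding C_k.simps by blast
  have c1: "continuous_on UNIV (dir_deriv w (dir_deriv v \<phi>))" for v w using ck[of "Suc (Suc 0)"] unfolding C_k.simps by blast
  have hd: "(\<phi> has_derivative frechet_derivative \<phi> (at z)) (at z)" for z
    using d1 frechet_derivative_works by blast
  show "(\<phi> has_derivative (\<lambda>v. time_deriv \<phi> z * fst v + (\<Sum>b\<in>Basis. \<phi>x b z * (snd v \<bullet> b)))) (at z)" for z
  proof -
    interpret L: bounded_linear "frechet_derivative \<phi> (at z)" by (rule has_derivative_bounded_linear[OF hd])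
    have "frechet_derivative \<phi> (at z) v = time_deriv \<phi> z * fst v + (\<Sum>b\<in>Basis. \<phi>x b z * (snd v \<bullet> b))" for v
    proof -
      have "v = fst v *\<^sub>R (1, 0) + (\<Sum>b\<in>Basis. (snd v \<bullet> b) *\<^sub>R (0::real, b))"
      proof (rule prod_eqI)
        show "snd v = snd (fst v *\<^sub>R (1, 0) + (\<Sum>b\<in>Basis. (snd v \<bullet> b) *\<^sub>R (0::real, b)))"
          by (simp add: snd_sum euclidean_representation)
      qed (simp add: fst_sum)
      then have "frechet_derivative \<phi> (at z) v = frechet_derivative \<phi> (at z) (fst v *\<^sub>R (1, 0) + (\<Sum>b\<in>Basis. (snd v \<bullet> b) *\<^sub>R (0::real, b)))"
        by simp
      also have "\<dots> = fst v * time_deriv \<phi> z + (\<Sum>b\<in>Basis. (snd v \<bullet> b) * \<phi>x b z)"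
        by (simp only: L.add L.sum L.scaleR) (simp add: time_deriv_def dir_deriv_def \<phi>x_def)
      finally show ?thesis by (simp add: mult.commute)
    qed
    then have "frechet_derivative \<phi> (at z) = (\<lambda>v. time_deriv \<phi> z * fst v + (\<Sum>b\<in>Basis. \<phi>x b z * (snd v \<bullet> b)))" by blast
    then show ?thesis using hd[of z] by metis
  qed
  show "((\<lambda>h. \<phi>x b (z + h *\<^sub>R (0, b))) has_real_derivative \<phi>xx b z) (at 0)" for b z
  proof -
    let ?D = "frechet_derivative (\<phi>x b) (at z)"
    have D: "(\<phi>x b has_derivative ?D) (at z)"
      using d2 frechet_derivative_works unfolding \<phi>x_def by blast
    interpret L: bounded_linear ?D by (rule has_derivative_bounded_linear[OF D])
    have l: "((\<lambda>h. z + h *\<^sub>R (0::real, b)) has_derivative (\<lambda>h. h *\<^sub>R (0, b))) (at 0)"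
      by (auto intro!: derivative_eq_intros)
    have "(\<phi>x b has_derivative ?D) (at (z + 0 *\<^sub>R (0, b)))" using D by (simp add: zero_prod_def[symmetric])
    from has_derivative_compose[OF l this]
    have "((\<lambda>h. \<phi>x b (z + h *\<^sub>R (0, b))) has_derivative (\<lambda>h. ?D (h *\<^sub>R (0, b)))) (at 0)" .
    moreover have "(\<lambda>h. ?D (h *\<^sub>R (0, b))) = (\<lambda>h. \<phi>xx b z * h)"
      unfolding L.scaleR by (simp add: \<phi>xx_def \<phi>x_def dir_deriv_def fun_eq_iff mult.commute)
    ultimately show ?thesis by (simp add: has_field_derivative_def)
  qed
  show "continuous_on UNIV \<phi>" using ck[of 0] by simp
  show "continuous_on UNIV (time_deriv \<phi>)" unfolding time_deriv_def by (rule c0)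
  show "continuous_on UNIV (\<phi>x b)" "continuous_on UNIV (\<phi>xx b)" for b
    unfolding \<phi>x_def \<phi>xx_def by (rule c0 c1)+
  define K where "K = closure {z. \<phi> z \<noteq> 0}"
  have K: "compact K" "K \<subseteq> \<Omega>" using \<phi> by (auto simp: test_function_def K_def)
  have z0: "z \<notin> K \<Longrightarrow> \<phi> z = 0" for z using closure_subset[of "{z. \<phi> z \<noteq> 0}"] by (auto simp: K_def)
  have z1: "z \<notin> K \<Longrightarrow> dir_deriv v \<phi> z = 0" for v z
    by (rule dir_deriv_zero_outside[of K]) (use K z0 compact_imp_closed in auto)
  have z2: "z \<notin> K \<Longrightarrow> dir_deriv w (dir_deriv v \<phi>) z = 0" for v w z
    by (rule dir_deriv_zero_outside[of K]) (use K z1 compact_imp_closed in auto)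
  show "\<exists>K. compact K \<and> K \<subseteq> \<Omega> \<and> (\<forall>z. z \<notin> K \<longrightarrow> \<phi> z = 0 \<and> time_deriv \<phi> z = 0 \<and> (\<forall>b. \<phi>x b z = 0 \<and> \<phi>xx b z = 0))"
    using K z0 z1 z2 by (intro exI[of _ K]) (auto simp: time_deriv_def \<phi>x_def \<phi>xx_def)
qed

lemma test_function_bounds:
  fixes \<phi> :: "real \<times> 'a::euclidean_space \<Rightarrow> real"
  assumes \<phi>: "test_function \<Omega> \<phi>"
  shows "\<exists>B\<ge>0. \<forall>z. \<bar>\<phi> z\<bar> \<le> B \<and> \<bar>time_deriv \<phi> z\<bar> \<le> B \<and>
    (\<forall>b\<in>Basis. \<bar>dir_deriv (0, b) \<phi> z\<bar> \<le> B \<and> \<bar>dir_deriv (0, b) (dir_deriv (0, b) \<phi>) z\<bar> \<le> B)"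
proof -
  note c = test_function_calculus[OF \<phi>]
  obtain K where K: "compact K" "\<And>z. z \<notin> K \<Longrightarrow> \<phi> z = 0 \<and> time_deriv \<phi> z = 0 \<and> (\<forall>b. dir_deriv (0, b) \<phi> z = 0 \<and> dir_deriv (0, b) (dir_deriv (0, b) \<phi>) z = 0)"
    using c(7) by blast
  obtain B0 where B0: "B0 \<ge> 0" "\<And>z. \<bar>\<phi> z\<bar> \<le> B0" using bounded_of_compact_support[OF c(3) K(1)] K(2) by blast
  obtain B1 where B1: "B1 \<ge> 0" "\<And>z. \<bar>time_deriv \<phi> z\<bar> \<le> B1" using bounded_of_compact_support[OF c(4) K(1)] K(2) by blast
  have "\<forall>b. \<exists>B\<ge>0. \<forall>z. \<bar>dir_deriv (0, b) \<phi> z\<bar> \<le> B" using bounded_of_compact_support[OF c(5) K(1)] K(2) by blast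
  then obtain B2 where B2: "\<And>b. B2 b \<ge> 0" "\<And>b z. \<bar>dir_deriv (0, b) \<phi> z\<bar> \<le> B2 b" by metis
  have "\<forall>b. \<exists>B\<ge>0. \<forall>z. \<bar>dir_deriv (0, b) (dir_deriv (0, b) \<phi>) z\<bar> \<le> B" using bounded_of_compact_support[OF c(6) K(1)] K(2) by blast
  then obtain B3 where B3: "\<And>b. B3 b \<ge> 0" "\<And>b z. \<bar>dir_deriv (0, b) (dir_deriv (0, b) \<phi>) z\<bar> \<le> B3 b" by metis
  define B where "B = B0 + B1 + (\<Sum>b\<in>(Basis::'a set). B2 b) + (\<Sum>b\<in>(Basis::'a set). B3 b)"
  have s0: "0 \<le> (\<Sum>b\<in>(Basis::'a set). B2 b)" "0 \<le> (\<Sum>b\<in>(Basis::'a set). B3 b)"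
    using B2 B3 by (auto intro: sum_nonneg)
  have le: "B0 \<le> B" "B1 \<le> B" using s0 B0 B1 unfolding B_def by linarith+
  have "B2 b \<le> (\<Sum>b\<in>(Basis::'a set). B2 b)" "B3 b \<le> (\<Sum>b\<in>(Basis::'a set). B3 b)" if "b \<in> Basis" for b
    using B2 B3 that by (auto intro: member_le_sum)
  then have le': "B2 b \<le> B" "B3 b \<le> B" if "b \<in> Basis" for b
    using s0 B0 B1 that unfolding B_def by (smt (verit))+
  show ?thesis
  proof (intro exI[of _ B] conjI allI ballI)
    show "0 \<le> B" using le B0(1) by linarith
    show "\<bar>\<phi> z\<bar> \<le> B" "\<bar>time_deriv \<phi> z\<bar> \<le> B" for z
      by (rule order_trans[OF B0(2) le(1)]) (rule order_trans[OF B1(2) le(2)])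
    fix z and b :: 'a assume b: "b \<in> Basis"
    show "\<bar>dir_deriv (0, b) \<phi> z\<bar> \<le> B" by (rule order_trans[OF B2(2) le'(1)[OF b]])
    show "\<bar>dir_deriv (0, b) (dir_deriv (0, b) \<phi>) z\<bar> \<le> B" by (rule order_trans[OF B3(2) le'(2)[OF b]])
  qed
qed

text \<open>The formal adjoint of \<open>\<partial>\<^sub>t - \<Delta>\<close>, up to sign.\<close>
definition heat_adjoint :: "(real \<times> 'a::euclidean_space \<Rightarrow> real) \<Rightarrow> real \<times> 'a \<Rightarrow> real" where
  "heat_adjoint \<phi> z = time_deriv \<phi> z + space_laplacian \<phi> z"

text \<open>The heat kernel is a fundamental solution: \<open>heat_kernel_ito\<close> for \<open>\<phi>\<close> shifted by \<open>q\<close>, with a final time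
  beyond the support of \<open>\<phi>\<close>.\<close>
lemma heat_kernel_adjoint:
  fixes \<phi> :: "real \<times> 'a::euclidean_space \<Rightarrow> real"
  assumes \<phi>: "test_function \<Omega> \<phi>"
  shows "integrable lborel (\<lambda>z. heat_kernel (z - q) * heat_adjoint \<phi> z)"
    and "(\<integral>z. heat_kernel (z - q) * heat_adjoint \<phi> z \<partial>lborel) = - \<phi> q"
proof -
  note c = test_function_calculus[OF \<phi>]
  obtain K where K: "compact K" "\<And>z. z \<notin> K \<Longrightarrow> \<phi> z = 0 \<and> time_deriv \<phi> z = 0 \<and> (\<forall>b. dir_deriv (0, b) \<phi> z = 0 \<and> dir_deriv (0, b) (dir_deriv (0, b) \<phi>) z = 0)"
    using c(7) by blast
  obtain B where B: "\<And>z. \<bar>\<phi> z\<bar> \<le> B" "\<And>z. \<bar>time_deriv \<phi> z\<bar> \<le> B" "\<And>b z. b \<in> Basis \<Longrightarrow> \<bar>dir_deriv (0, b) \<phi> z\<bar> \<le> B"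
    "\<And>b z. b \<in> Basis \<Longrightarrow> \<bar>dir_deriv (0, b) (dir_deriv (0, b) \<phi>) z\<bar> \<le> B"
    using test_function_bounds[OF \<phi>] by blast
  obtain R where R: "\<And>z. z \<in> K \<Longrightarrow> norm z \<le> R" using compact_imp_bounded[OF K(1)] by (auto simp: bounded_iff)
  define T where "T = \<bar>R\<bar> + \<bar>fst q\<bar> + 1"
  have T: "T > 0" by (simp add: T_def)
  have out: "q + z \<notin> K" if "T \<le> fst z" for z
  proof
    assume "q + z \<in> K"
    then have "norm (q + z) \<le> R" by (rule R)
    moreover have "\<bar>fst (q + z)\<bar> \<le> norm (q + z)" using norm_fst_le[of "fst (q + z)" "snd (q + z)"] unfolding prod.collapse real_norm_def .
    moreover have "\<bar>R\<bar> + 1 \<le> \<bar>fst (q + z)\<bar>" using that by (simp add: T_def)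
    ultimately show False by linarith
  qed
  have L0: "heat_adjoint \<phi> z = 0" if "z \<notin> K" for z
    using K(2)[OF that] by (simp add: heat_adjoint_def space_laplacian_def)
  have shift: "((\<lambda>z. q + z) has_derivative (\<lambda>v. v)) (at z)" for z :: "real \<times> 'a"
    by (auto intro!: derivative_eq_intros)
  have D: "((\<lambda>z. \<phi> (q + z)) has_derivative (\<lambda>v. time_deriv \<phi> (q + z) * fst v + (\<Sum>b\<in>Basis. dir_deriv (0, b) \<phi> (q + z) * (snd v \<bullet> b)))) (at z)" for z
    by (rule has_derivative_compose[OF shift c(1)])
  have D2: "((\<lambda>h. dir_deriv (0, b) \<phi> (q + (z + h *\<^sub>R (0, b)))) has_real_derivative dir_deriv (0, b) (dir_deriv (0, b) \<phi>) (q + z)) (at 0)" for b z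
    using c(2)[of b "q + z"] by (simp add: add.assoc)
  have cs: "continuous_on UNIV (\<lambda>z. f (q + z))" if "continuous_on UNIV f" for f :: "real \<times> 'a \<Rightarrow> real"
    by (intro continuous_on_compose2[OF that] continuous_intros) auto
  note ito = heat_kernel_ito[OF T D D2 cs[OF c(4)] cs[OF c(5)] cs[OF c(6)] B(1) B(2) B(3) B(4)]
  have eq: "indicator ({0<..<T} \<times> UNIV) z * (heat_kernel z * (time_deriv \<phi> (q + z) + (\<Sum>b\<in>Basis. dir_deriv (0, b) (dir_deriv (0, b) \<phi>) (q + z)))) = heat_kernel z * heat_adjoint \<phi> (q + z)" for z
    using L0[OF out, of z] by (cases "fst z > 0"; cases "fst z < T"; cases z)
      (auto simp: heat_adjoint_def space_laplacian_def heat_kernel_def indicator_def)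
  have m[measurable]: "heat_adjoint \<phi> \<in> borel_measurable borel"
    unfolding heat_adjoint_def[abs_def] space_laplacian_def using c
    by (intro borel_measurable_continuous_onI continuous_intros) auto
  have m2: "(\<lambda>z. heat_kernel (z - q) * heat_adjoint \<phi> z) \<in> borel_measurable borel" by measurable
  have "integrable lborel (\<lambda>z. heat_kernel z * heat_adjoint \<phi> (q + z))"
    using ito(1) unfolding eq by blast
  then show "integrable lborel (\<lambda>z. heat_kernel (z - q) * heat_adjoint \<phi> z)"
    using lborel_integrable_affine_iff[OF _ m2, of 1 q] by simp
  have "(\<integral>z. heat_kernel z * heat_adjoint \<phi> (q + z) \<partial>lborel) = (\<integral>x. heat_kernel (T, x) * \<phi> (q + (T, x)) \<partial>lborel) - \<phi> (q + (0, 0))"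
    using ito(2) unfolding eq by blast
  moreover have "\<phi> (q + (T, x)) = 0" for x using K(2)[OF out[of "(T, x)"]] by simp
  ultimately have "(\<integral>z. heat_kernel z * heat_adjoint \<phi> (q + z) \<partial>lborel) = - \<phi> q"
    by (simp add: zero_prod_def[symmetric])
  then show "(\<integral>z. heat_kernel (z - q) * heat_adjoint \<phi> z \<partial>lborel) = - \<phi> q"
    using lborel_integral_affine[OF _ m2, of 1 q] by simp
qed

text \<open>Local integrability of \<open>norm y powr (- k - 2)\<close> for \<open>k + 2 < N\<close> is read off from \<open>power_potential\<close>: at
  almost every time the function is integrable against the heat kernel, which is bounded below on balls.\<close>
lemma power_locally_integrable:
  assumes k: "0 < k" "k < real DIM('a) - 2"
  shows "integrable lborel (\<lambda>y::'a::euclidean_space. indicator (cball 0 R) y * norm y powr (- k - 2))"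
proof -
  obtain x :: 'a where x: "x \<noteq> 0" using nonempty_Basis nonzero_Basis by blast
  let ?f = "\<lambda>p. indicator ({0<..<1::real} \<times> UNIV) p * (heat_kernel p * norm (x - snd p) powr (- k - 2)) :: real"
  have "integrable (lborel \<Otimes>\<^sub>M lborel) ?f" using power_potential(2)[OF x k, of 1] by (simp add: lborel_prod)
  then have "AE s in lborel. integrable lborel (\<lambda>y. ?f (s, y))" by (rule lborel_pair.AE_integrable_fst')
  moreover have "\<not> (AE s in lborel. s \<notin> {0<..<1::real})"
  proof
    assume "AE s in lborel. s \<notin> {0<..<1::real}"
    then have "{0<..<1::real} \<in> null_sets lborel" using AE_iff_null_sets[of "{0<..<1::real}" lborel] by simp
    then show False by (simp add: null_sets_def)
  qed
  ultimately obtain s where s: "s \<in> {0<..<1}" "integrable lborel (\<lambda>y. ?f (s, y))"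
    by (metis (mono_tags, lifting) eventually_mono)
  have s0: "s > 0" using s by simp
  have i: "integrable lborel (\<lambda>y. heat_kernel (s, y) * norm (x - y) powr (- k - 2))" using s by simp
  define R' where "R' = norm x + \<bar>R\<bar>"
  obtain c where c: "c > 0" "\<And>y::'a. norm y \<le> R' \<Longrightarrow> c \<le> heat_kernel (s, y)"
  proof -
    define Z where "Z = (\<integral>x. exp (- ((norm (x::'a))\<^sup>2 / 4)) \<partial>lborel)"
    have Z: "Z > 0" unfolding Z_def by (rule gauss_mass_pos)
    show thesis
    proof (rule that[of "exp (- (R'\<^sup>2 / (4 * s))) / (sqrt s ^ DIM('a) * Z)"])
      show "exp (- (R'\<^sup>2 / (4 * s))) / (sqrt s ^ DIM('a) * Z) > 0" using Z s0 by simp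
      show "exp (- (R'\<^sup>2 / (4 * s))) / (sqrt s ^ DIM('a) * Z) \<le> heat_kernel (s, y)" if "norm y \<le> R'" for y :: 'a
        unfolding heat_kernel_eq[OF s0] Z_def[symmetric] using that s0 Z
        by (intro divide_right_mono) (auto intro!: divide_right_mono power_mono)
    qed
  qed
  have [measurable]: "cball (0::'a) R \<in> sets borel" by simp
  have "integrable lborel (\<lambda>y. indicator (cball 0 R) (x - y) * norm (x - y) powr (- k - 2))"
  proof (rule Bochner_Integration.integrable_bound)
    show "integrable lborel (\<lambda>y. 1 / c * (heat_kernel (s, y) * norm (x - y) powr (- k - 2)))" using i by (rule integrable_mult_right)
    show "AE y in lborel. norm (indicator (cball 0 R) (x - y) * norm (x - y) powr (- k - 2)) \<le> norm (1 / c * (heat_kernel (s, y) * norm (x - y) powr (- k - 2)))"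
    proof (intro AE_I2)
      fix y :: 'a
      show "norm (indicator (cball 0 R) (x - y) * norm (x - y) powr (- k - 2)) \<le> norm (1 / c * (heat_kernel (s, y) * norm (x - y) powr (- k - 2)))"
      proof (cases "norm (x - y) \<le> R")
        case True
        have "norm y \<le> R'" using norm_triangle_ineq4[of x "x - y"] True by (simp add: R'_def)
        then have "1 \<le> 1 / c * heat_kernel (s, y)" using c by (simp add: field_simps)
        then have "1 * norm (x - y) powr (- k - 2) \<le> (1 / c * heat_kernel (s, y)) * norm (x - y) powr (- k - 2)"
          by (intro mult_right_mono) auto
        then show ?thesis using True c by (simp add: abs_mult)
      qed (auto simp: indicator_def)
    qed
  qed measurable
  then show ?thesis
    using lborel_integrable_reflect_iff[of "\<lambda>y. indicator (cball 0 R) y * norm y powr (- k - 2)" x] by simp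
qed

text \<open>The weight \<open>\<psi>\<close> may be a derivative of a test function or the indicator function of \<open>K\<close>; so the lemma
  serves both the integrals in the weak formulation and the local Lebesgue spaces.\<close>
lemma slab_integrable:
  fixes f \<psi> :: "real \<times> 'a::euclidean_space \<Rightarrow> real"
  assumes k: "0 < k" "k < real DIM('a) - 2"
    and [measurable]: "f \<in> borel_measurable borel" "\<psi> \<in> borel_measurable borel"
    and K: "compact K" "K \<subseteq> {0<..<T} \<times> UNIV" and \<psi>: "\<And>z. \<bar>\<psi> z\<bar> \<le> B" "\<And>z. z \<notin> K \<Longrightarrow> \<psi> z = 0"
    and f: "\<And>z. z \<in> {0<..<T} \<times> UNIV \<Longrightarrow> snd z \<noteq> 0 \<Longrightarrow> \<bar>f z\<bar> \<le> C * (norm (snd z) powr (- k - 2) + 1)"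
  shows "integrable lborel (\<lambda>z. f z * \<psi> z)"
proof -
  obtain R where R: "\<And>z. z \<in> K \<Longrightarrow> norm z \<le> R" using compact_imp_bounded[OF K(1)] by (auto simp: bounded_iff)
  have B0: "B \<ge> 0" using \<psi>(1)[of 0] by linarith
  have i: "integrable lborel (\<lambda>y::'a. indicator (cball 0 R) y * norm y powr (- k - 2) + indicator (cball 0 R) y)"
    using power_locally_integrable[OF k, of R] emeasure_bounded_finite[OF bounded_cball, of "0::'a" R]
    by (intro Bochner_Integration.integrable_add integrable_real_indicator) auto
  have "integrable (lborel \<Otimes>\<^sub>M lborel) (\<lambda>p::real\<times>'a. indicator {0<..<T} (fst p) * (indicator (cball 0 R) (snd p) * norm (snd p) powr (- k - 2) + indicator (cball 0 R) (snd p)))"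
    by (rule integrable_lborel_product[OF _ i]) (cases "0 < T"; simp)
  then have i2: "integrable lborel (\<lambda>p::real\<times>'a. (\<bar>C\<bar> * B) * (indicator {0<..<T} (fst p) * (indicator (cball 0 R) (snd p) * norm (snd p) powr (- k - 2) + indicator (cball 0 R) (snd p))))"
    unfolding lborel_prod by (rule integrable_mult_right)
  show ?thesis
  proof (rule Bochner_Integration.integrable_bound[OF i2])
    show "AE z in lborel. norm (f z * \<psi> z) \<le> norm ((\<bar>C\<bar> * B) * (indicator {0<..<T} (fst z) * (indicator (cball 0 R) (snd z) * norm (snd z) powr (- k - 2) + indicator (cball 0 R) (snd z))))"
      using AE_snd_neq[of 0]
    proof eventually_elim
      case (elim z)
      show ?case
      proof (cases "z \<in> K")
        case True
        then have z: "z \<in> {0<..<T} \<times> UNIV" "norm (snd z) \<le> R" "fst z \<in> {0<..<T}"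
          using K R[of z] norm_snd_le[of "snd z" "fst z"] by (auto intro: order_trans)
        have "\<bar>f z\<bar> \<le> C * (norm (snd z) powr (- k - 2) + 1)" using f z elim by blast
        also have "\<dots> \<le> \<bar>C\<bar> * (norm (snd z) powr (- k - 2) + 1)" by (intro mult_right_mono) auto
        finally have "\<bar>f z\<bar> * \<bar>\<psi> z\<bar> \<le> (\<bar>C\<bar> * (norm (snd z) powr (- k - 2) + 1)) * B" using \<psi>(1)[of z] B0 by (intro mult_mono) auto
        then show ?thesis using z B0 by (simp add: abs_mult mult_ac)
      qed (simp add: \<psi>(2))
    qed
  qed measurable
qed

lemma heat_adjoint_borel_bounded:
  fixes \<phi> :: "real \<times> 'a::euclidean_space \<Rightarrow> real"
  assumes \<phi>: "test_function \<Omega> \<phi>"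
  shows "heat_adjoint \<phi> \<in> borel_measurable borel" and "\<exists>B\<ge>0. \<forall>z. \<bar>heat_adjoint \<phi> z\<bar> \<le> B"
proof -
  note c = test_function_calculus[OF \<phi>]
  have cont: "continuous_on UNIV (heat_adjoint \<phi>)"
    unfolding heat_adjoint_def[abs_def] space_laplacian_def using c by (intro continuous_intros) auto
  then show "heat_adjoint \<phi> \<in> borel_measurable borel" by (rule borel_measurable_continuous_onI)
  obtain K where K: "compact K" "\<And>z. z \<notin> K \<Longrightarrow> \<phi> z = 0 \<and> time_deriv \<phi> z = 0 \<and> (\<forall>b. dir_deriv (0, b) \<phi> z = 0 \<and> dir_deriv (0, b) (dir_deriv (0, b) \<phi>) z = 0)"
    using c(7) by blast
  show "\<exists>B\<ge>0. \<forall>z. \<bar>heat_adjoint \<phi> z\<bar> \<le> B"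
    by (rule bounded_of_compact_support[OF cont K(1)]) (use K(2) in \<open>auto simp: heat_adjoint_def space_laplacian_def\<close>)
qed

text \<open>By Fubini's theorem, the adjoint heat operator may be applied to the kernel for a fixed source point \<open>p\<close>, where
  \<open>heat_kernel_adjoint\<close> gives \<open>- \<phi> p\<close>. The majorant makes the double integral absolutely convergent.\<close>
lemma duhamel_distribution:
  fixes \<phi> h :: "real \<times> 'a::euclidean_space \<Rightarrow> real"
  assumes k: "0 < k" "k < real DIM('a) - 2" and \<phi>: "test_function ({0<..<T} \<times> UNIV) \<phi>"
    and [measurable]: "h \<in> borel_measurable borel" and bd: "\<And>p. \<bar>h p\<bar> \<le> power_majorant A k B p"
  shows "(\<integral>z. duhamel h z * heat_adjoint \<phi> z \<partial>lborel) = - (\<integral>p. indicator ({0<..} \<times> UNIV) p * h p * \<phi> p \<partial>lborel)"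
    and "integrable lborel (\<lambda>z. duhamel h z * heat_adjoint \<phi> z)"
proof -
  note c = test_function_calculus[OF \<phi>]
  note [measurable] = heat_adjoint_borel_bounded(1)[OF \<phi>]
  obtain M where M: "\<And>z. \<bar>heat_adjoint \<phi> z\<bar> \<le> M" using heat_adjoint_borel_bounded(2)[OF \<phi>] by blast
  obtain K where K: "compact K" "K \<subseteq> {0<..<T} \<times> UNIV" "\<And>z. z \<notin> K \<Longrightarrow> \<phi> z = 0 \<and> time_deriv \<phi> z = 0 \<and> (\<forall>b. dir_deriv (0, b) \<phi> z = 0 \<and> dir_deriv (0, b) (dir_deriv (0, b) \<phi>) z = 0)"
    using c(7) by blast
  have L0: "heat_adjoint \<phi> z = 0" if "z \<notin> K" for z
    using K(3)[OF that] by (simp add: heat_adjoint_def space_laplacian_def)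
  let ?P = "power_majorant A k B :: real \<times> 'a \<Rightarrow> real"
  have P0: "0 \<le> ?P p" for p using bd[of p] by linarith
  have maj: "\<bar>duhamel ?P z\<bar> \<le> (\<bar>A\<bar> / hardy DIM('a) k + \<bar>B\<bar> * T) * (norm (snd z) powr (- k - 2) + 1)"
    if z: "z \<in> {0<..<T} \<times> UNIV" "snd z \<noteq> 0" for z :: "real \<times> 'a"
  proof -
    have hk: "hardy DIM('a) k > 0" using k by (simp add: hardy_def)
    have t: "0 < fst z" "fst z < T" using z by auto
    have hf0: "0 \<le> heat_flow (\<lambda>y. norm y powr (- k)) z" unfolding heat_flow_def by (rule Bochner_Integration.integral_nonneg) auto
    have "0 \<le> duhamel ?P z" unfolding duhamel_def using P0 by (intro Bochner_Integration.integral_nonneg) auto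
    moreover have "duhamel (power_majorant \<bar>A\<bar> k \<bar>B\<bar>) z \<ge> duhamel ?P z"
      by (intro duhamel_mono duhamel_power_majorant(1) k t z) (auto simp: power_majorant_def intro!: add_mono mult_right_mono)
    moreover have "duhamel (power_majorant \<bar>A\<bar> k \<bar>B\<bar>) z \<le> \<bar>A\<bar> / hardy DIM('a) k * norm (snd z) powr (- k) + \<bar>B\<bar> * T"
      unfolding duhamel_power_majorant(2)[OF t(1) z(2) k] using hk hf0 t
      by (intro add_mono mult_left_mono) auto
    moreover have "norm (snd z) powr (- k) \<le> norm (snd z) powr (- k - 2) + 1"
    proof (cases "norm (snd z) \<le> 1")
      case True
      then have "norm (snd z) powr (- k) \<le> norm (snd z) powr (- k - 2)" using z by (intro powr_mono') auto
      then show ?thesis by simp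
    next
      case False
      then have "norm (snd z) powr (- k) \<le> 1 powr (- k)" using k by (intro powr_mono2') auto
      then have "norm (snd z) powr (- k) \<le> 1" by simp
      moreover have "0 \<le> norm (snd z) powr (- k - 2)" by simp
      ultimately show ?thesis by linarith
    qed
    then have "\<bar>A\<bar> / hardy DIM('a) k * norm (snd z) powr (- k) \<le> \<bar>A\<bar> / hardy DIM('a) k * (norm (snd z) powr (- k - 2) + 1)"
      using hk by (intro mult_left_mono) auto
    moreover have "\<bar>B\<bar> * T * 1 \<le> \<bar>B\<bar> * T * (norm (snd z) powr (- k - 2) + 1)" using t by (intro mult_left_mono) auto
    ultimately show ?thesis by (simp only: distrib_right mult_1_right) linarith
  qed
  have dm[measurable]: "duhamel ?P \<in> borel_measurable borel" "duhamel h \<in> borel_measurable borel"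
    by (intro duhamel_borel power_majorant_borel) (rule duhamel_borel, fact)
  have majint: "integrable lborel (\<lambda>z. duhamel ?P z * \<bar>heat_adjoint \<phi> z\<bar>)"
    by (rule slab_integrable[OF k _ _ K(1,2), where B=M and C="\<bar>A\<bar> / hardy DIM('a) k + \<bar>B\<bar> * T"]) (use M L0 maj in auto)
  have pint: "integrable lborel (duhamel_integrand h z)" "\<bar>duhamel h z\<bar> \<le> duhamel ?P z" if "z \<in> K" "snd z \<noteq> 0" for z
    using duhamel_dominated[OF assms(4) bd duhamel_power_majorant(1)[OF _ that(2) k]] that(1) K(2) by auto
  have absint: "(\<integral>p. \<bar>duhamel_integrand h z p\<bar> \<partial>lborel) \<le> duhamel ?P z" if "z \<in> K" "snd z \<noteq> 0" for z
    unfolding duhamel_def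
  proof (rule Bochner_Integration.integral_mono)
    show "integrable lborel (\<lambda>p. \<bar>duhamel_integrand h z p\<bar>)" by (rule integrable_abs[OF pint(1)[OF that]])
    show "integrable lborel (duhamel_integrand ?P z)"
      by (rule duhamel_power_majorant(1)[OF _ that(2) k]) (use that(1) K(2) in auto)
    show "\<bar>duhamel_integrand h z p\<bar> \<le> duhamel_integrand ?P z p" for p
      unfolding abs_mult using bd[of p] by (auto intro!: mult_left_mono split: split_indicator)
  qed
  show wint: "integrable lborel (\<lambda>z. duhamel h z * heat_adjoint \<phi> z)"
  proof (rule Bochner_Integration.integrable_bound[OF majint])
    show "AE z in lborel. norm (duhamel h z * heat_adjoint \<phi> z) \<le> norm (duhamel ?P z * \<bar>heat_adjoint \<phi> z\<bar>)"
      using AE_snd_neq[of 0]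
    proof eventually_elim
      case (elim z)
      then show ?case using pint(2)[of z] L0[of z] by (cases "z \<in> K") (auto simp: abs_mult intro!: mult_right_mono)
    qed
  qed measurable
  let ?J = "\<lambda>(z, p). duhamel_integrand h z p * heat_adjoint \<phi> z"
  have J: "integrable (lborel \<Otimes>\<^sub>M lborel) ?J"
  proof (rule lborel_pair.Fubini_integrable)
    have [measurable]: "(\<lambda>(z, p). duhamel_integrand h z p) \<in> borel_measurable (lborel \<Otimes>\<^sub>M lborel)"
      using duhamel_integrand_joint_borel[of h] by (simp cong: measurable_cong_sets)
    then show Jm: "?J \<in> borel_measurable (lborel \<Otimes>\<^sub>M lborel)"
      unfolding split_beta' by measurable
    show "integrable lborel (\<lambda>z. \<integral>p. norm (?J (z, p)) \<partial>lborel)"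
    proof (rule Bochner_Integration.integrable_bound[OF majint])
      have "(\<lambda>(z, p). norm (?J (z, p))) \<in> borel_measurable (lborel \<Otimes>\<^sub>M lborel)"
        using Jm by (auto simp: split_beta' intro!: borel_measurable_norm)
      then show "(\<lambda>z. \<integral>p. norm (?J (z, p)) \<partial>lborel) \<in> borel_measurable lborel"
        by (rule lborel.borel_measurable_lebesgue_integral)
      show "AE z in lborel. norm (\<integral>p. norm (?J (z, p)) \<partial>lborel) \<le> norm (duhamel ?P z * \<bar>heat_adjoint \<phi> z\<bar>)"
        using AE_snd_neq[of 0]
      proof eventually_elim
        case (elim z)
        have "(\<integral>p. norm (?J (z, p)) \<partial>lborel) = (\<integral>p. \<bar>duhamel_integrand h z p\<bar> \<partial>lborel) * \<bar>heat_adjoint \<phi> z\<bar>"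
          by (simp only: split_conv real_norm_def abs_mult[of _ "heat_adjoint \<phi> z"] integral_mult_left_zero)
        moreover have "0 \<le> (\<integral>p. \<bar>duhamel_integrand h z p\<bar> \<partial>lborel)" by (rule Bochner_Integration.integral_nonneg) auto
        ultimately show ?case
          using absint[of z] elim L0[of z] by (cases "z \<in> K") (auto simp: abs_mult intro!: mult_right_mono)
      qed
    qed
    show "AE z in lborel. integrable lborel (\<lambda>p. ?J (z, p))"
      using AE_snd_neq[of 0]
    proof eventually_elim
      case (elim z)
      then show ?case using pint(1)[of z] L0[of z] by (cases "z \<in> K") auto
    qed
  qed
  have "(\<integral>z. duhamel h z * heat_adjoint \<phi> z \<partial>lborel) = (\<integral>z. (\<integral>p. duhamel_integrand h z p * heat_adjoint \<phi> z \<partial>lborel) \<partial>lborel)"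
    unfolding duhamel_def by (simp only: integral_mult_left_zero)
  also have "\<dots> = (\<integral>p. (\<integral>z. duhamel_integrand h z p * heat_adjoint \<phi> z \<partial>lborel) \<partial>lborel)"
    using lborel_pair.Fubini_integral[OF J] by simp
  also have "\<dots> = (\<integral>p. - (indicator ({0<..} \<times> UNIV) p * h p * \<phi> p) \<partial>lborel)"
  proof (rule Bochner_Integration.integral_cong[OF refl])
    fix p :: "real \<times> 'a"
    have "(\<integral>z. duhamel_integrand h z p * heat_adjoint \<phi> z \<partial>lborel) = (\<integral>z. (indicator ({0<..} \<times> UNIV) p * h p) * (heat_kernel (z - p) * heat_adjoint \<phi> z) \<partial>lborel)"
      by (intro Bochner_Integration.integral_cong refl) (simp only: mult_ac)
    also have "\<dots> = (indicator ({0<..} \<times> UNIV) p * h p) * - \<phi> p"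
      by (simp only: integral_mult_right_zero heat_kernel_adjoint(2)[OF \<phi>])
    finally show "(\<integral>z. duhamel_integrand h z p * heat_adjoint \<phi> z \<partial>lborel) = - (indicator ({0<..} \<times> UNIV) p * h p * \<phi> p)" by simp
  qed
  finally show "(\<integral>z. duhamel h z * heat_adjoint \<phi> z \<partial>lborel) = - (\<integral>p. indicator ({0<..} \<times> UNIV) p * h p * \<phi> p \<partial>lborel)" by simp
qed

lemma heat_flow_borel:
  assumes [measurable]: "(f :: 'a::euclidean_space \<Rightarrow> real) \<in> borel_measurable borel"
  shows "heat_flow f \<in> borel_measurable borel"
  unfolding heat_flow_def[abs_def]
  by (rule lborel.borel_measurable_lebesgue_integral) measurable

lemma heat_flow_bounded:
  fixes f :: "'a::euclidean_space \<Rightarrow> real"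
  assumes [measurable]: "f \<in> borel_measurable borel" and bd: "\<And>y. \<bar>f y\<bar> \<le> M" and t: "t > 0"
  shows "integrable lborel (\<lambda>y. heat_kernel (t, x - y) * f y)" and "\<bar>heat_flow f (t, x)\<bar> \<le> M"
proof -
  have one: "integrable lborel (\<lambda>y. heat_kernel (t, x - y))" "(\<integral>y. heat_kernel (t, x - y) \<partial>lborel) = 1"
    using heat_kernel_integral_one[OF t, where 'a='a] lborel_integrable_reflect_iff[of "\<lambda>y. heat_kernel (t, y)" x]
      lborel_integral_reflect[of "\<lambda>y. heat_kernel (t, y)" x] by auto
  have M: "0 \<le> M" using bd[of 0] by linarith
  have le: "\<bar>heat_kernel (t, x - y) * f y\<bar> \<le> M * heat_kernel (t, x - y)" for y
    unfolding abs_mult using mult_left_mono[OF bd[of y] heat_kernel_nonneg[of "(t, x - y)"]] by (simp add: mult.commute)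
  show 1: "integrable lborel (\<lambda>y. heat_kernel (t, x - y) * f y)"
    by (rule Bochner_Integration.integrable_bound[where f="\<lambda>y. M * heat_kernel (t, x - y)"])
       (use one le M in \<open>auto simp: abs_mult intro!: AE_I2\<close>)
  have "\<bar>heat_flow f (t, x)\<bar> \<le> (\<integral>y. \<bar>heat_kernel (t, x - y) * f y\<bar> \<partial>lborel)"
    unfolding heat_flow_def fst_conv snd_conv by (rule integral_abs_bound)
  also have "\<dots> \<le> (\<integral>y. M * heat_kernel (t, x - y) \<partial>lborel)"
    by (rule Bochner_Integration.integral_mono) (use 1 one le in auto)
  finally show "\<bar>heat_flow f (t, x)\<bar> \<le> M" using one by simp
qed

text \<open>As in \<open>duhamel_distribution\<close>, with sources \<open>(0, y)\<close> on the initial hyperplane, where \<open>\<phi>\<close> vanishes.\<close>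
lemma heat_flow_distribution:
  fixes \<phi> :: "real \<times> 'a::euclidean_space \<Rightarrow> real" and f :: "'a \<Rightarrow> real"
  assumes \<phi>: "test_function ({0<..<T} \<times> UNIV) \<phi>"
    and [measurable]: "f \<in> borel_measurable borel" and bd: "\<And>y. \<bar>f y\<bar> \<le> M"
  shows "(\<integral>z. heat_flow f z * heat_adjoint \<phi> z \<partial>lborel) = 0"
    and "integrable lborel (\<lambda>z. heat_flow f z * heat_adjoint \<phi> z)"
proof -
  note c = test_function_calculus[OF \<phi>]
  note [measurable] = heat_adjoint_borel_bounded(1)[OF \<phi>] heat_flow_borel[OF assms(2)]
  obtain B where B: "\<And>z. \<bar>heat_adjoint \<phi> z\<bar> \<le> B" using heat_adjoint_borel_bounded(2)[OF \<phi>] by blast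
  obtain K where K: "compact K" "K \<subseteq> {0<..<T} \<times> UNIV" "\<And>z. z \<notin> K \<Longrightarrow> \<phi> z = 0 \<and> time_deriv \<phi> z = 0 \<and> (\<forall>b. dir_deriv (0, b) \<phi> z = 0 \<and> dir_deriv (0, b) (dir_deriv (0, b) \<phi>) z = 0)"
    using c(7) by blast
  have L0: "heat_adjoint \<phi> z = 0" if "z \<notin> K" for z
    using K(3)[OF that] by (simp add: heat_adjoint_def space_laplacian_def)
  have Kt: "fst z > 0" if "z \<in> K" for z using K(2) that by auto
  have M: "0 \<le> M" using bd[of 0] by linarith
  have majint: "integrable lborel (\<lambda>z. M * \<bar>heat_adjoint \<phi> z\<bar>)"
  proof (rule integrable_mult_right, rule Bochner_Integration.integrable_bound)
    show "integrable lborel (\<lambda>z. B * indicator K z)"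
      using K(1) emeasure_bounded_finite[OF compact_imp_bounded[OF K(1)]] by (auto intro!: integrable_mult_right simp: compact_imp_closed borel_closed)
    show "AE z in lborel. norm \<bar>heat_adjoint \<phi> z\<bar> \<le> norm (B * indicator K z)"
      using B L0 by (intro AE_I2) (auto simp: indicator_def intro: order_trans[OF _ abs_ge_self])
  qed measurable
  have hf: "\<bar>heat_flow f z\<bar> \<le> M" if "z \<in> K" for z
    using heat_flow_bounded(2)[OF assms(2) bd, of "fst z" "snd z"] Kt[OF that] by simp
  show "integrable lborel (\<lambda>z. heat_flow f z * heat_adjoint \<phi> z)"
  proof (rule Bochner_Integration.integrable_bound[OF majint])
    show "AE z in lborel. norm (heat_flow f z * heat_adjoint \<phi> z) \<le> norm (M * \<bar>heat_adjoint \<phi> z\<bar>)"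
    proof (intro AE_I2)
      fix z show "norm (heat_flow f z * heat_adjoint \<phi> z) \<le> norm (M * \<bar>heat_adjoint \<phi> z\<bar>)"
        using hf[of z] L0[of z] M by (cases "z \<in> K") (auto simp: abs_mult intro!: mult_right_mono)
    qed
  qed measurable
  let ?J = "\<lambda>(z, y). (heat_kernel (fst z, snd z - y) * f y) * heat_adjoint \<phi> z"
  have J: "integrable (lborel \<Otimes>\<^sub>M lborel) ?J"
  proof (rule lborel_pair.Fubini_integrable)
    show Jm: "?J \<in> borel_measurable (lborel \<Otimes>\<^sub>M lborel)"
      unfolding split_beta' by measurable
    show "integrable lborel (\<lambda>z. \<integral>y. norm (?J (z, y)) \<partial>lborel)"
    proof (rule Bochner_Integration.integrable_bound[OF majint])
      have "(\<lambda>(z, p). norm (?J (z, p))) \<in> borel_measurable (lborel \<Otimes>\<^sub>M lborel)"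
        using Jm by (auto simp: split_beta' intro!: borel_measurable_norm)
      then show "(\<lambda>z. \<integral>p. norm (?J (z, p)) \<partial>lborel) \<in> borel_measurable lborel"
        by (rule lborel.borel_measurable_lebesgue_integral)
      show "AE z in lborel. norm (\<integral>y. norm (?J (z, y)) \<partial>lborel) \<le> norm (M * \<bar>heat_adjoint \<phi> z\<bar>)"
      proof (intro AE_I2)
        fix z :: "real \<times> 'a"
        have eq: "(\<integral>y. norm (?J (z, y)) \<partial>lborel) = heat_flow (\<lambda>y. \<bar>f y\<bar>) z * \<bar>heat_adjoint \<phi> z\<bar>"
          by (simp add: abs_mult heat_flow_def)
        have "\<bar>heat_flow (\<lambda>y. \<bar>f y\<bar>) z\<bar> \<le> M" if "z \<in> K"
          using heat_flow_bounded(2)[of "\<lambda>y. \<bar>f y\<bar>" M "fst z" "snd z"] Kt[OF that] bd by simp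
        then show "norm (\<integral>y. norm (?J (z, y)) \<partial>lborel) \<le> norm (M * \<bar>heat_adjoint \<phi> z\<bar>)"
          unfolding eq using L0[of z] M by (cases "z \<in> K") (auto simp: abs_mult intro!: mult_right_mono)
      qed
    qed
    show "AE z in lborel. integrable lborel (\<lambda>y. ?J (z, y))"
    proof (intro AE_I2)
      fix z show "integrable lborel (\<lambda>y. ?J (z, y))"
        using heat_flow_bounded(1)[OF assms(2) bd, of "fst z" "snd z"] Kt[of z] L0[of z] by (cases "z \<in> K") auto
    qed
  qed
  have "(\<integral>z. heat_flow f z * heat_adjoint \<phi> z \<partial>lborel) = (\<integral>z. (\<integral>y. (heat_kernel (fst z, snd z - y) * f y) * heat_adjoint \<phi> z \<partial>lborel) \<partial>lborel)"
    unfolding heat_flow_def by (simp only: integral_mult_left_zero)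
  also have "\<dots> = (\<integral>y. (\<integral>z. (heat_kernel (fst z, snd z - y) * f y) * heat_adjoint \<phi> z \<partial>lborel) \<partial>lborel)"
    using lborel_pair.Fubini_integral[OF J] by simp
  also have "\<dots> = (\<integral>y. 0 \<partial>(lborel :: 'a measure))"
  proof (rule Bochner_Integration.integral_cong[OF refl])
    fix y :: 'a
    have "(\<integral>z. (heat_kernel (fst z, snd z - y) * f y) * heat_adjoint \<phi> z \<partial>lborel) = (\<integral>z. f y * (heat_kernel (z - (0, y)) * heat_adjoint \<phi> z) \<partial>lborel)"
      by (intro Bochner_Integration.integral_cong refl) (simp add: minus_prod_def mult_ac)
    also have "\<dots> = f y * - \<phi> (0, y)"
      by (simp only: integral_mult_right_zero heat_kernel_adjoint(2)[OF \<phi>])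
    also have "(0, y) \<notin> K" using K(2) by auto
    then have "\<phi> (0, y) = 0" using K(3) by blast
    finally show "(\<integral>z. (heat_kernel (fst z, snd z - y) * f y) * heat_adjoint \<phi> z \<partial>lborel) = 0" by simp
  qed
  finally show "(\<integral>z. heat_flow f z * heat_adjoint \<phi> z \<partial>lborel) = 0" by simp
qed

section \<open>The stationary solution as a distribution\<close>

lemma continuous_compact_support_integrable:
  fixes f :: "'a::euclidean_space \<Rightarrow> real"
  assumes "continuous_on UNIV f" "compact K" "\<And>z. z \<notin> K \<Longrightarrow> f z = 0"
  shows "integrable lborel f"
proof -
  have "integrable lborel (\<lambda>x. indicator K x *\<^sub>R f x)"
    using assms by (intro borel_integrable_compact) (auto intro: continuous_on_subset)
  moreover have "(\<lambda>x. indicator K x *\<^sub>R f x) = f" using assms(3) by (auto simp: fun_eq_iff indicator_def)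
  ultimately show ?thesis by simp
qed

definition clamp01 :: "real \<Rightarrow> real" where "clamp01 s = max 0 (min 1 s)"

text \<open>Since \<open>p'\<close> vanishes at both ends, extending \<open>p\<close> from \<open>[0, 1]\<close> by constants keeps it differentiable.\<close>
lemma clamp01_compose_derivative:
  assumes p: "\<And>u. (p has_real_derivative p' u) (at u)" and z: "p' 0 = 0" "p' 1 = 0"
  shows "((\<lambda>s. p (clamp01 s)) has_real_derivative p' (clamp01 s)) (at s)"
proof -
  have kink: "((\<lambda>s. p (clamp01 s)) has_real_derivative 0) (at c)" if c: "c = 0 \<or> c = 1" for c
  proof -
    have "((\<lambda>u. (p u - p c) / (u - c)) \<longlongrightarrow> 0) (at c)"
      using p[of c] c z by (auto simp: has_field_derivative_iff)
    then have "((\<lambda>u. norm ((p u - p c) / (u - c))) \<longlongrightarrow> 0) (at c)" by (rule tendsto_norm_zero)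
    then have "((\<lambda>u. (p (clamp01 u) - p (clamp01 c)) / (u - c)) \<longlongrightarrow> 0) (at c)"
    proof (rule Lim_null_comparison[rotated])
      have "\<forall>\<^sub>F u in nhds c. \<bar>u - c\<bar> < 1" 
        using eventually_nhds_in_open[of "ball c 1" c] by (auto elim!: eventually_mono simp: dist_real_def abs_minus_commute)
      then show "\<forall>\<^sub>F u in at c. norm ((p (clamp01 u) - p (clamp01 c)) / (u - c)) \<le> norm ((p u - p c) / (u - c))"
        unfolding eventually_at_filter
      proof eventually_elim
        case (elim u)
        have "clamp01 c = c" using c by (auto simp: clamp01_def)
        moreover have "clamp01 u = u \<or> clamp01 u = c" using c elim by (auto simp: clamp01_def max_def min_def)
        ultimately show ?case by auto
      qed
    qed
    then show ?thesis by (simp add: has_field_derivative_iff)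
  qed
  consider "s < 0" | "s = 0" | "0 < s" "s < 1" | "s = 1" | "s > 1" by linarith
  then show ?thesis
  proof cases
    case 1
    have "((\<lambda>s. p 0) has_real_derivative 0) (at s)" by simp
    then have "((\<lambda>s. p (clamp01 s)) has_real_derivative 0) (at s)"
      by (rule DERIV_cong_ev[THEN iffD1, OF refl _ refl, rotated])
         (use eventually_nhds_in_open[of "{..<0}" s] 1 in \<open>auto elim!: eventually_mono simp: clamp01_def\<close>)
    then show ?thesis using 1 z by (simp add: clamp01_def)
  next
    case 3
    have "((\<lambda>s. p (clamp01 s)) has_real_derivative p' s) (at s)"
      by (rule DERIV_cong_ev[THEN iffD1, OF refl _ refl, rotated, OF p])
         (use eventually_nhds_in_open[of "{0<..<1}" s] 3 in \<open>auto elim!: eventually_mono simp: clamp01_def\<close>)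
    then show ?thesis using 3 by (simp add: clamp01_def)
  next
    case 5
    have "((\<lambda>s. p 1) has_real_derivative 0) (at s)" by simp
    then have "((\<lambda>s. p (clamp01 s)) has_real_derivative 0) (at s)"
      by (rule DERIV_cong_ev[THEN iffD1, OF refl _ refl, rotated])
         (use eventually_nhds_in_open[of "{1<..}" s] 5 in \<open>auto elim!: eventually_mono simp: clamp01_def\<close>)
    then show ?thesis using 5 z by (simp add: clamp01_def)
  qed (use kink z in \<open>auto simp: clamp01_def\<close>)
qed

text \<open>A twice continuously differentiable transition from \<open>0\<close> to \<open>1\<close> on \<open>[1, 2]\<close>, together with its derivatives
  and a common bound for them.\<close>
definition C2_step :: "(real \<Rightarrow> real) \<Rightarrow> (real \<Rightarrow> real) \<Rightarrow> (real \<Rightarrow> real) \<Rightarrow> real \<Rightarrow> bool" where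
  "C2_step h h' h'' B \<longleftrightarrow> (\<forall>s. (h has_real_derivative h' s) (at s)) \<and> (\<forall>s. (h' has_real_derivative h'' s) (at s))
    \<and> continuous_on UNIV h'' \<and> (\<forall>s. 0 \<le> h s \<and> h s \<le> 1) \<and> (\<forall>s\<le>1. h s = 0) \<and> (\<forall>s\<ge>2. h s = 1)
    \<and> (\<forall>s. s \<le> 1 \<or> s \<ge> 2 \<longrightarrow> h' s = 0 \<and> h'' s = 0) \<and> (\<forall>s. \<bar>h' s\<bar> \<le> B \<and> \<bar>h'' s\<bar> \<le> B)"

lemma C2_step_exists: "\<exists>h h' h'' B. C2_step h h' h'' B"
proof -
  \<comment> \<open>the quintic whose first two derivatives vanish at \<open>0\<close> and \<open>1\<close>\<close>
  let ?p = "\<lambda>u::real. 10 * u^3 - 15 * u^4 + 6 * u^5" and ?p' = "\<lambda>u::real. 30 * u^2 * (1 - u)^2"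
    and ?p'' = "\<lambda>u::real. 60 * u * (1 - u) * (1 - 2 * u)"
  let ?c = "\<lambda>s. clamp01 (s - 1)"
  have p: "(?p has_real_derivative ?p' u) (at u)" for u
    by (rule derivative_eq_intros refl | simp)+ (simp add: power2_eq_square power3_eq_cube power4_eq_xxxx algebra_simps)
  have p': "(?p' has_real_derivative ?p'' u) (at u)" for u
    by (rule derivative_eq_intros refl | simp)+ (simp add: power2_eq_square algebra_simps)
  have c: "0 \<le> ?c s \<and> ?c s \<le> 1" for s by (auto simp: clamp01_def)
  have sh: "((\<lambda>s::real. s - 1) has_real_derivative 1) (at s)" for s by (auto intro!: derivative_eq_intros)
  have f1: "((\<lambda>s. ?p (?c s)) has_real_derivative ?p' (?c s)) (at s)" for s
    using DERIV_chain2[OF clamp01_compose_derivative[of ?p ?p', OF p] sh] by simp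
  have f2: "((\<lambda>s. ?p' (?c s)) has_real_derivative ?p'' (?c s)) (at s)" for s
    using DERIV_chain2[OF clamp01_compose_derivative[of ?p' ?p'', OF p'] sh] by simp
  have f3: "continuous_on UNIV (\<lambda>s. ?p'' (?c s))" unfolding clamp01_def by (intro continuous_intros)
  have f4: "?p (?c s) = 0" if "s \<le> 1" for s using that by (simp add: clamp01_def)
  have f5: "?p (?c s) = 1" if "s \<ge> 2" for s using that by (simp add: clamp01_def)
  have f6: "?p' (?c s) = 0 \<and> ?p'' (?c s) = 0" if "s \<le> 1 \<or> s \<ge> 2" for s using that by (auto simp: clamp01_def)
  have f7: "0 \<le> ?p (?c s) \<and> ?p (?c s) \<le> 1" for s
  proof -
    have mono: "?p u \<le> ?p w" if "0 \<le> u" "u \<le> w" "w \<le> 1" for u w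
      by (rule DERIV_nonneg_imp_nondecreasing[OF that(2)]) (use p in \<open>auto intro!: exI[of _ "?p' _"]\<close>)
    show ?thesis using mono[of 0 "?c s"] mono[of "?c s" 1] c[of s] by simp
  qed
  have f8: "\<bar>?p' (?c s)\<bar> \<le> 180 \<and> \<bar>?p'' (?c s)\<bar> \<le> 180" for s
  proof -
    obtain u where u: "u = ?c s" "0 \<le> u" "u \<le> 1" using c[of s] by blast
    have "u^2 \<le> 1" "(1 - u)^2 \<le> 1" "0 \<le> u^2" "0 \<le> (1 - u)^2" using u by (auto simp: power_le_one)
    then have 1: "u^2 * (1 - u)^2 \<le> 1 * 1" by (intro mult_mono) auto
    have "\<bar>u\<bar> * \<bar>1 - u\<bar> * \<bar>1 - 2 * u\<bar> \<le> 1 * 1 * 3" using u by (intro mult_mono) (auto simp: abs_le_iff)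
    then have "\<bar>?p'' u\<bar> \<le> 180" by (simp add: abs_mult)
    moreover have "\<bar>?p' u\<bar> \<le> 180" using 1 by (simp add: abs_mult)
    ultimately show ?thesis using u by simp
  qed
  have "C2_step (\<lambda>s. ?p (?c s)) (\<lambda>s. ?p' (?c s)) (\<lambda>s. ?p'' (?c s)) 180"
    unfolding C2_step_def using f1 f2 f3 f4 f5 f6 f7 f8 by (intro conjI allI impI) blast+
  then show ?thesis by blast
qed

lemma norm_directional_derivative:
  fixes x :: "'a::euclidean_space"
  assumes "x \<noteq> 0"
  shows "((\<lambda>h. norm (x + h *\<^sub>R b)) has_real_derivative (x \<bullet> b) / norm x) (at 0)"
proof -
  have q: "((\<lambda>h. (x + h *\<^sub>R b) \<bullet> (x + h *\<^sub>R b)) has_real_derivative 2 * (x \<bullet> b)) (at 0)"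
  proof -
    have "(\<lambda>h. (x + h *\<^sub>R b) \<bullet> (x + h *\<^sub>R b)) = (\<lambda>h. x \<bullet> x + 2 * h * (x \<bullet> b) + h\<^sup>2 * (b \<bullet> b))"
      by (simp add: fun_eq_iff inner_add_left inner_add_right inner_commute power2_eq_square algebra_simps)
    then show ?thesis by (auto intro!: derivative_eq_intros)
  qed
  have p: "(x + 0 *\<^sub>R b) \<bullet> (x + 0 *\<^sub>R b) > 0" using assms by simp
  show ?thesis unfolding norm_eq_sqrt_inner
    by (rule DERIV_cong[OF DERIV_chain2[OF DERIV_real_sqrt[OF p] q]]) (simp add: norm_eq_sqrt_inner field_simps)
qed

text \<open>Green's identity for a radial function that vanishes near the origin, obtained by applying
  \<open>integral_directional_derivative_zero\<close> to \<open>F \<partial>\<phi> - \<partial>F \<phi>\<close> in each coordinate direction.\<close>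
lemma radial_integration_by_parts:
  fixes \<phi> :: "real \<times> 'a::euclidean_space \<Rightarrow> real" and k k' k'' :: "real \<Rightarrow> real"
  assumes \<phi>: "test_function \<Omega> \<phi>"
    and dk: "\<And>r. r > 0 \<Longrightarrow> (k has_real_derivative k' r) (at r)"
    and dk': "\<And>r. r > 0 \<Longrightarrow> (k' has_real_derivative k'' r) (at r)"
    and ck: "continuous_on {0<..} k''" and e: "e > 0"
    and zero: "\<And>r. r < e \<Longrightarrow> k r = 0 \<and> k' r = 0 \<and> k'' r = 0"
  shows "(\<integral>z. k (norm (snd z)) * time_deriv \<phi> z \<partial>lborel) = 0"
    and "(\<integral>z. k (norm (snd z)) * space_laplacian \<phi> z \<partial>lborel)
      = (\<integral>z. (k'' (norm (snd z)) + (real DIM('a) - 1) / norm (snd z) * k' (norm (snd z))) * \<phi> z \<partial>lborel)"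
proof -
  note c = test_function_calculus[OF \<phi>]
  obtain K where K: "compact K" "\<And>z. z \<notin> K \<Longrightarrow> \<phi> z = 0 \<and> time_deriv \<phi> z = 0 \<and> (\<forall>b. dir_deriv (0, b) \<phi> z = 0 \<and> dir_deriv (0, b) (dir_deriv (0, b) \<phi>) z = 0)"
    using c(7) by blast
  \<comment> \<open>\<open>F\<close> is the radial function, \<open>G b\<close> and \<open>Q b\<close> are its first and second derivatives in direction \<open>b\<close>\<close>
  define F where "F = (\<lambda>x::'a. k (norm x))"
  define G where "G = (\<lambda>b (x::'a). k' (norm x) * ((x \<bullet> b) / norm x))"
  define Q where "Q = (\<lambda>b (x::'a). k'' (norm x) * ((x \<bullet> b) / norm x)\<^sup>2 + k' (norm x) * (1 / norm x - (x \<bullet> b)\<^sup>2 / norm x ^ 3))"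
  have near: "\<forall>\<^sub>F h in nhds (0::real). norm (x + h *\<^sub>R b) < e" if "norm x < e" for x b :: 'a
  proof -
    have "((\<lambda>h::real. norm (x + h *\<^sub>R b)) \<longlongrightarrow> norm (x + 0 *\<^sub>R b)) (nhds 0)"
      by (intro tendsto_intros filterlim_ident)
    then show ?thesis using that by (intro order_tendstoD(2)) auto
  qed
  have dF: "((\<lambda>h. F (x + h *\<^sub>R b)) has_real_derivative G b x) (at 0)" for x b
  proof (cases "norm x < e")
    case True
    have "((\<lambda>h. 0) has_real_derivative 0) (at (0::real))" by simp
    then have "((\<lambda>h. F (x + h *\<^sub>R b)) has_real_derivative 0) (at 0)"
      by (rule DERIV_cong_ev[THEN iffD1, OF refl _ refl, rotated])
         (use near[OF True, of b] zero in \<open>auto elim!: eventually_mono simp: F_def\<close>)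
    then show ?thesis using zero[OF True] by (simp add: G_def)
  next
    case False
    then have x: "x \<noteq> 0" using e by auto
    have d: "(k has_real_derivative k' (norm x)) (at (norm (x + 0 *\<^sub>R b)))" using dk[of "norm x"] x by simp
    show ?thesis unfolding F_def G_def
      by (rule DERIV_chain2[OF d norm_directional_derivative[OF x]])
  qed
  have dG: "((\<lambda>h. G b (x + h *\<^sub>R b)) has_real_derivative Q b x) (at 0)" if b: "b \<in> Basis" for x b
  proof (cases "norm x < e")
    case True
    have "((\<lambda>h. 0) has_real_derivative 0) (at (0::real))" by simp
    then have "((\<lambda>h. G b (x + h *\<^sub>R b)) has_real_derivative 0) (at 0)"
      by (rule DERIV_cong_ev[THEN iffD1, OF refl _ refl, rotated])
         (use near[OF True, of b] zero in \<open>auto elim!: eventually_mono simp: G_def\<close>)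
    then show ?thesis using zero[OF True] by (simp add: Q_def)
  next
    case False
    then have x: "x \<noteq> 0" using e by auto
    note dn = norm_directional_derivative[OF x, of b]
    have d: "(k' has_real_derivative k'' (norm x)) (at (norm (x + 0 *\<^sub>R b)))" using dk'[of "norm x"] x by simp
    have d1: "((\<lambda>h. k' (norm (x + h *\<^sub>R b))) has_real_derivative k'' (norm x) * ((x \<bullet> b) / norm x)) (at 0)"
      by (rule DERIV_chain2[OF d dn])
    have d2: "((\<lambda>h. (x + h *\<^sub>R b) \<bullet> b) has_real_derivative 1) (at 0)"
    proof -
      have "(\<lambda>h. (x + h *\<^sub>R b) \<bullet> b) = (\<lambda>h. x \<bullet> b + h)" using b by (simp add: fun_eq_iff inner_add_left inner_Basis)
      then show ?thesis by (auto intro!: derivative_eq_intros)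
    qed
    have n0: "norm (x + 0 *\<^sub>R b) \<noteq> 0" using x by simp
    show ?thesis unfolding G_def
      by (rule DERIV_cong[OF DERIV_mult[OF d1 DERIV_divide[OF d2 dn n0]]])
         (use x in \<open>simp add: Q_def power2_eq_square power3_eq_cube field_simps\<close>)
  qed
  have cont_k'': "continuous_on {0<..} k''" by fact
  have cont_k': "continuous_on {0<..} k'" by (rule continuous_at_imp_continuous_on) (use dk' DERIV_isCont in auto)
  have cont_k: "continuous_on {0<..} k" by (rule continuous_at_imp_continuous_on) (use dk DERIV_isCont in auto)
  have glue: "continuous_on UNIV f" if "continuous_on (- {0}) f" "\<And>x. norm x < e \<Longrightarrow> f x = 0" for f :: "'a \<Rightarrow> real"
  proof -
    have "continuous_on (ball 0 e) f"
      by (rule continuous_on_eq[OF continuous_on_const[of _ 0]]) (use that in auto)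
    then have "continuous_on (ball 0 e \<union> - {0}) f" using that(1) by (intro continuous_on_open_Un) auto
    moreover have "ball 0 e \<union> - {0} = (UNIV :: 'a set)" using e by auto
    ultimately show ?thesis by simp
  qed
  have cn: "continuous_on (- {0}) (\<lambda>x::'a. f (norm x))" if "continuous_on {0<..} f" for f :: "real \<Rightarrow> real"
    by (intro continuous_on_compose2[OF that] continuous_intros) auto
  have cF: "continuous_on UNIV F" unfolding F_def using zero by (intro glue cn cont_k) auto
  have cG: "continuous_on UNIV (G b)" for b
    unfolding G_def using zero by (intro glue continuous_intros cn cont_k') auto
  have cQ: "continuous_on UNIV (Q b)" for b
    unfolding Q_def using zero by (intro glue continuous_intros cn cont_k' cont_k'') auto
  have cs: "continuous_on UNIV (\<lambda>z::real\<times>'a. f (snd z))" if "continuous_on UNIV f" for f :: "'a \<Rightarrow> real"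
    by (intro continuous_on_compose2[OF that] continuous_intros) auto
  note int = continuous_compact_support_integrable[OF _ K(1)]
  have dphi: "((\<lambda>h. \<phi> (z + h *\<^sub>R v)) has_real_derivative time_deriv \<phi> z * fst v + (\<Sum>b\<in>Basis. dir_deriv (0, b) \<phi> z * (snd v \<bullet> b))) (at 0)" for z v
  proof -
    let ?D = "\<lambda>v. time_deriv \<phi> z * fst v + (\<Sum>b\<in>Basis. dir_deriv (0, b) \<phi> z * (snd v \<bullet> b))"
    have "((\<lambda>h. z + h *\<^sub>R v) has_derivative (\<lambda>h. h *\<^sub>R v)) (at 0)" by (auto intro!: derivative_eq_intros)
    moreover have "(\<phi> has_derivative ?D) (at (z + 0 *\<^sub>R v))" using c(1)[of z] by simp
    ultimately have "((\<lambda>h. \<phi> (z + h *\<^sub>R v)) has_derivative (\<lambda>h. ?D (h *\<^sub>R v))) (at 0)" by (rule has_derivative_compose)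
    moreover have "(\<lambda>h. ?D (h *\<^sub>R v)) = (\<lambda>h. ?D v * h)"
      by (simp add: fun_eq_iff distrib_right distrib_left sum_distrib_right sum_distrib_left mult_ac)
    ultimately show ?thesis by (simp add: has_field_derivative_def)
  qed
  have sx: "snd (z + h *\<^sub>R (0::real, b)) = snd z + h *\<^sub>R b" for z h and b :: 'a by simp
  show "(\<integral>z. k (norm (snd z)) * time_deriv \<phi> z \<partial>lborel) = 0"
  proof (rule integral_directional_derivative_zero[where F="\<lambda>z. F (snd z) * \<phi> z" and v="(1, 0)"])
    show "((\<lambda>h. F (snd (z + h *\<^sub>R (1, 0))) * \<phi> (z + h *\<^sub>R (1, 0))) has_real_derivative k (norm (snd z)) * time_deriv \<phi> z) (at 0)" for z
      using DERIV_cmult[OF dphi[of z "(1, 0)"], of "F (snd z)"] by (simp add: F_def)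
    show "continuous_on UNIV (\<lambda>z. k (norm (snd z)) * time_deriv \<phi> z)"
      using cs[OF cF] c(4) by (intro continuous_on_mult) (auto simp: F_def)
    show "integrable lborel (\<lambda>z. F (snd z) * \<phi> z)" using K cs[OF cF] c(3) by (intro int continuous_on_mult) auto
    show "integrable lborel (\<lambda>z. k (norm (snd z)) * time_deriv \<phi> z)" using K cs[OF cF] c(4) by (intro int continuous_on_mult) (auto simp: F_def)
  qed
  have i1: "integrable lborel (\<lambda>z. F (snd z) * dir_deriv (0, b) (dir_deriv (0, b) \<phi>) z)"
    and i2: "integrable lborel (\<lambda>z. Q b (snd z) * \<phi> z)" for b
    using K cs[OF cF] cs[OF cQ] c(3) c(6) by (intro int continuous_on_mult; auto)+
  have green: "(\<integral>z. F (snd z) * dir_deriv (0, b) (dir_deriv (0, b) \<phi>) z \<partial>lborel) = (\<integral>z. Q b (snd z) * \<phi> z \<partial>lborel)" if b: "b \<in> Basis" for b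
  proof -
    have "(\<integral>z. F (snd z) * dir_deriv (0, b) (dir_deriv (0, b) \<phi>) z - Q b (snd z) * \<phi> z \<partial>lborel) = 0"
    proof (rule integral_directional_derivative_zero[where F="\<lambda>z. F (snd z) * dir_deriv (0, b) \<phi> z - G b (snd z) * \<phi> z" and v="(0, b)"])
      fix z :: "real \<times> 'a"
      have d0: "((\<lambda>h. \<phi> (z + h *\<^sub>R (0, b))) has_real_derivative dir_deriv (0, b) \<phi> z) (at 0)"
      proof -
        have "(\<Sum>b'\<in>Basis. dir_deriv (0, b') \<phi> z * (b \<bullet> b')) = dir_deriv (0, b) \<phi> z"
          using b by (simp add: inner_Basis if_distrib sum.delta cong: if_cong)
        then show ?thesis using dphi[of z "(0, b)"] by simp
      qed
      have "((\<lambda>h. F (snd z + h *\<^sub>R b) * dir_deriv (0, b) \<phi> (z + h *\<^sub>R (0, b)) - G b (snd z + h *\<^sub>R b) * \<phi> (z + h *\<^sub>R (0, b)))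
         has_real_derivative F (snd z) * dir_deriv (0, b) (dir_deriv (0, b) \<phi>) z - Q b (snd z) * \<phi> z) (at 0)"
        by (rule DERIV_cong[OF DERIV_diff[OF DERIV_mult[OF dF c(2)] DERIV_mult[OF dG[OF b] d0]]])
           (simp add: zero_prod_def[symmetric] algebra_simps)
      then show "((\<lambda>h. F (snd (z + h *\<^sub>R (0, b))) * dir_deriv (0, b) \<phi> (z + h *\<^sub>R (0, b)) - G b (snd (z + h *\<^sub>R (0, b))) * \<phi> (z + h *\<^sub>R (0, b)))
         has_real_derivative F (snd z) * dir_deriv (0, b) (dir_deriv (0, b) \<phi>) z - Q b (snd z) * \<phi> z) (at 0)"
        unfolding sx .
    next
      show "continuous_on UNIV (\<lambda>z. F (snd z) * dir_deriv (0, b) (dir_deriv (0, b) \<phi>) z - Q b (snd z) * \<phi> z)"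
        using cs[OF cF] cs[OF cQ] c(3) c(6) by (intro continuous_on_diff continuous_on_mult) auto
      show "integrable lborel (\<lambda>z. F (snd z) * dir_deriv (0, b) \<phi> z - G b (snd z) * \<phi> z)"
        using K cs[OF cF] cs[OF cG] c(3) c(5) by (intro int continuous_on_diff continuous_on_mult) auto
      show "integrable lborel (\<lambda>z. F (snd z) * dir_deriv (0, b) (dir_deriv (0, b) \<phi>) z - Q b (snd z) * \<phi> z)"
        using i1 i2 by (rule Bochner_Integration.integrable_diff)
    qed
    then show ?thesis using i1 i2 by simp
  qed
  have lap: "(\<Sum>b\<in>Basis. Q b x) = k'' (norm x) + (real DIM('a) - 1) / norm x * k' (norm x)" if x: "x \<noteq> 0" for x
  proof -
    have n: "(\<Sum>b\<in>Basis. (x \<bullet> b)\<^sup>2) = (norm x)\<^sup>2"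
    proof -
      have "norm x * norm x = (\<Sum>b\<in>Basis. (x \<bullet> b)\<^sup>2)"
        using euclidean_inner[of x x] by (simp only: power2_eq_square power2_norm_eq_inner[symmetric])
      then show ?thesis by (simp only: power2_eq_square)
    qed
    have "(\<Sum>b\<in>Basis. Q b x) = k'' (norm x) / (norm x)\<^sup>2 * (\<Sum>b\<in>Basis. (x \<bullet> b)\<^sup>2) + (real DIM('a) * (k' (norm x) / norm x) - k' (norm x) / norm x ^ 3 * (\<Sum>b\<in>Basis. (x \<bullet> b)\<^sup>2))"
    proof -
      have "Q b x = k'' (norm x) / (norm x)\<^sup>2 * (x \<bullet> b)\<^sup>2 + (k' (norm x) / norm x - k' (norm x) / norm x ^ 3 * (x \<bullet> b)\<^sup>2)" for b
        by (simp add: Q_def power_divide right_diff_distrib)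
      then show ?thesis by (simp only: sum.distrib sum_subtractf sum_distrib_left[symmetric] sum_constant)
    qed
    also have "\<dots> = k'' (norm x) + (real DIM('a) - 1) / norm x * k' (norm x)"
      unfolding n using x by (simp add: power2_eq_square power3_eq_cube field_simps)
    finally show ?thesis .
  qed
  have "(\<integral>z. k (norm (snd z)) * space_laplacian \<phi> z \<partial>lborel) = (\<integral>z. (\<Sum>b\<in>Basis. F (snd z) * dir_deriv (0, b) (dir_deriv (0, b) \<phi>) z) \<partial>lborel)"
    by (simp add: F_def space_laplacian_def sum_distrib_left)
  also have "\<dots> = (\<Sum>b\<in>Basis. \<integral>z. F (snd z) * dir_deriv (0, b) (dir_deriv (0, b) \<phi>) z \<partial>lborel)"
    by (rule Bochner_Integration.integral_sum) (rule i1)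
  also have "\<dots> = (\<Sum>b\<in>Basis. \<integral>z. Q b (snd z) * \<phi> z \<partial>lborel)" by (intro sum.cong refl green)
  also have "\<dots> = (\<integral>z. (\<Sum>b\<in>Basis. Q b (snd z) * \<phi> z) \<partial>lborel)"
    by (rule Bochner_Integration.integral_sum[symmetric]) (rule i2)
  also have "\<dots> = (\<integral>z. (k'' (norm (snd z)) + (real DIM('a) - 1) / norm (snd z) * k' (norm (snd z))) * \<phi> z \<partial>lborel)"
  proof (rule Bochner_Integration.integral_cong[OF refl])
    fix z :: "real \<times> 'a"
    show "(\<Sum>b\<in>Basis. Q b (snd z) * \<phi> z) = (k'' (norm (snd z)) + (real DIM('a) - 1) / norm (snd z) * k' (norm (snd z))) * \<phi> z"
    proof (cases "snd z = 0")
      case True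
      then show ?thesis using zero[of 0] e by (simp add: Q_def)
    next
      case False
      then show ?thesis by (simp only: sum_distrib_right[symmetric] lap[OF False])
    qed
  qed
  finally show "(\<integral>z. k (norm (snd z)) * space_laplacian \<phi> z \<partial>lborel)
      = (\<integral>z. (k'' (norm (snd z)) + (real DIM('a) - 1) / norm (snd z) * k' (norm (snd z))) * \<phi> z \<partial>lborel)" .
qed

text \<open>The solution is cut off at radius \<open>\<epsilon>\<close>. By the bounds on \<open>v\<close> and \<open>v'\<close>, the cutoff error is of size
  \<open>r powr (- l - 2)\<close> uniformly in \<open>\<epsilon>\<close> and tends to \<open>0\<close> pointwise. As \<open>l + 2 < N\<close> this bound is locally integrable,
  so by dominated convergence the origin contributes nothing in the limit.\<close>
lemma stationary_distribution:
  fixes \<phi> :: "real \<times> 'a::euclidean_space \<Rightarrow> real" and v v' v'' f :: "real \<Rightarrow> real"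
  assumes \<phi>: "test_function ({0<..<T} \<times> UNIV) \<phi>"
    and l: "0 < l" "l < real DIM('a) - 2"
    and dv: "\<And>r. r > 0 \<Longrightarrow> (v has_real_derivative v' r) (at r)"
    and dv': "\<And>r. r > 0 \<Longrightarrow> (v' has_real_derivative v'' r) (at r)"
    and cv: "continuous_on {0<..} v''"
    and ode: "\<And>r. r > 0 \<Longrightarrow> v'' r + (real DIM('a) - 1) / r * v' r + f r = 0"
    and r0: "0 < r0" and C: "0 \<le> C"
    and vb: "\<And>r. 0 < r \<Longrightarrow> r \<le> r0 \<Longrightarrow> \<bar>v r\<bar> \<le> C * r powr (- l)"
    and vb': "\<And>r. 0 < r \<Longrightarrow> r \<le> r0 \<Longrightarrow> \<bar>v' r\<bar> \<le> C * r powr (- l - 1)"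
    and vfar: "\<And>r. r > 0 \<Longrightarrow> \<bar>v r\<bar> \<le> C * (r powr (- l - 2) + 1)"
    and fb: "\<And>r. r > 0 \<Longrightarrow> \<bar>f r\<bar> \<le> C * (r powr (- l - 2) + 1)"
  shows "(\<integral>z. v (norm (snd z)) * time_deriv \<phi> z \<partial>lborel) = 0"
    and "(\<integral>z. v (norm (snd z)) * space_laplacian \<phi> z \<partial>lborel) = - (\<integral>z. f (norm (snd z)) * \<phi> z \<partial>lborel)"
proof -
  note c = test_function_calculus[OF \<phi>]
  obtain K where K: "compact K" "K \<subseteq> {0<..<T} \<times> UNIV" "\<And>z. z \<notin> K \<Longrightarrow> \<phi> z = 0 \<and> time_deriv \<phi> z = 0 \<and> (\<forall>b. dir_deriv (0, b) \<phi> z = 0 \<and> dir_deriv (0, b) (dir_deriv (0, b) \<phi>) z = 0)"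
    using c(7) by blast
  have cL: "continuous_on UNIV (space_laplacian \<phi>)" unfolding space_laplacian_def[abs_def] using c(6) by (intro continuous_intros)
  have L0: "space_laplacian \<phi> z = 0" if "z \<notin> K" for z using K(3)[OF that] by (simp add: space_laplacian_def)
  obtain h h' h'' :: "real \<Rightarrow> real" and B where hc: "C2_step h h' h'' B" using C2_step_exists by blast
  have h: "\<And>s. (h has_real_derivative h' s) (at s)" "\<And>s. (h' has_real_derivative h'' s) (at s)"
    "continuous_on UNIV h''" "\<And>s. 0 \<le> h s \<and> h s \<le> 1" "\<And>s. s \<le> 1 \<Longrightarrow> h s = 0" "\<And>s. s \<ge> 2 \<Longrightarrow> h s = 1"
    "\<And>s. s \<le> 1 \<or> s \<ge> 2 \<Longrightarrow> h' s = 0 \<and> h'' s = 0" "\<And>s. \<bar>h' s\<bar> \<le> B \<and> \<bar>h'' s\<bar> \<le> B"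
    using hc unfolding C2_step_def by blast+
  have B: "0 \<le> B" using h(8)[of 0] by linarith
  define \<epsilon> where "\<epsilon> = (\<lambda>n. r0 / 2 * inverse (real (Suc n)))"
  have eps: "\<epsilon> n > 0" "2 * \<epsilon> n \<le> r0" for n using r0 by (auto simp: \<epsilon>_def field_simps)
  have eps_lim: "\<epsilon> \<longlonglongrightarrow> 0" unfolding \<epsilon>_def using tendsto_mult_right_zero[OF LIMSEQ_inverse_real_of_nat] by blast
  \<comment> \<open>the commutator of the radial Laplacian with the cutoff \<open>h (r / \<epsilon> n)\<close>, applied to \<open>v\<close>\<close>
  define err where "err = (\<lambda>n r. 2 * (h' (r / \<epsilon> n) / \<epsilon> n * v' r) + (h'' (r / \<epsilon> n) / (\<epsilon> n)\<^sup>2 + (real DIM('a) - 1) / r * (h' (r / \<epsilon> n) / \<epsilon> n)) * v r)"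
  have small: "\<forall>\<^sub>F n in sequentially. 2 * \<epsilon> n < r" if "r > 0" for r
  proof -
    have "(\<lambda>n. 2 * \<epsilon> n) \<longlonglongrightarrow> 2 * 0" by (intro tendsto_intros eps_lim)
    then show ?thesis using that by (intro order_tendstoD(2)[of _ "0"]) auto
  qed
  have ge2: "r / \<epsilon> n \<ge> 2" if "2 * \<epsilon> n < r" for r n using that eps(1)[of n] by (simp add: field_simps)
  have err_ev: "\<forall>\<^sub>F n in sequentially. err n r = 0 \<and> h (r / \<epsilon> n) = 1" if "r > 0" for r
    using small[OF that] by eventually_elim (use ge2 h(6,7) in \<open>auto simp: err_def\<close>)
  define D where "D = (8 * B + 2 * real DIM('a) * B) * C"
  have D0: "0 \<le> D" using B C by (simp add: D_def)
  have err_bd: "\<bar>err n r\<bar> \<le> D * r powr (- l - 2)" if r: "r > 0" for n r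
  proof (cases "r / \<epsilon> n \<le> 1 \<or> r / \<epsilon> n \<ge> 2")
    case True
    then show ?thesis using h(7) D0 by (simp add: err_def)
  next
    case False
    then have e2: "r < 2 * \<epsilon> n" using eps(1)[of n] by (simp add: field_simps)
    then have rr: "r \<le> r0" using eps(2)[of n] by linarith
    have ie: "1 / \<epsilon> n \<le> 2 / r" using e2 r eps(1)[of n] by (simp add: field_simps)
    have a1: "\<bar>h' (r / \<epsilon> n) / \<epsilon> n\<bar> \<le> B * (2 / r)"
    proof -
      have "\<bar>h' (r / \<epsilon> n) / \<epsilon> n\<bar> = \<bar>h' (r / \<epsilon> n)\<bar> * (1 / \<epsilon> n)" using eps(1)[of n] by (simp add: abs_divide)
      also have "\<dots> \<le> B * (2 / r)" using h(8) B ie eps(1)[of n] by (intro mult_mono) auto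
      finally show ?thesis .
    qed
    have a2: "\<bar>h'' (r / \<epsilon> n) / (\<epsilon> n)\<^sup>2\<bar> \<le> B * (2 / r)\<^sup>2"
    proof -
      have "\<bar>h'' (r / \<epsilon> n) / (\<epsilon> n)\<^sup>2\<bar> = \<bar>h'' (r / \<epsilon> n)\<bar> * (1 / \<epsilon> n)\<^sup>2" by (simp add: abs_divide power_one_over)
      also have "\<dots> \<le> B * (2 / r)\<^sup>2" using h(8) B ie eps(1)[of n] by (intro mult_mono power_mono) auto
      finally show ?thesis .
    qed
    have N1: "0 \<le> (real DIM('a) - 1) / r" "(real DIM('a) - 1) / r \<le> real DIM('a) / r" using r l by (auto intro!: divide_right_mono)
    have pw: "r powr (- l) = r\<^sup>2 * r powr (- l - 2)" "r powr (- l - 1) = r * r powr (- l - 2)"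
    proof -
      have "r\<^sup>2 * r powr (- l - 2) = r powr 2 * r powr (- l - 2)" using r by simp
      also have "\<dots> = r powr (- l)" unfolding powr_add[symmetric] by simp
      finally show "r powr (- l) = r\<^sup>2 * r powr (- l - 2)" by simp
      have "r * r powr (- l - 2) = r powr (1 + (- l - 2))" using powr_mult_base[of r "- l - 2"] r by simp
      also have "1 + (- l - 2) = - l - 1" by simp
      finally show "r powr (- l - 1) = r * r powr (- l - 2)" by simp
    qed
    let ?P = "r powr (- l - 2)"
    have "\<bar>2 * (h' (r / \<epsilon> n) / \<epsilon> n * v' r)\<bar> \<le> 2 * ((B * (2 / r)) * (C * (r * ?P)))"
      unfolding abs_mult[of 2] abs_mult[of "h' (r / \<epsilon> n) / \<epsilon> n"] using a1 vb'[OF r rr] B r unfolding pw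
      by (intro mult_mono) auto
    also have "\<dots> = 4 * B * C * ?P" using r by simp
    finally have t1: "\<bar>2 * (h' (r / \<epsilon> n) / \<epsilon> n * v' r)\<bar> \<le> 4 * B * C * ?P" .
    have "\<bar>h'' (r / \<epsilon> n) / (\<epsilon> n)\<^sup>2 + (real DIM('a) - 1) / r * (h' (r / \<epsilon> n) / \<epsilon> n)\<bar> \<le> B * (2 / r)\<^sup>2 + real DIM('a) / r * (B * (2 / r))"
      by (rule order_trans[OF abs_triangle_ineq], rule add_mono[OF a2], unfold abs_mult[of "(real DIM('a) - 1) / r"], rule mult_mono)
         (use N1 a1 in auto)
    then have "\<bar>(h'' (r / \<epsilon> n) / (\<epsilon> n)\<^sup>2 + (real DIM('a) - 1) / r * (h' (r / \<epsilon> n) / \<epsilon> n)) * v r\<bar> \<le> (B * (2 / r)\<^sup>2 + real DIM('a) / r * (B * (2 / r))) * (C * (r\<^sup>2 * ?P))"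
      unfolding abs_mult[of _ "v r"] using vb[OF r rr] B r unfolding pw by (intro mult_mono) auto
    also have "\<dots> = (4 * B + 2 * real DIM('a) * B) * C * ?P" using r by (simp add: power2_eq_square field_simps)
    finally have t2: "\<bar>(h'' (r / \<epsilon> n) / (\<epsilon> n)\<^sup>2 + (real DIM('a) - 1) / r * (h' (r / \<epsilon> n) / \<epsilon> n)) * v r\<bar> \<le> (4 * B + 2 * real DIM('a) * B) * C * ?P" .
    have "\<bar>err n r\<bar> \<le> 4 * B * C * ?P + (4 * B + 2 * real DIM('a) * B) * C * ?P"
      unfolding err_def by (rule order_trans[OF abs_triangle_ineq add_mono[OF t1 t2]])
    also have "\<dots> = D * ?P" by (simp add: D_def algebra_simps)
    finally show ?thesis .
  qed
  define k where "k = (\<lambda>n r. h (r / \<epsilon> n) * v r)"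
  define k' where "k' = (\<lambda>n r. h' (r / \<epsilon> n) / \<epsilon> n * v r + h (r / \<epsilon> n) * v' r)"
  define k'' where "k'' = (\<lambda>n r. h'' (r / \<epsilon> n) / (\<epsilon> n)\<^sup>2 * v r + 2 * (h' (r / \<epsilon> n) / \<epsilon> n * v' r) + h (r / \<epsilon> n) * v'' r)"
  have sc: "((\<lambda>r. r / \<epsilon> n) has_real_derivative 1 / \<epsilon> n) (at r)" for n r using eps(1)[of n] by (auto intro!: derivative_eq_intros)
  have dh: "((\<lambda>r. h (r / \<epsilon> n)) has_real_derivative h' (r / \<epsilon> n) / \<epsilon> n) (at r)"
    and dh': "((\<lambda>r. h' (r / \<epsilon> n) / \<epsilon> n) has_real_derivative h'' (r / \<epsilon> n) / (\<epsilon> n)\<^sup>2) (at r)" for n r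
  proof -
    show "((\<lambda>r. h (r / \<epsilon> n)) has_real_derivative h' (r / \<epsilon> n) / \<epsilon> n) (at r)" using DERIV_chain2[OF h(1) sc[of n r]] by simp
    show "((\<lambda>r. h' (r / \<epsilon> n) / \<epsilon> n) has_real_derivative h'' (r / \<epsilon> n) / (\<epsilon> n)\<^sup>2) (at r)"
      using DERIV_cdivide[OF DERIV_chain2[OF h(2) sc[of n r]], of "\<epsilon> n"] by (simp add: power2_eq_square)
  qed
  have dk: "(k n has_real_derivative k' n r) (at r)" if "r > 0" for n r
    unfolding k_def k'_def by (rule DERIV_cong[OF DERIV_mult[OF dh dv[OF that]]]) simp
  have dk': "(k' n has_real_derivative k'' n r) (at r)" if "r > 0" for n r
    unfolding k'_def k''_def by (rule DERIV_cong[OF DERIV_add[OF DERIV_mult[OF dh' dv[OF that]] DERIV_mult[OF dh dv'[OF that]]]]) simp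
  have cont_v: "continuous_on {0<..} v" by (rule continuous_at_imp_continuous_on) (use dv DERIV_isCont in auto)
  have cont_v': "continuous_on {0<..} v'" by (rule continuous_at_imp_continuous_on) (use dv' DERIV_isCont in auto)
  have conth: "continuous_on UNIV h" "continuous_on UNIV h'"
    by (rule continuous_at_imp_continuous_on, use h DERIV_isCont in blast)+
  have comp: "continuous_on S (\<lambda>r. g (r / \<epsilon> n))" if "continuous_on UNIV g" for g :: "real \<Rightarrow> real" and n S
    by (intro continuous_on_compose2[OF that] continuous_intros) (use eps(1)[of n] in auto)
  have ck: "continuous_on {0<..} (k'' n)" for n
    unfolding k''_def using eps(1)[of n] by (intro continuous_intros comp h(3) conth cont_v cont_v' cv) auto
  have zero: "k n r = 0 \<and> k' n r = 0 \<and> k'' n r = 0" if "r < \<epsilon> n" for n r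
  proof -
    have "r / \<epsilon> n \<le> 1" using that eps(1)[of n] by (simp add: field_simps)
    then show ?thesis using h(5,7) by (simp add: k_def k'_def k''_def)
  qed
  have lapk: "k'' n r + (real DIM('a) - 1) / r * k' n r = err n r - h (r / \<epsilon> n) * f r" if "r > 0" for n r
  proof -
    have "k'' n r + (real DIM('a) - 1) / r * k' n r = err n r + h (r / \<epsilon> n) * (v'' r + (real DIM('a) - 1) / r * v' r)"
      by (simp add: k'_def k''_def err_def algebra_simps)
    also have "v'' r + (real DIM('a) - 1) / r * v' r = - f r" using ode[OF that] by linarith
    finally show ?thesis by simp
  qed
  note ibp = radial_integration_by_parts[OF \<phi> dk dk' ck eps(1) zero]
  have bm: "(\<lambda>z::real\<times>'a. g (norm (snd z))) \<in> borel_measurable borel" if "continuous_on {0<..} g" for g :: "real \<Rightarrow> real"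
  proof -
    have "(\<lambda>x::'a. g (norm x)) \<in> borel_measurable borel"
      by (rule borel_measurable_continuous_countable_exceptions[of "{0}"])
         (auto intro!: continuous_on_compose2[OF that] continuous_intros)
    from measurable_compose[OF snd_borel_measurable this] show ?thesis .
  qed
  have [measurable]: "(\<lambda>z::real\<times>'a. v (norm (snd z))) \<in> borel_measurable borel" "(\<lambda>z::real\<times>'a. v' (norm (snd z))) \<in> borel_measurable borel"
    by (intro bm cont_v cont_v')+
  have cf: "continuous_on {0<..} f"
  proof -
    have "continuous_on {0<..} (\<lambda>r. - (v'' r + (real DIM('a) - 1) / r * v' r))" by (intro continuous_intros cv cont_v') auto
    then show ?thesis by (rule continuous_on_eq) (use ode in \<open>auto simp: add_eq_0_iff2\<close>)
  qed
  have [measurable]: "(\<lambda>z::real\<times>'a. f (norm (snd z))) \<in> borel_measurable borel" by (intro bm cf)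
  have [measurable]: "\<phi> \<in> borel_measurable borel" "time_deriv \<phi> \<in> borel_measurable borel" "space_laplacian \<phi> \<in> borel_measurable borel"
    using c(3,4) cL by (auto intro: borel_measurable_continuous_onI)
  have [measurable]: "h \<in> borel_measurable borel" "h' \<in> borel_measurable borel" "h'' \<in> borel_measurable borel"
    using conth h(3) by (auto intro: borel_measurable_continuous_onI)
  have AE0: "AE z in (lborel :: (real \<times> 'a) measure). snd z \<noteq> 0" by (rule AE_snd_neq)
  have vlim: "(\<lambda>n. \<integral>z. k n (norm (snd z)) * \<psi> z \<partial>lborel) \<longlonglongrightarrow> (\<integral>z. v (norm (snd z)) * \<psi> z \<partial>lborel)"
    if \<psi>: "continuous_on UNIV \<psi>" "\<And>z. z \<notin> K \<Longrightarrow> \<psi> z = 0" for \<psi> :: "real \<times> 'a \<Rightarrow> real"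
  proof -
    have [measurable]: "\<psi> \<in> borel_measurable borel" using \<psi>(1) by (rule borel_measurable_continuous_onI)
    obtain M where M: "\<And>z. \<bar>\<psi> z\<bar> \<le> M" using bounded_of_compact_support[OF \<psi>(1) K(1) \<psi>(2)] by blast
    have i: "integrable lborel (\<lambda>z. v (norm (snd z)) * \<psi> z)"
      by (rule slab_integrable[OF l _ _ K(1,2) M \<psi>(2), where C=C]) (use vfar in auto)
    show ?thesis
    proof (rule integral_dominated_convergence[OF _ _ integrable_abs[OF i]])
      show "AE z in lborel. (\<lambda>n. k n (norm (snd z)) * \<psi> z) \<longlonglongrightarrow> v (norm (snd z)) * \<psi> z"
        using AE0
      proof eventually_elim
        case (elim z)
        then have "norm (snd z) > 0" by simp
        from err_ev[OF this] have "\<forall>\<^sub>F n in sequentially. k n (norm (snd z)) * \<psi> z = v (norm (snd z)) * \<psi> z"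
          by eventually_elim (simp add: k_def)
        then show ?case by (rule tendsto_eventually)
      qed
      show "AE z in lborel. norm (k n (norm (snd z)) * \<psi> z) \<le> \<bar>v (norm (snd z)) * \<psi> z\<bar>" for n
      proof (intro AE_I2)
        fix z
        have "\<bar>h (norm (snd z) / \<epsilon> n)\<bar> * \<bar>v (norm (snd z)) * \<psi> z\<bar> \<le> 1 * \<bar>v (norm (snd z)) * \<psi> z\<bar>"
          using h(4) by (intro mult_right_mono) auto
        then show "norm (k n (norm (snd z)) * \<psi> z) \<le> \<bar>v (norm (snd z)) * \<psi> z\<bar>" by (simp add: k_def abs_mult)
      qed
    qed (unfold k_def, measurable)
  qed
  have "(\<lambda>n. \<integral>z. k n (norm (snd z)) * time_deriv \<phi> z \<partial>lborel) \<longlonglongrightarrow> (\<integral>z. v (norm (snd z)) * time_deriv \<phi> z \<partial>lborel)"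
    using K(3) by (intro vlim c(4)) auto
  moreover have "(\<integral>z. k n (norm (snd z)) * time_deriv \<phi> z \<partial>lborel) = 0" for n by (rule ibp(1))
  ultimately have "(\<lambda>n::nat. 0) \<longlonglongrightarrow> (\<integral>z. v (norm (snd z)) * time_deriv \<phi> z \<partial>lborel)"
    by simp
  then show "(\<integral>z. v (norm (snd z)) * time_deriv \<phi> z \<partial>lborel) = 0"
    by (rule LIMSEQ_unique[OF _ tendsto_const])
  have l1: "(\<lambda>n. \<integral>z. k n (norm (snd z)) * space_laplacian \<phi> z \<partial>lborel) \<longlonglongrightarrow> (\<integral>z. v (norm (snd z)) * space_laplacian \<phi> z \<partial>lborel)"
    using L0 by (intro vlim cL) auto
  obtain M where M: "\<And>z. \<bar>\<phi> z\<bar> \<le> M" using bounded_of_compact_support[OF c(3) K(1)] K(3) by blast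
  have l2: "(\<lambda>n. \<integral>z. (err n (norm (snd z)) - h (norm (snd z) / \<epsilon> n) * f (norm (snd z))) * \<phi> z \<partial>lborel) \<longlonglongrightarrow> (\<integral>z. - f (norm (snd z)) * \<phi> z \<partial>lborel)"
  proof (rule integral_dominated_convergence)
    show "integrable lborel (\<lambda>z::real\<times>'a. ((D + C) * (norm (snd z) powr (- l - 2) + 1)) * \<bar>\<phi> z\<bar>)"
      by (rule slab_integrable[OF l _ _ K(1,2), where B=M and C="D + C"]) (use M K(3) D0 C in \<open>auto simp: abs_mult abs_of_nonneg\<close>)
    show "AE z in lborel. (\<lambda>n. (err n (norm (snd z)) - h (norm (snd z) / \<epsilon> n) * f (norm (snd z))) * \<phi> z) \<longlonglongrightarrow> - f (norm (snd z)) * \<phi> z"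
      using AE0
    proof eventually_elim
      case (elim z)
      then have "norm (snd z) > 0" by simp
      from err_ev[OF this] have "\<forall>\<^sub>F n in sequentially. (err n (norm (snd z)) - h (norm (snd z) / \<epsilon> n) * f (norm (snd z))) * \<phi> z = - f (norm (snd z)) * \<phi> z"
        by eventually_elim simp
      then show ?case by (rule tendsto_eventually)
    qed
    show "AE z in lborel. norm ((err n (norm (snd z)) - h (norm (snd z) / \<epsilon> n) * f (norm (snd z))) * \<phi> z) \<le> ((D + C) * (norm (snd z) powr (- l - 2) + 1)) * \<bar>\<phi> z\<bar>" for n
      using AE0
    proof eventually_elim
      case (elim z)
      let ?r = "norm (snd z)"
      have r: "?r > 0" using elim by simp
      have "\<bar>h (?r / \<epsilon> n) * f ?r\<bar> \<le> 1 * (C * (?r powr (- l - 2) + 1))"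
        unfolding abs_mult using h(4)[of "?r / \<epsilon> n"] fb[OF r] by (intro mult_mono) auto
      moreover have "D * ?r powr (- l - 2) \<le> D * (?r powr (- l - 2) + 1)" using D0 by (intro mult_left_mono) auto
      ultimately have "\<bar>err n ?r - h (?r / \<epsilon> n) * f ?r\<bar> \<le> D * (?r powr (- l - 2) + 1) + C * (?r powr (- l - 2) + 1)"
        using err_bd[OF r, of n] abs_triangle_ineq4[of "err n ?r" "h (?r / \<epsilon> n) * f ?r"] by linarith
      then have "\<bar>err n ?r - h (?r / \<epsilon> n) * f ?r\<bar> \<le> (D + C) * (?r powr (- l - 2) + 1)" by (simp add: distrib_right)
      then show ?case unfolding real_norm_def abs_mult[of _ "\<phi> z"] by (intro mult_right_mono) auto
    qed
  qed (unfold err_def, measurable)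
  have rhs: "(\<integral>z. (k'' n (norm (snd z)) + (real DIM('a) - 1) / norm (snd z) * k' n (norm (snd z))) * \<phi> z \<partial>lborel) = (\<integral>z. (err n (norm (snd z)) - h (norm (snd z) / \<epsilon> n) * f (norm (snd z))) * \<phi> z \<partial>lborel)" for n
  proof (rule integral_cong_AE)
    show "AE z in lborel. (k'' n (norm (snd z)) + (real DIM('a) - 1) / norm (snd z) * k' n (norm (snd z))) * \<phi> z = (err n (norm (snd z)) - h (norm (snd z) / \<epsilon> n) * f (norm (snd z))) * \<phi> z"
      using AE0
    proof eventually_elim
      case (elim z)
      then have "norm (snd z) > 0" by simp
      from lapk[OF this] show ?case by (rule arg_cong[where f="\<lambda>a. a * \<phi> z"])
    qed
    have [measurable]: "(\<lambda>z::real\<times>'a. v'' (norm (snd z))) \<in> borel_measurable borel" by (intro bm cv)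
    show "(\<lambda>z. (k'' n (norm (snd z)) + (real DIM('a) - 1) / norm (snd z) * k' n (norm (snd z))) * \<phi> z) \<in> borel_measurable lborel"
      unfolding k''_def k'_def by measurable
    show "(\<lambda>z. (err n (norm (snd z)) - h (norm (snd z) / \<epsilon> n) * f (norm (snd z))) * \<phi> z) \<in> borel_measurable lborel"
      unfolding err_def by measurable
  qed
  have "(\<integral>z. k n (norm (snd z)) * space_laplacian \<phi> z \<partial>lborel) = (\<integral>z. (err n (norm (snd z)) - h (norm (snd z) / \<epsilon> n) * f (norm (snd z))) * \<phi> z \<partial>lborel)" for n
    by (rule trans[OF ibp(2) rhs])
  with l2 have "(\<lambda>n. \<integral>z. k n (norm (snd z)) * space_laplacian \<phi> z \<partial>lborel) \<longlonglongrightarrow> (\<integral>z. - f (norm (snd z)) * \<phi> z \<partial>lborel)"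
    by simp
  then have "(\<integral>z. v (norm (snd z)) * space_laplacian \<phi> z \<partial>lborel) = (\<integral>z. - f (norm (snd z)) * \<phi> z \<partial>lborel)"
    by (rule LIMSEQ_unique[OF l1])
  then show "(\<integral>z. v (norm (snd z)) * space_laplacian \<phi> z \<partial>lborel) = - (\<integral>z. f (norm (snd z)) * \<phi> z \<partial>lborel)" by simp
qed

section \<open>Asymptotics of singular radial stationary solutions\<close>

lemma increasing_bounded_tendsto_at_top:
  fixes f :: "real \<Rightarrow> real"
  assumes mono: "\<And>s t. t0 \<le> s \<Longrightarrow> s \<le> t \<Longrightarrow> f s \<le> f t" and bd: "\<And>t. t0 \<le> t \<Longrightarrow> f t \<le> M"
  shows "\<exists>l. (f \<longlongrightarrow> l) at_top"
proof -
  let ?l = "Sup (f ` {t0..})"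
  have ub: "f t \<le> ?l" if "t0 \<le> t" for t
    using that bd by (intro cSup_upper) (auto intro!: bdd_aboveI2[of _ _ M])
  have "(f \<longlongrightarrow> ?l) at_top"
  proof (rule order_tendstoI)
    fix a assume "a < ?l"
    moreover have "bdd_above (f ` {t0..})" using bd by (auto intro!: bdd_aboveI2[of _ _ M])
    ultimately obtain s where s: "s \<ge> t0" "a < f s"
      using less_cSup_iff[of "f ` {t0..}" a] by auto
    show "\<forall>\<^sub>F t in at_top. a < f t"
      using eventually_ge_at_top[of s] by eventually_elim (use s mono in force)
  next
    fix a assume "?l < a"
    show "\<forall>\<^sub>F t in at_top. f t < a"
      using eventually_ge_at_top[of t0] by eventually_elim (use ub \<open>?l < a\<close> in force)
  qed
  then show ?thesis by blast
qed

lemma abs_powr_has_derivative: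
  assumes "p > 1"
  shows "((\<lambda>x::real. \<bar>x\<bar> powr p) has_real_derivative p * (\<bar>x\<bar> powr (p - 2) * x)) (at x)"
proof -
  consider "x > 0" | "x < 0" | "x = 0" by linarith
  then show ?thesis
  proof cases
    case 1
    have "((\<lambda>x. x powr p) has_real_derivative p * x powr (p - 1)) (at x)"
      by (rule has_real_derivative_powr[OF 1])
    then have "((\<lambda>x. \<bar>x\<bar> powr p) has_real_derivative p * x powr (p - 1)) (at x)"
      by (rule DERIV_cong_ev[THEN iffD1, OF refl _ refl, rotated])
         (use eventually_nhds_in_open[of "{0<..}" x] 1 in \<open>auto elim!: eventually_mono\<close>)
    moreover have "x powr (p - 1) = x powr (p - 2) * x"
      using 1 powr_mult_base[of x "p - 2"] by (simp add: mult.commute add.commute)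
    ultimately show ?thesis using 1 by simp
  next
    case 2
    have "((\<lambda>x. (- x) powr p) has_real_derivative p * (- x) powr (p - 1) * (- 1)) (at x)"
      by (rule DERIV_chain2[OF has_real_derivative_powr]) (use 2 in \<open>auto intro!: derivative_eq_intros\<close>)
    then have "((\<lambda>x. \<bar>x\<bar> powr p) has_real_derivative p * (- x) powr (p - 1) * (- 1)) (at x)"
      by (rule DERIV_cong_ev[THEN iffD1, OF refl _ refl, rotated])
         (use eventually_nhds_in_open[of "{..<0}" x] 2 in \<open>auto elim!: eventually_mono\<close>)
    moreover have "(- x) powr (p - 1) = (- x) powr (p - 2) * (- x)"
      using 2 powr_mult_base[of "- x" "p - 2"] by (simp add: mult.commute add.commute)
    ultimately show ?thesis using 2 by simp
  next
    case 3
    have "((\<lambda>h::real. \<bar>h\<bar> powr (p - 1)) \<longlongrightarrow> \<bar>0\<bar> powr (p - 1)) (at 0)"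
      by (intro tendsto_powr' tendsto_rabs tendsto_ident_at) (use assms in auto)
    then have l: "((\<lambda>h::real. \<bar>h\<bar> powr (p - 1)) \<longlongrightarrow> 0) (at 0)" by simp
    have "((\<lambda>h::real. (\<bar>h\<bar> powr p - \<bar>0\<bar> powr p) / (h - 0)) \<longlongrightarrow> 0) (at 0)"
    proof (rule tendsto_rabs_zero_cancel, rule Lim_transform_eventually[OF l])
      show "\<forall>\<^sub>F h in at 0. \<bar>h\<bar> powr (p - 1) = \<bar>(\<bar>h\<bar> powr p - \<bar>0\<bar> powr p) / (h - 0)\<bar>"
        by (rule eventually_at_filter[THEN iffD2], rule always_eventually)
           (auto simp: powr_diff abs_divide)
    qed
    then show ?thesis using 3 by (simp add: has_field_derivative_iff)
  qed
qed

lemma DERIV_imp_continuous_on: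
  fixes f :: "real \<Rightarrow> real"
  assumes "\<And>x. (f has_real_derivative f' x) (at x)"
  shows "continuous_on S f"
  using assms DERIV_isCont continuous_at_imp_continuous_on by blast

text \<open>The equation for \<open>y = r powr (2 / \<alpha>) * v r\<close> in the variable \<open>t = - ln r\<close> (Emden-Fowler transformation). The
  friction \<open>a = 4 / \<alpha> - (N - 2)\<close> is positive because \<open>\<alpha>\<close> is below the Sobolev-critical exponent \<open>4 / (N - 2)\<close>.\<close>
locale damped_oscillator =
  fixes y y1 :: "real \<Rightarrow> real" and a \<beta> \<alpha> :: real
  assumes a: "a > 0" and b: "\<beta> > 0" and al: "\<alpha> > 0"
    and dy: "\<And>t. (y has_real_derivative y1 t) (at t)"
    and dy1: "\<And>t. (y1 has_real_derivative - a * y1 t + (\<beta> * y t - \<bar>y t\<bar> powr \<alpha> * y t)) (at t)"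
begin

text \<open>The force, whose zeros \<open>0\<close> and \<open>\<plusminus>ystar\<close> are the equilibria.\<close>
definition "F u = \<beta> * u - \<bar>u\<bar> powr \<alpha> * u"

definition "ystar = \<beta> powr (1 / \<alpha>)"

lemma ystar: "ystar > 0" "ystar powr \<alpha> = \<beta>"
  using b al by (auto simp: ystar_def powr_powr)

lemma F_cont: "continuous_on S F"
  unfolding F_def[abs_def] using al by (intro continuous_intros continuous_on_powr') auto

text \<open>The potential of the force \<open>F\<close>, that is, \<open>G' = - F\<close>; \<open>E\<close> below is the mechanical energy.\<close>
definition "G u = \<bar>u\<bar> powr (\<alpha> + 2) / (\<alpha> + 2) - \<beta> * u\<^sup>2 / 2"

definition "E t = (y1 t)\<^sup>2 / 2 + G (y t)"

lemma E_deriv: "(E has_real_derivative - a * (y1 t)\<^sup>2) (at t)"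
proof -
  have g: "(G has_real_derivative - F u) (at u)" for u
  proof -
    have 1: "((\<lambda>u. \<bar>u\<bar> powr (\<alpha> + 2) / (\<alpha> + 2)) has_real_derivative \<bar>u\<bar> powr \<alpha> * u) (at u)"
      using DERIV_cdivide[OF abs_powr_has_derivative[of "\<alpha> + 2" u], of "\<alpha> + 2"] al by simp
    have 2: "((\<lambda>u. \<beta> * u\<^sup>2 / 2) has_real_derivative \<beta> * u) (at u)"
      by (auto intro!: derivative_eq_intros)
    show ?thesis unfolding G_def F_def using DERIV_diff[OF 1 2] by simp
  qed
  show ?thesis unfolding E_def
    by (rule DERIV_cong[OF DERIV_add[OF DERIV_cdivide[OF DERIV_power[OF dy1]] DERIV_chain2[OF g dy]]])
       (simp add: F_def field_simps power2_eq_square)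
qed

lemma E_decreasing: "s \<le> t \<Longrightarrow> E t \<le> E s"
  using E_deriv a by (intro DERIV_nonpos_imp_nonincreasing[of s t E]) (auto intro!: exI mult_nonneg_nonneg)

lemma G_coercive: "\<exists>B. \<forall>u. u\<^sup>2 - B \<le> G u"
proof -
  define M where "M = (\<alpha> + 2) * (\<beta> / 2 + 1)"
  have M: "M > 0" using al b by (simp add: M_def)
  have "u\<^sup>2 - (1 + \<beta> / 2) * (M powr (1 / \<alpha>))\<^sup>2 \<le> G u" for u
  proof (cases "\<bar>u\<bar> powr \<alpha> \<ge> M")
    case True
    have "\<bar>u\<bar> powr (\<alpha> + 2) = \<bar>u\<bar> powr \<alpha> * u\<^sup>2" by (cases "u = 0") (auto simp: powr_add)
    moreover have "M * u\<^sup>2 \<le> \<bar>u\<bar> powr \<alpha> * u\<^sup>2" using True by (intro mult_right_mono) auto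
    ultimately have "M * u\<^sup>2 / (\<alpha> + 2) \<le> \<bar>u\<bar> powr (\<alpha> + 2) / (\<alpha> + 2)"
      using al by (intro divide_right_mono) auto
    moreover have "M * u\<^sup>2 / (\<alpha> + 2) = (\<beta> / 2 + 1) * u\<^sup>2" using al by (simp add: M_def)
    ultimately have "u\<^sup>2 \<le> G u" by (simp add: G_def algebra_simps)
    moreover have "0 \<le> (1 + \<beta> / 2) * (M powr (1 / \<alpha>))\<^sup>2" using b by simp
    ultimately show ?thesis by linarith
  next
    case False
    then have "(\<bar>u\<bar> powr \<alpha>) powr (1 / \<alpha>) \<le> M powr (1 / \<alpha>)" using al by (intro powr_mono2) auto
    then have "\<bar>u\<bar> \<le> M powr (1 / \<alpha>)" using al by (simp add: powr_powr)
    then have "u\<^sup>2 \<le> (M powr (1 / \<alpha>))\<^sup>2" using abs_le_square_iff[of u "M powr (1 / \<alpha>)"] by simp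
    then have "(1 + \<beta> / 2) * u\<^sup>2 \<le> (1 + \<beta> / 2) * (M powr (1 / \<alpha>))\<^sup>2" using b by (intro mult_left_mono) auto
    moreover have "0 \<le> \<bar>u\<bar> powr (\<alpha> + 2) / (\<alpha> + 2)" using al by simp
    ultimately show ?thesis by (simp add: G_def algebra_simps)
  qed
  then show ?thesis by blast
qed

text \<open>The energy decreases along the orbit and is coercive in \<open>y\<close>.\<close>
lemma bounded_orbit:
  obtains R where "R > 0" "\<And>t. t \<ge> 0 \<Longrightarrow> \<bar>y t\<bar> \<le> R" "\<And>t. t \<ge> 0 \<Longrightarrow> \<bar>y1 t\<bar> \<le> R" "\<And>t. t \<ge> 0 \<Longrightarrow> - R \<le> E t"
proof -
  obtain B where B: "\<And>u. u\<^sup>2 - B \<le> G u" using G_coercive by blast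
  define Q where "Q = \<bar>E 0 + B\<bar> + 1"
  have *: "(y1 t)\<^sup>2 / 2 + (y t)\<^sup>2 \<le> Q" if "t \<ge> 0" for t
    using B[of "y t"] E_decreasing[OF that] unfolding E_def Q_def by linarith
  define R where "R = 2 * Q + \<bar>B\<bar>"
  have Q: "Q \<ge> 1" by (simp add: Q_def)
  have sq: "\<bar>u\<bar> \<le> 2 * Q" if "u\<^sup>2 \<le> 2 * Q" for u :: real
  proof (rule abs_le_square_iff[THEN iffD2, THEN order_trans])
    have "2 * Q * 1 \<le> 2 * Q * (2 * Q)" using Q by (intro mult_left_mono) auto
    then show "u\<^sup>2 \<le> (2 * Q)\<^sup>2" using that by (simp add: power2_eq_square)
  qed (use Q in auto)
  show thesis
  proof
    show "R > 0" using Q by (simp add: R_def)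
    show "\<bar>y t\<bar> \<le> R" if "t \<ge> 0" for t
      using sq[of "y t"] *[OF that] zero_le_power2[of "y1 t"] zero_le_power2[of "y t"] by (simp add: R_def)
    show "\<bar>y1 t\<bar> \<le> R" if "t \<ge> 0" for t
      using sq[of "y1 t"] *[OF that] zero_le_power2[of "y1 t"] zero_le_power2[of "y t"] by (simp add: R_def)
    show "- R \<le> E t" for t
      using B[of "y t"] zero_le_power2[of "y1 t"] zero_le_power2[of "y t"] Q unfolding E_def R_def by linarith
  qed
qed

text \<open>The energy converges and loses \<open>a y1\<^sup>2\<close> per unit of time. If \<open>\<bar>y1\<bar>\<close> were at least \<open>e\<close> at arbitrarily late times,
  it would stay above \<open>e / 2\<close> for a time \<open>h\<close> that is independent of \<open>t\<close>, the second derivative being bounded, and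
  each such episode would cost a fixed amount of energy.\<close>
lemma y1_tendsto_0: "(y1 \<longlongrightarrow> 0) at_top"
proof -
  obtain R where R: "R > 0" "\<And>t. t \<ge> 0 \<Longrightarrow> \<bar>y t\<bar> \<le> R" "\<And>t. t \<ge> 0 \<Longrightarrow> \<bar>y1 t\<bar> \<le> R" "\<And>t. t \<ge> 0 \<Longrightarrow> - R \<le> E t"
    using bounded_orbit by blast
  define k where "k = a * R + \<beta> * R + R powr \<alpha> * R"
  have k: "k > 0" using a b R by (auto simp: k_def intro!: add_pos_pos add_pos_nonneg)
  have y2: "\<bar>- a * y1 t + (\<beta> * y t - \<bar>y t\<bar> powr \<alpha> * y t)\<bar> \<le> k" if "t \<ge> 0" for t
  proof -
    have "\<bar>a * y1 t\<bar> \<le> a * R" "\<bar>\<beta> * y t\<bar> \<le> \<beta> * R" "\<bar>\<bar>y t\<bar> powr \<alpha> * y t\<bar> \<le> R powr \<alpha> * R"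
      using R that a b al by (auto simp: abs_mult intro!: mult_mono powr_mono2)
    then show ?thesis unfolding k_def by linarith
  qed
  obtain l where l: "((\<lambda>t. - E t) \<longlongrightarrow> l) at_top"
    using increasing_bounded_tendsto_at_top[of 0 "\<lambda>t. - E t" R] E_decreasing R(4) by (metis minus_le_iff neg_le_iff_le)
  show ?thesis
  proof (rule tendstoI)
    fix e :: real assume e: "e > 0"
    define h where "h = e / (2 * k)"
    have h: "h > 0" using e k by (simp add: h_def)
    define d where "d = h * (a * (e / 2)\<^sup>2) / 2"
    have d: "d > 0" using h a e by (simp add: d_def)
    have "\<forall>\<^sub>F t in at_top. dist (- E t) l < d" using l d by (rule tendstoD)
    then obtain t0 where t0: "\<And>t. t \<ge> t0 \<Longrightarrow> dist (- E t) l < d"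
      by (auto simp: eventually_at_top_linorder)
    show "\<forall>\<^sub>F t in at_top. dist (y1 t) 0 < e"
      using eventually_ge_at_top[of "max t0 0"]
    proof eventually_elim
      case (elim t)
      show ?case
      proof (rule ccontr)
        assume "\<not> dist (y1 t) 0 < e"
        then have big: "\<bar>y1 t\<bar> \<ge> e" by simp
        obtain z where z: "t < z" "z < t + h" "E (t + h) - E t = h * (- a * (y1 z)\<^sup>2)"
          using MVT2[of t "t + h" E "\<lambda>t. - a * (y1 t)\<^sup>2"] E_deriv h by auto
        obtain w where w: "t < w" "w < z" "y1 z - y1 t = (z - t) * (- a * y1 w + (\<beta> * y w - \<bar>y w\<bar> powr \<alpha> * y w))"
          using MVT2[of t z y1 "\<lambda>t. - a * y1 t + (\<beta> * y t - \<bar>y t\<bar> powr \<alpha> * y t)"] dy1 z by auto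
        have "\<bar>y1 z - y1 t\<bar> \<le> h * k"
          unfolding w(3) abs_mult using z w elim y2[of w] h by (intro mult_mono) auto
        also have "h * k = e / 2" using k by (simp add: h_def)
        finally have "\<bar>y1 z\<bar> \<ge> e / 2" using big by linarith
        then have "(e / 2)\<^sup>2 \<le> (y1 z)\<^sup>2" using e abs_le_square_iff[of "e / 2" "y1 z"] by simp
        then have "h * (a * (e / 2)\<^sup>2) \<le> h * (a * (y1 z)\<^sup>2)" using h a by (intro mult_left_mono) auto
        then have "2 * d \<le> E t - E (t + h)" using z(3) by (simp add: d_def algebra_simps)
        moreover have "dist (- E t) l < d" "dist (- E (t + h)) l < d" using t0 elim h by auto
        ultimately show False unfolding dist_real_def by linarith
      qed
    qed
  qed
qed

text \<open>Over a unit time interval both \<open>y1\<close> and its increment are small at late times; the mean value theorem and the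
  equation give a point where \<open>F (y)\<close> is small, and \<open>y\<close> hardly moves on the interval.\<close>
lemma F_y_tendsto_0: "((\<lambda>t. F (y t)) \<longlongrightarrow> 0) at_top"
proof (rule tendstoI)
  fix e :: real assume e: "e > 0"
  obtain R where R: "R > 0" "\<And>t. t \<ge> 0 \<Longrightarrow> \<bar>y t\<bar> \<le> R" "\<And>t. t \<ge> 0 \<Longrightarrow> \<bar>y1 t\<bar> \<le> R" "\<And>t. t \<ge> 0 \<Longrightarrow> - R \<le> E t"
    using bounded_orbit by blast
  have "uniformly_continuous_on {-R..R} F"
    by (intro compact_uniformly_continuous F_cont) auto
  then obtain d where d: "d > 0" "\<And>u w. u \<in> {-R..R} \<Longrightarrow> w \<in> {-R..R} \<Longrightarrow> dist u w < d \<Longrightarrow> dist (F u) (F w) < e / 2"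
    using e unfolding uniformly_continuous_on_def by (metis half_gt_zero)
  define c where "c = min d (e / (2 * (2 + a)))"
  have c: "c > 0" using d e a by (simp add: c_def)
  obtain t0 where t0: "\<And>t. t \<ge> t0 \<Longrightarrow> dist (y1 t) 0 < c"
    using tendstoD[OF y1_tendsto_0 c] by (auto simp: eventually_at_top_linorder)
  show "\<forall>\<^sub>F t in at_top. dist (F (y t)) 0 < e"
    using eventually_ge_at_top[of "max t0 0"]
  proof eventually_elim
    case (elim t)
    obtain z where z: "t < z" "z < t + 1" "y1 (t + 1) - y1 t = - a * y1 z + F (y z)"
      using MVT2[of t "t + 1" y1 "\<lambda>t. - a * y1 t + (\<beta> * y t - \<bar>y t\<bar> powr \<alpha> * y t)"] dy1 by (auto simp: F_def)
    obtain w where w: "t < w" "w < z" "y z - y t = (z - t) * y1 w"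
      using MVT2[of t z y y1] dy z by auto
    have c1: "\<bar>y1 (t + 1)\<bar> < c" "\<bar>y1 t\<bar> < c" "\<bar>y1 z\<bar> < c" "\<bar>y1 w\<bar> < c"
      using t0[of "t + 1"] t0[of t] t0[of z] t0[of w] elim z w by auto
    have "\<bar>a * y1 z\<bar> \<le> a * c" using c1 a by (auto simp: abs_mult intro!: mult_left_mono)
    then have "\<bar>F (y z)\<bar> \<le> (2 + a) * c" using z(3) c1 by (simp add: algebra_simps)
    also have "\<dots> \<le> (2 + a) * (e / (2 * (2 + a)))" using a by (intro mult_left_mono) (auto simp: c_def)
    also have "\<dots> = e / 2" using a by (simp add: field_simps)
    finally have 1: "\<bar>F (y z)\<bar> \<le> e / 2" .
    have "\<bar>y z - y t\<bar> \<le> 1 * \<bar>y1 w\<bar>" unfolding w(3) abs_mult using z by (intro mult_right_mono) auto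
    then have "dist (y z) (y t) < d" using c1 by (simp add: dist_real_def c_def)
    then have "dist (F (y z)) (F (y t)) < e / 2"
      using R(2)[of z] R(2)[of t] z elim by (intro d) (auto simp: abs_le_iff)
    then show ?case using 1 unfolding dist_real_def by argo
  qed
qed

text \<open>Late in time the orbit cannot take the values \<open>\<plusminus>ystar / 2\<close>, where \<open>F\<close> is not small, so it is trapped by
  continuity in a region with a single zero of \<open>F\<close>.\<close>
lemma orbit_limits: "(y \<longlongrightarrow> 0) at_top \<or> (y \<longlongrightarrow> ystar) at_top \<or> (y \<longlongrightarrow> - ystar) at_top"
proof -
  define m where "m = ystar / 2"
  have m: "0 < m" "m powr \<alpha> < \<beta>"
    using ystar al powr_less_mono2[of \<alpha> m ystar] by (auto simp: m_def)
  have Fm: "0 < F m" "F (- m) = - F m" using m by (auto simp: F_def algebra_simps)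
  obtain t1 where t1: "\<And>t. t \<ge> t1 \<Longrightarrow> dist (F (y t)) 0 < F m"
    using tendstoD[OF F_y_tendsto_0 Fm(1)] by (auto simp: eventually_at_top_linorder)
  have ne: "\<bar>y t\<bar> \<noteq> m" if "t \<ge> t1" for t
    using t1[OF that] Fm by (auto simp: abs_if split: if_splits)
  have cy: "continuous_on S y" for S by (rule DERIV_imp_continuous_on[OF dy])
  have Fz: "((\<lambda>t. \<bar>F (y t)\<bar> / c) \<longlongrightarrow> 0) at_top" if "c > 0" for c
    using tendsto_divide[OF tendsto_rabs[OF F_y_tendsto_0] tendsto_const[of c]] that by simp
  have out: "((\<lambda>t. \<bar>y t\<bar>) \<longlongrightarrow> ystar) at_top" if big: "\<And>t. t \<ge> t1 \<Longrightarrow> m < \<bar>y t\<bar>"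
  proof -
    have "((\<lambda>t. \<bar>y t\<bar> powr \<alpha> - \<beta>) \<longlongrightarrow> 0) at_top"
    proof (rule Lim_null_comparison[OF _ Fz[OF m(1)]])
      show "\<forall>\<^sub>F t in at_top. norm (\<bar>y t\<bar> powr \<alpha> - \<beta>) \<le> \<bar>F (y t)\<bar> / m"
        using eventually_ge_at_top[of t1]
      proof eventually_elim
        case (elim t)
        have "\<bar>F (y t)\<bar> = \<bar>y t\<bar> * \<bar>\<bar>y t\<bar> powr \<alpha> - \<beta>\<bar>"
          by (simp add: F_def abs_mult[symmetric] algebra_simps abs_minus_commute)
        moreover have "m * \<bar>\<bar>y t\<bar> powr \<alpha> - \<beta>\<bar> \<le> \<bar>y t\<bar> * \<bar>\<bar>y t\<bar> powr \<alpha> - \<beta>\<bar>"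
          using big[OF elim] by (intro mult_right_mono) auto
        ultimately show ?case using m by (simp add: field_simps)
      qed
    qed
    then have "((\<lambda>t. \<bar>y t\<bar> powr \<alpha>) \<longlongrightarrow> \<beta>) at_top" by (simp add: LIM_zero_iff)
    then have "((\<lambda>t. (\<bar>y t\<bar> powr \<alpha>) powr (1 / \<alpha>)) \<longlongrightarrow> \<beta> powr (1 / \<alpha>)) at_top"
      using b by (intro tendsto_powr tendsto_const) auto
    then show ?thesis using al by (simp add: powr_powr ystar_def)
  qed
  have const: "(y t1 < c \<and> y t < c) \<or> (y t1 > c \<and> y t > c)" if "t \<ge> t1" "\<bar>c\<bar> = m" for t c
  proof (rule ccontr)
    assume "\<not> ?thesis"
    moreover have "y t1 \<noteq> c" "y t \<noteq> c" using ne[of t1] ne[of t] that by auto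
    ultimately have "y t1 \<le> c \<and> c \<le> y t \<or> y t \<le> c \<and> c \<le> y t1" by linarith
    then have "\<exists>s\<ge>t1. s \<le> t \<and> y s = c"
      using IVT'[of y t1 c t, OF _ _ that(1) cy] IVT2'[of y t c t1, OF _ _ that(1) cy] by (elim disjE conjE) auto
    then show False using ne that by auto
  qed
  consider "y t1 > m" | "y t1 < - m" | "\<bar>y t1\<bar> < m" using ne[of t1] by fastforce
  then show ?thesis
  proof cases
    case 1
    then have p: "y t > m" if "t \<ge> t1" for t using const[OF that, of m] m by auto
    have "((\<lambda>t. \<bar>y t\<bar>) \<longlongrightarrow> ystar) at_top" by (rule out) (use p m in force)
    then have "(y \<longlongrightarrow> ystar) at_top"
      by (rule Lim_transform_eventually) (use eventually_ge_at_top[of t1] p m in \<open>force elim!: eventually_mono\<close>)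
    then show ?thesis by blast
  next
    case 2
    then have p: "y t < - m" if "t \<ge> t1" for t using const[OF that, of "- m"] m by auto
    have "((\<lambda>t. \<bar>y t\<bar>) \<longlongrightarrow> ystar) at_top" by (rule out) (use p m in force)
    then have "((\<lambda>t. - y t) \<longlongrightarrow> ystar) at_top"
      by (rule Lim_transform_eventually) (use eventually_ge_at_top[of t1] p m in \<open>force elim!: eventually_mono\<close>)
    then have "(y \<longlongrightarrow> - ystar) at_top" using tendsto_minus by fastforce
    then show ?thesis by blast
  next
    case 3
    then have p: "\<bar>y t\<bar> < m" if "t \<ge> t1" for t using const[OF that, of m] const[OF that, of "- m"] m by auto
    have "(y \<longlongrightarrow> 0) at_top"
    proof (rule Lim_null_comparison[OF _ Fz[of "\<beta> - m powr \<alpha>"]])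
      show "\<forall>\<^sub>F t in at_top. norm (y t) \<le> \<bar>F (y t)\<bar> / (\<beta> - m powr \<alpha>)"
        using eventually_ge_at_top[of t1]
      proof eventually_elim
        case (elim t)
        have "\<bar>y t\<bar> powr \<alpha> \<le> m powr \<alpha>" using p[OF elim] al by (intro powr_mono2) auto
        then have "\<bar>y t\<bar> * (\<beta> - m powr \<alpha>) \<le> \<bar>y t\<bar> * \<bar>\<beta> - \<bar>y t\<bar> powr \<alpha>\<bar>"
          by (intro mult_left_mono) auto
        also have "\<dots> = \<bar>F (y t)\<bar>" by (simp add: F_def abs_mult[symmetric] algebra_simps)
        finally show ?case using m by (simp add: field_simps)
      qed
    qed (use m in auto)
    then show ?thesis by blast
  qed
qed

text \<open>The hypotheses on \<open>k1, k2\<close> say that the linearisation \<open>z'' + a z' + \<alpha> \<beta> z = 0\<close> at \<open>ystar\<close> has the exponents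
  \<open>- k1\<close> and \<open>- k2\<close>. Factoring the operator as \<open>(d/dt + k2) (d/dt + k1)\<close> gives a triangular system for \<open>z\<close> and
  \<open>p = z' + k1 z\<close>, in which a weighted sum of squares decays at the rate \<open>m\<close>.\<close>
lemma exponential_convergence:
  assumes lim: "(y \<longlongrightarrow> ystar) at_top" and k: "k1 > 0" "k2 > 0" "k1 + k2 = a" "k1 * k2 = \<alpha> * \<beta>"
  shows "\<exists>C m t0. m > 0 \<and> (\<forall>t\<ge>t0. \<bar>y t - ystar\<bar> \<le> C * exp (- m * t))"
proof -
  define m where "m = min k1 k2"
  have m: "m > 0" "m \<le> k1" "m \<le> k2" using k by (auto simp: m_def)
  define c where "c = m / 2"
  define \<epsilon> where "\<epsilon> = c * m / 2"
  have c: "c > 0" and eps: "\<epsilon> > 0" using m by (auto simp: c_def \<epsilon>_def)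
  have Fs: "F ystar = 0" using ystar by (simp add: F_def)
  have dF: "(F has_real_derivative - (\<alpha> * \<beta>)) (at ystar)"
  proof -
    have "((\<lambda>u. \<beta> * u - u powr (\<alpha> + 1)) has_real_derivative \<beta> - (\<alpha> + 1) * ystar powr (\<alpha> + 1 - 1)) (at ystar)"
      using ystar by (auto intro!: derivative_eq_intros has_real_derivative_powr)
    then have "(F has_real_derivative \<beta> - (\<alpha> + 1) * ystar powr (\<alpha> + 1 - 1)) (at ystar)"
      by (rule DERIV_cong_ev[THEN iffD1, OF refl _ refl, rotated])
         (use eventually_nhds_in_open[of "{0<..}" ystar] ystar in \<open>auto elim!: eventually_mono simp: F_def powr_add\<close>)
    then show ?thesis using ystar by (simp add: algebra_simps)
  qed
  have "\<forall>\<^sub>F u in nhds ystar. \<bar>F u + \<alpha> * \<beta> * (u - ystar)\<bar> \<le> \<epsilon> * \<bar>u - ystar\<bar>"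
  proof -
    have "\<forall>\<^sub>F u in at ystar. norm (F u - F ystar - (- (\<alpha> * \<beta>)) * (u - ystar)) \<le> \<epsilon> * norm (u - ystar)"
      using dF[unfolded has_field_derivative_def, THEN has_derivative_within_alt2[THEN iffD1]] eps by blast
    then show ?thesis
      unfolding eventually_at_filter
    proof (rule eventually_mono)
      fix u assume "u \<noteq> ystar \<longrightarrow> u \<in> UNIV \<longrightarrow> norm (F u - F ystar - (- (\<alpha> * \<beta>)) * (u - ystar)) \<le> \<epsilon> * norm (u - ystar)"
      then show "\<bar>F u + \<alpha> * \<beta> * (u - ystar)\<bar> \<le> \<epsilon> * \<bar>u - ystar\<bar>"
        using Fs by (cases "u = ystar") auto
    qed
  qed
  then have "\<forall>\<^sub>F t in at_top. \<bar>F (y t) + \<alpha> * \<beta> * (y t - ystar)\<bar> \<le> \<epsilon> * \<bar>y t - ystar\<bar>"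
    using lim unfolding filterlim_def le_filter_def eventually_filtermap by blast
  then obtain t0 where t0: "\<And>t. t \<ge> t0 \<Longrightarrow> \<bar>F (y t) + \<alpha> * \<beta> * (y t - ystar)\<bar> \<le> \<epsilon> * \<bar>y t - ystar\<bar>"
    by (auto simp: eventually_at_top_linorder)
  define z where "z = (\<lambda>t. y t - ystar)"
  define p where "p = (\<lambda>t. y1 t + k1 * z t)"
  define \<omega> where "\<omega> = (\<lambda>t. F (y t) + \<alpha> * \<beta> * z t)"
  have dz: "(z has_real_derivative p t - k1 * z t) (at t)" for t
    unfolding z_def p_def by (auto intro!: derivative_eq_intros dy)
  have dp: "(p has_real_derivative - k2 * p t + \<omega> t) (at t)" for t
  proof -
    have "(p has_real_derivative (- a * y1 t + (\<beta> * y t - \<bar>y t\<bar> powr \<alpha> * y t)) + k1 * (p t - k1 * z t)) (at t)"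
      unfolding p_def using dz[of t] by (auto intro!: derivative_eq_intros dy1 simp: p_def)
    moreover have "(- a * y1 t + F (y t)) + k1 * (p t - k1 * z t) = - k2 * p t + \<omega> t"
    proof -
      have "\<alpha> * \<beta> = k1 * k2" "a = k1 + k2" using k by auto
      then show ?thesis unfolding p_def \<omega>_def by (simp add: algebra_simps)
    qed
    ultimately show ?thesis by (simp add: F_def)
  qed
  \<comment> \<open>the small weight \<open>c\<close> absorbs the coupling of \<open>z\<close> to \<open>p\<close>\<close>
  define q where "q = (\<lambda>t. (p t)\<^sup>2 + c\<^sup>2 * (z t)\<^sup>2)"
  define q' where "q' = (\<lambda>t. 2 * p t * (- k2 * p t + \<omega> t) + c\<^sup>2 * (2 * z t * (p t - k1 * z t)))"
  have dq: "(q has_real_derivative q' t) (at t)" for t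
    unfolding q_def q'_def by (auto intro!: derivative_eq_intros dp dz simp: algebra_simps)
  have q': "q' t \<le> - m * q t" if "t \<ge> t0" for t
  proof -
    let ?A = "\<bar>p t\<bar>" and ?B = "c * \<bar>z t\<bar>"
    have sq: "2 * (?A * ?B) \<le> q t"
      using zero_le_power2[of "?A - ?B"] by (simp add: q_def power2_diff power_mult_distrib)
    have "\<omega> t * p t \<le> \<bar>\<omega> t\<bar> * ?A" by (simp add: abs_mult[symmetric])
    also have "\<dots> \<le> (\<epsilon> * \<bar>z t\<bar>) * ?A" using t0[OF that] by (intro mult_right_mono) (auto simp: \<omega>_def z_def)
    finally have 1: "2 * (\<omega> t * p t) \<le> m / 2 * (2 * (?A * ?B))" by (simp add: \<epsilon>_def algebra_simps)
    have "c * (c * (z t * p t)) \<le> c * (c * (\<bar>z t\<bar> * \<bar>p t\<bar>))"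
      using c by (intro mult_left_mono) (auto simp: abs_mult[symmetric])
    then have 2: "2 * (c * (c * (z t * p t))) \<le> m / 2 * (2 * (?A * ?B))" by (simp add: c_def algebra_simps)
    have 3: "m * (p t)\<^sup>2 \<le> k2 * (p t)\<^sup>2" "m * (c\<^sup>2 * (z t)\<^sup>2) \<le> k1 * (c\<^sup>2 * (z t)\<^sup>2)"
      using m by (auto intro!: mult_right_mono)
    have "m / 2 * (2 * (?A * ?B)) \<le> m / 2 * q t" using sq m by (intro mult_left_mono) auto
    then have 4: "2 * (\<omega> t * p t) + 2 * (c * (c * (z t * p t))) \<le> m * q t" using 1 2 by linarith
    have "q' t = - 2 * (k2 * (p t)\<^sup>2) - 2 * (k1 * (c\<^sup>2 * (z t)\<^sup>2)) + (2 * (\<omega> t * p t) + 2 * (c * (c * (z t * p t))))"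
      by (simp add: q'_def power2_eq_square algebra_simps)
    moreover have "2 * (m * q t) = 2 * (m * (p t)\<^sup>2) + 2 * (m * (c\<^sup>2 * (z t)\<^sup>2))"
      by (simp add: q_def algebra_simps)
    ultimately show ?thesis using 3 4 by linarith
  qed
  have dec: "q t * exp (m * t) \<le> q t0 * exp (m * t0)" if "t \<ge> t0" for t
  proof (rule DERIV_nonpos_imp_nonincreasing[OF that])
    fix s assume s: "t0 \<le> s" "s \<le> t"
    have "((\<lambda>t. q t * exp (m * t)) has_real_derivative (q' s + m * q s) * exp (m * s)) (at s)"
      by (auto intro!: derivative_eq_intros dq simp: algebra_simps)
    moreover have "(q' s + m * q s) * exp (m * s) \<le> 0"
      using q'[OF s(1)] by (intro mult_nonpos_nonneg) auto
    ultimately show "\<exists>y. ((\<lambda>t. q t * exp (m * t)) has_real_derivative y) (at s) \<and> y \<le> 0" by blast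
  qed
  define K where "K = q t0 * exp (m * t0)"
  have K: "K \<ge> 0" by (simp add: K_def q_def)
  have "\<bar>z t\<bar> \<le> sqrt K / c * exp (- (m / 2) * t)" if "t \<ge> t0" for t
  proof -
    have "q t \<le> K * exp (- (m * t))"
      using dec[OF that] by (simp add: K_def exp_minus field_simps)
    moreover have "(c * \<bar>z t\<bar>)\<^sup>2 = q t - (p t)\<^sup>2" by (simp add: q_def power_mult_distrib)
    ultimately have "(c * \<bar>z t\<bar>)\<^sup>2 \<le> K * exp (- (m * t))"
      using zero_le_power2[of "p t"] by linarith
    also have "\<dots> = (sqrt K * exp (- (m / 2) * t))\<^sup>2"
    proof -
      have "exp (- (m * t)) = (exp (- (m / 2) * t))\<^sup>2"
        unfolding power2_eq_square mult_exp_exp by (rule arg_cong[where f=exp]) simp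
      then show ?thesis using K by (simp add: power_mult_distrib)
    qed
    finally have "c * \<bar>z t\<bar> \<le> sqrt K * exp (- (m / 2) * t)"
      by (rule power2_le_imp_le) (use K in auto)
    then show ?thesis using c by (simp add: field_simps)
  qed
  then show ?thesis using m unfolding z_def by (intro exI[of _ "sqrt K / c"] exI[of _ "m / 2"] exI[of _ t0]) auto
qed

text \<open>At the saddle \<open>0\<close> the exponents are \<open>- \<rho>\<close> and \<open>\<mu>\<close>. The component \<open>p = y1 + \<rho> y\<close> along the growing direction
  tends to \<open>0\<close>, which is possible only if it is dominated by \<open>y\<close>: otherwise \<open>p\<^sup>2 - \<epsilon>\<^sup>2 y\<^sup>2\<close>, which increases, would
  stay positive. Then \<open>y\<close> decays almost like \<open>exp (- \<rho> t)\<close>, the nonlinearity and with it \<open>p\<close> decay strictly faster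
  than that, and the derivative \<open>exp (\<rho> t) * p t\<close> of \<open>exp (\<rho> t) * y t\<close> is integrable.\<close>
lemma decaying_orbit_asymptotics:
  assumes lim: "(y \<longlongrightarrow> 0) at_top" and lm: "\<rho> > 0" "\<mu> > 0" "a = \<rho> - \<mu>" "\<beta> = \<rho> * \<mu>"
  shows "\<exists>l. ((\<lambda>t. exp (\<rho> * t) * y t) \<longlongrightarrow> l) at_top"
proof -
  \<comment> \<open>small enough that \<open>k' = (\<rho> - \<epsilon>) (1 + \<alpha>)\<close>, the decay rate of the nonlinearity, exceeds \<open>\<rho>\<close>\<close>
  define \<epsilon> where "\<epsilon> = min (\<mu> / 2) (min (\<rho> / 2) (\<rho> * \<alpha> / (2 * (1 + \<alpha>))))"
  have e: "\<epsilon> > 0" "\<epsilon> \<le> \<mu> / 2" "\<epsilon> \<le> \<rho> / 2" "\<epsilon> \<le> \<rho> * \<alpha> / (2 * (1 + \<alpha>))"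
  proof -
    show "\<epsilon> > 0" using lm al by (simp add: \<epsilon>_def)
    show "\<epsilon> \<le> \<mu> / 2" unfolding \<epsilon>_def by (rule min.cobounded1)
    show "\<epsilon> \<le> \<rho> / 2" unfolding \<epsilon>_def by (rule order_trans[OF min.cobounded2 min.cobounded1])
    show "\<epsilon> \<le> \<rho> * \<alpha> / (2 * (1 + \<alpha>))" unfolding \<epsilon>_def by (rule order_trans[OF min.cobounded2 min.cobounded2])
  qed
  define k where "k = \<rho> - \<epsilon>"
  define k' where "k' = k * (1 + \<alpha>)"
  have k': "k' > \<rho>"
  proof -
    have "\<epsilon> * (1 + \<alpha>) \<le> \<rho> * \<alpha> / (2 * (1 + \<alpha>)) * (1 + \<alpha>)" using e al by (intro mult_right_mono) auto
    also have "\<dots> = \<rho> * \<alpha> / 2" using al by (simp add: field_simps)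
    finally have "k' \<ge> \<rho> * (1 + \<alpha>) - \<rho> * \<alpha> / 2" by (simp add: k'_def k_def algebra_simps)
    moreover have "\<rho> * \<alpha> > 0" using lm al by simp
    ultimately show ?thesis by (simp add: algebra_simps)
  qed
  define p where "p = (\<lambda>t. y1 t + \<rho> * y t)"
  have dy': "(y has_real_derivative p t - \<rho> * y t) (at t)" for t
    unfolding p_def using dy by simp
  have dp: "(p has_real_derivative \<mu> * p t - \<bar>y t\<bar> powr \<alpha> * y t) (at t)" for t
    unfolding p_def using lm by (auto intro!: derivative_eq_intros dy dy1 simp: algebra_simps)
  have pz: "(p \<longlongrightarrow> 0) at_top"
    unfolding p_def using tendsto_add[OF y1_tendsto_0 tendsto_mult[OF tendsto_const[of \<rho>] lim]] by simp
  have "((\<lambda>t. \<bar>y t\<bar> powr \<alpha>) \<longlongrightarrow> \<bar>0\<bar> powr \<alpha>) at_top"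
    using al by (intro tendsto_powr' tendsto_rabs lim tendsto_const) auto
  then have "((\<lambda>t. \<bar>y t\<bar> powr \<alpha>) \<longlongrightarrow> 0) at_top" by simp
  then have "\<forall>\<^sub>F t in at_top. \<bar>y t\<bar> powr \<alpha> < \<epsilon>\<^sup>2" using e(1) by (intro order_tendstoD(2)) auto
  then obtain t0 where t0: "\<And>t. t \<ge> t0 \<Longrightarrow> \<bar>y t\<bar> powr \<alpha> < \<epsilon>\<^sup>2"
    by (auto simp: eventually_at_top_linorder)
  define q where "q = (\<lambda>t. (p t)\<^sup>2 - \<epsilon>\<^sup>2 * (y t)\<^sup>2)"
  define q' where "q' = (\<lambda>t. 2 * p t * (\<mu> * p t - \<bar>y t\<bar> powr \<alpha> * y t) - \<epsilon>\<^sup>2 * (2 * y t * (p t - \<rho> * y t)))"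
  have dq: "(q has_real_derivative q' t) (at t)" for t
    unfolding q_def q'_def by (auto intro!: derivative_eq_intros dp dy' simp: algebra_simps)
  have q': "q' t \<ge> 0" if "t \<ge> t0" for t
  proof -
    let ?W = "\<bar>y t\<bar> powr \<alpha>"
    have "(?W + \<epsilon>\<^sup>2) * (y t * p t) \<le> (?W + \<epsilon>\<^sup>2) * (\<bar>y t\<bar> * \<bar>p t\<bar>)"
      by (intro mult_left_mono) (auto simp: abs_mult[symmetric])
    also have "\<dots> \<le> (2 * \<epsilon>\<^sup>2) * (\<bar>y t\<bar> * \<bar>p t\<bar>)"
      using t0[OF that] by (intro mult_right_mono) auto
    also have "\<dots> = \<epsilon> * (2 * (\<bar>p t\<bar> * (\<epsilon> * \<bar>y t\<bar>)))" by (simp add: power2_eq_square)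
    also have "\<dots> \<le> \<epsilon> * ((p t)\<^sup>2 + (\<epsilon> * \<bar>y t\<bar>)\<^sup>2)"
      using e zero_le_power2[of "\<bar>p t\<bar> - \<epsilon> * \<bar>y t\<bar>"] by (intro mult_left_mono) (auto simp: power2_diff)
    finally have 1: "(?W + \<epsilon>\<^sup>2) * (y t * p t) \<le> \<epsilon> * (p t)\<^sup>2 + \<epsilon> * (\<epsilon>\<^sup>2 * (y t)\<^sup>2)"
      by (simp add: power_mult_distrib algebra_simps)
    have 2: "\<epsilon> * (p t)\<^sup>2 \<le> \<mu> * (p t)\<^sup>2" "\<epsilon> * (\<epsilon>\<^sup>2 * (y t)\<^sup>2) \<le> \<rho> * (\<epsilon>\<^sup>2 * (y t)\<^sup>2)"
      using e lm by (auto intro!: mult_right_mono)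
    have "q' t = 2 * (\<mu> * (p t)\<^sup>2) + 2 * (\<rho> * (\<epsilon>\<^sup>2 * (y t)\<^sup>2)) - 2 * ((?W + \<epsilon>\<^sup>2) * (y t * p t))"
      by (simp add: q'_def power2_eq_square algebra_simps)
    then show ?thesis using 1 2 by linarith
  qed
  have qlim: "(q \<longlongrightarrow> 0) at_top"
    unfolding q_def using tendsto_diff[OF tendsto_power[OF pz, of 2] tendsto_mult[OF tendsto_const[of "\<epsilon>\<^sup>2"] tendsto_power[OF lim, of 2]]] by simp
  have qneg: "q t \<le> 0" if "t \<ge> t0" for t
  proof (rule tendsto_lowerbound[OF qlim])
    show "\<forall>\<^sub>F s in at_top. q t \<le> q s"
      using eventually_ge_at_top[of t]
    proof eventually_elim
      case (elim s)
      show ?case by (rule DERIV_nonneg_imp_nondecreasing[OF elim]) (use dq q' that in force)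
    qed
  qed simp
  have pe: "\<bar>p t\<bar> \<le> \<epsilon> * \<bar>y t\<bar>" if "t \<ge> t0" for t
    by (rule power2_le_imp_le) (use qneg[OF that] e in \<open>auto simp: q_def power_mult_distrib\<close>)
  have dec: "(y t)\<^sup>2 * exp (2 * k * t) \<le> (y t0)\<^sup>2 * exp (2 * k * t0)" if "t \<ge> t0" for t
  proof (rule DERIV_nonpos_imp_nonincreasing[OF that])
    fix s assume s: "t0 \<le> s" "s \<le> t"
    have "((\<lambda>t. (y t)\<^sup>2 * exp (2 * k * t)) has_real_derivative (2 * (y s * p s) - 2 * \<epsilon> * (y s)\<^sup>2) * exp (2 * k * s)) (at s)"
      by (auto intro!: derivative_eq_intros dy' simp: algebra_simps k_def power2_eq_square)
    moreover have "(2 * (y s * p s) - 2 * \<epsilon> * (y s)\<^sup>2) * exp (2 * k * s) \<le> 0"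
    proof -
      have "y s * p s \<le> \<bar>y s\<bar> * \<bar>p s\<bar>" by (simp add: abs_mult[symmetric])
      also have "\<dots> \<le> \<bar>y s\<bar> * (\<epsilon> * \<bar>y s\<bar>)" using pe[OF s(1)] by (intro mult_left_mono) auto
      also have "\<dots> = \<epsilon> * (y s)\<^sup>2" by (simp add: power2_eq_square abs_mult[symmetric])
      finally show ?thesis by (intro mult_nonpos_nonneg) auto
    qed
    ultimately show "\<exists>d. ((\<lambda>t. (y t)\<^sup>2 * exp (2 * k * t)) has_real_derivative d) (at s) \<and> d \<le> 0" by blast
  qed
  define C where "C = \<bar>y t0\<bar> * exp (k * t0)"
  have C: "C \<ge> 0" by (simp add: C_def)
  have yb: "\<bar>y t\<bar> \<le> C * exp (- (k * t))" if "t \<ge> t0" for t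
  proof -
    have ek: "exp (2 * k * s) = (exp (k * s))\<^sup>2" for s by (simp add: power2_eq_square exp_add[symmetric])
    have "(\<bar>y t\<bar> * exp (k * t))\<^sup>2 \<le> C\<^sup>2"
      using dec[OF that] unfolding ek C_def by (simp add: power_mult_distrib)
    then have "\<bar>y t\<bar> * exp (k * t) \<le> C" by (rule power2_le_imp_le[OF _ C])
    then show ?thesis by (simp add: exp_minus field_simps)
  qed
  define K where "K = C powr (1 + \<alpha>)"
  have nl: "\<bar>\<bar>y t\<bar> powr \<alpha> * y t\<bar> \<le> K * exp (- (k' * t))" if "t \<ge> t0" for t
  proof -
    have "\<bar>\<bar>y t\<bar> powr \<alpha> * y t\<bar> = \<bar>y t\<bar> powr (1 + \<alpha>)" by (cases "y t = 0") (auto simp: abs_mult powr_add)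
    also have "\<dots> \<le> (C * exp (- (k * t))) powr (1 + \<alpha>)" using yb[OF that] al by (intro powr_mono2) auto
    also have "\<dots> = K * exp (- (k' * t))"
      using C by (simp add: K_def powr_mult k'_def exp_powr_real algebra_simps)
    finally show ?thesis .
  qed
  define K2 where "K2 = K / (\<mu> + k')"
  have k'p: "\<mu> + k' > 0" using k' lm by simp
  have half: "\<sigma> * p t \<le> K2 * exp (- (k' * t))" if t: "t \<ge> t0" and \<sigma>: "\<bar>\<sigma>\<bar> = 1" for t \<sigma>
  proof -
    \<comment> \<open>\<open>S\<close> increases to \<open>0\<close>; the two signs of \<open>\<sigma>\<close> bound \<open>p\<close> from both sides\<close>
    define S where "S = (\<lambda>t. exp (- (\<mu> * t)) * (\<sigma> * p t) - K2 * exp (- ((\<mu> + k') * t)))"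
    have dS: "(S has_real_derivative exp (- (\<mu> * s)) * (K * exp (- (k' * s)) - \<sigma> * (\<bar>y s\<bar> powr \<alpha> * y s))) (at s)" for s
    proof -
      have d1: "(S has_real_derivative exp (- (\<mu> * s)) * (\<sigma> * (\<mu> * p s - \<bar>y s\<bar> powr \<alpha> * y s)) - \<mu> * exp (- (\<mu> * s)) * (\<sigma> * p s) + K2 * (\<mu> + k') * exp (- ((\<mu> + k') * s))) (at s)"
        unfolding S_def by (auto intro!: derivative_eq_intros dp simp: algebra_simps)
      have e1: "K2 * (\<mu> + k') = K" using k'p by (simp add: K2_def)
      have e2: "exp (- ((\<mu> + k') * s)) = exp (- (\<mu> * s)) * exp (- (k' * s))"
        unfolding mult_exp_exp by (rule arg_cong[where f=exp]) (simp add: algebra_simps)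
      show ?thesis by (rule DERIV_cong[OF d1], simp only: e1 e2) (simp add: algebra_simps)
    qed
    have "(S \<longlongrightarrow> 0 * (\<sigma> * 0) - K2 * 0) at_top"
    proof -
      have ez: "((\<lambda>t. exp (- (c * t))) \<longlongrightarrow> 0) at_top" if "c > 0" for c :: real
        using that by real_asymp
      show ?thesis unfolding S_def using lm k'p
        by (intro tendsto_diff tendsto_mult ez tendsto_const pz) auto
    qed
    then have S0: "(S \<longlongrightarrow> 0) at_top" by simp
    have "S t \<le> 0"
    proof (rule tendsto_lowerbound[OF S0])
      show "\<forall>\<^sub>F s in at_top. S t \<le> S s"
        using eventually_ge_at_top[of t]
      proof eventually_elim
        case (elim s)
        show ?case
        proof (rule DERIV_nonneg_imp_nondecreasing[OF elim])
          fix r assume r: "t \<le> r" "r \<le> s"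
          have "\<sigma> * (\<bar>y r\<bar> powr \<alpha> * y r) \<le> \<bar>\<sigma>\<bar> * \<bar>\<bar>y r\<bar> powr \<alpha> * y r\<bar>" unfolding abs_mult[symmetric] by simp
          also have "\<dots> \<le> K * exp (- (k' * r))" using nl[of r] r t \<sigma> by simp
          finally show "\<exists>d. (S has_real_derivative d) (at r) \<and> 0 \<le> d"
            using dS[of r] by (intro exI conjI) auto
        qed
      qed
    qed simp
    then have "exp (- (\<mu> * t)) * (\<sigma> * p t) \<le> exp (- (\<mu> * t)) * (K2 * exp (- (k' * t)))"
      using mult_exp_exp[of "- (\<mu> * t)" "- (k' * t)"] by (simp add: S_def algebra_simps)
    then show ?thesis by simp
  qed
  have pb: "\<bar>p t\<bar> \<le> K2 * exp (- (k' * t))" if "t \<ge> t0" for t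
    using half[OF that, of 1] half[OF that, of "- 1"] by (simp add: abs_le_iff)
  define \<theta> where "\<theta> = k' - \<rho>"
  have th: "\<theta> > 0" using k' by (simp add: \<theta>_def)
  define v where "v = (\<lambda>t. exp (\<rho> * t) * y t)"
  have dv: "(v has_real_derivative exp (\<rho> * t) * p t) (at t)" for t
    unfolding v_def by (auto intro!: derivative_eq_intros dy' simp: algebra_simps)
  have vb: "\<bar>exp (\<rho> * t) * p t\<bar> \<le> K2 * exp (- (\<theta> * t))" if "t \<ge> t0" for t
  proof -
    have "\<bar>exp (\<rho> * t) * p t\<bar> \<le> exp (\<rho> * t) * (K2 * exp (- (k' * t)))"
      unfolding abs_mult using pb[OF that] by simp
    also have "\<dots> = K2 * (exp (\<rho> * t) * exp (- (k' * t)))" by simp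
    also have "exp (\<rho> * t) * exp (- (k' * t)) = exp (- (\<theta> * t))"
      unfolding mult_exp_exp by (rule arg_cong[where f=exp]) (simp add: \<theta>_def algebra_simps)
    finally show ?thesis .
  qed
  \<comment> \<open>correcting by the integral of the bound on its derivative makes \<open>exp (\<rho> t) y\<close> monotone\<close>
  define A where "A = (\<lambda>s t. v t + s * (K2 / \<theta>) * exp (- (\<theta> * t)))"
  have dA: "(A s has_real_derivative exp (\<rho> * t) * p t - s * (K2 * exp (- (\<theta> * t)))) (at t)" for s t
    unfolding A_def using th by (auto intro!: derivative_eq_intros dv simp: field_simps)
  have inc: "A (- 1) s \<le> A (- 1) t" if "t0 \<le> s" "s \<le> t" for s t
  proof (rule DERIV_nonneg_imp_nondecreasing[OF that(2)])
    fix r assume "s \<le> r" "r \<le> t"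
    then show "\<exists>d. (A (- 1) has_real_derivative d) (at r) \<and> 0 \<le> d"
      using dA[of "- 1" r] vb[of r] that by (intro exI conjI) (auto simp: abs_le_iff)
  qed
  have K20: "K2 \<ge> 0" using k'p by (simp add: K2_def K_def)
  have bd: "A (- 1) t \<le> A 1 t0" if "t0 \<le> t" for t
  proof -
    have "A 1 t \<le> A 1 t0"
    proof (rule DERIV_nonpos_imp_nonincreasing[OF that])
      fix r assume "t0 \<le> r" "r \<le> t"
      then show "\<exists>d. (A 1 has_real_derivative d) (at r) \<and> d \<le> 0"
        using dA[of 1 r] vb[of r] that by (intro exI conjI) (auto simp: abs_le_iff)
    qed
    moreover have "A (- 1) t \<le> A 1 t" using K20 th by (simp add: A_def)
    ultimately show ?thesis by linarith
  qed
  obtain l where l: "(A (- 1) \<longlongrightarrow> l) at_top"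
    using increasing_bounded_tendsto_at_top[of t0 "A (- 1)" "A 1 t0"] inc bd by blast
  have "((\<lambda>t. exp (- (\<theta> * t))) \<longlongrightarrow> 0) at_top" using th by real_asymp
  then have "((\<lambda>t. A (- 1) t + K2 / \<theta> * exp (- (\<theta> * t))) \<longlongrightarrow> l + K2 / \<theta> * 0) at_top"
    by (intro tendsto_add l tendsto_mult tendsto_const)
  then show ?thesis by (auto simp: A_def v_def)
qed

end

text \<open>With \<open>l = 2 / \<alpha>\<close> the upper bound on \<open>\<alpha>\<close> reads \<open>l - (N - 4) / 2 > sqrt (N - 1)\<close>. Squaring gives
  \<open>\<beta> (\<alpha> + 1) = (l + 2) (N - 2 - l) < (N - 2)\<^sup>2 / 4\<close>, so \<open>\<eta>\<close> is a real root of \<open>hardy N k = \<beta> (\<alpha> + 1)\<close>.\<close>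
lemma exponent_relations:
  fixes N :: nat and \<alpha> :: real
  assumes N: "N \<ge> 3" and al: "2 / (real N - 2) < \<alpha>" "\<alpha> < alpha0 N"
  shows "\<alpha> > 0" and "(real N - 2) / 2 < 2 / \<alpha>" and "2 / \<alpha> < real N - 2" and "beta N \<alpha> > 0"
    and "0 < eta N \<alpha>" and "eta N \<alpha> < (real N - 2) / 2"
    and "eta N \<alpha> * (real N - 2 - eta N \<alpha>) = beta N \<alpha> * (\<alpha> + 1)"
proof -
  define n where "n = real N"
  define l where "l = 2 / \<alpha>"
  have n: "n \<ge> 3" using N by (simp add: n_def)
  have "0 < 2 / (n - 2)" using n by simp
  then show a0: "\<alpha> > 0" using al(1) unfolding n_def by (rule less_trans)
  have l0: "l > 0" using a0 by (simp add: l_def)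
  have la: "l * \<alpha> = 2" using a0 by (simp add: l_def)
  show l1: "2 / \<alpha> < real N - 2"
    using al(1) a0 n by (simp add: n_def field_simps)
  have s: "sqrt (n - 1) > 1" using n by simp
  have al0: "\<alpha> < 4 / (n - 4 + 2 * sqrt (n - 1))" using al(2) by (simp add: alpha0_def n_def)
  have den: "n - 4 + 2 * sqrt (n - 1) > 0" using s n by linarith
  have "\<alpha> * (n - 4 + 2 * sqrt (n - 1)) < 4" using al0 den by (simp add: field_simps)
  then have l2: "(n - 4) / 2 + sqrt (n - 1) < l"
    using a0 by (simp add: l_def field_simps)
  then have "(n - 2) / 2 < l" using s by argo
  then show l3: "(real N - 2) / 2 < 2 / \<alpha>" by (simp add: l_def n_def)
  have bl: "beta N \<alpha> = l * (n - 2 - l)" by (simp add: beta_def l_def n_def)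
  show b0: "beta N \<alpha> > 0" unfolding bl using l0 l1 by (intro mult_pos_pos) (auto simp: l_def n_def)
  have ba: "beta N \<alpha> * (\<alpha> + 1) = (l + 2) * (n - 2 - l)"
  proof -
    have "beta N \<alpha> * (\<alpha> + 1) = (l * \<alpha> + l) * (n - 2 - l)" by (simp add: bl algebra_simps)
    then show ?thesis unfolding la by (simp add: add.commute)
  qed
  have "(sqrt (n - 1))\<^sup>2 < (l - (n - 4) / 2)\<^sup>2"
    using l2 s by (intro power_strict_mono) auto
  then have "n - 1 < (l - (n - 4) / 2)\<^sup>2" using n by simp
  then have disc: "beta N \<alpha> * (\<alpha> + 1) < (n - 2)\<^sup>2 / 4"
    unfolding ba by (simp add: power2_eq_square field_simps)
  define S where "S = sqrt ((n - 2)\<^sup>2 / 4 - beta N \<alpha> * (\<alpha> + 1))"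
  have S2: "S\<^sup>2 = (n - 2)\<^sup>2 / 4 - beta N \<alpha> * (\<alpha> + 1)" and S0: "S > 0"
    using disc by (auto simp: S_def)
  have eta: "eta N \<alpha> = (n - 2) / 2 - S" by (simp add: eta_def S_def n_def)
  have "S\<^sup>2 < ((n - 2) / 2)\<^sup>2" using S2 b0 a0 by (simp add: power_divide)
  then have "S < (n - 2) / 2" using n by (intro power_less_imp_less_base[of S 2]) auto
  then show "0 < eta N \<alpha>" by (simp add: eta)
  have "eta N \<alpha> < (n - 2) / 2" using S0 eta by argo
  then show "eta N \<alpha> < (real N - 2) / 2" unfolding n_def .
  have "eta N \<alpha> * (n - 2 - eta N \<alpha>) = (n - 2)\<^sup>2 / 4 - S\<^sup>2" by (simp add: eta power2_eq_square field_simps)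
  then show "eta N \<alpha> * (real N - 2 - eta N \<alpha>) = beta N \<alpha> * (\<alpha> + 1)" unfolding S2 by (simp add: n_def)
qed

text \<open>Near the origin this is the asymptotic analysis of the damped oscillator: \<open>y \<rightarrow> 0\<close> is excluded since then
  \<open>v = exp (l t) y\<close> would converge. Away from the origin the energy \<open>v'\<^sup>2 / 2 + \<bar>v\<bar> powr (\<alpha> + 2) / (\<alpha> + 2)\<close> decreases
  in \<open>r\<close> and bounds both \<open>v\<close> and \<open>v'\<close>.\<close>
lemma singular_profile:
  fixes v v' v'' :: "real \<Rightarrow> real" and N :: nat and \<alpha> :: real
  assumes N: "N \<ge> 3" and al: "2 / (real N - 2) < \<alpha>" "\<alpha> < alpha0 N"
    and dv: "\<And>r. r > 0 \<Longrightarrow> (v has_real_derivative v' r) (at r)"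
    and dv': "\<And>r. r > 0 \<Longrightarrow> (v' has_real_derivative v'' r) (at r)"
    and ode: "\<And>r. r > 0 \<Longrightarrow> v'' r + (real N - 1) / r * v' r + \<bar>v r\<bar> powr \<alpha> * v r = 0"
    and sing: "\<not> (\<exists>l. (v \<longlongrightarrow> l) (at_right 0))"
  shows "\<exists>\<sigma>\<in>{1, - 1}. \<exists>C k r0. C > 0 \<and> k > 0 \<and> 0 < r0 \<and> r0 \<le> 1
    \<and> (\<forall>r. 0 < r \<and> r \<le> r0 \<longrightarrow> \<bar>r powr (2 / \<alpha>) * v r - \<sigma> * beta N \<alpha> powr (1 / \<alpha>)\<bar> \<le> C * r powr k)
    \<and> (\<forall>r. 0 < r \<and> r \<le> r0 \<longrightarrow> \<bar>v' r\<bar> \<le> C * r powr (- (2 / \<alpha>) - 1))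
    \<and> (\<forall>r\<ge>r0. \<bar>v r\<bar> \<le> C \<and> \<bar>v' r\<bar> \<le> C)"
proof -
  define n where "n = real N"
  define l where "l = 2 / \<alpha>"
  define a where "a = 2 * l - (n - 2)"
  define b where "b = beta N \<alpha>"
  define e where "e = eta N \<alpha>"
  note ef = exponent_relations[OF N al]
  have a0: "\<alpha> > 0" by (rule ef(1))
  have la: "l * \<alpha> = 2" using a0 by (simp add: l_def)
  have l: "(n - 2) / 2 < l" "l < n - 2" using ef(2,3) by (auto simp: l_def n_def)
  have n: "n \<ge> 3" using N by (simp add: n_def)
  have l0: "l > 0" using l n by argo
  have b: "b = l * (n - 2 - l)" "b > 0" using ef(4) by (auto simp: b_def beta_def l_def n_def)
  have e: "0 < e" "e < (n - 2) / 2" "e * (n - 2 - e) = b * (\<alpha> + 1)"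
    using ef(5-7) by (auto simp: e_def b_def n_def)
  define y where "y = (\<lambda>t. exp (- (l * t)) * v (exp (- t)))"
  define w where "w = (\<lambda>t. exp (- ((l + 1) * t)) * v' (exp (- t)))"
  define y1 where "y1 = (\<lambda>t. - l * y t - w t)"
  have expw: "exp (- (l * t)) * exp (- t) = exp (- ((l + 1) * t))" for t
    unfolding mult_exp_exp by (rule arg_cong[where f=exp]) (simp add: algebra_simps)
  have dvc: "((\<lambda>t. v (exp (- t))) has_real_derivative v' (exp (- t)) * (- exp (- t))) (at t)"
    and dvc': "((\<lambda>t. v' (exp (- t))) has_real_derivative v'' (exp (- t)) * (- exp (- t))) (at t)" for t
  proof -
    have 1: "((\<lambda>t. exp (- t)) has_real_derivative - exp (- t)) (at t)" by (auto intro!: derivative_eq_intros)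
    show "((\<lambda>t. v (exp (- t))) has_real_derivative v' (exp (- t)) * (- exp (- t))) (at t)"
      by (rule DERIV_chain2[OF dv 1]) simp
    show "((\<lambda>t. v' (exp (- t))) has_real_derivative v'' (exp (- t)) * (- exp (- t))) (at t)"
      by (rule DERIV_chain2[OF dv' 1]) simp
  qed
  have dex: "((\<lambda>t. exp (- (c * t))) has_real_derivative - c * exp (- (c * t))) (at t)" for c t :: real
    by (auto intro!: derivative_eq_intros)
  have dy: "(y has_real_derivative y1 t) (at t)" for t
  proof -
    have alg: "- l * A * V + V' * (- B) * A = - l * (A * V) - A * B * V'" for A B V V' :: real
      by (simp add: algebra_simps)
    show ?thesis
      unfolding y_def
      by (rule DERIV_cong[OF DERIV_mult[OF dex dvc]]) (unfold y1_def w_def y_def expw[symmetric], rule alg)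
  qed
  have nl: "exp (- ((l + 1) * t)) * (exp (- t) * (\<bar>v (exp (- t))\<bar> powr \<alpha> * v (exp (- t)))) = \<bar>y t\<bar> powr \<alpha> * y t" for t
  proof -
    have e2: "- (l * t) * \<alpha> = - 2 * t" using la by (simp add: algebra_simps)
    have "\<bar>y t\<bar> powr \<alpha> = exp (- (l * t) * \<alpha>) * \<bar>v (exp (- t))\<bar> powr \<alpha>"
      by (simp add: y_def abs_mult powr_mult exp_powr_real)
    then have "\<bar>y t\<bar> powr \<alpha> * y t = (exp (- 2 * t) * \<bar>v (exp (- t))\<bar> powr \<alpha>) * (exp (- (l * t)) * v (exp (- t)))"
      unfolding e2 by (simp only: y_def)
    also have "\<dots> = (exp (- 2 * t) * exp (- (l * t))) * (\<bar>v (exp (- t))\<bar> powr \<alpha> * v (exp (- t)))"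
      by (simp only: mult_ac)
    also have "exp (- 2 * t) * exp (- (l * t)) = exp (- ((l + 1) * t)) * exp (- t)"
      unfolding mult_exp_exp by (rule arg_cong[where f=exp]) (simp add: algebra_simps)
    finally show ?thesis by (simp only: mult.assoc)
  qed
  have dw: "(w has_real_derivative (n - 2 - l) * w t + \<bar>y t\<bar> powr \<alpha> * y t) (at t)" for t
  proof -
    have d: "(w has_real_derivative - (l + 1) * exp (- ((l + 1) * t)) * v' (exp (- t)) + v'' (exp (- t)) * (- exp (- t)) * exp (- ((l + 1) * t))) (at t)"
      unfolding w_def by (rule DERIV_mult[OF dex dvc'])
    have "v'' (exp (- t)) = - ((n - 1) / exp (- t) * v' (exp (- t))) - \<bar>v (exp (- t))\<bar> powr \<alpha> * v (exp (- t))"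
      using ode[of "exp (- t)"] by (simp add: n_def algebra_simps)
    moreover have "(- (c / X * V) - W) * (- X) = c * V + X * W" if "X \<noteq> 0" for c V W X :: real
      using that by (simp add: field_simps)
    ultimately have h: "v'' (exp (- t)) * (- exp (- t)) = (n - 1) * v' (exp (- t)) + exp (- t) * (\<bar>v (exp (- t))\<bar> powr \<alpha> * v (exp (- t)))"
      by (simp only: exp_not_eq_zero not_False_eq_True)
    then have "v'' (exp (- t)) * (- exp (- t)) * exp (- ((l + 1) * t)) = (n - 1) * w t + \<bar>y t\<bar> powr \<alpha> * y t"
      unfolding nl[symmetric] h w_def by (simp only: distrib_right mult_ac) (simp only: distrib_left mult_ac)
    then show ?thesis
      by (intro DERIV_cong[OF d]) (simp add: w_def algebra_simps)
  qed
  have dy1: "(y1 has_real_derivative - a * y1 t + (b * y t - \<bar>y t\<bar> powr \<alpha> * y t)) (at t)" for t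
  proof -
    have d: "(y1 has_real_derivative - l * y1 t - ((n - 2 - l) * w t + \<bar>y t\<bar> powr \<alpha> * y t)) (at t)"
      unfolding y1_def using DERIV_diff[OF DERIV_cmult[OF dy[of t], of "- l"] dw[of t]] by (simp add: y1_def)
    have wt: "w t = - l * y t - y1 t" by (simp add: y1_def)
    show ?thesis by (rule DERIV_cong[OF d]) (simp only: a_def b(1) wt, simp add: algebra_simps)
  qed
  have a: "a > 0" using l by (simp add: a_def)
  interpret D: damped_oscillator y y1 a b \<alpha>
    by unfold_locales (use a b a0 dy dy1 in auto)
  \<comment> \<open>the equation is odd, so an orbit tending to \<open>- ystar\<close> is reflected\<close>
  have minus: "damped_oscillator (\<lambda>t. - y t) (\<lambda>t. - y1 t) a b \<alpha>"
    by unfold_locales (use a b a0 in \<open>auto intro!: derivative_eq_intros dy dy1 simp: algebra_simps\<close>)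
  have "\<not> (y \<longlongrightarrow> 0) at_top"
  proof
    assume "(y \<longlongrightarrow> 0) at_top"
    then obtain L where L: "((\<lambda>t. exp (l * t) * y t) \<longlongrightarrow> L) at_top"
      using D.decaying_orbit_asymptotics[of l "n - 2 - l"] l l0 b by (auto simp: a_def)
    have "(\<lambda>t. exp (l * t) * y t) = (\<lambda>t. v (exp (- t)))"
      by (simp add: y_def mult.assoc[symmetric] mult_exp_exp)
    then have L': "((\<lambda>t. v (exp (- t))) \<longlongrightarrow> L) at_top" using L by simp
    have "filterlim (\<lambda>r::real. - ln r) at_top (at_right 0)" by real_asymp
    from filterlim_compose[OF L' this] have "((\<lambda>r. v (exp (- (- ln r)))) \<longlongrightarrow> L) (at_right 0)" .
    then have "(v \<longlongrightarrow> L) (at_right 0)"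
      by (rule Lim_transform_eventually) (auto simp: eventually_at_filter intro!: always_eventually)
    then show False using sing by blast
  qed
  then have cl: "(y \<longlongrightarrow> D.ystar) at_top \<or> (y \<longlongrightarrow> - D.ystar) at_top"
    using D.orbit_limits by blast
  \<comment> \<open>as \<open>e\<close> and \<open>n - 2 - e\<close> are the roots of \<open>hardy N k = \<beta> (\<alpha> + 1)\<close>, the exponents at \<open>ystar\<close> are \<open>e - l\<close> and \<open>n - 2 - e - l\<close>\<close>
  have kk: "l - e > 0" "l - (n - 2 - e) > 0" "(l - e) + (l - (n - 2 - e)) = a" "(l - e) * (l - (n - 2 - e)) = \<alpha> * b"
  proof -
    show 1: "l - e > 0" using l e by linarith
    show 2: "(l - e) * (l - (n - 2 - e)) = \<alpha> * b"
    proof -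
      have "(l - e) * (l - (n - 2 - e)) = e * (n - 2 - e) - l * (n - 2 - l)" by (simp add: algebra_simps)
      then show ?thesis unfolding e(3) b(1)[symmetric] by (simp add: algebra_simps)
    qed
    have "(l - e) * (l - (n - 2 - e)) > 0" unfolding 2 using a0 b by simp
    then show "l - (n - 2 - e) > 0" using 1 by (simp add: zero_less_mult_iff)
    show "(l - e) + (l - (n - 2 - e)) = a" by (simp add: a_def)
  qed
  have ys: "D.ystar = beta N \<alpha> powr (1 / \<alpha>)" by (subst D.ystar_def) (simp add: b_def)
  obtain \<sigma> C m t0 where \<sigma>: "\<sigma> \<in> {1, - 1}" and m: "m > 0" and conv: "\<And>t. t \<ge> t0 \<Longrightarrow> \<bar>y t - \<sigma> * D.ystar\<bar> \<le> C * exp (- m * t)"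
  proof (cases "(y \<longlongrightarrow> D.ystar) at_top")
    case True
    then show thesis using D.exponential_convergence[OF True kk] that[of 1] by auto
  next
    case False
    with cl have "((\<lambda>t. - y t) \<longlongrightarrow> D.ystar) at_top" using tendsto_minus by fastforce
    then obtain C m t0 where "m > 0" "\<forall>t\<ge>t0. \<bar>- y t - D.ystar\<bar> \<le> C * exp (- m * t)"
      using damped_oscillator.exponential_convergence[OF minus _ kk] by blast
    moreover have "\<bar>- u - D.ystar\<bar> = \<bar>u - (- 1) * D.ystar\<bar>" for u by (simp add: abs_if)
    ultimately show thesis using that[of "- 1" m t0 C] by simp
  qed
  obtain t1 where t1: "\<And>t. t \<ge> t1 \<Longrightarrow> dist (y1 t) 0 < 1"
    using tendstoD[OF D.y1_tendsto_0, of 1] by (auto simp: eventually_at_top_linorder)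
  define r0 where "r0 = min 1 (exp (- max t0 t1))"
  have r0: "0 < r0" "r0 \<le> 1" by (auto simp: r0_def)
  define E where "E = (\<lambda>r. (v' r)\<^sup>2 / 2 + \<bar>v r\<bar> powr (\<alpha> + 2) / (\<alpha> + 2))"
  have dE: "(E has_real_derivative - ((n - 1) / r * (v' r)\<^sup>2)) (at r)" if r: "r > 0" for r
  proof -
    have 1: "((\<lambda>r. \<bar>v r\<bar> powr (\<alpha> + 2)) has_real_derivative (\<alpha> + 2) * (\<bar>v r\<bar> powr (\<alpha> + 2 - 2) * v r) * v' r) (at r)"
      by (rule DERIV_chain2[OF abs_powr_has_derivative dv[OF r]]) (use a0 in simp)
    have 2: "v'' r = - ((n - 1) / r * v' r) - \<bar>v r\<bar> powr \<alpha> * v r"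
      using ode[OF r] by (simp add: n_def)
    have 3: "((\<lambda>r. \<bar>v r\<bar> powr (\<alpha> + 2) / (\<alpha> + 2)) has_real_derivative \<bar>v r\<bar> powr \<alpha> * v r * v' r) (at r)"
      using DERIV_cdivide[OF 1, of "\<alpha> + 2"] a0 by (simp add: mult.assoc)
    have 4: "((\<lambda>r. (v' r)\<^sup>2 / 2) has_real_derivative v' r * v'' r) (at r)"
      using DERIV_cdivide[OF DERIV_power[OF dv'[OF r], of 2], of 2] by (simp add: mult_ac)
    show ?thesis unfolding E_def
      by (rule DERIV_cong[OF DERIV_add[OF 4 3]]) (simp add: 2 power2_eq_square algebra_simps)
  qed
  have E: "E r \<le> E r0" if "r \<ge> r0" for r
  proof (rule DERIV_nonpos_imp_nonincreasing[OF that])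
    fix x assume "r0 \<le> x" "x \<le> r"
    then show "\<exists>y. (E has_real_derivative y) (at x) \<and> y \<le> 0"
      using dE[of x] r0 n by (intro exI conjI) auto
  qed
  have E0: "E r0 \<ge> 0" using a0 by (simp add: E_def)
  define C1 where "C1 = sqrt (2 * E r0) + ((\<alpha> + 2) * E r0) powr (1 / (\<alpha> + 2))"
  have C1: "C1 \<ge> 0" using E0 by (simp add: C1_def)
  have far: "\<bar>v r\<bar> \<le> C1 \<and> \<bar>v' r\<bar> \<le> C1" if r: "r \<ge> r0" for r
  proof
    have p: "0 \<le> \<bar>v r\<bar> powr (\<alpha> + 2) / (\<alpha> + 2)" using a0 by simp
    have "\<bar>v r\<bar> powr (\<alpha> + 2) / (\<alpha> + 2) \<le> E r0" using E[OF r] zero_le_power2[of "v' r"] unfolding E_def by linarith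
    then have "\<bar>v r\<bar> powr (\<alpha> + 2) \<le> (\<alpha> + 2) * E r0" using a0 by (simp add: field_simps)
    then have "(\<bar>v r\<bar> powr (\<alpha> + 2)) powr (1 / (\<alpha> + 2)) \<le> ((\<alpha> + 2) * E r0) powr (1 / (\<alpha> + 2))"
      using a0 by (intro powr_mono2) auto
    then have "\<bar>v r\<bar> \<le> ((\<alpha> + 2) * E r0) powr (1 / (\<alpha> + 2))" using a0 by (simp add: powr_powr)
    moreover have "0 \<le> sqrt (2 * E r0)" using E0 by simp
    ultimately show "\<bar>v r\<bar> \<le> C1" unfolding C1_def by linarith
    have "E r = (v' r)\<^sup>2 / 2 + \<bar>v r\<bar> powr (\<alpha> + 2) / (\<alpha> + 2)" by (simp add: E_def)
    then have "(v' r)\<^sup>2 \<le> 2 * E r0" using E[OF r] p by argo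
    then have "\<bar>v' r\<bar> \<le> sqrt (2 * E r0)" by (rule real_le_rsqrt[of "\<bar>v' r\<bar>", simplified])
    moreover have "0 \<le> ((\<alpha> + 2) * E r0) powr (1 / (\<alpha> + 2))" by simp
    ultimately show "\<bar>v' r\<bar> \<le> C1" unfolding C1_def by linarith
  qed
  have near_t: "- ln r \<ge> t0 \<and> - ln r \<ge> t1 \<and> exp (- (- ln r)) = r \<and> - ln r \<ge> 0" if "0 < r" "r \<le> r0" for r
  proof -
    have "r \<le> exp (- max t0 t1)" "r \<le> 1" using that by (auto simp: r0_def)
    then have "ln r \<le> - max t0 t1" using that ln_mono[of r "exp (- max t0 t1)"] by simp
    then show ?thesis using that \<open>r \<le> 1\<close> by auto
  qed
  have yr: "y (- ln r) = r powr l * v r" if "r > 0" for r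
    using that by (simp add: y_def powr_def mult.commute)
  have wr: "w (- ln r) = r powr (l + 1) * v' r" if "r > 0" for r
    using that by (simp add: w_def powr_def mult.commute)
  have C0: "\<bar>C\<bar> \<ge> 0" by simp
  have near: "\<bar>r powr l * v r - \<sigma> * D.ystar\<bar> \<le> \<bar>C\<bar> * r powr m" if r: "0 < r" "r \<le> r0" for r
  proof -
    have "\<bar>r powr l * v r - \<sigma> * D.ystar\<bar> \<le> C * exp (- m * (- ln r))"
      using conv[of "- ln r"] near_t[OF r] yr[OF r(1)] by simp
    also have "exp (- m * (- ln r)) = r powr m" using r by (simp add: powr_def)
    also have "C * r powr m \<le> \<bar>C\<bar> * r powr m" by (intro mult_right_mono) auto
    finally show ?thesis .
  qed
  define C2 where "C2 = 1 + l * (\<bar>C\<bar> + D.ystar)"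
  have near': "\<bar>v' r\<bar> \<le> C2 * r powr (- l - 1)" if r: "0 < r" "r \<le> r0" for r
  proof -
    have "r powr m \<le> 1" using r r0 m by (intro powr_le1) auto
    then have "\<bar>C\<bar> * r powr m \<le> \<bar>C\<bar>" by (intro mult_left_le) auto
    then have "\<bar>y (- ln r)\<bar> \<le> \<bar>C\<bar> + D.ystar"
    proof -
      have "\<bar>\<sigma> * D.ystar\<bar> = D.ystar" using \<sigma> D.ystar by auto
      moreover have "\<bar>u\<bar> \<le> \<bar>u - w\<bar> + \<bar>w\<bar>" for u w :: real by simp
      ultimately have "\<bar>r powr l * v r\<bar> \<le> \<bar>r powr l * v r - \<sigma> * D.ystar\<bar> + D.ystar" by metis
      then show ?thesis using near[OF r] \<open>\<bar>C\<bar> * r powr m \<le> \<bar>C\<bar>\<close> unfolding yr[OF r(1)] by linarith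
    qed
    then have "\<bar>l * y (- ln r)\<bar> \<le> l * (\<bar>C\<bar> + D.ystar)" using l0 by (simp add: abs_mult)
    moreover have "\<bar>y1 (- ln r)\<bar> < 1" using t1[of "- ln r"] near_t[OF r] by simp
    moreover have "w (- ln r) = - (l * y (- ln r)) - y1 (- ln r)" by (simp add: y1_def)
    ultimately have "\<bar>w (- ln r)\<bar> \<le> C2" unfolding C2_def by linarith
    then have "r powr (l + 1) * \<bar>v' r\<bar> \<le> C2" using r by (simp add: wr abs_mult)
    then have "r powr (- l - 1) * (r powr (l + 1) * \<bar>v' r\<bar>) \<le> r powr (- l - 1) * C2" by (intro mult_left_mono) auto
    moreover have "r powr (- l - 1) * (r powr (l + 1) * \<bar>v' r\<bar>) = \<bar>v' r\<bar>"
      using r by (simp add: mult.assoc[symmetric] powr_add[symmetric])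
    ultimately show ?thesis by (simp only: mult.commute[of C2])
  qed
  have C2: "C2 > 0" using l0 D.ystar by (auto simp: C2_def intro!: add_pos_nonneg)
  define CC where "CC = C1 + \<bar>C\<bar> + C2"
  have CC: "CC > 0" "C1 \<le> CC" "\<bar>C\<bar> \<le> CC" "C2 \<le> CC" using C1 C2 by (auto simp: CC_def)
  show ?thesis
  proof (rule bexI[OF _ \<sigma>], rule exI[of _ CC], rule exI[of _ m], rule exI[of _ r0], intro conjI allI impI)
    fix r assume r: "0 < r \<and> r \<le> r0"
    have "\<bar>C\<bar> * r powr m \<le> CC * r powr m" using CC by (intro mult_right_mono) auto
    then show "\<bar>r powr (2 / \<alpha>) * v r - \<sigma> * beta N \<alpha> powr (1 / \<alpha>)\<bar> \<le> CC * r powr m"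
      using near[of r] r unfolding ys[symmetric] l_def[symmetric] by linarith
    have "C2 * r powr (- l - 1) \<le> CC * r powr (- l - 1)" using CC by (intro mult_right_mono) auto
    then show "\<bar>v' r\<bar> \<le> CC * r powr (- (2 / \<alpha>) - 1)"
      using near'[of r] r unfolding l_def[symmetric] by linarith
  next
    fix r assume "r \<ge> r0"
    then show "\<bar>v r\<bar> \<le> CC" "\<bar>v' r\<bar> \<le> CC" using far[of r] CC by auto
  qed (use CC m r0 in auto)
qed

section \<open>The initial trace\<close>

text \<open>Almost everywhere approximation of \<open>f\<close> by continuous functions with the same bound; the enlarged radius
  \<open>R + A\<close> keeps the translated ball inside the region of approximation.\<close>
lemma translation_L1_continuous:
  fixes f :: "'a::euclidean_space \<Rightarrow> real" and a :: "nat \<Rightarrow> 'a"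
  assumes [measurable]: "f \<in> borel_measurable borel" and bd: "\<And>x. \<bar>f x\<bar> \<le> M" and a: "a \<longlonglongrightarrow> 0"
  shows "(\<lambda>n. \<integral>x. indicator (cball 0 R) x * \<bar>f (x - a n) - f x\<bar> \<partial>lborel) \<longlonglongrightarrow> 0"
proof -
  have [measurable]: "cball (0::'a) r \<in> sets borel" for r by simp
  have M: "0 \<le> M" using bd[of 0] by linarith
  obtain A where A: "\<And>n. norm (a n) \<le> A"
    using convergent_imp_bounded[OF a] by (auto simp: bounded_iff)
  have "f measurable_on UNIV"
    by (rule lebesgue_measurable_imp_measurable_on) (auto simp: measurable_completion)
  then obtain N g where N: "negligible N" and g: "\<And>n. continuous_on UNIV (g n)" and lim: "\<And>x. x \<notin> N \<Longrightarrow> (\<lambda>n. g n x) \<longlonglongrightarrow> f x"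
    unfolding measurable_on_def by auto
  define c where "c = (\<lambda>m x. max (- M) (min M (g m x)))"
  have c_cont: "continuous_on UNIV (c m)" for m unfolding c_def by (intro continuous_intros g)
  then have [measurable]: "c m \<in> borel_measurable borel" for m by (rule borel_measurable_continuous_onI)
  have c_bd: "\<bar>c m x\<bar> \<le> M" for m x using M by (auto simp: c_def)
  have AEN: "AE x in lborel. x \<notin> N"
  proof -
    obtain N' where "N' \<in> null_sets lborel" "N \<subseteq> N'"
      using N unfolding negligible_iff_null_sets null_sets_completion_iff2 by blast
    then show ?thesis using AE_not_in[of N' lborel] by (auto elim!: eventually_mono)
  qed
  have c_lim: "AE x in lborel. (\<lambda>m. c m x) \<longlonglongrightarrow> f x"
    using AEN
  proof eventually_elim
    case (elim x)
    have "(\<lambda>m. c m x) \<longlonglongrightarrow> max (- M) (min M (f x))"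
      unfolding c_def by (intro tendsto_max tendsto_min tendsto_const lim elim)
    moreover have "- M \<le> f x" "f x \<le> M" using bd[of x] by (auto simp: abs_le_iff)
    ultimately show ?case by (simp add: min_absorb2 max_absorb2)
  qed
  define \<delta> where "\<delta> = (\<lambda>m. \<integral>x. indicator (cball 0 (R + A)) x * \<bar>c m x - f x\<bar> \<partial>lborel)"
  have ball_int: "integrable lborel (\<lambda>x::'a. indicator (cball 0 r) x * h x)"
    if [measurable]: "h \<in> borel_measurable borel" and h: "\<And>x. \<bar>h x\<bar> \<le> B" for r B and h :: "'a \<Rightarrow> real"
  proof (rule Bochner_Integration.integrable_bound)
    show "integrable lborel (\<lambda>x::'a. B * indicator (cball 0 r) x)"
      using emeasure_bounded_finite[OF bounded_cball, of "0::'a" r] by (intro integrable_mult_right integrable_real_indicator) auto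
    show "AE x in lborel. norm (indicator (cball 0 r) x * h x) \<le> norm (B * indicator (cball 0 r) x)"
      using h by (intro AE_I2) (auto simp: indicator_def intro: order_trans[OF _ abs_ge_self])
  qed measurable
  have d_bd: "\<bar>c m x - f y\<bar> \<le> 2 * M" "\<bar>c m x - c m y\<bar> \<le> 2 * M" "\<bar>f x - f y\<bar> \<le> 2 * M" for m x y
    using c_bd[of m x] c_bd[of m y] bd[of x] bd[of y] by linarith+
  have \<delta>_lim: "\<delta> \<longlonglongrightarrow> 0"
  proof -
    have "\<delta> \<longlonglongrightarrow> (\<integral>x. 0 \<partial>(lborel :: 'a measure))"
      unfolding \<delta>_def
    proof (rule integral_dominated_convergence)
      show "integrable lborel (\<lambda>x::'a. indicator (cball 0 (R + A)) x * (2 * M))" by (rule ball_int[of "\<lambda>_. 2 * M" "2 * M"]) (use M in auto)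
      show "AE x in lborel. (\<lambda>m. indicator (cball 0 (R + A)) x * \<bar>c m x - f x\<bar>) \<longlonglongrightarrow> 0"
        using c_lim
      proof eventually_elim
        case (elim x)
        have "(\<lambda>m. indicator (cball 0 (R + A)) x * \<bar>c m x - f x\<bar>) \<longlonglongrightarrow> indicator (cball 0 (R + A)) x * \<bar>f x - f x\<bar>"
          by (intro tendsto_intros elim)
        then show ?case by simp
      qed
      show "AE x in lborel. norm (indicator (cball 0 (R + A)) x * \<bar>c m x - f x\<bar>) \<le> indicator (cball 0 (R + A)) x * (2 * M)" for m
        using d_bd(1) by (intro AE_I2) (auto simp: abs_mult intro!: mult_left_mono)
    qed measurable
    then show ?thesis by simp
  qed
  have key: "(\<integral>x. indicator (cball 0 R) x * \<bar>f (x - a n) - f x\<bar> \<partial>lborel)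
      \<le> 2 * \<delta> m + (\<integral>x. indicator (cball 0 R) x * \<bar>c m (x - a n) - c m x\<bar> \<partial>lborel)" for m n
  proof -
    let ?h1 = "\<lambda>x. indicator (cball 0 (R + A)) (x - a n) * \<bar>c m (x - a n) - f (x - a n)\<bar> :: real"
    let ?h2 = "\<lambda>x. indicator (cball 0 R) x * \<bar>c m (x - a n) - c m x\<bar> :: real"
    let ?h3 = "\<lambda>x. indicator (cball 0 (R + A)) x * \<bar>c m x - f x\<bar> :: real"
    have A0: "0 \<le> A" using A[of 0] norm_ge_zero[of "a 0"] by linarith
    have m3: "?h3 \<in> borel_measurable borel" by measurable
    have i3: "integrable lborel ?h3" by (rule ball_int[of _ "2 * M"]) (use d_bd in auto)
    have i1: "integrable lborel ?h1" and e1: "(\<integral>x. ?h1 x \<partial>lborel) = \<delta> m"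
      using lborel_integrable_affine_iff[OF _ m3, of 1 "- a n"] lborel_integral_affine[OF _ m3, of 1 "- a n"] i3
      by (auto simp: \<delta>_def)
    have i2: "integrable lborel ?h2" by (rule ball_int[of _ "2 * M"]) (use d_bd in auto)
    have i0: "integrable lborel (\<lambda>x. indicator (cball 0 R) x * \<bar>f (x - a n) - f x\<bar>)"
      by (rule ball_int[of _ "2 * M"]) (use d_bd in auto)
    have "(\<integral>x. indicator (cball 0 R) x * \<bar>f (x - a n) - f x\<bar> \<partial>lborel) \<le> (\<integral>x. ?h1 x + ?h2 x + ?h3 x \<partial>lborel)"
    proof (rule Bochner_Integration.integral_mono[OF i0])
      show "integrable lborel (\<lambda>x. ?h1 x + ?h2 x + ?h3 x)" using i1 i2 i3 by (intro Bochner_Integration.integrable_add)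
      fix x :: 'a
      show "indicator (cball 0 R) x * \<bar>f (x - a n) - f x\<bar> \<le> ?h1 x + ?h2 x + ?h3 x"
      proof (cases "norm x \<le> R")
        case True
        have "norm (x - a n) \<le> R + A" using norm_triangle_ineq4[of x "a n"] A[of n] True by linarith
        then show ?thesis using True A0 by (simp add: indicator_def)
      qed (simp add: indicator_def)
    qed
    also have "\<dots> = 2 * \<delta> m + (\<integral>x. ?h2 x \<partial>lborel)" using i1 i2 i3 e1 by (simp add: \<delta>_def)
    finally show ?thesis .
  qed
  have c_tr: "(\<lambda>n. \<integral>x. indicator (cball 0 R) x * \<bar>c m (x - a n) - c m x\<bar> \<partial>lborel) \<longlonglongrightarrow> 0" for m
  proof -
    have "(\<lambda>n. \<integral>x. indicator (cball 0 R) x * \<bar>c m (x - a n) - c m x\<bar> \<partial>lborel) \<longlonglongrightarrow> (\<integral>x. 0 \<partial>(lborel :: 'a measure))"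
    proof (rule integral_dominated_convergence)
      show "integrable lborel (\<lambda>x::'a. indicator (cball 0 R) x * (2 * M))" by (rule ball_int[of "\<lambda>_. 2 * M" "2 * M"]) (use M in auto)
      show "AE x in lborel. (\<lambda>n. indicator (cball 0 R) x * \<bar>c m (x - a n) - c m x\<bar>) \<longlonglongrightarrow> 0"
      proof (intro AE_I2)
        fix x
        have "isCont (c m) (x - 0)" using c_cont by (auto simp: continuous_on_eq_continuous_at)
        then have "(\<lambda>n. c m (x - a n)) \<longlonglongrightarrow> c m (x - 0)"
          by (rule isCont_tendsto_compose) (intro tendsto_intros a)
        then have "(\<lambda>n. indicator (cball 0 R) x * \<bar>c m (x - a n) - c m x\<bar>) \<longlonglongrightarrow> indicator (cball 0 R) x * \<bar>c m (x - 0) - c m x\<bar>"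
          by (intro tendsto_intros)
        then show "(\<lambda>n. indicator (cball 0 R) x * \<bar>c m (x - a n) - c m x\<bar>) \<longlonglongrightarrow> 0" by simp
      qed
      show "AE x in lborel. norm (indicator (cball 0 R) x * \<bar>c m (x - a n) - c m x\<bar>) \<le> indicator (cball 0 R) x * (2 * M)" for n
        using d_bd(2) by (intro AE_I2) (auto simp: abs_mult intro!: mult_left_mono)
    qed measurable
    then show ?thesis by simp
  qed
  show ?thesis
  proof (rule LIMSEQ_I)
    fix e :: real assume e: "e > 0"
    obtain m where m: "norm (\<delta> m - 0) < e / 4" using LIMSEQ_D[OF \<delta>_lim, of "e / 4"] e by auto
    obtain n0 where n0: "\<And>n. n \<ge> n0 \<Longrightarrow> norm ((\<integral>x. indicator (cball 0 R) x * \<bar>c m (x - a n) - c m x\<bar> \<partial>lborel) - 0) < e / 2"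
      using LIMSEQ_D[OF c_tr[of m], of "e / 2"] e by auto
    show "\<exists>n0. \<forall>n\<ge>n0. norm ((\<integral>x. indicator (cball 0 R) x * \<bar>f (x - a n) - f x\<bar> \<partial>lborel) - 0) < e"
    proof (intro exI allI impI)
      fix n assume n: "n \<ge> n0"
      have "0 \<le> (\<integral>x. indicator (cball 0 R) x * \<bar>f (x - a n) - f x\<bar> \<partial>lborel)"
        by (rule Bochner_Integration.integral_nonneg) auto
      then show "norm ((\<integral>x. indicator (cball 0 R) x * \<bar>f (x - a n) - f x\<bar> \<partial>lborel) - 0) < e"
        using key[of n m] m n0[OF n] unfolding real_norm_def by argo
    qed
  qed
qed

text \<open>The heat flow is a Gaussian average of translations of \<open>f\<close> by \<open>sqrt t * z\<close>.\<close>
lemma heat_flow_L1_continuous: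
  fixes f :: "'a::euclidean_space \<Rightarrow> real" and s :: "nat \<Rightarrow> real"
  assumes [measurable]: "f \<in> borel_measurable borel" and bd: "\<And>x. \<bar>f x\<bar> \<le> M" and s: "\<And>n. s n > 0" "s \<longlonglongrightarrow> 0"
  shows "(\<lambda>n. \<integral>x. indicator (cball 0 R) x * \<bar>heat_flow f (s n, x) - f x\<bar> \<partial>lborel) \<longlonglongrightarrow> 0"
proof -
  have [measurable]: "cball (0::'a) r \<in> sets borel" for r by simp
  have M: "0 \<le> M" using bd[of 0] by linarith
  have flow: "heat_flow f (t, x) = (\<integral>z. gauss z * f (x - sqrt t *\<^sub>R z) \<partial>lborel)" if t: "t > 0" for t x
  proof -
    have "heat_flow f (t, x) = (\<integral>y. heat_kernel (t, y) * f (x - y) \<partial>lborel)"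
      using lborel_integral_reflect[of "\<lambda>y. heat_kernel (t, y) * f (x - y)" x] by (simp add: heat_flow_def)
    also have "\<dots> = (\<integral>z. gauss z * f (x - sqrt t *\<^sub>R z) \<partial>lborel)"
      by (rule heat_kernel_integral_rescale[OF t]) measurable
    finally show ?thesis .
  qed
  have gi: "integrable lborel (\<lambda>z. gauss z * f (x - r *\<^sub>R z))" for x r
    by (rule gauss_mult_bounded_integrable[OF _ bd]) measurable
  have pt: "\<bar>heat_flow f (t, x) - f x\<bar> \<le> (\<integral>z. gauss z * \<bar>f (x - sqrt t *\<^sub>R z) - f x\<bar> \<partial>lborel)" if t: "t > 0" for t x
  proof -
    have "heat_flow f (t, x) - f x = (\<integral>z. gauss z * f (x - sqrt t *\<^sub>R z) \<partial>lborel) - (\<integral>z. gauss (z::'a) * f x \<partial>lborel)"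
      using flow[OF t] gauss_integral[where 'a='a] by simp
    also have "\<dots> = (\<integral>z. gauss z * (f (x - sqrt t *\<^sub>R z) - f x) \<partial>lborel)"
      using gi gauss_integrable[where 'a='a] by (simp add: right_diff_distrib)
    also have "\<bar>\<dots>\<bar> \<le> (\<integral>z. \<bar>gauss z * (f (x - sqrt t *\<^sub>R z) - f x)\<bar> \<partial>lborel)" by (rule integral_abs_bound)
    finally show ?thesis by (simp add: abs_mult)
  qed
  define V where "V = (\<integral>x. (indicator (cball 0 R) x :: real) \<partial>(lborel :: 'a measure))"
  have Vi: "integrable lborel (indicator (cball 0 R) :: 'a \<Rightarrow> real)"
    using emeasure_bounded_finite[OF bounded_cball, of "0::'a" R] by (intro integrable_real_indicator) auto
  have V0: "V \<ge> 0" unfolding V_def by (rule Bochner_Integration.integral_nonneg) auto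
  define I where "I = (\<lambda>t z. \<integral>x. indicator (cball 0 R) x * \<bar>f (x - sqrt t *\<^sub>R z) - f x\<bar> \<partial>lborel)"
  have d_bd: "\<bar>f x - f y\<bar> \<le> 2 * M" for x y using bd[of x] bd[of y] by linarith
  have Iint: "integrable lborel (\<lambda>x. indicator (cball 0 R) x * \<bar>f (x - sqrt t *\<^sub>R z) - f x\<bar>)" for t z
  proof (rule Bochner_Integration.integrable_bound)
    show "integrable lborel (\<lambda>x::'a. (2 * M) * indicator (cball 0 R) x)" using Vi by (rule integrable_mult_right)
    show "AE x in lborel. norm (indicator (cball 0 R) x * \<bar>f (x - sqrt t *\<^sub>R z) - f x\<bar>) \<le> norm (2 * M * indicator (cball 0 R) x)"
      using d_bd M by (intro AE_I2) (auto simp: indicator_def)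
  qed measurable
  have I_bd: "0 \<le> I t z \<and> I t z \<le> 2 * M * V" for t z
  proof
    show "0 \<le> I t z" unfolding I_def by (rule Bochner_Integration.integral_nonneg) auto
    have "I t z \<le> (\<integral>x. (2 * M) * indicator (cball 0 R) (x::'a) \<partial>lborel)" unfolding I_def
      by (rule Bochner_Integration.integral_mono[OF Iint integrable_mult_right[OF Vi]]) (use d_bd in \<open>auto simp: indicator_def\<close>)
    then show "I t z \<le> 2 * M * V" by (simp add: V_def)
  qed
  have I_m[measurable]: "I t \<in> borel_measurable borel" for t
    unfolding I_def by (rule lborel.borel_measurable_lebesgue_integral) measurable
  have bound: "(\<integral>x. indicator (cball 0 R) x * \<bar>heat_flow f (t, x) - f x\<bar> \<partial>lborel) \<le> (\<integral>z. gauss z * I t z \<partial>lborel)" if t: "t > 0" for t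
  proof -
    let ?J = "\<lambda>(x, z). indicator (cball 0 R) x * (gauss z * \<bar>f (x - sqrt t *\<^sub>R z) - f x\<bar>) :: real"
    have J: "integrable (lborel \<Otimes>\<^sub>M lborel) ?J"
    proof (rule Bochner_Integration.integrable_bound)
      show "integrable (lborel \<Otimes>\<^sub>M lborel) (\<lambda>p::'a\<times>'a. ((2 * M) * indicator (cball 0 R) (fst p)) * gauss (snd p))"
        using Vi gauss_integrable by (intro integrable_lborel_product integrable_mult_right)
      show "AE p in lborel \<Otimes>\<^sub>M lborel. norm (?J p) \<le> norm (((2 * M) * indicator (cball 0 R) (fst p)) * gauss (snd p))"
      proof (intro AE_I2)
        fix p :: "'a \<times> 'a"
        have "gauss (snd p) * \<bar>f (fst p - sqrt t *\<^sub>R snd p) - f (fst p)\<bar> \<le> gauss (snd p) * (2 * M)"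
          using d_bd by (intro mult_left_mono) auto
        then show "norm (?J p) \<le> norm (((2 * M) * indicator (cball 0 R) (fst p)) * gauss (snd p))"
          using M by (auto simp: split_beta' indicator_def abs_mult mult_ac)
      qed
      show "?J \<in> borel_measurable (lborel \<Otimes>\<^sub>M lborel)" unfolding split_beta' by measurable
    qed
    have hm: "heat_flow f \<in> borel_measurable borel" by (rule heat_flow_borel) fact
    have [measurable]: "(\<lambda>x. heat_flow f (t, x)) \<in> borel_measurable borel"
      by (rule measurable_compose[OF _ hm]) measurable
    have "(\<integral>x. indicator (cball 0 R) x * \<bar>heat_flow f (t, x) - f x\<bar> \<partial>lborel) \<le> (\<integral>x. (\<integral>z. ?J (x, z) \<partial>lborel) \<partial>lborel)"
    proof (rule Bochner_Integration.integral_mono)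
      show "integrable lborel (\<lambda>x. \<integral>z. ?J (x, z) \<partial>lborel)" by (rule lborel_pair.integrable_fst'[OF J])
      show "indicator (cball 0 R) x * \<bar>heat_flow f (t, x) - f x\<bar> \<le> (\<integral>z. ?J (x, z) \<partial>lborel)" for x
        using pt[OF t, of x] by (auto intro!: mult_left_mono)
      show "integrable lborel (\<lambda>x. indicator (cball 0 R) x * \<bar>heat_flow f (t, x) - f x\<bar>)"
      proof (rule Bochner_Integration.integrable_bound)
        show "integrable lborel (\<lambda>x::'a. (2 * M) * indicator (cball 0 R) x)" using Vi by (rule integrable_mult_right)
        have "\<bar>heat_flow f (t, x) - f x\<bar> \<le> 2 * M" for x using heat_flow_bounded(2)[OF assms(1) bd t, of x] bd[of x] by linarith
        then show "AE x in lborel. norm (indicator (cball 0 R) x * \<bar>heat_flow f (t, x) - f x\<bar>) \<le> norm (2 * M * indicator (cball 0 R) x)"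
          using M by (intro AE_I2) (auto simp: indicator_def)
      qed measurable
    qed
    also have "\<dots> = (\<integral>z. (\<integral>x. ?J (x, z) \<partial>lborel) \<partial>lborel)"
      using lborel_pair.Fubini_integral[OF J] by simp
    also have "\<dots> = (\<integral>z. gauss z * I t z \<partial>lborel)"
      unfolding I_def by (simp add: mult.left_commute[of "indicator _ _"])
    finally show ?thesis .
  qed
  have "(\<lambda>n. \<integral>z. gauss z * I (s n) z \<partial>lborel) \<longlonglongrightarrow> (\<integral>z. 0 \<partial>(lborel :: 'a measure))"
  proof (rule integral_dominated_convergence)
    show "integrable lborel (\<lambda>z::'a. (2 * M * V) * gauss z)" using gauss_integrable by (rule integrable_mult_right)
    show "AE z in lborel. (\<lambda>n. gauss z * I (s n) z) \<longlonglongrightarrow> 0"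
    proof (intro AE_I2)
      fix z :: 'a
      have "(\<lambda>n. sqrt (s n) *\<^sub>R z) \<longlonglongrightarrow> sqrt 0 *\<^sub>R z" by (intro tendsto_intros s)
      then have "(\<lambda>n. sqrt (s n) *\<^sub>R z) \<longlonglongrightarrow> 0" by simp
      then have "(\<lambda>n. I (s n) z) \<longlonglongrightarrow> 0" unfolding I_def by (rule translation_L1_continuous[OF assms(1) bd])
      then show "(\<lambda>n. gauss z * I (s n) z) \<longlonglongrightarrow> 0" by (rule tendsto_mult_right_zero)
    qed
    show "AE z in lborel. norm (gauss z * I (s n) z) \<le> (2 * M * V) * gauss z" for n
    proof (intro AE_I2)
      fix z :: 'a
      have "gauss z * I (s n) z \<le> gauss z * (2 * M * V)" using I_bd by (intro mult_left_mono) auto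
      then show "norm (gauss z * I (s n) z) \<le> (2 * M * V) * gauss z" using I_bd by (simp add: abs_mult mult.commute)
    qed
  qed measurable
  then have l: "(\<lambda>n. \<integral>z. gauss z * I (s n) z \<partial>lborel) \<longlonglongrightarrow> 0" by simp
  show ?thesis
    by (rule tendsto_sandwich[OF _ _ tendsto_const l])
       (use bound s in \<open>auto intro!: always_eventually Bochner_Integration.integral_nonneg\<close>)
qed

text \<open>The pointwise limit is \<open>duhamel_power_majorant_tendsto_0\<close>, and the explicit formula for the Duhamel integral
  provides a majorant that is independent of time.\<close>
lemma duhamel_L1_tendsto_0:
  fixes R :: real
  assumes k: "0 < k" "k < real DIM('a) - 2" and AB: "0 \<le> A" "0 \<le> B"
    and s: "\<And>n. 0 < s n" "\<And>n. s n < 1" "s \<longlonglongrightarrow> 0"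
  shows "(\<lambda>n. \<integral>x. indicator (cball 0 R) x * duhamel (power_majorant A k B) (s n, x :: 'a::euclidean_space) \<partial>lborel) \<longlonglongrightarrow> 0"
    and "\<And>n. integrable lborel (\<lambda>x. indicator (cball 0 R) x * duhamel (power_majorant A k B) (s n, x :: 'a))"
proof -
  let ?P = "power_majorant A k B :: real \<times> 'a \<Rightarrow> real"
  let ?w = "\<lambda>x::'a. (A / hardy DIM('a) k + B) * (indicator (cball 0 R) x * norm x powr (- k - 2) + indicator (cball 0 R) x)"
  have hk: "hardy DIM('a) k > 0" using k by (simp add: hardy_def)
  have [measurable]: "cball (0::'a) R \<in> sets borel" by simp
  have dm: "duhamel ?P \<in> borel_measurable borel" by (rule duhamel_borel) measurable
  have [measurable]: "(\<lambda>x. duhamel ?P (s n, x)) \<in> borel_measurable borel" for n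
    by (rule measurable_compose[OF _ dm]) measurable
  have wi: "integrable lborel ?w"
    using power_locally_integrable[OF k, of R] emeasure_bounded_finite[OF bounded_cball, of "0::'a" R]
    by (intro integrable_mult_right Bochner_Integration.integrable_add integrable_real_indicator) auto
  have AEx: "AE x in lborel. x \<noteq> (0::'a)" by (rule AE_lborel_singleton)
  have P0: "0 \<le> duhamel ?P z" for z
    unfolding duhamel_def using AB by (intro Bochner_Integration.integral_nonneg) (auto simp: power_majorant_def)
  have le: "duhamel ?P (s n, x) \<le> (A / hardy DIM('a) k + B) * (norm x powr (- k - 2) + 1)" if x: "x \<noteq> 0" for n x
  proof -
    have hf0: "0 \<le> heat_flow (\<lambda>y. norm y powr (- k)) (s n, x)" unfolding heat_flow_def by (rule Bochner_Integration.integral_nonneg) auto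
    have 1: "norm x powr (- k) \<le> norm x powr (- k - 2) + 1"
    proof (cases "norm x \<le> 1")
      case True
      then have "norm x powr (- k) \<le> norm x powr (- k - 2)" using x by (intro powr_mono') auto
      then show ?thesis by simp
    next
      case False
      then have "norm x powr (- k) \<le> 1 powr (- k)" using k by (intro powr_mono2') auto
      then have "norm x powr (- k) \<le> 1" by simp
      moreover have "0 \<le> norm x powr (- k - 2)" by simp
      ultimately show ?thesis by linarith
    qed
    have "duhamel ?P (s n, x) = A / hardy DIM('a) k * (norm x powr (- k) - heat_flow (\<lambda>y. norm y powr (- k)) (s n, x)) + B * s n"
      using duhamel_power_majorant(2)[of "(s n, x)" k A B] x s k by simp
    also have "\<dots> \<le> A / hardy DIM('a) k * (norm x powr (- k - 2) + 1) + B * (norm x powr (- k - 2) + 1)"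
      using hk AB hf0 1 s(2)[of n] by (intro add_mono mult_left_mono) (auto intro: order_trans[of _ 1])
    finally show ?thesis by (simp add: distrib_right)
  qed
  have dom: "AE x in lborel. norm (indicator (cball 0 R) x * duhamel ?P (s n, x)) \<le> ?w x" for n
    using AEx
  proof eventually_elim
    case (elim x)
    then show ?case using le[OF elim, of n] P0[of "(s n, x)"] by (auto simp: indicator_def)
  qed
  show "integrable lborel (\<lambda>x. indicator (cball 0 R) x * duhamel ?P (s n, x))" for n
  proof (rule Bochner_Integration.integrable_bound[OF wi])
    show "AE x in lborel. norm (indicator (cball 0 R) x * duhamel ?P (s n, x)) \<le> norm (?w x)"
      using dom[of n] by eventually_elim (unfold real_norm_def, rule order_trans[OF _ abs_ge_self])
  qed measurable
  have "(\<lambda>n. \<integral>x. indicator (cball 0 R) x * duhamel ?P (s n, x) \<partial>lborel) \<longlonglongrightarrow> (\<integral>x. 0 \<partial>(lborel :: 'a measure))"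
  proof (rule integral_dominated_convergence[OF _ _ wi _ dom])
    show "AE x in lborel. (\<lambda>n. indicator (cball 0 R) x * duhamel ?P (s n, x)) \<longlonglongrightarrow> 0"
      using AEx
    proof eventually_elim
      case (elim x)
      show ?case by (rule tendsto_mult_right_zero[OF duhamel_power_majorant_tendsto_0[OF k elim s]])
    qed
  qed measurable
  then show "(\<lambda>n. \<integral>x. indicator (cball 0 R) x * duhamel ?P (s n, x) \<partial>lborel) \<longlonglongrightarrow> 0" by simp
qed

section \<open>The mild solution between two barriers\<close>

lemma odd_power_has_derivative:
  assumes al: "\<alpha> > 0"
  shows "((\<lambda>s::real. \<bar>s\<bar> powr \<alpha> * s) has_real_derivative (\<alpha> + 1) * \<bar>s\<bar> powr \<alpha>) (at s)"
proof -
  consider "s > 0" | "s < 0" | "s = 0" by linarith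
  then show ?thesis
  proof cases
    case 1
    have "((\<lambda>s. s powr (\<alpha> + 1)) has_real_derivative (\<alpha> + 1) * s powr (\<alpha> + 1 - 1)) (at s)"
      by (rule has_real_derivative_powr[OF 1])
    then have "((\<lambda>s. \<bar>s\<bar> powr \<alpha> * s) has_real_derivative (\<alpha> + 1) * s powr (\<alpha> + 1 - 1)) (at s)"
      by (rule DERIV_cong_ev[THEN iffD1, OF refl _ refl, rotated])
         (use eventually_nhds_in_open[of "{0<..}" s] 1 in \<open>auto elim!: eventually_mono simp: powr_add\<close>)
    then show ?thesis using 1 by simp
  next
    case 2
    have "((\<lambda>s. (- s) powr (\<alpha> + 1)) has_real_derivative (\<alpha> + 1) * (- s) powr (\<alpha> + 1 - 1) * (- 1)) (at s)"
      by (rule DERIV_chain2[OF has_real_derivative_powr]) (use 2 in \<open>auto intro!: derivative_eq_intros\<close>)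
    from DERIV_minus[OF this] have "((\<lambda>s. - ((- s) powr (\<alpha> + 1))) has_real_derivative (\<alpha> + 1) * (- s) powr \<alpha>) (at s)" by simp
    then have "((\<lambda>s. \<bar>s\<bar> powr \<alpha> * s) has_real_derivative (\<alpha> + 1) * (- s) powr \<alpha>) (at s)"
      by (rule DERIV_cong_ev[THEN iffD1, OF refl _ refl, rotated])
         (use eventually_nhds_in_open[of "{..<0}" s] 2 in \<open>auto elim!: eventually_mono simp: powr_add\<close>)
    then show ?thesis using 2 by simp
  next
    case 3
    have "((\<lambda>h::real. \<bar>h\<bar> powr \<alpha>) \<longlongrightarrow> \<bar>0\<bar> powr \<alpha>) (at 0)"
      by (intro tendsto_powr' tendsto_rabs tendsto_ident_at) (use al in auto)
    then have l: "((\<lambda>h::real. \<bar>h\<bar> powr \<alpha>) \<longlongrightarrow> 0) (at 0)" by simp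
    have "((\<lambda>h::real. (\<bar>h\<bar> powr \<alpha> * h - \<bar>0\<bar> powr \<alpha> * 0) / (h - 0)) \<longlongrightarrow> 0) (at 0)"
      by (rule Lim_transform_eventually[OF l]) (auto simp: eventually_at_filter intro!: always_eventually)
    then show ?thesis using 3 by (simp add: has_field_derivative_iff)
  qed
qed

lemma odd_power_mono:
  assumes "\<alpha> > 0" "a \<le> b"
  shows "\<bar>a\<bar> powr \<alpha> * a \<le> \<bar>b\<bar> powr \<alpha> * (b::real)"
proof (rule DERIV_nonneg_imp_nondecreasing[OF assms(2)])
  fix x :: real
  have "0 \<le> (\<alpha> + 1) * \<bar>x\<bar> powr \<alpha>" using assms by simp
  with odd_power_has_derivative[OF assms(1)]
  show "\<exists>y. ((\<lambda>s. \<bar>s\<bar> powr \<alpha> * s) has_real_derivative y) (at x) \<and> 0 \<le> y" by blast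
qed

text \<open>The mean value theorem, with the derivative bounded at \<open>\<bar>s\<bar> + \<bar>a\<bar>\<close>.\<close>
lemma odd_power_difference:
  assumes al: "\<alpha> > 0"
  shows "\<bar>\<bar>s + a\<bar> powr \<alpha> * (s + a) - \<bar>s\<bar> powr \<alpha> * s\<bar> \<le> (\<alpha> + 1) * (\<bar>s\<bar> + \<bar>a\<bar>) powr \<alpha> * \<bar>a::real\<bar>"
proof -
  have *: "\<bar>\<bar>y\<bar> powr \<alpha> * y - \<bar>x\<bar> powr \<alpha> * x\<bar> \<le> (\<alpha> + 1) * c powr \<alpha> * \<bar>y - x\<bar>" if "x < y" "\<bar>x\<bar> \<le> c" "\<bar>y\<bar> \<le> c" for x y c :: real
  proof -
    have "\<exists>z>x. z < y \<and> \<bar>y\<bar> powr \<alpha> * y - \<bar>x\<bar> powr \<alpha> * x = (y - x) * ((\<alpha> + 1) * \<bar>z\<bar> powr \<alpha>)"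
      by (rule MVT2[OF that(1)]) (rule odd_power_has_derivative[OF al])
    then obtain z where z: "x < z" "z < y" "\<bar>y\<bar> powr \<alpha> * y - \<bar>x\<bar> powr \<alpha> * x = (y - x) * ((\<alpha> + 1) * \<bar>z\<bar> powr \<alpha>)"
      by blast
    have "\<bar>z\<bar> \<le> c" using z that by linarith
    then have "\<bar>z\<bar> powr \<alpha> \<le> c powr \<alpha>" using al by (intro powr_mono2) auto
    then have "(y - x) * ((\<alpha> + 1) * \<bar>z\<bar> powr \<alpha>) \<le> (y - x) * ((\<alpha> + 1) * c powr \<alpha>)"
      using that al by (intro mult_left_mono) auto
    moreover have "0 \<le> (y - x) * ((\<alpha> + 1) * \<bar>z\<bar> powr \<alpha>)" using that al by (intro mult_nonneg_nonneg) auto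
    ultimately show ?thesis unfolding z(3) using that by (simp add: mult.commute)
  qed
  consider "a = 0" | "a > 0" | "a < 0" by linarith
  then show ?thesis
  proof cases
    case 2
    then show ?thesis using *[of s "s + a" "\<bar>s\<bar> + \<bar>a\<bar>"] by simp
  next
    case 3
    then show ?thesis using *[of "s + a" s "\<bar>s\<bar> + \<bar>a\<bar>"] by (simp add: abs_minus_commute)
  qed simp
qed

lemma inverse_power_large_near_0:
  fixes A s :: real
  assumes s: "s > 0"
  shows "\<exists>\<rho>>0. \<forall>r. 0 < r \<and> r \<le> \<rho> \<longrightarrow> A \<le> r powr (- s)"
proof -
  define A' where "A' = max A 1"
  have A: "A' > 0" "A \<le> A'" by (auto simp: A'_def)
  have "A \<le> r powr (- s)" if r: "0 < r" "r \<le> A' powr (- (1 / s))" for r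
  proof -
    have "(A' powr (- (1 / s))) powr (- s) \<le> r powr (- s)" using r s by (intro powr_mono2') auto
    moreover have "(A' powr (- (1 / s))) powr (- s) = A'" using A s by (simp add: powr_powr)
    ultimately show ?thesis using A by simp
  qed
  then show ?thesis using A by (intro exI[of _ "A' powr (- (1 / s))"]) auto
qed

text \<open>With \<open>\<bar>v r\<bar> \<le> r powr (- l) * (Y + C * r powr k)\<close> and \<open>e < l\<close>, the base on the left is
  \<open>Y r powr (- l) (1 + O (r powr d))\<close>, and \<open>r powr (- l * \<alpha>) = r powr (- 2)\<close>.\<close>
lemma potential_bound:
  fixes v :: "real \<Rightarrow> real"
  assumes al: "\<alpha> > 0" and l: "l * \<alpha> = 2" and Y: "Y > 0" "Y powr \<alpha> = b" and e: "0 < e" "e < l"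
    and k: "k > 0" and C: "C > 0" and d: "0 < d" "d \<le> k" "d \<le> l - e" and r0: "r0 \<le> 1"
    and v: "\<And>r. 0 < r \<Longrightarrow> r \<le> r0 \<Longrightarrow> \<bar>r powr l * v r\<bar> \<le> Y + C * r powr k"
  shows "\<exists>C1>0. \<forall>r. 0 < r \<and> r \<le> r0 \<longrightarrow> (\<alpha> + 1) * (\<bar>v r\<bar> + 2 * r powr (- e)) powr \<alpha> \<le> b * (\<alpha> + 1) * r powr (- 2) + C1 * r powr (d - 2)"
proof -
  define X where "X = (C + 2) / Y"
  have X: "X > 0" using C Y by (simp add: X_def)
  define C1 where "C1 = b * (\<alpha> + 1) * (\<alpha> * X * exp (\<alpha> * X))"
  have b: "b > 0" using Y by auto
  have C1: "C1 > 0" using b al X by (simp add: C1_def)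
  have "(\<alpha> + 1) * (\<bar>v r\<bar> + 2 * r powr (- e)) powr \<alpha> \<le> b * (\<alpha> + 1) * r powr (- 2) + C1 * r powr (d - 2)"
    if r: "0 < r" "r \<le> r0" for r
  proof -
    have r1: "r \<le> 1" using r r0 by simp
    have "\<bar>v r\<bar> + 2 * r powr (- e) = r powr (- l) * (r powr l * \<bar>v r\<bar> + 2 * r powr (l - e))"
    proof -
      have "r powr (- l) * r powr l = 1" using r by (simp add: powr_add[symmetric])
      moreover have "r powr (- l) * r powr (l - e) = r powr (- e)" using r by (simp add: powr_add[symmetric])
      ultimately show ?thesis by (simp add: distrib_left mult.assoc[symmetric] mult.left_commute[of _ 2])
    qed
    also have "\<dots> \<le> r powr (- l) * (Y * (1 + X * r powr d))"
    proof (rule mult_left_mono)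
      have "r powr k \<le> r powr d" "r powr (l - e) \<le> r powr d" using r r1 d by (auto intro: powr_mono')
      then have "C * r powr k \<le> C * r powr d" "2 * r powr (l - e) \<le> 2 * r powr d" using C by auto
      moreover have "r powr l * \<bar>v r\<bar> \<le> Y + C * r powr k" using v[OF r] by (simp add: abs_mult)
      ultimately have "r powr l * \<bar>v r\<bar> + 2 * r powr (l - e) \<le> Y + (C + 2) * r powr d" by (simp add: distrib_right)
      also have "\<dots> = Y * (1 + X * r powr d)" using Y by (simp add: X_def field_simps)
      finally show "r powr l * \<bar>v r\<bar> + 2 * r powr (l - e) \<le> Y * (1 + X * r powr d)" .
    qed simp
    finally have "(\<bar>v r\<bar> + 2 * r powr (- e)) powr \<alpha> \<le> (r powr (- l) * (Y * (1 + X * r powr d))) powr \<alpha>"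
      using al by (intro powr_mono2) auto
    also have "\<dots> = r powr (- 2) * (b * (1 + X * r powr d) powr \<alpha>)"
    proof -
      have "(r powr (- l)) powr \<alpha> = r powr (- 2)" using l by (simp add: powr_powr)
      then show ?thesis using Y X by (simp add: powr_mult)
    qed
    also have "\<dots> \<le> r powr (- 2) * (b * (1 + \<alpha> * X * exp (\<alpha> * X) * r powr d))"
    proof (intro mult_left_mono)
      define q where "q = X * r powr d"
      have rd: "r powr d \<le> 1" using r r1 d by (intro powr_le1) auto
      have q: "0 \<le> q" "q \<le> X" using X rd by (auto simp: q_def intro: mult_left_le)
      have "(1 + q) powr \<alpha> = exp (\<alpha> * ln (1 + q))" using q by (simp add: powr_def)
      also have "\<dots> \<le> exp (\<alpha> * q)" using q al ln_add_one_self_le_self[of q] by simp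
      also have "\<dots> \<le> 1 + (\<alpha> * q) * exp (\<alpha> * q)"
      proof -
        have "1 - \<alpha> * q \<le> exp (- (\<alpha> * q))" using exp_ge_add_one_self[of "- (\<alpha> * q)"] by simp
        then have "(1 - \<alpha> * q) * exp (\<alpha> * q) \<le> exp (- (\<alpha> * q)) * exp (\<alpha> * q)" by (intro mult_right_mono) auto
        also have "exp (- (\<alpha> * q)) * exp (\<alpha> * q) = 1" unfolding mult_exp_exp by simp
        finally show ?thesis by (simp add: left_diff_distrib)
      qed
      also have "(\<alpha> * q) * exp (\<alpha> * q) \<le> (\<alpha> * q) * exp (\<alpha> * X)" using q al by (intro mult_left_mono) auto
      finally show "(1 + X * r powr d) powr \<alpha> \<le> 1 + \<alpha> * X * exp (\<alpha> * X) * r powr d" by (simp add: q_def mult_ac)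
    qed (use b in auto)
    finally have "(\<alpha> + 1) * (\<bar>v r\<bar> + 2 * r powr (- e)) powr \<alpha> \<le> (\<alpha> + 1) * (r powr (- 2) * (b * (1 + \<alpha> * X * exp (\<alpha> * X) * r powr d)))"
      using al by (intro mult_left_mono) auto
    also have "\<dots> = b * (\<alpha> + 1) * r powr (- 2) + C1 * (r powr (- 2) * r powr d)" by (simp add: C1_def algebra_simps)
    also have "r powr (- 2) * r powr d = r powr (d - 2)" unfolding powr_add[symmetric] by simp
    finally show ?thesis .
  qed
  then show ?thesis using C1 by blast
qed

text \<open>The numbers \<open>Pe\<close> and \<open>P1\<close> stand for \<open>hardy N e\<close> and \<open>hardy N (e - d)\<close>, so the right-hand side is
  \<open>- \<Delta>\<Phi> + D\<close> for \<open>\<Phi> = K + r powr (- e) - c * r powr (- (e - d))\<close>. For small \<open>r\<close>, where \<open>\<Phi> \<le> 2 * r powr (- e)\<close>, the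
  critical parts \<open>Pe * r powr (- e - 2)\<close> cancel, and the gap \<open>c * (Pe - P1) * r powr (- (e - d) - 2)\<close> pays for the error of the
  potential and for the constant \<open>K\<close>. For large \<open>r\<close> everything is bounded and \<open>D\<close> takes over.\<close>
lemma supersolution_profile:
  fixes v :: "real \<Rightarrow> real"
  assumes al: "\<alpha> > 0" and d: "0 < d" "d < e" and P: "0 \<le> P1" "P1 < Pe" and r0: "0 < r0" "r0 \<le> 1" and C1: "C1 > 0"
    and M: "M \<ge> 0"
    and pot: "\<And>r. 0 < r \<Longrightarrow> r \<le> r0 \<Longrightarrow> (\<alpha> + 1) * (\<bar>v r\<bar> + 2 * r powr (- e)) powr \<alpha> \<le> Pe * r powr (- 2) + C1 * r powr (d - 2)"
    and far: "\<And>\<rho>. \<rho> > 0 \<Longrightarrow> \<exists>C. \<forall>r\<ge>\<rho>. \<bar>v r\<bar> \<le> C"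
  shows "\<exists>c K D. c > 0 \<and> D \<ge> 0 \<and> K \<ge> 1
    \<and> (\<forall>r>0. c * r powr (- (e - d)) - r powr (- e) + M + 1 \<le> K)
    \<and> (\<forall>r>0. (\<alpha> + 1) * (\<bar>v r\<bar> + (K + r powr (- e) - c * r powr (- (e - d)))) powr \<alpha> * (K + r powr (- e) - c * r powr (- (e - d)))
          \<le> Pe * r powr (- e - 2) - c * P1 * r powr (- (e - d) - 2) + D)"
proof -
  define e1 where "e1 = e - d"
  have e1: "e1 > 0" "e > 0" using d by (auto simp: e1_def)
  \<comment> \<open>one half of the gap \<open>2 * C1\<close> is for the error of the potential, the other one for the terms with \<open>K\<close>\<close>
  define c where "c = 2 * C1 / (Pe - P1)"
  have c: "c > 0" "c * (Pe - P1) = 2 * C1" using C1 P by (auto simp: c_def)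
  obtain rs where rs: "rs > 0" "\<And>r. 0 < r \<Longrightarrow> r \<le> rs \<Longrightarrow> c \<le> r powr (- d)"
    using inverse_power_large_near_0[OF d(1), of c] by blast
  \<comment> \<open>makes \<open>\<Phi> \<ge> M + 1\<close>, also where \<open>c * r powr (- e1)\<close> exceeds \<open>r powr (- e)\<close>\<close>
  define K where "K = M + 1 + c * rs powr (- e1)"
  have K: "K \<ge> 1" using M c rs by (simp add: K_def)
  have Kb: "c * r powr (- e1) - r powr (- e) + M + 1 \<le> K" if r: "r > 0" for r
  proof (cases "r \<le> rs")
    case True
    have "c * r powr (- e1) \<le> r powr (- d) * r powr (- e1)" using rs(2)[OF r True] by (intro mult_right_mono) auto
    also have "\<dots> = r powr (- e)" unfolding powr_add[symmetric] by (simp add: e1_def)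
    finally have "c * r powr (- e1) \<le> r powr (- e)" .
    moreover have "0 \<le> c * rs powr (- e1)" using c(1) by simp
    ultimately show ?thesis unfolding K_def by linarith
  next
    case False
    then have "r powr (- e1) \<le> rs powr (- e1)" using rs e1 by (intro powr_mono2') auto
    then have "c * r powr (- e1) \<le> c * rs powr (- e1)" using c by (intro mult_left_mono) auto
    moreover have "0 \<le> r powr (- e)" by simp
    ultimately show ?thesis unfolding K_def by linarith
  qed
  define \<Phi> where "\<Phi> = (\<lambda>r. K + r powr (- e) - c * r powr (- e1))"
  have \<Phi>1: "\<Phi> r \<ge> 1" if "r > 0" for r using Kb[OF that] M unfolding \<Phi>_def by linarith
  have \<Phi>2: "\<Phi> r \<le> K + r powr (- e)" for r using c by (simp add: \<Phi>_def)
  obtain ra where ra: "ra > 0" "\<And>r. 0 < r \<Longrightarrow> r \<le> ra \<Longrightarrow> K \<le> r powr (- e)"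
    using inverse_power_large_near_0[OF e1(2), of K] by blast
  obtain rb where rb: "rb > 0" "\<And>r. 0 < r \<Longrightarrow> r \<le> rb \<Longrightarrow> (Pe + C1) * K / C1 \<le> r powr (- e1)"
    using inverse_power_large_near_0[OF e1(1), of "(Pe + C1) * K / C1"] by blast
  define r1 where "r1 = min r0 (min ra rb)"
  have r1: "r1 > 0" "r1 \<le> r0" "r1 \<le> ra" "r1 \<le> rb" using r0 ra rb by (auto simp: r1_def)
  obtain Cf where Cf: "\<And>r. r \<ge> r1 \<Longrightarrow> \<bar>v r\<bar> \<le> Cf" using far[OF r1(1)] by blast
  define D1 where "D1 = (\<alpha> + 1) * (Cf + (K + r1 powr (- e))) powr \<alpha> * (K + r1 powr (- e))"
  define D where "D = D1 + c * P1 * r1 powr (- e1 - 2)"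
  have D10: "0 \<le> D1" using al K unfolding D1_def by (intro mult_nonneg_nonneg) auto
  have D0: "0 \<le> c * P1 * r1 powr (- e1 - 2)" using c P by (intro mult_nonneg_nonneg) auto
  have main: "(\<alpha> + 1) * (\<bar>v r\<bar> + \<Phi> r) powr \<alpha> * \<Phi> r \<le> Pe * r powr (- e - 2) - c * P1 * r powr (- e1 - 2) + D"
    if r: "r > 0" for r
  proof (cases "r \<le> r1")
    case True
    have rr: "r \<le> r0" "r \<le> ra" "r \<le> rb" "r \<le> 1" using True r1 r0 by auto
    have "\<Phi> r \<le> 2 * r powr (- e)" using \<Phi>2[of r] ra(2)[OF r rr(2)] by simp
    then have "(\<bar>v r\<bar> + \<Phi> r) powr \<alpha> \<le> (\<bar>v r\<bar> + 2 * r powr (- e)) powr \<alpha>"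
      using al \<Phi>1[OF r] by (intro powr_mono2) auto
    then have "(\<alpha> + 1) * (\<bar>v r\<bar> + \<Phi> r) powr \<alpha> \<le> (\<alpha> + 1) * (\<bar>v r\<bar> + 2 * r powr (- e)) powr \<alpha>"
      using al by (intro mult_left_mono) auto
    also have "\<dots> \<le> Pe * r powr (- 2) + C1 * r powr (d - 2)" by (rule pot[OF r rr(1)])
    finally have "(\<alpha> + 1) * (\<bar>v r\<bar> + \<Phi> r) powr \<alpha> * \<Phi> r \<le> (Pe * r powr (- 2) + C1 * r powr (d - 2)) * \<Phi> r"
      using \<Phi>1[OF r] by (intro mult_right_mono) auto
    also have "\<dots> = Pe * r powr (- 2) * \<Phi> r + C1 * r powr (d - 2) * \<Phi> r" by (simp add: distrib_right)
    also have "\<dots> \<le> Pe * r powr (- 2) * \<Phi> r + C1 * r powr (d - 2) * (K + r powr (- e))"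
      using \<Phi>2[of r] C1 by (intro add_left_mono mult_left_mono) auto
    also have "\<dots> = Pe * (r powr (- 2) * r powr (- e)) - c * Pe * (r powr (- 2) * r powr (- e1)) + C1 * (r powr (d - 2) * r powr (- e)) + Pe * K * r powr (- 2) + C1 * K * r powr (d - 2)"
      by (simp add: \<Phi>_def algebra_simps)
    also have "r powr (- 2) * r powr (- e) = r powr (- e - 2)" unfolding powr_add[symmetric] by (rule arg_cong[where f="\<lambda>a. _ powr a"]) simp
    also have "r powr (- 2) * r powr (- e1) = r powr (- e1 - 2)" unfolding powr_add[symmetric] by (rule arg_cong[where f="\<lambda>a. _ powr a"]) simp
    also have "r powr (d - 2) * r powr (- e) = r powr (- e1 - 2)" unfolding powr_add[symmetric] by (rule arg_cong[where f="\<lambda>a. _ powr a"]) (simp add: e1_def)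
    finally have A: "(\<alpha> + 1) * (\<bar>v r\<bar> + \<Phi> r) powr \<alpha> * \<Phi> r \<le> Pe * r powr (- e - 2) - c * Pe * r powr (- e1 - 2) + C1 * r powr (- e1 - 2) + Pe * K * r powr (- 2) + C1 * K * r powr (d - 2)" .
    have "r powr (d - 2) \<le> r powr (- 2)" using r rr d by (intro powr_mono') auto
    then have "C1 * K * r powr (d - 2) \<le> C1 * K * r powr (- 2)" using C1 K by (intro mult_left_mono) auto
    moreover have "Pe * K * r powr (- 2) + C1 * K * r powr (- 2) \<le> C1 * r powr (- e1 - 2)"
    proof -
      have "(Pe + C1) * K \<le> C1 * r powr (- e1)" using rb(2)[OF r rr(3)] C1 by (simp add: field_simps)
      then have "(Pe + C1) * K * r powr (- 2) \<le> C1 * r powr (- e1) * r powr (- 2)" by (intro mult_right_mono) auto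
      moreover have "r powr (- e1) * r powr (- 2) = r powr (- e1 - 2)" unfolding powr_add[symmetric] by simp
      ultimately show ?thesis by (simp add: distrib_right mult.assoc)
    qed
    moreover have "c * Pe * r powr (- e1 - 2) = c * P1 * r powr (- e1 - 2) + 2 * C1 * r powr (- e1 - 2)"
    proof -
      have "c * Pe = c * P1 + 2 * C1" using c(2) by (simp add: right_diff_distrib)
      then show ?thesis by (simp only: distrib_right)
    qed
    ultimately have "(\<alpha> + 1) * (\<bar>v r\<bar> + \<Phi> r) powr \<alpha> * \<Phi> r \<le> Pe * r powr (- e - 2) - c * P1 * r powr (- e1 - 2)"
      using A by argo
    then show ?thesis using D10 D0 unfolding D_def by linarith
  next
    case False
    then have rr: "r1 \<le> r" by simp
    have "r powr (- e) \<le> r1 powr (- e)" using r1 rr e1 by (intro powr_mono2') auto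
    then have p: "\<Phi> r \<le> K + r1 powr (- e)" using \<Phi>2[of r] by linarith
    then have "(\<bar>v r\<bar> + \<Phi> r) powr \<alpha> \<le> (Cf + (K + r1 powr (- e))) powr \<alpha>"
      using al \<Phi>1[OF r] Cf[OF rr] by (intro powr_mono2 add_mono) auto
    then have "(\<alpha> + 1) * (\<bar>v r\<bar> + \<Phi> r) powr \<alpha> * \<Phi> r \<le> D1"
      unfolding D1_def using al p \<Phi>1[OF r] by (intro mult_mono mult_nonneg_nonneg) auto
    moreover have "c * P1 * r powr (- e1 - 2) \<le> c * P1 * r1 powr (- e1 - 2)"
      using c P r1 rr e1 by (intro mult_left_mono powr_mono2') auto
    moreover have "0 \<le> Pe * r powr (- e - 2)" using P by simp
    ultimately show ?thesis unfolding D_def by linarith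
  qed
  show ?thesis
    by (rule exI[of _ c], rule exI[of _ K], rule exI[of _ D])
       (use c K D10 D0 Kb main in \<open>auto simp: D_def \<Phi>_def e1_def\<close>)
qed

lemma L_loc_of_borel:
  fixes u :: "'b::euclidean_space \<Rightarrow> real"
  assumes u: "u \<in> borel_measurable borel"
    and int: "\<And>K. compact K \<Longrightarrow> K \<subseteq> \<Omega> \<Longrightarrow> integrable lborel (\<lambda>z. indicator K z * \<bar>u z\<bar> powr p)"
  shows "L_loc p \<Omega> u"
  unfolding L_loc_def
proof (intro conjI allI impI)
  show "u \<in> borel_measurable (lebesgue_on \<Omega>)"
    using u by (intro measurable_restrict_space1) (auto simp: measurable_completion)
  fix K assume K: "compact K \<and> K \<subseteq> \<Omega>"
  have [measurable]: "K \<in> sets borel" using K by (intro borel_closed compact_imp_closed) simp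
  note [measurable] = u
  have "integrable lebesgue (\<lambda>z. indicator K z * \<bar>u z\<bar> powr p)"
    using int K by (subst integrable_completion) auto
  then show "set_integrable lebesgue K (\<lambda>x. \<bar>u x\<bar> powr p)" by (simp add: set_integrable_def)
qed

lemma norm_powr_tendsto_0:
  assumes "s > 0"
  shows "((\<lambda>x::'a::euclidean_space. norm x powr s) \<longlongrightarrow> 0) (at 0)"
proof -
  have "((\<lambda>x::'a. norm x powr s) \<longlongrightarrow> norm (0::'a) powr s) (at 0)"
    by (intro tendsto_powr' tendsto_norm tendsto_ident_at tendsto_const) (use assms in auto)
  then show ?thesis by simp
qed

text \<open>The barrier \<open>\<Phi>\<close> of \<open>supersolution_profile\<close> is invariant on a short time interval: by \<open>duhamel_power_majorant\<close>,
  the Duhamel integral of \<open>H = - \<Delta>\<Phi> + D\<close> is \<open>\<Phi>\<close> minus its heat flow plus \<open>D t\<close>. The heat flow of \<open>\<Phi>\<close> is at least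
  \<open>M + 1\<close>, which covers the flow of the data and \<open>D t \<le> 1\<close>. Then \<open>duhamel_fixed_point\<close> applies.\<close>
lemma mild_solution_near_stationary:
  fixes v :: "real \<Rightarrow> real" and w0 :: "'a::euclidean_space \<Rightarrow> real"
  assumes al: "\<alpha> > 0" and e: "0 < d" "d < e" "e < (real DIM('a) - 2) / 2"
    and r0: "0 < r0" "r0 \<le> 1" and C1: "C1 > 0" and M: "0 \<le> M" and bd: "\<And>x. \<bar>w0 x\<bar> \<le> M"
    and w0m [measurable]: "w0 \<in> borel_measurable borel"
    and vm [measurable]: "(\<lambda>x::'a. v (norm x)) \<in> borel_measurable borel"
    and pot: "\<And>r. 0 < r \<Longrightarrow> r \<le> r0 \<Longrightarrow> (\<alpha> + 1) * (\<bar>v r\<bar> + 2 * r powr (- e)) powr \<alpha> \<le> hardy DIM('a) e * r powr (- 2) + C1 * r powr (d - 2)"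
    and far: "\<And>\<rho>. \<rho> > 0 \<Longrightarrow> \<exists>C. \<forall>r\<ge>\<rho>. \<bar>v r\<bar> \<le> C"
  shows "\<exists>T>0. \<exists>K\<ge>1. \<exists>A\<ge>0. \<exists>B\<ge>0. \<exists>w h :: real \<times> 'a \<Rightarrow> real. w \<in> borel_measurable borel \<and> h \<in> borel_measurable borel
    \<and> (\<forall>p. \<bar>h p\<bar> \<le> power_majorant A e B p)
    \<and> (\<forall>p. 0 < fst p \<and> fst p < T \<and> snd p \<noteq> 0 \<longrightarrow> \<bar>w p\<bar> \<le> K + norm (snd p) powr (- e)
         \<and> w p = heat_flow w0 p + duhamel h p
         \<and> h p = \<bar>v (norm (snd p)) + w p\<bar> powr \<alpha> * (v (norm (snd p)) + w p) - \<bar>v (norm (snd p))\<bar> powr \<alpha> * v (norm (snd p)))"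
proof -
  define N where "N = real DIM('a)"
  define e1 where "e1 = e - d"
  define Pe where "Pe = hardy DIM('a) e"
  define P1 where "P1 = hardy DIM('a) e1"
  have e1: "0 < e1" "e1 < e" using e by (auto simp: e1_def)
  have eN: "e < N - 2" "e1 < N - 2" "0 < e" using e e1 unfolding N_def by argo+
  have P: "0 \<le> P1" "P1 < Pe"
  proof -
    show "0 \<le> P1" unfolding P1_def hardy_def using e1 eN by (intro mult_nonneg_nonneg) (auto simp: N_def)
    have "Pe - P1 = d * (N - 2 - e - e1)" by (simp add: Pe_def P1_def hardy_def N_def e1_def algebra_simps)
    moreover have "N - 2 - e - e1 > 0" using e e1 unfolding N_def by argo
    ultimately have "Pe - P1 > 0" using e by simp
    then show "P1 < Pe" by simp
  qed
  obtain c K D where c: "c > 0" and D: "D \<ge> 0" and K: "K \<ge> 1"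
    and Kb: "\<And>r. r > 0 \<Longrightarrow> c * r powr (- e1) - r powr (- e) + M + 1 \<le> K"
    and sup: "\<And>r. r > 0 \<Longrightarrow> (\<alpha> + 1) * (\<bar>v r\<bar> + (K + r powr (- e) - c * r powr (- e1))) powr \<alpha> * (K + r powr (- e) - c * r powr (- e1))
          \<le> Pe * r powr (- e - 2) - c * P1 * r powr (- e1 - 2) + D"
    using supersolution_profile[OF al e(1,2) P r0 C1 M pot[folded Pe_def] far] unfolding e1_def by blast
  define T where "T = 1 / (D + 1)"
  have T: "T > 0" "D * t \<le> 1" if "t < T" for t
  proof -
    show "T > 0" using D by (simp add: T_def)
    have "D * t \<le> D * T" using that D by (intro mult_left_mono) auto
    also have "D * T \<le> 1" using D by (simp add: T_def field_simps)
    finally show "D * t \<le> 1" .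
  qed
  have T0: "T > 0" using D by (simp add: T_def)
  define \<Phi> where "\<Phi> = (\<lambda>y::'a. K + norm y powr (- e) - c * norm y powr (- e1))"
  define H where "H = (\<lambda>y::'a. Pe * norm y powr (- e - 2) - c * P1 * norm y powr (- e1 - 2) + D)"
  define f where "f = (\<lambda>s::real. \<bar>s\<bar> powr \<alpha> * s)"
  \<comment> \<open>the source term of the equation for the difference to the stationary solution\<close>
  define g where "g = (\<lambda>(y::'a) a. f (v (norm y) + a) - f (v (norm y)))"
  define Q where "Q = {p :: real \<times> 'a. 0 < fst p \<and> fst p < T \<and> snd p \<noteq> 0}"
  have \<Phi>1: "1 \<le> \<Phi> y" if "y \<noteq> 0" for y using Kb[of "norm y"] that M unfolding \<Phi>_def by simp
  have bound: "\<bar>g y a\<bar> \<le> H y" if y: "y \<noteq> 0" and a: "\<bar>a\<bar> \<le> \<Phi> y" for y a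
  proof -
    have "\<bar>g y a\<bar> \<le> (\<alpha> + 1) * (\<bar>v (norm y)\<bar> + \<bar>a\<bar>) powr \<alpha> * \<bar>a\<bar>"
      unfolding g_def f_def by (rule odd_power_difference[OF al])
    also have "\<dots> \<le> (\<alpha> + 1) * (\<bar>v (norm y)\<bar> + \<Phi> y) powr \<alpha> * \<Phi> y"
      using al a \<Phi>1[OF y] by (intro mult_mono mult_left_mono powr_mono2 mult_nonneg_nonneg) auto
    also have "\<dots> \<le> H y" unfolding \<Phi>_def H_def using sup[of "norm y"] y by simp
    finally show ?thesis .
  qed
  have H0: "0 \<le> H y" for y
  proof (cases "y = 0")
    case True
    then show ?thesis using D by (simp add: H_def)
  next
    case False
    then show ?thesis using bound[OF False, of 0] \<Phi>1[OF False] by simp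
  qed
  have fm: "f \<in> borel_measurable borel" unfolding f_def by measurable
  have gm: "(\<lambda>p. g (fst p) (snd p)) \<in> borel_measurable borel"
  proof -
    have [measurable]: "(\<lambda>p::'a\<times>real. v (norm (fst p))) \<in> borel_measurable borel"
      by (rule measurable_compose[OF fst_borel_measurable vm])
    note [measurable] = fm
    show ?thesis unfolding g_def by measurable
  qed
  have fcont: "continuous_on UNIV f"
    by (rule DERIV_imp_continuous_on) (unfold f_def, rule odd_power_has_derivative[OF al])
  have gcont: "continuous_on UNIV (g y)" for y
    unfolding g_def by (intro continuous_intros continuous_on_compose2[OF fcont]) auto
  have Fm: "heat_flow w0 \<in> borel_measurable borel" by (rule heat_flow_borel[OF w0m])
  have split: "duhamel_integrand (\<lambda>q. H (snd q)) p = (\<lambda>q. duhamel_integrand (power_majorant Pe e D) p q - duhamel_integrand (power_majorant (c * P1) e1 0) p q)" for p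
    by (auto simp: H_def power_majorant_def algebra_simps)
  have parts: "integrable lborel (duhamel_integrand (power_majorant Pe e D) p)" "integrable lborel (duhamel_integrand (power_majorant (c * P1) e1 0) p)"
    if "p \<in> Q" for p
    using that eN e1 by (auto intro!: duhamel_power_majorant(1) simp: Q_def N_def)
  have Hint: "integrable lborel (duhamel_integrand (\<lambda>q. H (snd q)) p)" if "p \<in> Q" for p
    unfolding split by (intro Bochner_Integration.integrable_diff parts that)
  have inv: "\<bar>heat_flow w0 p\<bar> + duhamel (\<lambda>q. H (snd q)) p \<le> \<Phi> (snd p)" if p: "p \<in> Q" for p
  proof -
    obtain t x where pe: "p = (t, x)" by (cases p)
    have t: "0 < t" "t < T" and x: "x \<noteq> 0" using p by (auto simp: Q_def pe)
    have kk: "0 < e" "e < real DIM('a) - 2" "0 < e1" "e1 < real DIM('a) - 2" using eN e1 by (auto simp: N_def)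
    have h1: "hardy DIM('a) e = Pe" "hardy DIM('a) e1 = P1" by (auto simp: Pe_def P1_def)
    have Pp: "Pe > 0" "P1 > 0"
    proof -
      show "P1 > 0" unfolding P1_def hardy_def using kk(3,4) by simp
      then show "Pe > 0" using P(2) by simp
    qed
    let ?S = "\<lambda>k. heat_flow (\<lambda>y. norm y powr (- k)) (t, x)"
    have "duhamel (\<lambda>q. H (snd q)) p = duhamel (power_majorant Pe e D) p - duhamel (power_majorant (c * P1) e1 0) p"
      unfolding duhamel_def split using parts[OF p] by (rule Bochner_Integration.integral_diff)
    also have "\<dots> = (norm x powr (- e) - ?S e) + D * t - c * (norm x powr (- e1) - ?S e1)"
      using duhamel_power_majorant(2)[of "(t, x)" e Pe D] duhamel_power_majorant(2)[of "(t, x)" e1 "c * P1" 0] t x kk Pp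
      by (simp add: pe h1)
    finally have dH: "duhamel (\<lambda>q. H (snd q)) p = norm x powr (- e) - c * norm x powr (- e1) + (c * ?S e1 - ?S e) + D * t"
      by (simp add: right_diff_distrib)
    have ii: "integrable lborel (\<lambda>y. heat_kernel (t, x - y) * norm y powr (- e))" "integrable lborel (\<lambda>y. heat_kernel (t, x - y) * norm y powr (- e1))"
      using heat_flow_power_integrable[OF x _ _ t(1)] kk by auto
    have one: "integrable lborel (\<lambda>y::'a. heat_kernel (t, x - y) * (K - M - 1))" "heat_flow (\<lambda>y::'a. K - M - 1) (t, x) \<le> \<bar>K - M - 1\<bar>"
      using heat_flow_bounded[of "\<lambda>y::'a. K - M - 1" "\<bar>K - M - 1\<bar>" t x] t by (auto simp: abs_le_iff)
    have KM: "0 \<le> K - M - 1 \<or> K - M - 1 < 0" by linarith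
    have "c * ?S e1 - ?S e = (\<integral>y. heat_kernel (t, x - y) * (c * norm y powr (- e1) - norm y powr (- e)) \<partial>lborel)"
      unfolding heat_flow_def fst_conv snd_conv using ii by (simp add: right_diff_distrib mult.left_commute[of _ c])
    also have "\<dots> \<le> (\<integral>y. heat_kernel (t, x - y) * (K - M - 1) \<partial>lborel)"
    proof (rule integral_mono_AE)
      show "integrable lborel (\<lambda>y. heat_kernel (t, x - y) * (c * norm y powr (- e1) - norm y powr (- e)))"
        using ii by (simp add: right_diff_distrib mult.left_commute[of _ c])
      show "AE y in lborel. heat_kernel (t, x - y) * (c * norm y powr (- e1) - norm y powr (- e)) \<le> heat_kernel (t, x - y) * (K - M - 1)"
        using AE_lborel_singleton[of "0::'a"]
      proof eventually_elim
        case (elim y)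
        then show ?case using Kb[of "norm y"] by (intro mult_left_mono) auto
      qed
    qed (rule one)
    also have "\<dots> = K - M - 1"
    proof -
      have "(\<integral>y. heat_kernel (t, x - y) \<partial>lborel) = 1"
        using heat_kernel_integral_one(1)[OF t(1), where 'a='a] lborel_integral_reflect[of "\<lambda>y. heat_kernel (t, y)" x] by auto
      then show ?thesis by simp
    qed
    finally have S: "c * ?S e1 - ?S e \<le> K - M - 1" .
    have "\<bar>heat_flow w0 p\<bar> \<le> M" unfolding pe by (rule heat_flow_bounded(2)[OF w0m bd t(1)])
    moreover have "D * t \<le> 1" using T(2) t by simp
    ultimately show ?thesis unfolding dH unfolding \<Phi>_def pe snd_conv using S by linarith
  qed
  have \<Phi>m: "\<Phi> \<in> borel_measurable borel" "H \<in> borel_measurable borel" unfolding \<Phi>_def H_def by measurable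
  have "\<exists>w \<in> borel_measurable borel. (\<forall>p\<in>Q. \<bar>w p\<bar> \<le> \<Phi> (snd p) \<and>
     w p = heat_flow w0 p + duhamel (\<lambda>q. if q \<in> Q then g (snd q) (w q) else 0) p)"
    unfolding Q_def
  proof (rule duhamel_fixed_point[OF gm \<Phi>m Fm])
    show "g y a \<le> g y b" if "a \<le> b" for y a b
      unfolding g_def f_def using odd_power_mono[OF al, of "v (norm y) + a" "v (norm y) + b"] that by simp
    show "0 \<le> \<Phi> y" if "y \<noteq> 0" for y using \<Phi>1[OF that] by simp
  qed (use gcont bound H0 Hint[unfolded Q_def] inv[unfolded Q_def] in auto)
  then obtain w where w: "w \<in> borel_measurable borel" "\<And>p. p \<in> Q \<Longrightarrow> \<bar>w p\<bar> \<le> \<Phi> (snd p)"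
    "\<And>p. p \<in> Q \<Longrightarrow> w p = heat_flow w0 p + duhamel (\<lambda>q. if q \<in> Q then g (snd q) (w q) else 0) p" by blast
  define h where "h = (\<lambda>q. if q \<in> Q then g (snd q) (w q) else 0)"
  have hm: "h \<in> borel_measurable borel"
  proof -
    have [measurable]: "Measurable.pred borel (\<lambda>p. p \<in> Q)" unfolding Q_def by simp
    have "(\<lambda>q. (snd q, w q)) \<in> borel_measurable borel" using w(1) by (intro borel_measurable_Pair) measurable
    from measurable_compose[OF this gm] have [measurable]: "(\<lambda>q. g (snd q) (w q)) \<in> borel_measurable borel" by simp
    show ?thesis unfolding h_def by measurable
  qed
  have hb: "\<bar>h p\<bar> \<le> power_majorant Pe e D p" for p
  proof (cases "p \<in> Q")
    case True
    then have "\<bar>h p\<bar> \<le> H (snd p)" using bound[of "snd p" "w p"] w(2)[OF True] by (simp add: h_def Q_def)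
    also have "\<dots> \<le> power_majorant Pe e D p" using c P by (simp add: H_def power_majorant_def)
    finally show ?thesis .
  next
    case False
    then show ?thesis using P D by (simp add: h_def power_majorant_def)
  qed
  have \<Phi>le: "\<Phi> y \<le> K + norm y powr (- e)" for y using c by (simp add: \<Phi>_def)
  have fin: "\<bar>w p\<bar> \<le> K + norm (snd p) powr (- e) \<and> w p = heat_flow w0 p + duhamel h p
         \<and> h p = \<bar>v (norm (snd p)) + w p\<bar> powr \<alpha> * (v (norm (snd p)) + w p) - \<bar>v (norm (snd p))\<bar> powr \<alpha> * v (norm (snd p))"
    if "0 < fst p \<and> fst p < T \<and> snd p \<noteq> 0" for p
  proof -
    have p: "p \<in> Q" using that by (simp add: Q_def)
    show ?thesis using order_trans[OF w(2)[OF p] \<Phi>le] w(3)[OF p] p by (simp add: h_def[symmetric]) (simp add: h_def g_def f_def)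
  qed
  show ?thesis
    by (rule exI[of _ T], rule conjI[OF T0], rule exI[of _ K], rule conjI[OF K], rule exI[of _ Pe], rule conjI,
        (use P in simp), rule exI[of _ D], rule conjI[OF D], rule exI[of _ w], rule exI[of _ h])
       (use w(1) hm hb fin in blast)
qed

section \<open>The solution with prescribed singular data\<close>

lemma set_integral_lebesgue_eq_lborel:
  fixes g :: "'b::euclidean_space \<Rightarrow> real"
  assumes g: "g \<in> borel_measurable borel" and z: "\<And>z. z \<notin> \<Omega> \<Longrightarrow> g z = 0"
  shows "(LINT z:\<Omega>|lebesgue. g z) = (\<integral>z. g z \<partial>lborel)"
proof -
  have "(\<lambda>y. indicator \<Omega> y *\<^sub>R g y) = g"
  proof
    show "indicator \<Omega> y *\<^sub>R g y = g y" for y using z[of y] by (cases "y \<in> \<Omega>") auto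
  qed
  then show ?thesis unfolding set_lebesgue_integral_def using g by (simp add: integral_completion)
qed

text \<open>Converts growth of order \<open>r powr (- l)\<close> of a function into growth of order \<open>r powr (- l - 2)\<close> of the function and of its
  nonlinear term; the latter holds because \<open>l * (\<alpha> + 1) = l + 2\<close>.\<close>
lemma growth_bound:
  fixes s r :: real
  assumes al: "\<alpha> > 0" and l: "l > 0" "l * \<alpha> = 2" and C: "C \<ge> 0" and r: "r > 0"
    and s: "\<bar>s\<bar> \<le> C * (r powr (- l) + 1)"
  shows "\<bar>s\<bar> \<le> (2 * C + (2 * C) powr (\<alpha> + 1)) * (r powr (- l - 2) + 1)"
    and "\<bar>s\<bar> powr (\<alpha> + 1) \<le> (2 * C + (2 * C) powr (\<alpha> + 1)) * (r powr (- l - 2) + 1)"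
proof -
  define P where "P = r powr (- l - 2) + 1"
  have "\<bar>s\<bar> \<le> 2 * C * P \<and> \<bar>s\<bar> powr (\<alpha> + 1) \<le> (2 * C) powr (\<alpha> + 1) * P"
  proof (cases "r \<le> 1")
    case True
    have "1 \<le> r powr (- l)" using True r l powr_mono2'[of "- l" r 1] by simp
    then have "C * (r powr (- l) + 1) \<le> C * (2 * r powr (- l))" using C by (intro mult_left_mono) auto
    then have b: "\<bar>s\<bar> \<le> (2 * C) * r powr (- l)" using s by simp
    have "r powr (- l) \<le> r powr (- l - 2)" using True r by (intro powr_mono') auto
    then have "(2 * C) * r powr (- l) \<le> (2 * C) * P" using C unfolding P_def by (intro mult_left_mono) auto
    moreover have "\<bar>s\<bar> powr (\<alpha> + 1) \<le> ((2 * C) * r powr (- l)) powr (\<alpha> + 1)"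
      using b al by (intro powr_mono2) auto
    moreover have "((2 * C) * r powr (- l)) powr (\<alpha> + 1) = (2 * C) powr (\<alpha> + 1) * r powr (- l * (\<alpha> + 1))"
      using C by (simp add: powr_mult powr_powr)
    moreover have "- l * (\<alpha> + 1) = - l - 2" using l by (simp add: algebra_simps)
    moreover have "(2 * C) powr (\<alpha> + 1) * r powr (- l - 2) \<le> (2 * C) powr (\<alpha> + 1) * P"
      unfolding P_def by (intro mult_left_mono) auto
    ultimately show ?thesis using b by simp
  next
    case False
    have "r powr (- l) \<le> 1" using False l powr_mono2'[of "- l" 1 r] by simp
    then have "C * (r powr (- l) + 1) \<le> C * 2" using C by (intro mult_left_mono) auto
    then have b: "\<bar>s\<bar> \<le> 2 * C" using s by simp
    have P: "1 \<le> P" by (simp add: P_def)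
    have "2 * C * 1 \<le> 2 * C * P" using P C by (intro mult_left_mono) auto
    moreover have "(2 * C) powr (\<alpha> + 1) * 1 \<le> (2 * C) powr (\<alpha> + 1) * P" using P by (intro mult_left_mono) auto
    moreover have "\<bar>s\<bar> powr (\<alpha> + 1) \<le> (2 * C) powr (\<alpha> + 1)" using b al by (intro powr_mono2) auto
    ultimately show ?thesis using b by simp
  qed
  moreover have "0 \<le> 2 * C * P" "0 \<le> (2 * C) powr (\<alpha> + 1) * P" using C by (auto simp: P_def)
  ultimately show "\<bar>s\<bar> \<le> (2 * C + (2 * C) powr (\<alpha> + 1)) * (r powr (- l - 2) + 1)"
    "\<bar>s\<bar> powr (\<alpha> + 1) \<le> (2 * C + (2 * C) powr (\<alpha> + 1)) * (r powr (- l - 2) + 1)"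
    unfolding P_def[symmetric] distrib_right by linarith+
qed

text \<open>The growth bound makes all integrals over the slab converge on supports of test functions, so the weak
  formulation reduces to one identity between integrals over the whole space.\<close>
lemma heat_solution_distrI:
  fixes u :: "real \<times> 'a::euclidean_space \<Rightarrow> real"
  assumes al: "\<alpha> > 0" and l: "l * \<alpha> = 2" "0 < l" "l < real DIM('a) - 2" and C: "C \<ge> 0"
    and um: "u \<in> borel_measurable borel"
    and ub: "\<And>z. z \<in> {0<..<T} \<times> UNIV \<Longrightarrow> snd z \<noteq> 0 \<Longrightarrow> \<bar>u z\<bar> \<le> C * (norm (snd z) powr (- l) + 1)"
    and eq: "\<And>\<phi>. test_function ({0<..<T} \<times> UNIV) \<phi> \<Longrightarrow>
      (\<integral>z. u z * heat_adjoint \<phi> z \<partial>lborel) = - (\<integral>z. \<bar>u z\<bar> powr \<alpha> * u z * \<phi> z \<partial>lborel)"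
  shows "L_loc (\<alpha> + 1) ({0<..<T} \<times> UNIV) u" and "heat_solution_distr \<alpha> T u"
proof -
  define \<Omega> where "\<Omega> = {0<..<T} \<times> (UNIV :: 'a set)"
  define C' where "C' = 2 * C + (2 * C) powr (\<alpha> + 1)"
  note [measurable] = um
  have pos: "norm (snd z) > 0" if "snd z \<noteq> 0" for z :: "real \<times> 'a" using that by simp
  have b1: "\<bar>u z\<bar> \<le> C' * (norm (snd z) powr (- l - 2) + 1)" if "z \<in> {0<..<T} \<times> UNIV" "snd z \<noteq> 0" for z
    unfolding C'_def by (rule growth_bound(1)[OF al l(2,1) C pos[OF that(2)] ub[OF that]])
  have b2: "\<bar>u z\<bar> powr (\<alpha> + 1) \<le> C' * (norm (snd z) powr (- l - 2) + 1)" if "z \<in> {0<..<T} \<times> UNIV" "snd z \<noteq> 0" for z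
    unfolding C'_def by (rule growth_bound(2)[OF al l(2,1) C pos[OF that(2)] ub[OF that]])
  have op: "\<bar>\<bar>s\<bar> powr \<alpha> * s\<bar> = \<bar>s\<bar> powr (\<alpha> + 1)" for s :: real by (cases "s = 0") (auto simp: abs_mult powr_add)
  have loc: "integrable lborel (\<lambda>z. g z * \<psi> z)"
    if "g \<in> borel_measurable borel" "\<psi> \<in> borel_measurable borel" "compact K" "K \<subseteq> \<Omega>" "\<And>z. \<bar>\<psi> z\<bar> \<le> B" "\<And>z. z \<notin> K \<Longrightarrow> \<psi> z = 0"
      "\<And>z. z \<in> {0<..<T} \<times> UNIV \<Longrightarrow> snd z \<noteq> 0 \<Longrightarrow> \<bar>g z\<bar> \<le> C' * (norm (snd z) powr (- l - 2) + 1)"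
    for g \<psi> :: "real \<times> 'a \<Rightarrow> real" and K B
    by (rule slab_integrable[OF l(2,3) that(1,2,3) that(4)[unfolded \<Omega>_def] that(5,6,7)])
  have locK: "integrable lborel (\<lambda>z. indicator K z * g z)"
    if "g \<in> borel_measurable borel" "compact K" "K \<subseteq> \<Omega>"
      "\<And>z. z \<in> {0<..<T} \<times> UNIV \<Longrightarrow> snd z \<noteq> 0 \<Longrightarrow> \<bar>g z\<bar> \<le> C' * (norm (snd z) powr (- l - 2) + 1)"
    for g :: "real \<times> 'a \<Rightarrow> real" and K
  proof -
    have "K \<in> sets borel" using that by (intro borel_closed compact_imp_closed)
    then have "integrable lborel (\<lambda>z. g z * indicator K z)"
      by (intro loc[where K=K and B=1] that) (auto simp: indicator_def)
    then show ?thesis by (simp add: mult.commute)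
  qed
  show "L_loc (\<alpha> + 1) ({0<..<T} \<times> UNIV) u"
    unfolding \<Omega>_def[symmetric] by (rule L_loc_of_borel[OF um], rule locK) (use b2 in auto)
  have fm: "(\<lambda>z. \<bar>u z\<bar> powr \<alpha> * u z) \<in> borel_measurable borel" by measurable
  have L1: "L_loc 1 \<Omega> u"
    by (rule L_loc_of_borel[OF um], rule locK) (use b1 in auto)
  have L2: "L_loc 1 \<Omega> (\<lambda>z. \<bar>u z\<bar> powr \<alpha> * u z)"
    by (rule L_loc_of_borel[OF fm], rule locK) (use b2 op in auto)
  have "(LINT z:\<Omega>|lebesgue. u z * (- time_deriv \<phi> z)) =
           (LINT z:\<Omega>|lebesgue. u z * space_laplacian \<phi> z)
             + (LINT z:\<Omega>|lebesgue. \<bar>u z\<bar> powr \<alpha> * u z * \<phi> z)" if t: "test_function \<Omega> \<phi>" for \<phi>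
  proof -
    note c = test_function_calculus[OF t]
    obtain K where K: "compact K" "K \<subseteq> \<Omega>" "\<And>z. z \<notin> K \<Longrightarrow> \<phi> z = 0 \<and> time_deriv \<phi> z = 0 \<and> (\<forall>b. dir_deriv (0, b) \<phi> z = 0 \<and> dir_deriv (0, b) (dir_deriv (0, b) \<phi>) z = 0)"
      using c(7) by blast
    have cL: "continuous_on UNIV (space_laplacian \<phi>)" unfolding space_laplacian_def[abs_def] using c(6) by (intro continuous_intros)
    have z: "\<phi> z = 0" "time_deriv \<phi> z = 0" "space_laplacian \<phi> z = 0" if "z \<notin> K" for z
      using K(3)[OF that] by (auto simp: space_laplacian_def)
    have m [measurable]: "\<phi> \<in> borel_measurable borel" "time_deriv \<phi> \<in> borel_measurable borel" "space_laplacian \<phi> \<in> borel_measurable borel"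
      using c(3,4) cL by (auto intro: borel_measurable_continuous_onI)
    obtain Bt where Bt: "\<And>z. \<bar>time_deriv \<phi> z\<bar> \<le> Bt" using bounded_of_compact_support[OF c(4) K(1)] z by blast
    obtain Bl where Bl: "\<And>z. \<bar>space_laplacian \<phi> z\<bar> \<le> Bl" using bounded_of_compact_support[OF cL K(1)] z by blast
    have it: "integrable lborel (\<lambda>z. u z * time_deriv \<phi> z)" by (rule loc[OF um m(2) K(1,2) Bt z(2) b1])
    have il: "integrable lborel (\<lambda>z. u z * space_laplacian \<phi> z)" by (rule loc[OF um m(3) K(1,2) Bl z(3) b1])
    have "(\<integral>z. u z * time_deriv \<phi> z \<partial>lborel) + (\<integral>z. u z * space_laplacian \<phi> z \<partial>lborel) = (\<integral>z. u z * heat_adjoint \<phi> z \<partial>lborel)"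
      unfolding heat_adjoint_def distrib_left by (rule Bochner_Integration.integral_add[OF it il, symmetric])
    also have "\<dots> = - (\<integral>z. \<bar>u z\<bar> powr \<alpha> * u z * \<phi> z \<partial>lborel)" by (rule eq[OF t[unfolded \<Omega>_def]])
    finally have e: "- (\<integral>z. u z * time_deriv \<phi> z \<partial>lborel) = (\<integral>z. u z * space_laplacian \<phi> z \<partial>lborel) + (\<integral>z. \<bar>u z\<bar> powr \<alpha> * u z * \<phi> z \<partial>lborel)"
      by simp
    have off: "z \<notin> \<Omega> \<Longrightarrow> z \<notin> K" for z using K(2) by blast
    have "(LINT z:\<Omega>|lebesgue. u z * (- time_deriv \<phi> z)) = (\<integral>z. u z * (- time_deriv \<phi> z) \<partial>lborel)"
      by (rule set_integral_lebesgue_eq_lborel) (measurable, use z off in auto)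
    moreover have "(LINT z:\<Omega>|lebesgue. u z * space_laplacian \<phi> z) = (\<integral>z. u z * space_laplacian \<phi> z \<partial>lborel)"
      by (rule set_integral_lebesgue_eq_lborel) (measurable, use z off in auto)
    moreover have "(LINT z:\<Omega>|lebesgue. \<bar>u z\<bar> powr \<alpha> * u z * \<phi> z) = (\<integral>z. \<bar>u z\<bar> powr \<alpha> * u z * \<phi> z \<partial>lborel)"
      by (rule set_integral_lebesgue_eq_lborel) (measurable, use z off in auto)
    ultimately show ?thesis using e by simp
  qed
  then show "heat_solution_distr \<alpha> T u"
    unfolding heat_solution_distr_def Let_def \<Omega>_def[symmetric] using L1 L2 by blast
qed

text \<open>At almost every point \<open>u(t) - u0\<close> is the sum of \<open>heat_flow w0 (t, x) - w0 x\<close> and of a Duhamel term below the one of its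
  majorant; both tend to \<open>0\<close> in \<open>L\<^sup>1\<close> on balls.\<close>
lemma perturbation_L1_trace:
  fixes Ub w0 u0 :: "'a::euclidean_space \<Rightarrow> real" and u h :: "real \<times> 'a \<Rightarrow> real"
  assumes T: "T > 0" and k: "0 < k" "k < real DIM('a) - 2" and l: "0 < l" "l < real DIM('a) - 2" and AB: "0 \<le> A" "0 \<le> B"
    and um: "u \<in> borel_measurable borel" and Ub: "Ub \<in> borel_measurable borel" and w0: "w0 \<in> borel_measurable borel" "\<And>x. \<bar>w0 x\<bar> \<le> M"
    and h: "h \<in> borel_measurable borel" "\<And>p. \<bar>h p\<bar> \<le> power_majorant A k B p"
    and ub: "\<And>t x. 0 < t \<Longrightarrow> t < T \<Longrightarrow> x \<noteq> 0 \<Longrightarrow> \<bar>u (t, x)\<bar> \<le> C * (norm x powr (- l - 2) + 1)"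
    and dec: "\<And>t x. 0 < t \<Longrightarrow> t < T \<Longrightarrow> x \<noteq> 0 \<Longrightarrow> u (t, x) = Ub x + (heat_flow w0 (t, x) + duhamel h (t, x))"
    and u0: "L_loc 1 UNIV u0" "AE x in lebesgue. u0 x = Ub x + w0 x"
  shows "tendsto_L1_loc (\<lambda>t x. u (t, x)) u0 (at_right 0)"
  unfolding tendsto_L1_loc_def
proof (intro conjI allI impI)
  note [measurable] = um Ub w0(1) h(1)
  have ball: "cball (0::'a) R \<in> sets borel" for R by simp
  note [measurable] = ball
  have um1 [measurable]: "(\<lambda>x. u (t, x)) \<in> borel_measurable borel" for t
  proof -
    have "(\<lambda>x::'a. (t, x)) \<in> borel_measurable borel" by (intro borel_measurable_continuous_onI continuous_intros)
    from measurable_compose[OF this um] show ?thesis .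
  qed
  have [measurable]: "heat_flow w0 \<in> borel_measurable borel" by (rule heat_flow_borel[OF w0(1)])
  have hf [measurable]: "(\<lambda>x. heat_flow w0 (t, x)) \<in> borel_measurable borel" for t
  proof -
    have "(\<lambda>x::'a. (t, x)) \<in> borel_measurable borel" by (intro borel_measurable_continuous_onI continuous_intros)
    from measurable_compose[OF this heat_flow_borel[OF w0(1)]] show ?thesis .
  qed
  have C: "0 \<le> C"
  proof -
    obtain x :: 'a where x: "norm x = 1" using vector_choose_size[of 1] by auto
    then have "x \<noteq> 0" by auto
    from ub[of "T / 2" x] T this x have "0 \<le> C * 2" by (simp add: order_trans[OF abs_ge_zero])
    then show ?thesis by simp
  qed
  have "L_loc 1 UNIV (\<lambda>x. u (t, x))" if t: "0 < t" "t < T" for t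
  proof (rule L_loc_of_borel[OF um1])
    fix K :: "'a set" assume K: "compact K"
    then have [measurable]: "K \<in> sets borel" by (intro borel_closed compact_imp_closed)
    obtain R where "\<forall>x\<in>K. norm x \<le> R" using compact_imp_bounded[OF K] unfolding bounded_iff by blast
  then have R: "K \<subseteq> cball 0 R" by auto
    have i1: "integrable lborel (\<lambda>y::'a. indicator (cball 0 R) y :: real)"
      by (rule integrable_real_indicator) (use emeasure_lborel_cball_finite[of "0::'a" R] in simp_all)
    have "integrable lborel (\<lambda>y::'a. C * (indicator (cball 0 R) y * norm y powr (- l - 2)) + C * indicator (cball 0 R) y)"
      by (rule Bochner_Integration.integrable_add[OF integrable_mult_right[OF power_locally_integrable[OF l]] integrable_mult_right[OF i1]])
    then show "integrable lborel (\<lambda>x. indicator K x * \<bar>u (t, x)\<bar> powr 1)"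
    proof (rule Bochner_Integration.integrable_bound)
      show "AE x in lborel. norm (indicator K x * \<bar>u (t, x)\<bar> powr 1) \<le> norm (C * (indicator (cball 0 R) x * norm x powr (- l - 2)) + C * indicator (cball 0 R) x)"
        using AE_lborel_singleton[of "0::'a"]
      proof eventually_elim
        case (elim x)
        show ?case
        proof (cases "x \<in> K")
          case True
          then have "x \<in> cball 0 R" using R by blast
          then show ?thesis using True ub[OF t elim] C by (simp add: distrib_left)
        qed simp
      qed
    qed measurable
  qed
  moreover have "\<forall>\<^sub>F t in at_right 0. 0 < t \<and> t < T" using T eventually_at_right[of 0 T] by auto
  ultimately show "\<forall>\<^sub>F t in at_right 0. L_loc 1 UNIV (\<lambda>x. u (t, x))" by (auto elim!: eventually_mono)
  show "L_loc 1 UNIV u0" by (rule u0(1))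
  fix K :: "'a set" assume K: "compact K"
  then have Km [measurable]: "K \<in> sets borel" by (intro borel_closed compact_imp_closed)
  obtain R where "\<forall>x\<in>K. norm x \<le> R" using compact_imp_bounded[OF K] unfolding bounded_iff by blast
  then have R: "K \<subseteq> cball 0 R" by auto
  have u0m: "u0 \<in> borel_measurable lebesgue" using u0(1) by (simp add: L_loc_def lebesgue_on_UNIV_eq)
  show "((\<lambda>t. LINT x:K|lebesgue. \<bar>u (t, x) - u0 x\<bar>) \<longlongrightarrow> 0) (at_right 0)"
  proof (rule tendsto_at_right_sequentially[of _ "min T 1"])
    show "0 < min T 1" using T by simp
    fix s :: "nat \<Rightarrow> real"
    assume s: "\<And>n. 0 < s n" "\<And>n. s n < min T 1" "s \<longlonglongrightarrow> 0"
    have s1: "s n < T" "s n < 1" for n using s(2)[of n] by auto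
    define a where "a = (\<lambda>n. \<integral>x. indicator (cball 0 R) x * \<bar>heat_flow w0 (s n, x) - w0 x\<bar> \<partial>lborel)"
    define b where "b = (\<lambda>n. \<integral>x. indicator (cball 0 R) x * duhamel (power_majorant A k B) (s n, x :: 'a) \<partial>lborel)"
    have lim: "(\<lambda>n. a n + b n) \<longlonglongrightarrow> 0 + 0"
      unfolding a_def b_def by (intro tendsto_add heat_flow_L1_continuous[OF w0 s(1,3)] duhamel_L1_tendsto_0(1)[OF k AB s(1) s1(2) s(3)])
    have le: "(LINT x:K|lebesgue. \<bar>u (s n, x) - u0 x\<bar>) \<le> a n + b n" for n
    proof -
      have ia: "integrable lborel (\<lambda>x. indicator (cball 0 R) x * \<bar>heat_flow w0 (s n, x) - w0 x\<bar>)"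
      proof (rule Bochner_Integration.integrable_bound)
        show "integrable lborel (\<lambda>y::'a. (2 * M) * indicator (cball 0 R) y)"
          by (rule integrable_mult_right, rule integrable_real_indicator) (use emeasure_lborel_cball_finite[of "0::'a" R] in simp_all)
        show "AE x in lborel. norm (indicator (cball 0 R) x * \<bar>heat_flow w0 (s n, x) - w0 x\<bar>) \<le> norm ((2 * M) * indicator (cball 0 R) x)"
        proof (rule AE_I2)
          fix x
          have "\<bar>heat_flow w0 (s n, x)\<bar> \<le> M" by (rule heat_flow_bounded(2)[OF w0 s(1)])
          then have "\<bar>heat_flow w0 (s n, x) - w0 x\<bar> \<le> 2 * M" using w0(2)[of x] by linarith
          then show "norm (indicator (cball 0 R) x * \<bar>heat_flow w0 (s n, x) - w0 x\<bar>) \<le> norm ((2 * M) * indicator (cball 0 R) x)"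
            by (simp add: indicator_def)
        qed
      qed measurable
      have dom: "\<bar>duhamel h (s n, x)\<bar> \<le> duhamel (power_majorant A k B) (s n, x)" if "x \<noteq> 0" for x
        by (rule duhamel_dominated(2)[OF h], rule duhamel_power_majorant(1)) (use k s(1) that in auto)
      note ib = duhamel_L1_tendsto_0(2)[OF k AB s(1) s1(2) s(3), of R n]
      have "(LINT x:K|lebesgue. \<bar>u (s n, x) - u0 x\<bar>) = (\<integral>x. indicator K x * \<bar>u (s n, x) - u0 x\<bar> \<partial>lebesgue)"
        by (simp add: set_lebesgue_integral_def)
      also have "\<dots> = (\<integral>x. indicator K x * \<bar>u (s n, x) - (Ub x + w0 x)\<bar> \<partial>lebesgue)"
      proof (rule integral_cong_AE)
        have lm: "g \<in> borel_measurable lebesgue" if "g \<in> borel_measurable borel" for g :: "'a \<Rightarrow> real"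
          using that by (simp add: measurable_completion)
        note [measurable] = lm[OF borel_measurable_indicator[OF Km]] lm[OF um1] lm[OF Ub] lm[OF w0(1)]
        note [measurable] = u0m
        show "(\<lambda>x. indicator K x * \<bar>u (s n, x) - u0 x\<bar>) \<in> borel_measurable lebesgue" by measurable
        show "(\<lambda>x. indicator K x * \<bar>u (s n, x) - (Ub x + w0 x)\<bar>) \<in> borel_measurable lebesgue" by measurable
        show "AE x in lebesgue. indicator K x * \<bar>u (s n, x) - u0 x\<bar> = indicator K x * \<bar>u (s n, x) - (Ub x + w0 x)\<bar>"
          using u0(2) by eventually_elim simp
      qed
      also have "\<dots> = (\<integral>x. indicator K x * \<bar>u (s n, x) - (Ub x + w0 x)\<bar> \<partial>lborel)"
        by (rule integral_completion) measurable
      also have "\<dots> \<le> (\<integral>x. indicator (cball 0 R) x * \<bar>heat_flow w0 (s n, x) - w0 x\<bar> + indicator (cball 0 R) x * duhamel (power_majorant A k B) (s n, x) \<partial>lborel)"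
      proof (rule integral_mono_AE')
        show "integrable lborel (\<lambda>x. indicator (cball 0 R) x * \<bar>heat_flow w0 (s n, x) - w0 x\<bar> + indicator (cball 0 R) x * duhamel (power_majorant A k B) (s n, x))"
          by (intro Bochner_Integration.integrable_add ia ib)
        show "AE x in lborel. indicator K x * \<bar>u (s n, x) - (Ub x + w0 x)\<bar> \<le> indicator (cball 0 R) x * \<bar>heat_flow w0 (s n, x) - w0 x\<bar> + indicator (cball 0 R) x * duhamel (power_majorant A k B) (s n, x)"
          using AE_lborel_singleton[of "0::'a"]
        proof eventually_elim
          case (elim x)
          note d = dom[OF elim]
          have "\<bar>u (s n, x) - (Ub x + w0 x)\<bar> \<le> \<bar>heat_flow w0 (s n, x) - w0 x\<bar> + duhamel (power_majorant A k B) (s n, x)"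
            unfolding dec[OF s(1) s1(1) elim] using d by linarith
          moreover have "0 \<le> duhamel (power_majorant A k B) (s n, x)" using d by linarith
          ultimately show ?case using R by (auto simp: indicator_def)
        qed
        show "AE x in lborel. 0 \<le> indicator (cball 0 R) x * \<bar>heat_flow w0 (s n, x) - w0 x\<bar> + indicator (cball 0 R) x * duhamel (power_majorant A k B) (s n, x)"
          using AE_lborel_singleton[of "0::'a"]
        proof eventually_elim
          case (elim x)
          have "0 \<le> duhamel (power_majorant A k B) (s n, x)" using dom[OF elim] by linarith
          then show ?case by simp
        qed
      qed
      also have "\<dots> = a n + b n" unfolding a_def b_def by (rule Bochner_Integration.integral_add[OF ia ib])
      finally show ?thesis .
    qed
    show "(\<lambda>n. LINT x:K|lebesgue. \<bar>u (s n, x) - u0 x\<bar>) \<longlonglongrightarrow> 0"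
    proof (rule tendsto_sandwich)
      show "\<forall>\<^sub>F n in sequentially. 0 \<le> (LINT x:K|lebesgue. \<bar>u (s n, x) - u0 x\<bar>)"
        unfolding set_lebesgue_integral_def by (intro always_eventually allI Bochner_Integration.integral_nonneg) auto
      show "\<forall>\<^sub>F n in sequentially. (LINT x:K|lebesgue. \<bar>u (s n, x) - u0 x\<bar>) \<le> a n + b n" using le by simp
      show "(\<lambda>n. a n + b n) \<longlonglongrightarrow> 0" using lim by simp
    qed simp
  qed
qed

text \<open>The difference \<open>u0 - Ub\<close> vanishes inside the ball of radius \<open>\<delta>\<close> and is bounded outside; on the sphere, a null set,
  nothing is known. Truncating a Borel version makes the bound hold everywhere.\<close>
lemma bounded_perturbation_exists:
  fixes Ub U u0 :: "'a::euclidean_space \<Rightarrow> real"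
  assumes Ub: "Ub \<in> borel_measurable borel" "\<And>x. x \<noteq> 0 \<Longrightarrow> U x = Ub x" and M2: "\<And>x. norm x \<ge> \<delta> \<Longrightarrow> \<bar>Ub x\<bar> \<le> M2"
    and u0: "u0 \<in> borel_measurable lebesgue" "AE x in lebesgue. norm x > \<delta> \<longrightarrow> \<bar>u0 x\<bar> \<le> M1" "AE x in lebesgue. norm x < \<delta> \<longrightarrow> u0 x = U x"
  shows "\<exists>w0 \<in> borel_measurable borel. \<exists>M\<ge>0. (\<forall>x. \<bar>w0 x\<bar> \<le> M) \<and> (AE x in lebesgue. u0 x = Ub x + w0 x)"
proof -
  define M where "M = \<bar>M1\<bar> + \<bar>M2\<bar>"
  have "Ub \<in> borel_measurable lebesgue" using Ub(1) by (simp add: measurable_completion)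
  with u0(1) have "(\<lambda>x. u0 x - Ub x) \<in> borel_measurable lebesgue" by measurable
  from completion_ex_borel_measurable_real[OF this] obtain g
    where g: "g \<in> borel_measurable lborel" "AE x in lborel. u0 x - Ub x = g x" by blast
  have gm [measurable]: "g \<in> borel_measurable borel" using g(1) by simp
  define w0 where "w0 = (\<lambda>x. max (- M) (min M (g x)))"
  have "AE x in lebesgue. u0 x - Ub x = g x" using g(2) by (rule AE_completion)
  moreover have "AE x in (lebesgue :: 'a measure). x \<noteq> 0" by (rule AE_completion) (rule AE_lborel_singleton)
  moreover have "AE x in (lebesgue :: 'a measure). norm x \<noteq> \<delta>"
  proof -
    have "negligible (sphere (0::'a) \<delta>)" by (rule negligible_sphere)
    then have "sphere (0::'a) \<delta> \<in> null_sets lebesgue" by (simp add: negligible_iff_null_sets)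
    then show ?thesis by (rule AE_I') auto
  qed
  ultimately have "AE x in lebesgue. u0 x = Ub x + w0 x"
    using u0(2,3)
  proof eventually_elim
    case (elim x)
    have "\<bar>g x\<bar> \<le> M"
    proof (cases "norm x < \<delta>")
      case True
      then show ?thesis using elim Ub(2)[of x] by (simp add: M_def)
    next
      case False
      then have "\<delta> < norm x" "\<delta> \<le> norm x" using elim by auto
      then show ?thesis using elim M2[of x] unfolding M_def by linarith
    qed
    then have "w0 x = g x" unfolding w0_def by simp
    then show ?case using elim by simp
  qed
  moreover have "w0 \<in> borel_measurable borel" unfolding w0_def by measurable
  moreover have M0: "0 \<le> M" by (simp add: M_def)
  moreover have "\<bar>w0 x\<bar> \<le> M" for x using M0 unfolding w0_def by (auto simp: abs_le_iff)
  ultimately show ?thesis by blast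
qed

theorem theorem1p3:
  fixes \<alpha> \<delta> :: real and U u\<^sub>0 :: "'a::euclidean_space \<Rightarrow> real"
  assumes "DIM('a) \<ge> 3"
    and "2 / (real DIM('a) - 2) < \<alpha>" and "\<alpha> < alpha0 DIM('a)"
    and "singular_radial_stationary \<alpha> U"
    and "\<delta> > 0"
    and "L_loc 1 UNIV u\<^sub>0"
    and "\<exists>M. AE x in lebesgue. norm x > \<delta> \<longrightarrow> \<bar>u\<^sub>0 x\<bar> \<le> M"
    and "AE x in lebesgue. norm x < \<delta> \<longrightarrow> u\<^sub>0 x = U x"
  shows "\<exists>T>0. \<exists>u :: real \<times> 'a \<Rightarrow> real.
    L_loc (\<alpha> + 1) ({0<..<T} \<times> UNIV) u \<and>
    continuous_on ({0<..<T} \<times> (UNIV - {0})) u \<and>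
    heat_solution_distr \<alpha> T u \<and>
    (\<exists>C. \<forall>t\<in>{0<..<T}. \<forall>x. x \<noteq> 0 \<longrightarrow>
       \<bar>u (t, x) - U x\<bar> \<le> C * (1 + norm x powr (- eta DIM('a) \<alpha>))) \<and>
    tendsto_L1_loc (\<lambda>t x. u (t, x)) u\<^sub>0 (at_right 0) \<and>
    (\<forall>t\<in>{0<..<T}. singular_at_origin (\<lambda>x. u (t, x))) \<and>
    (\<exists>\<sigma>\<in>{1, -1}. (\<forall>\<^sub>F x in at 0. sgn (U x) = \<sigma>) \<and>
       (\<forall>t\<in>{0<..<T}.
          ((\<lambda>x. norm x powr (2 / \<alpha>) * u (t, x)) \<longlongrightarrow> \<sigma> * beta DIM('a) \<alpha> powr (1 / \<alpha>)) (at 0)))"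
proof -
  define l where "l = 2 / \<alpha>"
  define e where "e = eta DIM('a) \<alpha>"
  define Y where "Y = beta DIM('a) \<alpha> powr (1 / \<alpha>)"
  note ex = exponent_relations[OF assms(1-3)]
  have al: "\<alpha> > 0" by (rule ex(1))
  have l: "l * \<alpha> = 2" "0 < l" "l < real DIM('a) - 2" using al ex(3) by (auto simp: l_def)
  have e: "0 < e" "e < (real DIM('a) - 2) / 2" using ex(5,6) by (auto simp: e_def)
  have el: "e < l" using e(2) ex(2) unfolding l_def by (rule less_trans)
  have eN: "e < real DIM('a) - 2" using el l by simp
  have Y: "Y > 0" "Y powr \<alpha> = beta DIM('a) \<alpha>" using ex(4) al by (auto simp: Y_def powr_powr)
  obtain v v' v'' where dv: "\<And>r. r > 0 \<Longrightarrow> (v has_real_derivative v' r) (at r)"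
    and dv': "\<And>r. r > 0 \<Longrightarrow> (v' has_real_derivative v'' r) (at r)"
    and cv: "continuous_on {0<..} v''"
    and ode: "\<And>r. r > 0 \<Longrightarrow> v'' r + (real DIM('a) - 1) / r * v' r + \<bar>v r\<bar> powr \<alpha> * v r = 0"
    and sing: "\<not> (\<exists>l::real. (v \<longlongrightarrow> l) (at_right 0))"
    and U: "\<And>x. x \<noteq> 0 \<Longrightarrow> U x = v (norm x)"
    using assms(4) unfolding singular_radial_stationary_def by blast
  have "\<exists>\<sigma>\<in>{1, - 1}. \<exists>C k r0. C > 0 \<and> k > 0 \<and> 0 < r0 \<and> r0 \<le> 1
    \<and> (\<forall>r. 0 < r \<and> r \<le> r0 \<longrightarrow> \<bar>r powr l * v r - \<sigma> * Y\<bar> \<le> C * r powr k)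
    \<and> (\<forall>r. 0 < r \<and> r \<le> r0 \<longrightarrow> \<bar>v' r\<bar> \<le> C * r powr (- l - 1))
    \<and> (\<forall>r\<ge>r0. \<bar>v r\<bar> \<le> C \<and> \<bar>v' r\<bar> \<le> C)"
    unfolding l_def Y_def by (rule singular_profile[OF assms(1-3) dv dv' ode sing])
  then obtain \<sigma> C0 k0 r0 where sg: "\<sigma> \<in> {1, - 1}" and prof: "C0 > 0 \<and> k0 > 0 \<and> 0 < r0 \<and> r0 \<le> 1
    \<and> (\<forall>r. 0 < r \<and> r \<le> r0 \<longrightarrow> \<bar>r powr l * v r - \<sigma> * Y\<bar> \<le> C0 * r powr k0)
    \<and> (\<forall>r. 0 < r \<and> r \<le> r0 \<longrightarrow> \<bar>v' r\<bar> \<le> C0 * r powr (- l - 1))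
    \<and> (\<forall>r\<ge>r0. \<bar>v r\<bar> \<le> C0 \<and> \<bar>v' r\<bar> \<le> C0)" by (elim bexE exE)
  have C0: "C0 > 0" and k0: "k0 > 0" and r0: "0 < r0" "r0 \<le> 1"
    and near: "\<And>r. 0 < r \<Longrightarrow> r \<le> r0 \<Longrightarrow> \<bar>r powr l * v r - \<sigma> * Y\<bar> \<le> C0 * r powr k0"
    and near': "\<And>r. 0 < r \<Longrightarrow> r \<le> r0 \<Longrightarrow> \<bar>v' r\<bar> \<le> C0 * r powr (- l - 1)"
    and far0: "\<And>r. r \<ge> r0 \<Longrightarrow> \<bar>v r\<bar> \<le> C0"
    using prof by auto
  define Ub where "Ub = (\<lambda>x::'a. v (norm x))"
  have cont_v: "continuous_on {0<..} v" by (rule continuous_at_imp_continuous_on) (use dv DERIV_isCont in auto)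
  have Ubc: "continuous_on (- {0}) Ub"
    unfolding Ub_def by (intro continuous_on_compose2[OF cont_v] continuous_intros) auto
  have Ubm: "Ub \<in> borel_measurable borel"
    by (rule borel_measurable_continuous_countable_exceptions[of "{0}"]) (use Ubc in auto)
  \<comment> \<open>the profile has size \<open>r powr (-l)\<close> near the origin and is bounded away from it\<close>
  have lv: "\<bar>r powr l * v r\<bar> \<le> Y + C0 * r powr k0" if "0 < r" "r \<le> r0" for r
  proof -
    have "\<bar>\<sigma> * Y\<bar> = Y" using sg Y(1) by auto
    then show ?thesis using near[OF that] by linarith
  qed
  have vnear: "\<bar>v r\<bar> \<le> (Y + C0) * r powr (- l)" if r: "0 < r" "r \<le> r0" for r
  proof -
    have "r powr k0 \<le> 1" using r r0 k0 by (intro powr_le1) auto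
    then have "C0 * r powr k0 \<le> C0 * 1" using C0 by (intro mult_left_mono) auto
    then have "r powr l * \<bar>v r\<bar> \<le> Y + C0" using lv[OF r] by (simp add: abs_mult)
    then have "r powr (- l) * (r powr l * \<bar>v r\<bar>) \<le> r powr (- l) * (Y + C0)" by (intro mult_left_mono) auto
    moreover have "r powr (- l) * (r powr l * \<bar>v r\<bar>) = \<bar>v r\<bar>"
      unfolding mult.assoc[symmetric] using r by (simp add: powr_add[symmetric])
    ultimately show ?thesis by (simp only: mult.commute[of "Y + C0"])
  qed
  have vall: "\<bar>v r\<bar> \<le> (Y + C0) * (r powr (- l) + 1)" if r: "0 < r" for r
  proof (cases "r \<le> r0")
    case True
    have "(Y + C0) * r powr (- l) \<le> (Y + C0) * (r powr (- l) + 1)" using Y(1) C0 by (intro mult_left_mono) auto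
    with vnear[OF r True] show ?thesis by (rule order_trans)
  next
    case False
    have "C0 * 1 \<le> (Y + C0) * (r powr (- l) + 1)" using Y(1) C0 by (intro mult_mono) auto
    then show ?thesis using far0[of r] False by simp
  qed
  have far: "\<exists>C. \<forall>r\<ge>\<rho>. \<bar>v r\<bar> \<le> C" if \<rho>: "\<rho> > 0" for \<rho>
  proof (rule exI[of _ "(Y + C0) * (\<rho> powr (- l) + 1)"], intro allI impI)
    fix r assume r: "r \<ge> \<rho>"
    have "\<bar>v r\<bar> \<le> (Y + C0) * (r powr (- l) + 1)" using vall r \<rho> by simp
    also have "\<dots> \<le> (Y + C0) * (\<rho> powr (- l) + 1)"
      using Y(1) C0 l(2) r \<rho> by (intro mult_left_mono add_right_mono powr_mono2') auto
    finally show "\<bar>v r\<bar> \<le> (Y + C0) * (\<rho> powr (- l) + 1)" .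
  qed
  obtain M1 where M1: "AE x in lebesgue. norm x > \<delta> \<longrightarrow> \<bar>u\<^sub>0 x\<bar> \<le> M1" using assms(7) by blast
  obtain M2 where M2: "\<And>r. r \<ge> \<delta> \<Longrightarrow> \<bar>v r\<bar> \<le> M2" using far[OF assms(5)] by blast
  have u0m: "u\<^sub>0 \<in> borel_measurable lebesgue" using assms(6) by (simp add: L_loc_def lebesgue_on_UNIV_eq)
  have "\<exists>w0 \<in> borel_measurable borel. \<exists>M\<ge>0. (\<forall>x. \<bar>w0 x\<bar> \<le> M) \<and> (AE x in lebesgue. u\<^sub>0 x = Ub x + w0 x)"
    by (rule bounded_perturbation_exists[OF Ubm _ _ u0m M1 assms(8)]) (use U M2 in \<open>auto simp: Ub_def\<close>)
  then obtain w0 M where w0m: "w0 \<in> borel_measurable borel" and M: "M \<ge> 0" and w0b: "\<And>x. \<bar>w0 x\<bar> \<le> M"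
    and w0e: "AE x in lebesgue. u\<^sub>0 x = Ub x + w0 x" by blast
  \<comment> \<open>the error of the potential has the rate \<open>k0\<close> of the profile or the rate \<open>l - e\<close> of \<open>w / v\<close>; \<open>e / 2\<close> keeps \<open>e - d\<close> positive\<close>
  define d where "d = min k0 (min (l - e) (e / 2))"
  have d: "0 < d" "d \<le> k0" "d \<le> l - e" "d < e" using k0 el e by (auto simp: d_def)
  have hd: "beta DIM('a) \<alpha> * (\<alpha> + 1) = hardy DIM('a) e" using ex(7) by (simp add: hardy_def e_def)
  obtain C1 where C1: "C1 > 0" and pot: "\<And>r. 0 < r \<Longrightarrow> r \<le> r0 \<Longrightarrow>
      (\<alpha> + 1) * (\<bar>v r\<bar> + 2 * r powr (- e)) powr \<alpha> \<le> hardy DIM('a) e * r powr (- 2) + C1 * r powr (d - 2)"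
    using potential_bound[OF al l(1) Y e(1) el k0 C0 d(1-3) r0(2) lv, unfolded hd] by blast
  have "\<exists>T>0. \<exists>K\<ge>1. \<exists>A\<ge>0. \<exists>B\<ge>0. \<exists>w h :: real \<times> 'a \<Rightarrow> real. w \<in> borel_measurable borel \<and> h \<in> borel_measurable borel
    \<and> (\<forall>p. \<bar>h p\<bar> \<le> power_majorant A e B p)
    \<and> (\<forall>p. 0 < fst p \<and> fst p < T \<and> snd p \<noteq> 0 \<longrightarrow> \<bar>w p\<bar> \<le> K + norm (snd p) powr (- e)
         \<and> w p = heat_flow w0 p + duhamel h p
         \<and> h p = \<bar>v (norm (snd p)) + w p\<bar> powr \<alpha> * (v (norm (snd p)) + w p) - \<bar>v (norm (snd p))\<bar> powr \<alpha> * v (norm (snd p)))"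
    by (rule mild_solution_near_stationary[OF al d(1,4) e(2) r0 C1 M w0b w0m Ubm[unfolded Ub_def]], (rule pot; assumption), rule far)
  then obtain T K A B w h where T: "T > 0" and K: "K \<ge> 1" and AB: "A \<ge> 0" "B \<ge> 0"
    and wm: "w \<in> borel_measurable borel" and hm: "h \<in> borel_measurable borel"
    and hb': "\<forall>p. \<bar>h p\<bar> \<le> power_majorant A e B (p :: real \<times> 'a)"
    and w': "\<forall>p. 0 < fst p \<and> fst p < T \<and> snd p \<noteq> 0 \<longrightarrow> \<bar>w p\<bar> \<le> K + norm (snd p) powr (- e)
         \<and> w p = heat_flow w0 p + duhamel h p
         \<and> h p = \<bar>v (norm (snd p)) + w p\<bar> powr \<alpha> * (v (norm (snd p)) + w p) - \<bar>v (norm (snd p))\<bar> powr \<alpha> * v (norm (snd p))"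
    by (elim exE conjE)
  note hb = hb'[rule_format] and w = w'[rule_format]
  have w_bound: "\<bar>w (t, x)\<bar> \<le> K + norm x powr (- e)" and w_mild: "w (t, x) = heat_flow w0 (t, x) + duhamel h (t, x)"
    if "0 < t" "t < T" "x \<noteq> 0" for t x
    using w[of "(t, x)", unfolded fst_conv snd_conv] that by blast+
  define u where "u = (\<lambda>z. Ub (snd z) + w z)"
  have um: "u \<in> borel_measurable borel"
    unfolding u_def by (intro borel_measurable_add wm measurable_compose[OF snd_borel_measurable Ubm])
  have ub: "\<bar>u z\<bar> \<le> (Y + C0 + K + 1) * (norm (snd z) powr (- l) + 1)" if z: "0 < fst z" "fst z < T" "snd z \<noteq> 0" for z
  proof -
    let ?r = "norm (snd z)"
    have r: "?r > 0" using z by simp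
    have "?r powr (- e) \<le> ?r powr (- l) + 1"
    proof (cases "?r \<le> 1")
      case True
      then have "?r powr (- e) \<le> ?r powr (- l)" using r el by (intro powr_mono') auto
      then show ?thesis by simp
    next
      case False
      then have "?r powr (- e) \<le> 1" using e powr_mono2'[of "- e" 1 ?r] by simp
      moreover have "0 \<le> ?r powr (- l)" by simp
      ultimately show ?thesis by linarith
    qed
    moreover have "K * 1 \<le> K * (?r powr (- l) + 1)" using K by (intro mult_left_mono) auto
    moreover have "\<bar>w z\<bar> \<le> K + ?r powr (- e)" using w z by blast
    ultimately have "\<bar>w z\<bar> \<le> (K + 1) * (?r powr (- l) + 1)" unfolding distrib_right[of K 1] by simp
    then have "\<bar>u z\<bar> \<le> (Y + C0) * (?r powr (- l) + 1) + (K + 1) * (?r powr (- l) + 1)"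
      using vall[OF r] unfolding u_def Ub_def by linarith
    then show ?thesis by (simp add: distrib_right)
  qed
  have C3: "0 \<le> Y + C0 + K + 1" using Y(1) C0 K by simp
  have eq: "(\<integral>z. u z * heat_adjoint \<phi> z \<partial>lborel) = - (\<integral>z. \<bar>u z\<bar> powr \<alpha> * u z * \<phi> z \<partial>lborel)"
    if \<phi>: "test_function ({0<..<T} \<times> UNIV) \<phi>" for \<phi> :: "real \<times> 'a \<Rightarrow> real"
  proof -
    note c = test_function_calculus[OF \<phi>]
    obtain Kc where Kc: "compact Kc" "Kc \<subseteq> {0<..<T} \<times> UNIV" "\<And>z. z \<notin> Kc \<Longrightarrow> \<phi> z = 0 \<and> time_deriv \<phi> z = 0 \<and> (\<forall>b. dir_deriv (0, b) \<phi> z = 0 \<and> dir_deriv (0, b) (dir_deriv (0, b) \<phi>) z = 0)"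
      using c(7) by blast
    have cL: "continuous_on UNIV (space_laplacian \<phi>)" unfolding space_laplacian_def[abs_def] using c(6) by (intro continuous_intros)
    have z: "\<phi> z = 0" "time_deriv \<phi> z = 0" "space_laplacian \<phi> z = 0" "heat_adjoint \<phi> z = 0" if "z \<notin> Kc" for z
      using Kc(3)[OF that] by (auto simp: space_laplacian_def heat_adjoint_def)
    have m: "\<phi> \<in> borel_measurable borel" "time_deriv \<phi> \<in> borel_measurable borel" "space_laplacian \<phi> \<in> borel_measurable borel"
      using c(3,4) cL by (auto intro: borel_measurable_continuous_onI)
    obtain B0 where B0: "\<And>z. \<bar>\<phi> z\<bar> \<le> B0" using bounded_of_compact_support[OF c(3) Kc(1)] z by blast
    obtain Bt where Bt: "\<And>z. \<bar>time_deriv \<phi> z\<bar> \<le> Bt" using bounded_of_compact_support[OF c(4) Kc(1)] z by blast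
    obtain Bl where Bl: "\<And>z. \<bar>space_laplacian \<phi> z\<bar> \<le> Bl" using bounded_of_compact_support[OF cL Kc(1)] z by blast
    define G where "G = 2 * (Y + C0) + (2 * (Y + C0)) powr (\<alpha> + 1)"
    have YC: "0 \<le> Y + C0" using Y(1) C0 by simp
    have G: "Y + C0 \<le> G" "C0 \<le> G" "0 \<le> G" using Y(1) C0 by (auto simp: G_def add_increasing2)
    have G1: "\<bar>v r\<bar> \<le> G * (r powr (- l - 2) + 1)" if "r > 0" for r
      unfolding G_def by (rule growth_bound(1)[OF al l(2,1) YC that vall[OF that]])
    have G2: "\<bar>\<bar>v r\<bar> powr \<alpha> * v r\<bar> \<le> G * (r powr (- l - 2) + 1)" if "r > 0" for r
    proof -
      have "\<bar>\<bar>v r\<bar> powr \<alpha> * v r\<bar> = \<bar>v r\<bar> powr (\<alpha> + 1)" by (cases "v r = 0") (auto simp: abs_mult powr_add)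
      then show ?thesis unfolding G_def using growth_bound(2)[OF al l(2,1) YC that vall[OF that]] by simp
    qed
    have vb: "\<bar>v r\<bar> \<le> G * r powr (- l)" "\<bar>v' r\<bar> \<le> G * r powr (- l - 1)" if "0 < r" "r \<le> r0" for r
    proof -
      have "(Y + C0) * r powr (- l) \<le> G * r powr (- l)" "C0 * r powr (- l - 1) \<le> G * r powr (- l - 1)"
        using G by (auto intro: mult_right_mono)
      then show "\<bar>v r\<bar> \<le> G * r powr (- l)" "\<bar>v' r\<bar> \<le> G * r powr (- l - 1)"
        using vnear[OF that] near'[OF that] by linarith+
    qed
    note st = stationary_distribution[OF \<phi> l(2,3) dv dv' cv ode r0(1) G(3) vb G1 G2]
    have Vm: "(\<lambda>z::real\<times>'a. v (norm (snd z))) \<in> borel_measurable borel"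
      using measurable_compose[OF snd_borel_measurable Ubm] by (simp add: Ub_def)
    define fv where "fv = (\<lambda>z::real\<times>'a. \<bar>v (norm (snd z))\<bar> powr \<alpha> * v (norm (snd z)))"
    have fvm: "fv \<in> borel_measurable borel" using Vm unfolding fv_def by measurable
    have it: "integrable lborel (\<lambda>z. v (norm (snd z)) * time_deriv \<phi> z)"
      by (rule slab_integrable[OF l(2,3) Vm m(2) Kc(1,2) Bt z(2), where C=G]) (use G1 in auto)
    have il: "integrable lborel (\<lambda>z. v (norm (snd z)) * space_laplacian \<phi> z)"
      by (rule slab_integrable[OF l(2,3) Vm m(3) Kc(1,2) Bl z(3), where C=G]) (use G1 in auto)
    have ifv: "integrable lborel (\<lambda>z. fv z * \<phi> z)"
      by (rule slab_integrable[OF l(2,3) fvm m(1) Kc(1,2) B0 z(1), where C=G]) (use G2 in \<open>auto simp: fv_def\<close>)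
    have ihp: "integrable lborel (\<lambda>z. h z * \<phi> z)"
    proof (rule slab_integrable[OF e(1) eN hm m(1) Kc(1,2) B0 z(1), where C="A + B"])
      fix z :: "real \<times> 'a"
      have "\<bar>h z\<bar> \<le> A * norm (snd z) powr (- e - 2) + B" using hb[of z] by (simp add: power_majorant_def)
      moreover have "0 \<le> A + B * norm (snd z) powr (- e - 2)" using AB by simp
      ultimately show "\<bar>h z\<bar> \<le> (A + B) * (norm (snd z) powr (- e - 2) + 1)" unfolding distrib_left distrib_right by linarith
    qed
    note hd1 = heat_flow_distribution[OF \<phi> w0m w0b]
    note hd2 = duhamel_distribution[OF e(1) eN \<phi> hm hb]
    have AE0: "AE z in (lborel :: (real \<times> 'a) measure). snd z \<noteq> 0" by (rule AE_snd_neq)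
    have slab: "0 < fst z \<and> fst z < T" if "z \<in> Kc" for z using Kc(2) that by auto
    \<comment> \<open>\<open>u\<close> is split into the stationary solution, the heat flow of the data and the Duhamel term\<close>
    have "(\<integral>z. u z * heat_adjoint \<phi> z \<partial>lborel) = (\<integral>z. (v (norm (snd z)) * time_deriv \<phi> z + v (norm (snd z)) * space_laplacian \<phi> z) + (heat_flow w0 z * heat_adjoint \<phi> z + duhamel h z * heat_adjoint \<phi> z) \<partial>lborel)"
    proof (rule integral_cong_AE)
      have [measurable]: "heat_adjoint \<phi> \<in> borel_measurable borel" by (rule heat_adjoint_borel_bounded(1)[OF \<phi>])
      note [measurable] = um heat_flow_borel[OF w0m] duhamel_borel[OF hm] Vm m
      show "(\<lambda>z. u z * heat_adjoint \<phi> z) \<in> borel_measurable lborel" by measurable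
      show "(\<lambda>z. (v (norm (snd z)) * time_deriv \<phi> z + v (norm (snd z)) * space_laplacian \<phi> z) + (heat_flow w0 z * heat_adjoint \<phi> z + duhamel h z * heat_adjoint \<phi> z)) \<in> borel_measurable lborel"
        by measurable
      show "AE z in lborel. u z * heat_adjoint \<phi> z = (v (norm (snd z)) * time_deriv \<phi> z + v (norm (snd z)) * space_laplacian \<phi> z) + (heat_flow w0 z * heat_adjoint \<phi> z + duhamel h z * heat_adjoint \<phi> z)"
        using AE0
      proof eventually_elim
        case (elim x)
        show ?case
        proof (cases "x \<in> Kc")
          case True
          then have "w x = heat_flow w0 x + duhamel h x" using w slab elim by blast
          then show ?thesis by (simp add: u_def Ub_def heat_adjoint_def algebra_simps)
        next
          case False
          then show ?thesis using z by simp
        qed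
      qed
    qed
    also have "\<dots> = (0 + - (\<integral>z. fv z * \<phi> z \<partial>lborel)) + (0 + - (\<integral>z. indicator ({0<..} \<times> UNIV) z * h z * \<phi> z \<partial>lborel))"
      using it il hd1(2) hd2(2) by (simp add: st hd1(1) hd2(1) fv_def)
    also have "(\<lambda>z. indicator ({0<..} \<times> UNIV) z * h z * \<phi> z) = (\<lambda>z. h z * \<phi> z)"
    proof
      fix x :: "real \<times> 'a"
      show "indicator ({0<..} \<times> UNIV) x * h x * \<phi> x = h x * \<phi> x"
        using slab[of x] z(1)[of x] by (cases "x \<in> Kc") (auto simp: indicator_def mem_Times_iff)
    qed
    also have "(0 + - (\<integral>z. fv z * \<phi> z \<partial>lborel)) + (0 + - (\<integral>z. h z * \<phi> z \<partial>lborel)) = - (\<integral>z. fv z * \<phi> z + h z * \<phi> z \<partial>lborel)"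
      using ifv ihp by simp
    also have "(\<integral>z. fv z * \<phi> z + h z * \<phi> z \<partial>lborel) = (\<integral>z. \<bar>u z\<bar> powr \<alpha> * u z * \<phi> z \<partial>lborel)"
    proof (rule integral_cong_AE)
      note [measurable] = um hm fvm m(1)
      show "(\<lambda>z. fv z * \<phi> z + h z * \<phi> z) \<in> borel_measurable lborel" by measurable
      show "(\<lambda>z. \<bar>u z\<bar> powr \<alpha> * u z * \<phi> z) \<in> borel_measurable lborel" by measurable
      show "AE z in lborel. fv z * \<phi> z + h z * \<phi> z = \<bar>u z\<bar> powr \<alpha> * u z * \<phi> z"
        using AE0
      proof eventually_elim
        case (elim x)
        show ?case
        proof (cases "x \<in> Kc")
          case True
          then have "h x = \<bar>v (norm (snd x)) + w x\<bar> powr \<alpha> * (v (norm (snd x)) + w x) - \<bar>v (norm (snd x))\<bar> powr \<alpha> * v (norm (snd x))"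
            using w slab elim by blast
          then show ?thesis by (simp add: u_def Ub_def fv_def left_diff_distrib)
        next
          case False
          then show ?thesis using z by simp
        qed
      qed
    qed
    finally show ?thesis .
  qed
  have solution: "L_loc (\<alpha> + 1) ({0<..<T} \<times> UNIV) u" "heat_solution_distr \<alpha> T u"
    using heat_solution_distrI[OF al l C3 um _ eq] ub by auto
  have wcont: "continuous_on ({0<..<T} \<times> (UNIV - {0})) u"
  proof -
    have "continuous_on ({0<..} \<times> UNIV) (heat_flow w0)"
      by (rule heat_flow_continuous[OF w0m]) (rule heat_flow_bounded(1)[OF w0m w0b])
    then have c1: "continuous_on ({0<..<T} \<times> (UNIV - {0})) (heat_flow w0)" by (rule continuous_on_subset) auto
    have pm: "power_majorant A e B \<in> borel_measurable (borel :: (real \<times> 'a) measure)"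
      unfolding power_majorant_def[abs_def] by measurable
    have "continuous_on ({0<..} \<times> - {0}) (duhamel h)"
      by (rule duhamel_continuous[OF hm pm hb _ duhamel_power_majorant_continuous[OF e(1) eN]])
         (auto intro!: duhamel_power_majorant(1) e(1) eN)
    then have c2: "continuous_on ({0<..<T} \<times> (UNIV - {0})) (duhamel h)" by (rule continuous_on_subset) auto
    have c3: "continuous_on ({0<..<T} \<times> (UNIV - {0})) (\<lambda>z. Ub (snd z))"
      by (intro continuous_on_compose2[OF Ubc] continuous_intros) auto
    have "continuous_on ({0<..<T} \<times> (UNIV - {0})) (\<lambda>z. Ub (snd z) + (heat_flow w0 z + duhamel h z))"
      by (intro continuous_on_add c1 c2 c3)
    then show ?thesis
    proof (rule continuous_on_eq)
      fix z :: "real \<times> 'a" assume "z \<in> {0<..<T} \<times> (UNIV - {0})"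
      then have "w z = heat_flow w0 z + duhamel h z" using w[of z] by (simp add: mem_Times_iff)
      then show "Ub (snd z) + (heat_flow w0 z + duhamel h z) = u z" by (simp add: u_def)
    qed
  qed
  have err: "\<bar>u (t, x) - U x\<bar> \<le> (K + 1) * (1 + norm x powr (- e))" if t: "0 < t" "t < T" and x: "x \<noteq> 0" for t x
  proof -
    have "\<bar>w (t, x)\<bar> \<le> K + norm x powr (- e)" by (rule w_bound[OF t x])
    also have "\<dots> \<le> (K + 1) * (1 + norm x powr (- e))" using K by (simp add: algebra_simps)
    finally show ?thesis using U[OF x] by (simp add: u_def Ub_def)
  qed
  have trace: "tendsto_L1_loc (\<lambda>t x. u (t, x)) u\<^sub>0 (at_right 0)"
  proof (rule perturbation_L1_trace[OF T e(1) eN l(2,3) AB um Ubm w0m w0b hm hb _ _ assms(6) w0e])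
    fix t x assume tx: "0 < t" "t < T" "x \<noteq> (0::'a)"
    then show "u (t, x) = Ub x + (heat_flow w0 (t, x) + duhamel h (t, x))" by (simp add: u_def w_mild)
    from growth_bound(1)[OF al l(2,1) C3, of "norm x" "u (t, x)"] ub[of "(t, x)"] tx
    show "\<bar>u (t, x)\<bar> \<le> (2 * (Y + C0 + K + 1) + (2 * (Y + C0 + K + 1)) powr (\<alpha> + 1)) * (norm x powr (- l - 2) + 1)"
      by simp
  qed
  have near0: "\<forall>\<^sub>F x in at (0::'a). x \<noteq> 0 \<and> norm x \<le> r0"
    unfolding eventually_at using r0 by (intro exI[of _ r0]) (auto simp: dist_norm)
  have Ulim: "((\<lambda>x. norm x powr l * U x) \<longlongrightarrow> \<sigma> * Y) (at 0)"
  proof (rule LIM_zero_cancel, rule Lim_null_comparison)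
    show "\<forall>\<^sub>F x in at 0. norm (norm x powr l * U x - \<sigma> * Y) \<le> C0 * norm x powr k0"
      using near0 by eventually_elim (use near U in auto)
    show "((\<lambda>x::'a. C0 * norm x powr k0) \<longlongrightarrow> 0) (at 0)" by (rule tendsto_mult_right_zero[OF norm_powr_tendsto_0[OF k0]])
  qed
  have ulim: "((\<lambda>x. norm x powr l * u (t, x)) \<longlongrightarrow> \<sigma> * Y) (at 0)" if t: "0 < t" "t < T" for t
  proof -
    have "((\<lambda>x. norm x powr l * (u (t, x) - U x)) \<longlongrightarrow> 0) (at 0)"
    proof (rule Lim_null_comparison)
      show "\<forall>\<^sub>F x in at 0. norm (norm x powr l * (u (t, x) - U x)) \<le> (K + 1) * (norm x powr l + norm x powr (l - e))"
        using near0
      proof eventually_elim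
        case (elim x)
        then have x: "x \<noteq> 0" by simp
        have "norm x powr l * \<bar>u (t, x) - U x\<bar> \<le> norm x powr l * ((K + 1) * (1 + norm x powr (- e)))"
          using err[OF t x] by (intro mult_left_mono) auto
        also have "\<dots> = (K + 1) * (norm x powr l + norm x powr l * norm x powr (- e))" by (simp add: algebra_simps)
        also have "norm x powr l * norm x powr (- e) = norm x powr (l - e)" unfolding powr_add[symmetric] by simp
        finally show ?case by (simp add: abs_mult)
      qed
      have "((\<lambda>x::'a. norm x powr l + norm x powr (l - e)) \<longlongrightarrow> 0 + 0) (at 0)"
        by (intro tendsto_add norm_powr_tendsto_0) (use l el in auto)
      then have "((\<lambda>x::'a. norm x powr l + norm x powr (l - e)) \<longlongrightarrow> 0) (at 0)" by simp
      then show "((\<lambda>x::'a. (K + 1) * (norm x powr l + norm x powr (l - e))) \<longlongrightarrow> 0) (at 0)" by (rule tendsto_mult_right_zero)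
    qed
    from tendsto_add[OF Ulim this] show ?thesis by (simp add: algebra_simps)
  qed
  have sY: "\<sigma> * Y \<noteq> 0" using sg Y(1) by auto
  have singular: "singular_at_origin (\<lambda>x. u (t, x))" if t: "0 < t" "t < T" for t
    unfolding singular_at_origin_def
  proof
    assume "\<exists>L::real. ((\<lambda>x. u (t, x)) \<longlongrightarrow> L) (at 0)"
    then obtain L :: real where "((\<lambda>x. u (t, x)) \<longlongrightarrow> L) (at 0)" by blast
    from tendsto_mult[OF norm_powr_tendsto_0[OF l(2)] this]
    have "((\<lambda>x. norm x powr l * u (t, x)) \<longlongrightarrow> 0) (at 0)" by simp
    from tendsto_unique[OF _ this ulim[OF t]] sY show False by simp
  qed
  have sign: "\<forall>\<^sub>F x in at 0. sgn (U x) = \<sigma>"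
  proof -
    have "((\<lambda>x. \<sigma> * (norm x powr l * U x)) \<longlongrightarrow> \<sigma> * (\<sigma> * Y)) (at 0)" by (intro tendsto_mult tendsto_const Ulim)
    moreover have "\<sigma> * (\<sigma> * Y) = Y" using sg by auto
    ultimately have "\<forall>\<^sub>F x in at 0. 0 < \<sigma> * (norm x powr l * U x)" using Y(1) by (intro order_tendstoD(1)) auto
    with near0 show ?thesis
    proof eventually_elim
      case (elim x)
      then have "0 < norm x powr l * (\<sigma> * U x)" by (simp add: mult_ac)
      then have "0 < \<sigma> * U x" by (simp add: zero_less_mult_iff)
      then show ?case using sg by auto
    qed
  qed
  show ?thesis
  proof (rule exI[of _ T], rule conjI[OF T], rule exI[of _ u], intro conjI)
    show "\<exists>C. \<forall>t\<in>{0<..<T}. \<forall>x. x \<noteq> 0 \<longrightarrow> \<bar>u (t, x) - U x\<bar> \<le> C * (1 + norm x powr (- eta DIM('a) \<alpha>))"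
      by (rule exI[of _ "K + 1"]) (use err in \<open>auto simp: e_def\<close>)
    show "\<forall>t\<in>{0<..<T}. singular_at_origin (\<lambda>x. u (t, x))" using singular by auto
    show "\<exists>\<sigma>\<in>{1, -1}. (\<forall>\<^sub>F x in at 0. sgn (U x) = \<sigma>) \<and>
       (\<forall>t\<in>{0<..<T}. ((\<lambda>x. norm x powr (2 / \<alpha>) * u (t, x)) \<longlongrightarrow> \<sigma> * beta DIM('a) \<alpha> powr (1 / \<alpha>)) (at 0))"
      by (rule bexI[OF _ sg]) (use sign ulim in \<open>auto simp: l_def Y_def\<close>)
  qed (use solution wcont trace in auto)
qed

end
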